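(* (a) Let $\Omega$ be a minimal, aperiodic, uniquely ergodic tiling space in $\mathbb{R}^d$ with finite local complexity (FLC) and invariant probability measure $\mu$, and let $\alpha\in H^1_s(\Omega;\mathbb{R}^d)$ be such that $C_\mu(\alpha)$ is invertible. Then there exist an FLC tiling space $\Omega'$ and a strongly pattern-equivariant 1-form $\bar\alpha$ representing $\alpha$ such that the shape deformation induced by $\bar\alpha$ is a homeomorphism $h_{\bar\alpha}:\Omega\to\Omega'$, and such that $[h_{\bar\alpha}]=\alpha$. (b) Let $\tilde\Omega$ be a minimal, aperiodic, uniquely ergodic tiling space in $\mathbb{R}^d$, with no assumption of FLC, with invariant probability measure $\mu$, and let $\alpha\in H^1_w(\tilde\Omega;\mathbb{R}^d)$ be such that $C_\mu(\alpha)$ is invertible. Then there exist a tiling space $\tilde\Omega'$ and a weakly pattern-equivariant 1-form $\bar\alpha$ such that the shape deformation induced by $\bar\alpha$ is an orbit equivalence $h_{\bar\alpha}:\tilde\Omega\to\tilde\Omega'$, and such that $[h_{\bar\alpha}]=\alpha$.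
   Context: **Tiling spaces.** A tile is a convex polytope in $\mathbb{R}^d$ with non-empty interior, possibly carrying a label in a compact metric space; the set of prototiles (tiles up to translation) is compact. A tiling is a collection of tiles covering $\mathbb{R}^d$, any two of which meet only along their boundaries. A Delone set is a uniformly discrete and relatively dense subset of $\mathbb{R}^d$, possibly labelled. Tilings and labelled Delone sets are used interchangeably. $\mathbb{R}^d$ acts by translation, $T\mapsto T-x$. The patch $T\cap B(x,R)$ is the set of labelled tiles meeting $B(x,R)$ (for Delone sets: labelled points in $B(x,R)$). Two tilings (Delone sets) are $\varepsilon$-close if on a ball of radius about $1/\varepsilon$ around the origin there is a one-to-one correspondence between their tiles (points), corresponding tiles being $\varepsilon$-close in Hausdorff distance (points being $\varepsilon$-close) with $\varepsilon$-close labels. A tiling space is a compact translation-invariant set of tilings (or labelled Delone sets). It is minimal if every $\mathbb{R}^d$-orbit is dense, aperiodic if $T-x=T$ implies $x=0$ for each of its elements, uniquely ergodic if it carries exactly one translation-invariant Borel probability measure, FLC if for each $R$ there are finitely many patches of radius $R$ up to translation. **Weak cohomology and weak class.** An orbit equivalence is a homeomorphism sending $\mathbb{R}^d$-orbits to $\mathbb{R}^d$-orbits. A weak 1-cocycle is a continuous $\alpha:\Omega\times\mathbb{R}^d\to\mathbb{R}^d$ with $\alpha(T,x)+\alpha(T-x,y)=\alpha(T,x+y)$; it is a weak coboundary if $\alpha(T,v)=s(T-v)-s(T)$ with $s:\Omega\to\mathbb{R}^d$ continuous. $H^1_w(\Omega;\mathbb{R}^d)$ is the quotient. For an orbit equivalence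 $h:\Omega\to\Omega'$ of aperiodic tiling spaces, define $h_T(x)$ by $h(T-x)=h(T)-h_T(x)$; the weak class $[h]\in H^1_w(\Omega;\mathbb{R}^d)$ is the class of $(T,v)\mapsto h_T(v)$. **Strong cohomology and strong class (FLC case).** A local derivation between FLC tiling spaces is a continuous onto map $\phi$ with $\phi(T-x)=\phi(T)-x$ such that for all $r>0$ there is $R>0$ with: $T\cap B(0,R)=T'\cap B(0,R)$ implies $\phi(T)\cap B(0,r)=\phi(T')\cap B(0,r)$. The canonical transversal of a space of Delone sets is the set of its elements containing the origin; an FLC transversal of $\Omega$ is $\mathcal{D}^{-1}(\Xi')$, where $\mathcal{D}:\Omega\to\Omega_0$ is a local derivation to a space of Delone sets with canonical transversal $\Xi'$. A function on $\Omega$ is transversally locally constant if its restriction to every FLC transversal is locally constant. A strong 1-cocycle is a weak 1-cocycle $\alpha$ with $\alpha(\cdot,v)$ transversally locally constant for each $v$; a strong coboundary is $\alpha(T,v)=s(T-v)-s(T)$ with $s$ continuous and transversally locally constant. The quotient $H^1_s(\Omega;\mathbb{R}^d)$ is canonically isomorphic to $\check H^1(\Omega;\mathbb{R}^d)$: on an open flow box $U=\{S-x: S\in\Xi, |x|<\varepsilon\}$ ($\Xi$ an FLC transversal) put $c_U(S-x)=\alpha(S,x)$; the differences $c_U-c_V$ on overlaps are locally constant and form the Čech cocycle. The fundamental shape class $[\mathcal{F}(\Omega)]$ is the class of $\mathcal{F}(T,v)=v$. The strong class of a homeomorphism $h:\Omega\to\Omega'$ of FLC spaces is $[h]:=h^*[\mathcal{F}(\Omega')]$,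 with $h^*$ the pullback in Čech cohomology. In (a) $[h_{\bar\alpha}]$ is the strong class, in (b) the weak class. **Ruelle–Sullivan map.** $C_\mu([\alpha])$ is the linear map ($d\times d$ matrix) $v\mapsto\int_\Omega\alpha(T,v)\,d\mu(T)=\lim_{r\to\infty}r^{-d}\int_{C_r}\alpha(T-s,v)\,ds$ (any $T$), with $C_r=[-r/2,r/2]^d$; it depends only on the (weak or strong) class. **Pattern-equivariant forms.** Fix $T\in\Omega$. A function $f$ on $\mathbb{R}^d$ is strongly pattern-equivariant (PE) with radius $R$ (FLC case) if $f(x)=f(y)$ whenever $(T-x)\cap B(0,R)=(T-y)\cap B(0,R)$; it is weakly PE if there is a continuous $F$ on $\Omega$ with $f(x)=F(T-x)$. A smooth $\mathbb{R}^d$-valued 1-form is strongly PE if its coefficients are strongly PE (with a common radius), and weakly PE if its coefficients and all their partial derivatives are weakly PE. A closed strongly (weakly) PE form $\omega$ represents the class of the cocycle determined by $\alpha(T-x,v)=\int_x^{x+v}\omega$. **Shape deformation.** Let $T\in\Omega$ be a tiling with a vertex at $0$, with vertex set (or associated Delone set) $\Lambda$. Let $\omega$ be a closed strongly PE (FLC case) or weakly PE (general case) $\mathbb{R}^d$-valued 1-form, $A(x)=\int_0^x\omega$, and suppose $A:\mathbb{R}^d\to\mathbb{R}^d$ is a homeomorphism. In the FLC case with PE radius $R$, label each $p\in\Lambda$ by the patch of $T$ of radius $R_0$ around $p$, where $R_0$ exceeds $R$ plus the greatest distance between neighbouring points of $\Lambda$; in the general case label $p$ by $T-p$. Let $\Lambda'$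 be obtained by moving each $p$ to $A(p)$, keeping its label; view $\Lambda'$ as (the vertex set of) a new tiling $T'$, and let $\Omega'$ be the orbit closure of $T'$. The map $h_\omega(T-x)=T'-A(x)$ extends to a homeomorphism $h_\omega:\Omega\to\Omega'$, the shape deformation (shape change) induced by $\omega$. In particular, the existence of $h_{\bar\alpha}$ includes the assertion that $x\mapsto\int_0^x\bar\alpha$ is a homeomorphism of $\mathbb{R}^d$. *)

theory Defs
  imports "HOL-Analysis.Analysis" "HOL-Probability.Probability"
begin

section \<open>Tilings and labelled Delone sets\<close>

text \<open>
  Tilings and labelled Delone sets share one carrier: a configuration is a set of pairs
  (support, label). The support of a tile is a polytope, the support of a point p of a labelled
  Delone set is the singleton {p}. Translation, patches and the tiling metric then have a single
  definition: the singleton {p} meets a ball iff p lies in it, and the Hausdorff distance of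
  singletons is the distance of the points.

  Labels live in a metric space given by a carrier L and a distance function dL, not by
  a type class, because the labels of a deformed configuration are themselves configurations.
\<close>

type_synonym ('a, 'l) config = "('a set \<times> 'l) set"

definition translate :: "('a::real_normed_vector, 'l) config \<Rightarrow> 'a \<Rightarrow> ('a, 'l) config" where
  "translate T x = (\<lambda>(K, l). ((\<lambda>y. y - x) ` K, l)) ` T"

definition patch :: "('a::real_normed_vector, 'l) config \<Rightarrow> 'a \<Rightarrow> real \<Rightarrow> ('a, 'l) config" where
  "patch T x R = {t \<in> T. fst t \<inter> ball x R \<noteq> {}}"

definition points :: "('a, 'l) config \<Rightarrow> 'a set" where
  "points T = \<Union> (fst ` T)"

text \<open>
  For a labelled Delone set the vertices are its points, since p is the only extreme point of {p}.
\<close>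

definition vertices :: "('a::real_vector, 'l) config \<Rightarrow> 'a set" where
  "vertices T = {v. \<exists>t\<in>T. v extreme_point_of fst t}"

definition labelled_points :: "'a set \<Rightarrow> ('a \<Rightarrow> 'l) \<Rightarrow> ('a, 'l) config" where
  "labelled_points \<Lambda> lab = (\<lambda>p. ({p}, lab p)) ` \<Lambda>"

definition relatively_dense :: "'a::metric_space set \<Rightarrow> bool" where
  "relatively_dense \<Lambda> \<longleftrightarrow> (\<exists>R. \<forall>x. \<exists>p\<in>\<Lambda>. dist x p \<le> R)"

definition is_delone :: "'l set \<Rightarrow> ('a::euclidean_space, 'l) config \<Rightarrow> bool" where
  "is_delone L T \<longleftrightarrow>
     (\<exists>\<Lambda> lab. uniform_discrete \<Lambda> \<and> relatively_dense \<Lambda> \<and> lab ` \<Lambda> \<subseteq> L \<and> T = labelled_points \<Lambda> lab)"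

definition is_tile :: "'l set \<Rightarrow> 'a::euclidean_space set \<times> 'l \<Rightarrow> bool" where
  "is_tile L t \<longleftrightarrow> polytope (fst t) \<and> interior (fst t) \<noteq> {} \<and> snd t \<in> L"

definition is_tiling :: "'l set \<Rightarrow> ('a::euclidean_space, 'l) config \<Rightarrow> bool" where
  "is_tiling L T \<longleftrightarrow> (\<forall>t\<in>T. is_tile L t) \<and> \<Union> (fst ` T) = UNIV \<and>
     (\<forall>t\<in>T. \<forall>t'\<in>T. t \<noteq> t' \<longrightarrow> fst t \<inter> fst t' \<subseteq> frontier (fst t) \<inter> frontier (fst t'))"

text \<open>The Hausdorff distance; only used for non-empty compact sets.\<close>

definition hausdist :: "'a::metric_space set \<Rightarrow> 'a set \<Rightarrow> real" where
  "hausdist S T = max (SUP x\<in>S. infdist x T) (SUP y\<in>T. infdist y S)"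

definition tile_dist ::
    "('l \<Rightarrow> 'l \<Rightarrow> real) \<Rightarrow> 'a::metric_space set \<times> 'l \<Rightarrow> 'a set \<times> 'l \<Rightarrow> real" where
  "tile_dist dL t t' = max (hausdist (fst t) (fst t')) (dL (snd t) (snd t'))"

definition tile_topology ::
    "'l set \<Rightarrow> ('l \<Rightarrow> 'l \<Rightarrow> real) \<Rightarrow> ('a::euclidean_space set \<times> 'l) topology" where
  "tile_topology L dL = Metric_space.mtopology {t. is_tile L t} (tile_dist dL)"


section \<open>The tiling metric and tiling spaces\<close>

text \<open>
  Closeness: a one-to-one correspondence between parts of the two configurations which contain
  everything that meets the ball of radius 1/e around the origin. Allowing the corresponding
  parts to be larger than the two patches avoids boundary effects, and makes closeness with
  e1 and with e2 compose to closeness with e1 + e2 as long as e1 + e2 is at most 1. Hence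
  the distance below, truncated at 1, satisfies the triangle inequality.
\<close>

definition config_close ::
    "('l \<Rightarrow> 'l \<Rightarrow> real) \<Rightarrow> real \<Rightarrow> ('a::real_normed_vector, 'l) config \<Rightarrow> ('a, 'l) config \<Rightarrow> bool" where
  "config_close dL e T T' \<longleftrightarrow>
     (\<exists>P P' f. patch T 0 (1 / e) \<subseteq> P \<and> P \<subseteq> T \<and> patch T' 0 (1 / e) \<subseteq> P' \<and> P' \<subseteq> T' \<and>
        bij_betw f P P' \<and> (\<forall>t\<in>P. tile_dist dL t (f t) \<le> e))"

definition config_dist ::
    "('l \<Rightarrow> 'l \<Rightarrow> real) \<Rightarrow> ('a::real_normed_vector, 'l) config \<Rightarrow> ('a, 'l) config \<Rightarrow> real" where
  "config_dist dL T T' = Inf (insert 1 {e. 0 < e \<and> e < 1 \<and> config_close dL e T T'})"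

definition config_topology ::
    "('l \<Rightarrow> 'l \<Rightarrow> real) \<Rightarrow> ('a::real_normed_vector, 'l) config set \<Rightarrow> ('a, 'l) config topology" where
  "config_topology dL \<Omega> = Metric_space.mtopology \<Omega> (config_dist dL)"

definition tiling_space ::
    "'l set \<Rightarrow> ('l \<Rightarrow> 'l \<Rightarrow> real) \<Rightarrow> ('a::euclidean_space, 'l) config set \<Rightarrow> bool" where
  "tiling_space L dL \<Omega> \<longleftrightarrow>
     Metric_space L dL \<and> compact_space (Metric_space.mtopology L dL) \<and>
     ((\<forall>T\<in>\<Omega>. is_delone L T) \<or>
      (\<forall>T\<in>\<Omega>. is_tiling L T) \<and>
      (\<exists>\<P>. compactin (tile_topology L dL) \<P> \<and>
         (\<forall>T\<in>\<Omega>. \<forall>(K, l)\<in>T. \<exists>K0 x. (K0, l) \<in> \<P> \<and> K = (\<lambda>y. y + x) ` K0))) \<and>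
     (\<forall>T\<in>\<Omega>. \<forall>x. translate T x \<in> \<Omega>) \<and>
     compact_space (config_topology dL \<Omega>)"

definition FLC :: "('a::real_normed_vector, 'l) config set \<Rightarrow> bool" where
  "FLC \<Omega> \<longleftrightarrow> (\<forall>R. finite ((\<lambda>P. range (translate P)) ` {patch T x R | T x. T \<in> \<Omega>}))"

definition translation_orbit :: "('a::real_normed_vector, 'l) config \<Rightarrow> ('a, 'l) config set" where
  "translation_orbit T = range (translate T)"

definition minimal_space ::
    "('l \<Rightarrow> 'l \<Rightarrow> real) \<Rightarrow> ('a::real_normed_vector, 'l) config set \<Rightarrow> bool" where
  "minimal_space dL \<Omega> \<longleftrightarrow> (\<forall>T\<in>\<Omega>. config_topology dL \<Omega> closure_of translation_orbit T = \<Omega>)"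

definition aperiodic :: "('a::real_normed_vector, 'l) config set \<Rightarrow> bool" where
  "aperiodic \<Omega> \<longleftrightarrow> (\<forall>T\<in>\<Omega>. \<forall>x. translate T x = T \<longrightarrow> x = 0)"

definition invariant_probability ::
    "('l \<Rightarrow> 'l \<Rightarrow> real) \<Rightarrow> ('a::real_normed_vector, 'l) config set \<Rightarrow> ('a, 'l) config measure \<Rightarrow> bool" where
  "invariant_probability dL \<Omega> \<mu> \<longleftrightarrow>
     sets \<mu> = sets (sigma \<Omega> {U. openin (config_topology dL \<Omega>) U}) \<and> prob_space \<mu> \<and>
     (\<forall>x. \<forall>B\<in>sets \<mu>. emeasure \<mu> ((\<lambda>T. translate T x) ` B) = emeasure \<mu> B)"

definition uniquely_ergodic ::
    "('l \<Rightarrow> 'l \<Rightarrow> real) \<Rightarrow> ('a::real_normed_vector, 'l) config set \<Rightarrow> bool" where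
  "uniquely_ergodic dL \<Omega> \<longleftrightarrow> (\<exists>!\<mu>. invariant_probability dL \<Omega> \<mu>)"


section \<open>Orbit equivalences, weak cohomology and the weak class\<close>

definition orbit_equivalence ::
    "('l \<Rightarrow> 'l \<Rightarrow> real) \<Rightarrow> ('a::real_normed_vector, 'l) config set \<Rightarrow>
     ('k \<Rightarrow> 'k \<Rightarrow> real) \<Rightarrow> ('a, 'k) config set \<Rightarrow>
     (('a, 'l) config \<Rightarrow> ('a, 'k) config) \<Rightarrow> bool" where
  "orbit_equivalence dL \<Omega> dL' \<Omega>' h \<longleftrightarrow>
     homeomorphic_map (config_topology dL \<Omega>) (config_topology dL' \<Omega>') h \<and>
     (\<forall>T\<in>\<Omega>. h ` translation_orbit T = translation_orbit (h T))"

type_synonym ('a, 'l) cochain = "('a, 'l) config \<Rightarrow> 'a \<Rightarrow> 'a"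

definition weak_cocycle ::
    "('l \<Rightarrow> 'l \<Rightarrow> real) \<Rightarrow> ('a::real_normed_vector, 'l) config set \<Rightarrow> ('a, 'l) cochain \<Rightarrow> bool" where
  "weak_cocycle dL \<Omega> \<alpha> \<longleftrightarrow>
     continuous_map (prod_topology (config_topology dL \<Omega>) euclidean) euclidean (\<lambda>(T, x). \<alpha> T x) \<and>
     (\<forall>T\<in>\<Omega>. \<forall>x y. \<alpha> T x + \<alpha> (translate T x) y = \<alpha> T (x + y))"

definition weak_coboundary ::
    "('l \<Rightarrow> 'l \<Rightarrow> real) \<Rightarrow> ('a::real_normed_vector, 'l) config set \<Rightarrow> ('a, 'l) cochain \<Rightarrow> bool" where
  "weak_coboundary dL \<Omega> \<alpha> \<longleftrightarrow>
     (\<exists>s. continuous_map (config_topology dL \<Omega>) euclidean s \<and>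
          (\<forall>T\<in>\<Omega>. \<forall>v. \<alpha> T v = s (translate T v) - s T))"

definition weak_rel ::
    "('l \<Rightarrow> 'l \<Rightarrow> real) \<Rightarrow> ('a::real_normed_vector, 'l) config set \<Rightarrow> ('a, 'l) cochain rel" where
  "weak_rel dL \<Omega> = {(\<alpha>, \<beta>). weak_cocycle dL \<Omega> \<alpha> \<and> weak_cocycle dL \<Omega> \<beta> \<and>
                            weak_coboundary dL \<Omega> (\<lambda>T v. \<alpha> T v - \<beta> T v)}"

definition H1_weak ::
    "('l \<Rightarrow> 'l \<Rightarrow> real) \<Rightarrow> ('a::real_normed_vector, 'l) config set \<Rightarrow> ('a, 'l) cochain set set" where
  "H1_weak dL \<Omega> = {\<alpha>. weak_cocycle dL \<Omega> \<alpha>} // weak_rel dL \<Omega>"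

text \<open>Well defined when the target space is aperiodic.\<close>

definition orbit_displacement ::
    "(('a::real_normed_vector, 'l) config \<Rightarrow> ('a, 'k) config) \<Rightarrow> ('a, 'l) cochain" where
  "orbit_displacement h T x = (THE w. h (translate T x) = translate (h T) w)"

definition weak_class ::
    "('l \<Rightarrow> 'l \<Rightarrow> real) \<Rightarrow> ('a::real_normed_vector, 'l) config set \<Rightarrow>
     (('a, 'l) config \<Rightarrow> ('a, 'k) config) \<Rightarrow> ('a, 'l) cochain set" where
  "weak_class dL \<Omega> h = weak_rel dL \<Omega> `` {orbit_displacement h}"


section \<open>Derivations, transversals and strong cohomology\<close>

definition factor_map ::
    "('l \<Rightarrow> 'l \<Rightarrow> real) \<Rightarrow> ('a::real_normed_vector, 'l) config set \<Rightarrow>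
     ('k \<Rightarrow> 'k \<Rightarrow> real) \<Rightarrow> ('a, 'k) config set \<Rightarrow>
     (('a, 'l) config \<Rightarrow> ('a, 'k) config) \<Rightarrow> bool" where
  "factor_map dL \<Omega> dL' \<Omega>' \<phi> \<longleftrightarrow>
     continuous_map (config_topology dL \<Omega>) (config_topology dL' \<Omega>') \<phi> \<and> \<phi> ` \<Omega> = \<Omega>' \<and>
     (\<forall>T\<in>\<Omega>. \<forall>x. \<phi> (translate T x) = translate (\<phi> T) x)"

definition local_derivation ::
    "'l set \<Rightarrow> ('l \<Rightarrow> 'l \<Rightarrow> real) \<Rightarrow> ('a::euclidean_space, 'l) config set \<Rightarrow>
     'k set \<Rightarrow> ('k \<Rightarrow> 'k \<Rightarrow> real) \<Rightarrow> ('a, 'k) config set \<Rightarrow>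
     (('a, 'l) config \<Rightarrow> ('a, 'k) config) \<Rightarrow> bool" where
  "local_derivation L dL \<Omega> L' dL' \<Omega>' \<phi> \<longleftrightarrow>
     tiling_space L dL \<Omega> \<and> FLC \<Omega> \<and> tiling_space L' dL' \<Omega>' \<and> FLC \<Omega>' \<and>
     factor_map dL \<Omega> dL' \<Omega>' \<phi> \<and>
     (\<forall>r>0. \<exists>R>0. \<forall>T\<in>\<Omega>. \<forall>T'\<in>\<Omega>.
        patch T 0 R = patch T' 0 R \<longrightarrow> patch (\<phi> T) 0 r = patch (\<phi> T') 0 r)"

text \<open>
  Unlabelled Delone sets: the label space is the one-point space. Forgetting labels of a space
  of labelled Delone sets is a local derivation which does not affect membership of the origin,
  so unlabelled target spaces yield every FLC transversal.
\<close>

abbreviation unit_dist :: "unit \<Rightarrow> unit \<Rightarrow> real" where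
  "unit_dist \<equiv> (\<lambda>_ _. 0)"

definition delone_space :: "('a::euclidean_space, unit) config set \<Rightarrow> bool" where
  "delone_space \<Omega> \<longleftrightarrow> tiling_space UNIV unit_dist \<Omega> \<and> (\<forall>T\<in>\<Omega>. is_delone UNIV T)"

text \<open>
  Associated Delone sets. Without FLC the vertices of a tiling may be arbitrarily close to each
  other or fail to depend continuously on the tiling, so a Delone set has to be associated with
  it in some other way, e.g. by the centroids of the tiles. For labelled Delone sets the map
  \<^const>\<open>vertices\<close> qualifies.
\<close>

definition associated_delone_sets ::
    "('l \<Rightarrow> 'l \<Rightarrow> real) \<Rightarrow> ('a::euclidean_space, 'l) config set \<Rightarrow>
     (('a, 'l) config \<Rightarrow> 'a set) \<Rightarrow> bool" where
  "associated_delone_sets dL \<Omega> \<Lambda> \<longleftrightarrow>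
     (\<exists>\<Omega>0. delone_space \<Omega>0 \<and>
        factor_map dL \<Omega> unit_dist \<Omega>0 (\<lambda>T. labelled_points (\<Lambda> T) (\<lambda>_. ())))"

definition FLC_transversal ::
    "'l set \<Rightarrow> ('l \<Rightarrow> 'l \<Rightarrow> real) \<Rightarrow> ('a::euclidean_space, 'l) config set \<Rightarrow>
     ('a, 'l) config set \<Rightarrow> bool" where
  "FLC_transversal L dL \<Omega> \<Xi> \<longleftrightarrow>
     (\<exists>\<Omega>0 \<D>. delone_space \<Omega>0 \<and> local_derivation L dL \<Omega> UNIV unit_dist \<Omega>0 \<D> \<and>
            \<Xi> = {T \<in> \<Omega>. 0 \<in> points (\<D> T)})"

definition transversally_locally_constant ::
    "'l set \<Rightarrow> ('l \<Rightarrow> 'l \<Rightarrow> real) \<Rightarrow> ('a::euclidean_space, 'l) config set \<Rightarrow>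
     (('a, 'l) config \<Rightarrow> 'b) \<Rightarrow> bool" where
  "transversally_locally_constant L dL \<Omega> f \<longleftrightarrow>
     (\<forall>\<Xi>. FLC_transversal L dL \<Omega> \<Xi> \<longrightarrow>
        (\<forall>S\<in>\<Xi>. \<exists>U. openin (config_topology dL \<Omega>) U \<and> S \<in> U \<and> (\<forall>S'\<in>U \<inter> \<Xi>. f S' = f S)))"

definition strong_cocycle ::
    "'l set \<Rightarrow> ('l \<Rightarrow> 'l \<Rightarrow> real) \<Rightarrow> ('a::euclidean_space, 'l) config set \<Rightarrow>
     ('a, 'l) cochain \<Rightarrow> bool" where
  "strong_cocycle L dL \<Omega> \<alpha> \<longleftrightarrow>
     weak_cocycle dL \<Omega> \<alpha> \<and> (\<forall>v. transversally_locally_constant L dL \<Omega> (\<lambda>T. \<alpha> T v))"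

definition strong_coboundary ::
    "'l set \<Rightarrow> ('l \<Rightarrow> 'l \<Rightarrow> real) \<Rightarrow> ('a::euclidean_space, 'l) config set \<Rightarrow>
     ('a, 'l) cochain \<Rightarrow> bool" where
  "strong_coboundary L dL \<Omega> \<alpha> \<longleftrightarrow>
     (\<exists>s. continuous_map (config_topology dL \<Omega>) euclidean s \<and>
          transversally_locally_constant L dL \<Omega> s \<and>
          (\<forall>T\<in>\<Omega>. \<forall>v. \<alpha> T v = s (translate T v) - s T))"

definition strong_rel ::
    "'l set \<Rightarrow> ('l \<Rightarrow> 'l \<Rightarrow> real) \<Rightarrow> ('a::euclidean_space, 'l) config set \<Rightarrow>
     ('a, 'l) cochain rel" where
  "strong_rel L dL \<Omega> = {(\<alpha>, \<beta>). strong_cocycle L dL \<Omega> \<alpha> \<and> strong_cocycle L dL \<Omega> \<beta> \<and>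
                               strong_coboundary L dL \<Omega> (\<lambda>T v. \<alpha> T v - \<beta> T v)}"

definition H1_strong ::
    "'l set \<Rightarrow> ('l \<Rightarrow> 'l \<Rightarrow> real) \<Rightarrow> ('a::euclidean_space, 'l) config set \<Rightarrow>
     ('a, 'l) cochain set set" where
  "H1_strong L dL \<Omega> = {\<alpha>. strong_cocycle L dL \<Omega> \<alpha>} // strong_rel L dL \<Omega>"


section \<open>Cech cohomology in degree one and the strong class\<close>

text \<open>
  A Cech 1-cochain of an indexed cover is a triple (I, U, g) of an index set, a family of sets
  and functions g i j on U i \<inter> U j. Coefficients form the constant sheaf of a discrete group,
  hence local constancy. Two cocycles have the same class in the direct limit over open covers
  iff their pullbacks to some common refinement differ by a coboundary. The refinement may be
  taken indexed by itself, since every indexed cover is refined by its set of members.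
\<close>

type_synonym ('i, 'x, 'b) cech_cochain = "'i set \<times> ('i \<Rightarrow> 'x set) \<times> ('i \<Rightarrow> 'i \<Rightarrow> 'x \<Rightarrow> 'b)"

definition open_cover :: "'x topology \<Rightarrow> 'i set \<Rightarrow> ('i \<Rightarrow> 'x set) \<Rightarrow> bool" where
  "open_cover X I U \<longleftrightarrow> (\<forall>i\<in>I. openin X (U i)) \<and> (\<Union>i\<in>I. U i) = topspace X"

definition locally_constant_on :: "'x topology \<Rightarrow> 'x set \<Rightarrow> ('x \<Rightarrow> 'b) \<Rightarrow> bool" where
  "locally_constant_on X S f \<longleftrightarrow>
     (\<forall>x\<in>S. \<exists>V. openin X V \<and> x \<in> V \<and> (\<forall>y\<in>V \<inter> S. f y = f x))"

definition cech_cocycle :: "'x topology \<Rightarrow> ('i, 'x, 'b::ab_group_add) cech_cochain \<Rightarrow> bool" where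
  "cech_cocycle X c \<longleftrightarrow> (case c of (I, U, g) \<Rightarrow>
     open_cover X I U \<and>
     (\<forall>i\<in>I. \<forall>j\<in>I. locally_constant_on X (U i \<inter> U j) (g i j)) \<and>
     (\<forall>i\<in>I. \<forall>j\<in>I. \<forall>k\<in>I. \<forall>x\<in>U i \<inter> U j \<inter> U k. g i j x + g j k x = g i k x))"

definition cech_cohomologous ::
    "'x topology \<Rightarrow> ('i, 'x, 'b::ab_group_add) cech_cochain \<Rightarrow> ('j, 'x, 'b) cech_cochain \<Rightarrow> bool" where
  "cech_cohomologous X c c' \<longleftrightarrow> cech_cocycle X c \<and> cech_cocycle X c' \<and>
     (case c of (I, U, g) \<Rightarrow> case c' of (J, V, k) \<Rightarrow>
       \<exists>\<W> r s b. open_cover X \<W> id \<and>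
         (\<forall>W\<in>\<W>. r W \<in> I \<and> W \<subseteq> U (r W) \<and> s W \<in> J \<and> W \<subseteq> V (s W) \<and>
                 locally_constant_on X W (b W)) \<and>
         (\<forall>W\<in>\<W>. \<forall>W'\<in>\<W>. \<forall>x\<in>W \<inter> W'.
            g (r W) (r W') x - k (s W) (s W') x = b W x - b W' x))"

definition cech_pullback ::
    "'x topology \<Rightarrow> ('x \<Rightarrow> 'y) \<Rightarrow> ('i, 'y, 'b) cech_cochain \<Rightarrow> ('i, 'x, 'b) cech_cochain" where
  "cech_pullback X h c =
     (case c of (I, V, k) \<Rightarrow> (I, \<lambda>i. {x \<in> topspace X. h x \<in> V i}, \<lambda>i j x. k i j (h x)))"

text \<open>
  The Cech cocycle of a strong 1-cocycle. The cover consists of all open flow boxes, indexed by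
  a transversal \<open>\<Xi>\<close> and a radius for which the product coordinates are unique, so that the
  potential with value \<open>\<alpha> S x\<close> at \<open>S - x\<close> is well defined on the box.
\<close>

definition flow :: "('a::real_normed_vector, 'l) config \<times> 'a \<Rightarrow> ('a, 'l) config" where
  "flow = (\<lambda>(S, x). translate S x)"

definition flow_boxes ::
    "'l set \<Rightarrow> ('l \<Rightarrow> 'l \<Rightarrow> real) \<Rightarrow> ('a::euclidean_space, 'l) config set \<Rightarrow>
     (('a, 'l) config set \<times> real) set" where
  "flow_boxes L dL \<Omega> =
     {(\<Xi>, e). FLC_transversal L dL \<Omega> \<Xi> \<and> 0 < e \<and> inj_on flow (\<Xi> \<times> ball 0 e) \<and>
              openin (config_topology dL \<Omega>) (flow ` (\<Xi> \<times> ball 0 e))}"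

definition flow_box_potential ::
    "('a::real_normed_vector, 'l) cochain \<Rightarrow> ('a, 'l) config set \<times> real \<Rightarrow> ('a, 'l) config \<Rightarrow> 'a" where
  "flow_box_potential \<alpha> = (\<lambda>(\<Xi>, e) P.
     case the_inv_into (\<Xi> \<times> ball 0 e) flow P of (S, x) \<Rightarrow> \<alpha> S x)"

definition cech_of_cocycle ::
    "'l set \<Rightarrow> ('l \<Rightarrow> 'l \<Rightarrow> real) \<Rightarrow> ('a::euclidean_space, 'l) config set \<Rightarrow>
     ('a, 'l) cochain \<Rightarrow> (('a, 'l) config set \<times> real, ('a, 'l) config, 'a) cech_cochain" where
  "cech_of_cocycle L dL \<Omega> \<alpha> =
     (flow_boxes L dL \<Omega>, \<lambda>(\<Xi>, e). flow ` (\<Xi> \<times> ball 0 e),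
      \<lambda>i j P. flow_box_potential \<alpha> i P - flow_box_potential \<alpha> j P)"

definition fundamental_shape :: "('a, 'l) cochain" where
  "fundamental_shape T v = v"

text \<open>
  The strong class of a homeomorphism h, the Cech pullback of the fundamental shape class of the
  target, equals the image of c under the canonical isomorphism from strong to Cech cohomology.
  As that map is well defined on classes, it is computed from a representative of c.
\<close>

definition has_strong_class ::
    "'l set \<Rightarrow> ('l \<Rightarrow> 'l \<Rightarrow> real) \<Rightarrow> ('a::euclidean_space, 'l) config set \<Rightarrow>
     'k set \<Rightarrow> ('k \<Rightarrow> 'k \<Rightarrow> real) \<Rightarrow> ('a, 'k) config set \<Rightarrow>
     (('a, 'l) config \<Rightarrow> ('a, 'k) config) \<Rightarrow> ('a, 'l) cochain set \<Rightarrow> bool" where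
  "has_strong_class L dL \<Omega> L' dL' \<Omega>' h c \<longleftrightarrow>
     (\<exists>\<alpha>\<in>c. cech_cohomologous (config_topology dL \<Omega>)
        (cech_pullback (config_topology dL \<Omega>) h (cech_of_cocycle L' dL' \<Omega>' fundamental_shape))
        (cech_of_cocycle L dL \<Omega> \<alpha>))"


section \<open>The Ruelle-Sullivan map\<close>

definition ruelle_sullivan ::
    "(real ^ 'n, 'l) config measure \<Rightarrow> (real ^ 'n, 'l) cochain \<Rightarrow> real ^ 'n ^ 'n" where
  "ruelle_sullivan \<mu> \<alpha> = matrix (\<lambda>v. \<integral>T. \<alpha> T v \<partial>\<mu>)"

text \<open>The matrix only depends on the class, so any representative may be chosen.\<close>

definition ruelle_sullivan_class ::
    "(real ^ 'n, 'l) config measure \<Rightarrow> (real ^ 'n, 'l) cochain set \<Rightarrow> real ^ 'n ^ 'n" where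
  "ruelle_sullivan_class \<mu> c = ruelle_sullivan \<mu> (SOME \<alpha>. \<alpha> \<in> c)"


section \<open>Pattern-equivariant forms\<close>

text \<open>
  A vector-valued 1-form is a matrix field: its value at x on a vector v is \<open>\<omega> x *v v\<close>, so
  \<open>\<omega> x $ i $ j\<close> is the coefficient of the j-th coordinate differential in the i-th component.
\<close>

type_synonym 'n form = "real ^ 'n \<Rightarrow> real ^ 'n ^ 'n"

definition partial_deriv :: "'n::finite \<Rightarrow> (real ^ 'n \<Rightarrow> real) \<Rightarrow> real ^ 'n \<Rightarrow> real" where
  "partial_deriv k f x = deriv (\<lambda>t. f (x + t *\<^sub>R axis k 1)) 0"

definition iterated_partial :: "'n::finite list \<Rightarrow> (real ^ 'n \<Rightarrow> real) \<Rightarrow> real ^ 'n \<Rightarrow> real" where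
  "iterated_partial ks f = foldr partial_deriv ks f"

text \<open>Differentiability of all iterated partial derivatives makes them continuous as well.\<close>

definition smooth_fun :: "(real ^ 'n::finite \<Rightarrow> real) \<Rightarrow> bool" where
  "smooth_fun f \<longleftrightarrow> (\<forall>ks x. iterated_partial ks f differentiable (at x))"

definition smooth_form :: "'n::finite form \<Rightarrow> bool" where
  "smooth_form \<omega> \<longleftrightarrow> (\<forall>i j. smooth_fun (\<lambda>x. \<omega> x $ i $ j))"

definition closed_form :: "'n::finite form \<Rightarrow> bool" where
  "closed_form \<omega> \<longleftrightarrow>
     (\<forall>i j k x. partial_deriv k (\<lambda>y. \<omega> y $ i $ j) x = partial_deriv j (\<lambda>y. \<omega> y $ i $ k) x)"

definition strongly_PE ::
    "('a::real_normed_vector, 'l) config \<Rightarrow> real \<Rightarrow> ('a \<Rightarrow> 'b) \<Rightarrow> bool" where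
  "strongly_PE T R f \<longleftrightarrow>
     (\<forall>x y. patch (translate T x) 0 R = patch (translate T y) 0 R \<longrightarrow> f x = f y)"

definition weakly_PE ::
    "('l \<Rightarrow> 'l \<Rightarrow> real) \<Rightarrow> ('a::real_normed_vector, 'l) config set \<Rightarrow> ('a, 'l) config \<Rightarrow>
     ('a \<Rightarrow> real) \<Rightarrow> bool" where
  "weakly_PE dL \<Omega> T f \<longleftrightarrow>
     (\<exists>F. continuous_map (config_topology dL \<Omega>) euclidean F \<and> (\<forall>x. f x = F (translate T x)))"

definition strongly_PE_form ::
    "(real ^ 'n, 'l) config \<Rightarrow> real \<Rightarrow> 'n::finite form \<Rightarrow> bool" where
  "strongly_PE_form T R \<omega> \<longleftrightarrow>
     0 < R \<and> smooth_form \<omega> \<and> (\<forall>i j. strongly_PE T R (\<lambda>x. \<omega> x $ i $ j))"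

definition weakly_PE_form ::
    "('l \<Rightarrow> 'l \<Rightarrow> real) \<Rightarrow> (real ^ 'n, 'l) config set \<Rightarrow> (real ^ 'n, 'l) config \<Rightarrow>
     'n::finite form \<Rightarrow> bool" where
  "weakly_PE_form dL \<Omega> T \<omega> \<longleftrightarrow>
     smooth_form \<omega> \<and> (\<forall>ks i j. weakly_PE dL \<Omega> T (iterated_partial ks (\<lambda>x. \<omega> x $ i $ j)))"

text \<open>The integral along the straight segment; for closed forms every path gives this value.\<close>

definition form_integral :: "'n::finite form \<Rightarrow> real ^ 'n \<Rightarrow> real ^ 'n \<Rightarrow> real ^ 'n" where
  "form_integral \<omega> x y = integral {0..1} (\<lambda>t. \<omega> (x + t *\<^sub>R (y - x)) *v (y - x))"

definition represents ::
    "(real ^ 'n, 'l) config \<Rightarrow> 'n::finite form \<Rightarrow> (real ^ 'n, 'l) cochain set \<Rightarrow> bool" where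
  "represents T \<omega> c \<longleftrightarrow>
     (\<exists>\<alpha>\<in>c. \<forall>x v. \<alpha> (translate T x) v = form_integral \<omega> x (x + v))"


section \<open>Shape deformations\<close>

definition orbit_closure ::
    "'l set \<Rightarrow> ('l \<Rightarrow> 'l \<Rightarrow> real) \<Rightarrow> ('a::euclidean_space, 'l) config \<Rightarrow> ('a, 'l) config set" where
  "orbit_closure L dL T = config_topology dL {S. is_delone L S} closure_of translation_orbit T"

text \<open>
  T' is the set of points of \<open>\<Lambda>\<close> moved by \<open>A(x) = \<integral>\<^sub>0\<^sup>x \<omega>\<close>, with their labels; h is the continuous
  extension of \<open>T - x \<mapsto> T' - A(x)\<close>. It is unique if the orbit of T is dense.
\<close>

definition shape_deformation ::
    "('l \<Rightarrow> 'l \<Rightarrow> real) \<Rightarrow> (real ^ 'n, 'l) config set \<Rightarrow> (real ^ 'n, 'l) config \<Rightarrow>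
     (real ^ 'n) set \<Rightarrow> 'n::finite form \<Rightarrow>
     'k set \<Rightarrow> ('k \<Rightarrow> 'k \<Rightarrow> real) \<Rightarrow> (real ^ 'n \<Rightarrow> 'k) \<Rightarrow> (real ^ 'n, 'k) config set \<Rightarrow>
     ((real ^ 'n, 'l) config \<Rightarrow> (real ^ 'n, 'k) config) \<Rightarrow> bool" where
  "shape_deformation dL \<Omega> T \<Lambda> \<omega> L' dL' lab \<Omega>' h \<longleftrightarrow>
     closed_form \<omega> \<and>
     (let A = form_integral \<omega> 0; T' = (\<lambda>p. ({A p}, lab p)) ` \<Lambda> in
        homeomorphic_map euclidean euclidean A \<and>
        \<Omega>' = orbit_closure L' dL' T' \<and>
        continuous_map (config_topology dL \<Omega>) (config_topology dL' \<Omega>') h \<and>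
        (\<forall>x. h (translate T x) = translate T' (A x)))"

text \<open>Neighbouring points of a Delone set: their Voronoi cells meet.\<close>

definition neighbours :: "'a::metric_space set \<Rightarrow> 'a \<Rightarrow> 'a \<Rightarrow> bool" where
  "neighbours \<Lambda> p q \<longleftrightarrow>
     p \<in> \<Lambda> \<and> q \<in> \<Lambda> \<and> (\<exists>x. dist x p = infdist x \<Lambda> \<and> dist x q = infdist x \<Lambda>)"

definition patch_label ::
    "('a::real_normed_vector, 'l) config \<Rightarrow> real \<Rightarrow> 'a \<Rightarrow> ('a, 'l) config" where
  "patch_label T R0 p = patch (translate T p) 0 R0"

text \<open>
  FLC case: labels are patches of radius R0, centred at the origin. There are finitely many of
  them, and they carry the discrete metric.
\<close>

definition strong_shape_deformation ::
    "('l \<Rightarrow> 'l \<Rightarrow> real) \<Rightarrow> (real ^ 'n, 'l) config set \<Rightarrow> (real ^ 'n, 'l) config \<Rightarrow>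
     (real ^ 'n) set \<Rightarrow> 'n::finite form \<Rightarrow> real \<Rightarrow> real \<Rightarrow>
     (real ^ 'n, (real ^ 'n, 'l) config) config set \<Rightarrow>
     ((real ^ 'n, 'l) config \<Rightarrow> (real ^ 'n, (real ^ 'n, 'l) config) config) \<Rightarrow> bool" where
  "strong_shape_deformation dL \<Omega> T \<Lambda> \<omega> R R0 \<Omega>' h \<longleftrightarrow>
     strongly_PE_form T R \<omega> \<and> (\<forall>p q. neighbours \<Lambda> p q \<longrightarrow> R + dist p q < R0) \<and>
     shape_deformation dL \<Omega> T \<Lambda> \<omega>
       (patch_label T R0 ` \<Lambda>) discrete_metric.dd (patch_label T R0) \<Omega>' h"

text \<open>General case: the label of p is \<open>T - p\<close>, an element of the compact metric space \<open>\<Omega>\<close>.\<close>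

definition weak_shape_deformation ::
    "('l \<Rightarrow> 'l \<Rightarrow> real) \<Rightarrow> (real ^ 'n, 'l) config set \<Rightarrow> (real ^ 'n, 'l) config \<Rightarrow>
     (real ^ 'n) set \<Rightarrow> 'n::finite form \<Rightarrow>
     (real ^ 'n, (real ^ 'n, 'l) config) config set \<Rightarrow>
     ((real ^ 'n, 'l) config \<Rightarrow> (real ^ 'n, (real ^ 'n, 'l) config) config) \<Rightarrow> bool" where
  "weak_shape_deformation dL \<Omega> T \<Lambda> \<omega> \<Omega>' h \<longleftrightarrow>
     weakly_PE_form dL \<Omega> T \<omega> \<and>
     shape_deformation dL \<Omega> T \<Lambda> \<omega> \<Omega> (config_dist dL) (translate T) \<Omega>' h"

end

theory Submission
 imports Defs "HOL-Computational_Algebra.Polynomial"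
begin

text \<open>
 A class is represented by the smoothing of one of its cocycles. Convolving \<open>\<beta>(T, \<cdot>)\<close> with a bump
 of width r changes \<open>\<beta>\<close> by a coboundary and yields a cocycle \<open>\<gamma>\<close> that is smooth along orbits; its
 derivative at the origin is an average of difference quotients of \<open>\<beta>\<close> over the distance r. Under
 unique ergodicity orbit averages of continuous functions converge uniformly
 (\<open>uniform_ergodic_averages\<close>), so \<open>\<beta>(T, v)\<close> differs from \<open>C v\<close> by at most \<open>\<epsilon> |v| + B\<close>, uniformly
 in T, where C is the Ruelle-Sullivan matrix (\<open>cocycle_growth\<close>). For large r the derivative of \<open>\<gamma>\<close>
 is therefore uniformly close to C. As C is invertible, \<open>x \<mapsto> \<gamma>(T, x)\<close> is, for all T at once, a
 homeomorphism of the Euclidean space that expands distances up to a constant factor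
 (\<open>near_linear_smoothing\<close>). This map is the integral of a closed pattern-equivariant form.

 Let \<open>deform T\<close> consist of the points p of the Delone set of T, moved to \<open>\<gamma>(T, p)\<close> with their labels.
 The cocycle equation gives \<open>deform (T - x) = deform T - \<gamma>(T, x)\<close>. By expansion, deform is
 continuous; by compactness and minimality, its image is the orbit closure of \<open>deform T\<close>. What has
 to be proved for each kind of labels is injectivity. A label \<open>T - p\<close> contains the entire
 configuration. A patch of large radius contains the neighbouring vertices and their displacements,
 so agreement at one vertex spreads along chains of vertices (\<open>deform_propagate\<close>). In the general
 case the displacement cocycle of deform is \<open>\<gamma>\<close>, which is cohomologous to \<open>\<beta>\<close>; this computes the weak
 class. The Delone sets exist because tiles have a continuous choice of interior points, namely
 centres of mass for the distance to the complement (\<open>associated_delone_sets_exist\<close>).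

 The strong case requires the form to depend on patches only. A strong cocycle need not: it is
 locally constant on transversals, but arbitrary along the flow. Its values between vertices are
 determined by patches, however, and replacing its value at x by an average over the vertices near
 x alters it by a strong coboundary (\<open>local_representative\<close>). Smoothing keeps it local. All
 arguments of this kind rest on rigidity: elements of a space of finite local complexity that are
 close in the tiling metric show the same patch up to a small translation (\<open>patch_rigidity\<close>).
 Rigidity also compares the Cech cocycles. If Q' is matched with Q by a small translation z, the
 potential of \<open>\<gamma>\<close> on each flow box of the space and that of the fundamental shape on each flow box of
 the image drop by the same vector \<open>\<gamma>(Q', z)\<close>, so their differences are locally constant
 (\<open>has_strong_class_deform\<close>).
\<close>

section \<open>The tiling metric\<close>

text \<open>Compactness lets infima be attained, so closeness at exactly e needs no slack.\<close>

lemma hausdist_le_iff: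
 fixes S T :: "'a::heine_borel set"
 assumes "compact S" "S ~= {}" "compact T" "T ~= {}"
 shows "hausdist S T <= e \<longleftrightarrow> (\<forall>x\<in>S. \<exists>y\<in>T. dist x y <= e) \<and> (\<forall>y\<in>T. \<exists>x\<in>S. dist x y <= e)"
proof -
 have *: "(SUP x\<in>A. infdist x B) <= e \<longleftrightarrow> (\<forall>x\<in>A. \<exists>y\<in>B. dist x y <= e)"
  if A: "compact A" "A ~= {}" and B: "compact B" "B ~= {}" for A B :: "'a set"
 proof -
  have "bdd_above ((\<lambda>x. infdist x B) ` A)"
   by (intro compact_imp_bounded bounded_imp_bdd_above compact_continuous_image
     continuous_on_infdist continuous_on_id A)
  then have "(SUP x\<in>A. infdist x B) <= e \<longleftrightarrow> (\<forall>x\<in>A. infdist x B <= e)"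
   using A by (auto intro: cSUP_least cSUP_upper2 simp: cSUP_le_iff)
  also have "... \<longleftrightarrow> (\<forall>x\<in>A. \<exists>y\<in>B. dist x y <= e)"
  proof (intro ball_cong refl iffI)
   fix x assume "infdist x B <= e"
   moreover obtain y where "y \<in> B" "infdist x B = dist x y"
    using infdist_attains_inf[of B x] B compact_imp_closed by metis
   ultimately show "\<exists>y\<in>B. dist x y <= e" by auto
  next
   fix x assume "\<exists>y\<in>B. dist x y <= e"
   then show "infdist x B <= e" by (meson infdist_le order_trans)
  qed
  finally show ?thesis .
 qed
 show ?thesis
  unfolding hausdist_def using *[of S T] *[of T S] assms by (auto simp: dist_commute)
qed

lemma hausdist_commute: "hausdist S T = hausdist T S"
 unfolding hausdist_def by (simp add: max.commute)

lemma hausdist_nearest: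
 fixes S T :: "'a::heine_borel set"
 assumes "compact S" "S ~= {}" "compact T" "T ~= {}" "x \<in> S"
 obtains y where "y \<in> T" "dist x y <= hausdist S T"
 using hausdist_le_iff[OF assms(1-4), of "hausdist S T"] assms(5) by auto

lemma hausdist_nonneg:
 fixes S T :: "'a::heine_borel set"
 assumes "compact S" "S ~= {}" "compact T" "T ~= {}"
 shows "0 <= hausdist S T"
 using hausdist_nearest[OF assms] assms(2) by (metis all_not_in_conv order_trans zero_le_dist)

lemma hausdist_triangle:
 fixes S T U :: "'a::heine_borel set"
 assumes "compact S" "S ~= {}" "compact T" "T ~= {}" "compact U" "U ~= {}"
 shows "hausdist S U <= hausdist S T + hausdist T U"
proof -
 have "\<exists>z\<in>C. dist x z <= hausdist A B + hausdist B C"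
  if AB: "compact A" "A ~= {}" "compact B" "B ~= {}" "compact C" "C ~= {}" and xA: "x \<in> A" for A B C :: "'a set" and x
 proof -
  obtain y where y: "y \<in> B" "dist x y <= hausdist A B" by (rule hausdist_nearest[OF AB(1-4) xA])
  obtain z where z: "z \<in> C" "dist y z <= hausdist B C" by (rule hausdist_nearest[OF AB(3-6) y(1)])
  show ?thesis using y z dist_triangle[of x z y] by (intro bexI[of _ z]) auto
 qed
 note * = this
 have "\<forall>x\<in>S. \<exists>z\<in>U. dist x z <= hausdist S T + hausdist T U" using *[OF assms] by blast
 moreover have "\<forall>z\<in>U. \<exists>x\<in>S. dist x z <= hausdist S T + hausdist T U"
  using *[OF assms(5,6,3,4,1,2)]
  by (simp add: hausdist_commute[of U T] hausdist_commute[of T S] dist_commute add.commute)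
 ultimately show ?thesis
  unfolding hausdist_le_iff[OF assms(1,2,5,6)] by blast
qed

lemma hausdist_self [simp]:
 fixes S :: "'a::heine_borel set"
 shows "compact S ==> S ~= {} ==> hausdist S S = 0"
 by (intro antisym hausdist_nonneg) (use order_refl in \<open>force simp: hausdist_le_iff\<close>)+

lemma hausdist_zero_imp_eq:
 fixes S T :: "'a::heine_borel set"
 assumes "compact S" "S ~= {}" "compact T" "T ~= {}" "hausdist S T <= 0"
 shows "S = T"
 using assms(5) unfolding hausdist_le_iff[OF assms(1-4)] by (auto simp: dist_le_zero_iff)

lemma hausdist_translates:
 fixes S T :: "'a::euclidean_space set"
 assumes "compact S" "S ~= {}" "compact T" "T ~= {}"
 shows "hausdist ((\<lambda>y. y - x) ` S) ((\<lambda>y. y - x') ` T) <= hausdist S T + norm (x - x')"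
proof -
 have c: "compact ((\<lambda>y. y - z) ` A)" if "compact A" for A and z :: 'a
  using compact_translation_subtract[OF that] .
 have d: "dist (p - a) (q - b) <= dist p q + norm (a - b)" for p q a b :: 'a
 proof -
  have "(p - a) - (q - b) = (p - q) - (a - b)" by simp
  then show ?thesis unfolding dist_norm by (metis norm_triangle_ineq4)
 qed
 have "\<exists>y\<in>T. dist (p - x) (y - x') <= hausdist S T + norm (x - x')" if p: "p \<in> S" for p
 proof -
  obtain y where "y \<in> T" "dist p y <= hausdist S T" using hausdist_nearest[OF assms p] .
  then show ?thesis using d[of p x y x'] by (intro bexI[of _ y]) auto
 qed
 moreover have "\<exists>p\<in>S. dist (p - x) (y - x') <= hausdist S T + norm (x - x')" if y: "y \<in> T" for y
 proof -
  obtain p where "p \<in> S" "dist y p <= hausdist T S" using hausdist_nearest[OF assms(3,4,1,2) y] .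
  then show ?thesis using d[of p x y x']
   by (intro bexI[of _ p]) (auto simp: hausdist_commute dist_commute)
 qed
 ultimately show ?thesis
  using assms by (subst hausdist_le_iff) (auto simp: c)
qed

lemma hausdist_singletons [simp]: "hausdist {x} {y} = dist x y"
 by (simp add: hausdist_def dist_commute)

text \<open>
 Closeness of configurations only needs tiles to have compact non-empty supports; in this
 generality tiles and labelled points are treated together.
\<close>

definition ctile :: "'l set => 'a::heine_borel set \<times> 'l => bool" where
 "ctile L t \<longleftrightarrow> compact (fst t) \<and> fst t ~= {} \<and> snd t \<in> L"

definition locally_finite_config :: "'l set => ('a::euclidean_space, 'l) config => bool" where
 "locally_finite_config L T \<longleftrightarrow> (\<forall>t\<in>T. ctile L t) \<and> (\<forall>R. finite (patch T 0 R))"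

lemma is_tile_imp_ctile: "is_tile L t ==> ctile L t"
 unfolding is_tile_def ctile_def using polytope_imp_compact by fastforce

lemma tile_dist_commute:
 assumes "Metric_space L dL" shows "tile_dist dL t t' = tile_dist dL t' t"
 unfolding tile_dist_def by (metis hausdist_commute Metric_space.commute assms)

lemma tile_dist_self:
 assumes "Metric_space L dL" "ctile L t" shows "tile_dist dL t t = 0"
 using assms unfolding tile_dist_def ctile_def by (simp add: Metric_space.mdist_zero)

lemma tile_dist_nonneg:
 assumes "Metric_space L dL" shows "0 <= tile_dist dL t t'"
 unfolding tile_dist_def by (metis max.coboundedI2 Metric_space.nonneg assms)

lemma tile_dist_triangle:
 assumes "Metric_space L dL" "ctile L t" "ctile L t'" "ctile L t''"
 shows "tile_dist dL t t'' <= tile_dist dL t t' + tile_dist dL t' t''"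
proof -
 have "hausdist (fst t) (fst t'') <= hausdist (fst t) (fst t') + hausdist (fst t') (fst t'')"
  using assms(2-) unfolding ctile_def by (intro hausdist_triangle) auto
 moreover have "dL (snd t) (snd t'') <= dL (snd t) (snd t') + dL (snd t') (snd t'')"
  using assms unfolding ctile_def by (auto intro: Metric_space.triangle)
 ultimately show ?thesis unfolding tile_dist_def by linarith
qed

lemma tile_dist_zero_imp_eq:
 assumes "Metric_space L dL" "ctile L t" "ctile L t'" "tile_dist dL t t' <= 0"
 shows "t = t'"
proof -
 have "hausdist (fst t) (fst t') <= 0" "dL (snd t) (snd t') <= 0"
  using assms(4) unfolding tile_dist_def by auto
 moreover have "0 <= dL (snd t) (snd t')" using assms(1) by (simp add: Metric_space.nonneg)
 ultimately have "fst t = fst t'" "snd t = snd t'"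
  using assms(1-3) hausdist_zero_imp_eq unfolding ctile_def
  by (blast, metis (no_types, lifting) Metric_space.zero antisym)
 then show ?thesis by (simp add: prod_eq_iff)
qed

text \<open>Approximation by elements of a finite set is eventually equality.\<close>

lemma tile_in_finite_set:
 assumes L: "Metric_space L dL" and A: "finite A" "!!u. u \<in> A ==> ctile L u" and t: "ctile L t"
  and near: "!!e. 0 < e ==> \<exists>u\<in>A. tile_dist dL t u <= e"
 shows "t \<in> A"
proof (rule ccontr)
 assume "t \<notin> A"
 then have "0 < tile_dist dL t u" if "u \<in> A" for u
  using tile_dist_zero_imp_eq[OF L t A(2)[OF that]] that by force
 then have "0 < Min (insert 1 (tile_dist dL t ` A))" using A(1) by simp
 then obtain u where "u \<in> A" "tile_dist dL t u <= Min (insert 1 (tile_dist dL t ` A)) / 2" using near half_gt_zero by blast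
 moreover from this have "Min (insert 1 (tile_dist dL t ` A)) <= tile_dist dL t u" using A(1) by simp
 ultimately show False using \<open>0 < Min (insert 1 (tile_dist dL t ` A))\<close> by linarith
qed

lemma tile_dist_meets_ball:
 assumes "ctile L t" "ctile L t'" "tile_dist dL t t' <= e"
  and "fst t \<inter> ball 0 R ~= {}"
 shows "fst t' \<inter> ball (0::'a::euclidean_space) (R + e) ~= {}"
proof -
 obtain x where x: "x \<in> fst t" "norm x < R" using assms(4) by auto
 have "hausdist (fst t) (fst t') <= e" using assms(3) unfolding tile_dist_def by auto
 then obtain y where y: "y \<in> fst t'" "dist x y <= e"
  using assms(1,2) x hausdist_le_iff unfolding ctile_def by metis
 then have "norm y < R + e" using x
  by (metis add.commute add_mono_thms_linordered_field(3) dist_commute dist_norm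
    le_less_trans norm_triangle_sub)
 then show ?thesis using y by auto
qed

lemma patch_subset: "patch T x R \<subseteq> T" unfolding patch_def by auto

lemma patch_mono: "R <= R' ==> patch T x R \<subseteq> patch T x R'"
 unfolding patch_def by auto

lemma config_close_mono:
 assumes "config_close dL e T T'" "0 < e" "e <= e'"
 shows "config_close dL e' T T'"
proof -
 have "1 / e' <= 1 / e" using assms by (simp add: frac_le)
 then show ?thesis using assms(1,3) patch_mono[of "1/e'" "1/e"]
  unfolding config_close_def by (meson order_trans)
qed

lemma config_close_commute:
 assumes "Metric_space L dL" "config_close dL e T T'"
 shows "config_close dL e T' T"
proof -
 from assms(2) obtain P P' f where f: "patch T 0 (1 / e) \<subseteq> P" "P \<subseteq> T" "patch T' 0 (1 / e) \<subseteq> P'" "P' \<subseteq> T'"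
    "bij_betw f P P'" "\<forall>t\<in>P. tile_dist dL t (f t) <= e"
  unfolding config_close_def by blast
 have g: "bij_betw (inv_into P f) P' P" using f by (simp add: bij_betw_inv_into)
 have "tile_dist dL t (inv_into P f t) <= e" if "t \<in> P'" for t
 proof -
  have "inv_into P f t \<in> P" using g that by (meson bij_betwE)
  moreover have "f (inv_into P f t) = t" using f(5) that by (simp add: bij_betw_inv_into_right)
  ultimately show ?thesis using f(6) tile_dist_commute[OF assms(1)] by metis
 qed
 then show ?thesis unfolding config_close_def using f g by blast
qed

text \<open>
 The condition \<open>e + e' <= 1\<close> makes the radii fit: it yields \<open>1 / (e + e') + e <= 1 / e'\<close>, so a
 tile meeting the ball of radius \<open>1 / (e + e')\<close> still meets the ball controlled by the second
 correspondence after it has moved by e. The composite correspondence lives on those tiles whose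
 partners lie in the domain of the second one.
\<close>

lemma config_close_trans:
 fixes T T' T'' :: "('a::euclidean_space, 'l) config"
 assumes L: "Metric_space L dL"
  and T: "\<forall>t\<in>T. ctile L t" "\<forall>t\<in>T'. ctile L t" "\<forall>t\<in>T''. ctile L t"
  and c: "config_close dL e T T'" "config_close dL e' T' T''"
  and e: "0 < e" "0 < e'" "e + e' <= 1"
 shows "config_close dL (e + e') T T''"
proof -
 from c(1) obtain P P' f where f: "patch T 0 (1 / e) \<subseteq> P" "P \<subseteq> T" "patch T' 0 (1 / e) \<subseteq> P'" "P' \<subseteq> T'"
    "bij_betw f P P'" "\<forall>t\<in>P. tile_dist dL t (f t) <= e"
  unfolding config_close_def by blast
 from c(2) obtain Q Q' g where g: "patch T' 0 (1 / e') \<subseteq> Q" "Q \<subseteq> T'" "patch T'' 0 (1 / e') \<subseteq> Q'" "Q' \<subseteq> T''"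
    "bij_betw g Q Q'" "\<forall>t\<in>Q. tile_dist dL t (g t) <= e'"
  unfolding config_close_def by blast
 have r: "1 / (e + e') + a <= 1 / b" if "a + b = e + e'" "0 < a" "0 < b" for a b
 proof -
  have "(1 / (e + e') + a) * b <= 1"
  proof -
   have "(1 / (e + e') + a) * b = b / (e + e') + a * b" by (simp add: algebra_simps)
   moreover have "a * b <= a / (e + e')"
   proof -
    have "b * (e+e') <= 1" using that e by (intro mult_le_one) auto
    then have "b <= 1 / (e + e')" using e by (simp add: field_simps)
    then have "a * b <= a * (1 / (e+e'))" using that by (intro mult_left_mono) auto
    then show ?thesis by simp
   qed
   moreover have "b / (e+e') + a / (e+e') = 1" using that e by (simp flip: add_divide_distrib add: add.commute)
   ultimately show ?thesis by linarith
  qed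
  then show ?thesis using that by (simp add: field_simps)
 qed
 have r1: "1 / (e + e') + e <= 1 / e'" "1 / (e + e') + e' <= 1 / e" using r[of e e'] r[of e' e] e by auto
 define A where "A = {t \<in> P. f t \<in> Q}"
 define B where "B = (g \<circ> f) ` A"
 have fA: "f ` A = P' \<inter> Q" unfolding A_def using f(5) by (auto simp: bij_betw_def)
 have inj: "inj_on (g \<circ> f) A"
 proof (rule comp_inj_on)
  show "inj_on f A" using f(5) unfolding A_def bij_betw_def by (auto intro: inj_on_subset)
  show "inj_on g (f ` A)" using g(5) unfolding fA bij_betw_def by (auto intro: inj_on_subset)
 qed
 have "patch T 0 (1/(e+e')) \<subseteq> A"
 proof
  fix t assume t: "t \<in> patch T 0 (1/(e+e'))"
  have tP: "t \<in> P" using t f(1) patch_mono[of "1/(e+e')" "1/e" T 0] r1(2) e by force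
  then have "f t \<in> P'" using f(5) by (meson bij_betwE)
  then have ft: "f t \<in> T'" "tile_dist dL t (f t) <= e" using f tP by auto
  have "fst (f t) \<inter> ball 0 (1/(e+e') + e) ~= {}"
   using t ft T unfolding patch_def by (intro tile_dist_meets_ball[of L t]) auto
  then have "f t \<in> patch T' 0 (1/e')" using ft(1) r1(1) unfolding patch_def by auto
  then show "t \<in> A" unfolding A_def using tP g(1) by auto
 qed
 moreover have "patch T'' 0 (1/(e+e')) \<subseteq> B"
 proof
  fix t assume t: "t \<in> patch T'' 0 (1/(e+e'))"
  have "t \<in> Q'" using t g(3) patch_mono[of "1/(e+e')" "1/e'" T'' 0] r1(1) e by force
  then obtain s where s: "s \<in> Q" "g s = t" using g(5) by (auto simp: bij_betw_def)
  then have "s \<in> T'" "tile_dist dL s t <= e'" using g(2,6) s by auto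
  then have ft: "s \<in> T'" "tile_dist dL t s <= e'" unfolding tile_dist_commute[OF L, of t s] by auto
  have "fst s \<inter> ball 0 (1/(e+e') + e') ~= {}"
   using t ft T unfolding patch_def by (intro tile_dist_meets_ball[of L t]) auto
  then have "s \<in> patch T' 0 (1/e)" using ft(1) r1(2) unfolding patch_def by auto
  then have "s \<in> f ` A" unfolding fA using s f(3) by auto
  then show "t \<in> B" unfolding B_def using s by auto
 qed
 moreover have "A \<subseteq> T" "B \<subseteq> T''" unfolding A_def B_def using f g by (auto simp: bij_betw_def)
 moreover have "bij_betw (g \<circ> f) A B" using inj unfolding B_def by (rule inj_on_imp_bij_betw)
 moreover have "tile_dist dL t ((g \<circ> f) t) <= e + e'" if "t \<in> A" for t
 proof -
  have "t \<in> P" "f t \<in> P'" "f t \<in> Q" "g (f t) \<in> Q'"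
   using that f(5) g(5) unfolding A_def by (auto simp: bij_betw_def)
  then have "t \<in> T" "f t \<in> T'" "g (f t) \<in> T''" "tile_dist dL t (f t) <= e" "tile_dist dL (f t) (g (f t)) <= e'"
   using f g by auto
  then show ?thesis using tile_dist_triangle[OF L, of t "f t" "g (f t)"] T by fastforce
 qed
 ultimately show ?thesis unfolding config_close_def
  by (intro exI[of _ A] exI[of _ B] exI[of _ "g \<circ> f"]) auto
qed

lemma config_dist_nonneg: "0 <= config_dist dL T T'"
 unfolding config_dist_def by (rule cInf_greatest) auto

lemma config_dist_le_1: "config_dist dL T T' <= 1"
 unfolding config_dist_def by (rule cInf_lower) (auto intro: bdd_belowI[of _ 0])

lemma config_dist_le:
 assumes "config_close dL e T T'" "0 < e"
 shows "config_dist dL T T' <= e"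
proof (cases "e < 1")
 case True
 then show ?thesis unfolding config_dist_def
  by (intro cInf_lower) (auto intro: bdd_belowI[of _ 0] assms)
qed (use config_dist_le_1[of dL T T'] in linarith)

lemma config_dist_less_imp_close:
 assumes "config_dist dL T T' < e" "e <= 1"
 obtains e' where "0 < e'" "e' < e" "config_close dL e' T T'"
proof -
 have "\<exists>x\<in>insert 1 {e. 0 < e \<and> e < 1 \<and> config_close dL e T T'}. x < e"
  using assms(1) unfolding config_dist_def
  by (subst (asm) cInf_less_iff) (auto intro: bdd_belowI[of _ 0])
 then show ?thesis using assms(2) that by auto
qed

text \<open>
 By local finiteness the tiles of T' that approximate a given tile t better and better all belong
 to one finite patch, so one of them is t.
\<close>

lemma config_close_all_imp_subset:
 assumes L: "Metric_space L dL" and T: "locally_finite_config L T" "locally_finite_config L T'"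
  and c: "!!e. 0 < e ==> e < 1 ==> config_close dL e T T'"
 shows "T \<subseteq> T'"
proof
 fix t assume t: "t \<in> T"
 have ct: "ctile L t" using T t unfolding locally_finite_config_def by auto
 then obtain x where x: "x \<in> fst t" unfolding ctile_def by auto
 define R where "R = norm x + 1"
 have R: "R \<ge> 1" unfolding R_def by simp
 define F where "F = patch T' 0 (R + 1)"
 have F: "finite F" "\<forall>s\<in>F. ctile L s" using T unfolding F_def locally_finite_config_def patch_def by auto
 have "\<exists>s\<in>F. tile_dist dL t s <= e" if e: "0 < e" "e < 1 / R" for e
 proof -
  have e1: "e < 1" using e R by (smt (verit) divide_le_eq_1)
  have Re: "R < 1 / e" using e R by (simp add: field_simps)
  from c[OF e(1) e1] obtain P P' f where f: "patch T 0 (1 / e) \<subseteq> P" "P \<subseteq> T" "patch T' 0 (1 / e) \<subseteq> P'" "P' \<subseteq> T'"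
    "bij_betw f P P'" "\<forall>t\<in>P. tile_dist dL t (f t) <= e"
   unfolding config_close_def by blast
  have xR: "x \<in> ball 0 R" unfolding R_def by simp
  have "t \<in> patch T 0 (1/e)" using t x xR Re unfolding patch_def by auto
  then have tP: "t \<in> P" using f by auto
  have s: "f t \<in> T'" "tile_dist dL t (f t) <= e" using f tP by (auto simp: bij_betw_def)
  have "fst (f t) \<inter> ball 0 (R + e) ~= {}"
   using x xR s ct T by (intro tile_dist_meets_ball[of L t]) (auto simp: locally_finite_config_def)
  then have "f t \<in> F" unfolding F_def patch_def using s e1 by auto
  then show ?thesis using s by auto
 qed
 note * = this
 have "t \<in> F"
 proof (rule tile_in_finite_set[OF L F(1) _ ct])
  fix e :: real assume "0 < e"
  moreover have "0 < 1 / (2 * R)" "1 / (2 * R) < 1 / R" using R by (simp_all add: field_simps)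
  ultimately show "\<exists>s\<in>F. tile_dist dL t s <= e" using *[of "min e (1 / (2 * R))"] by (auto simp: min_less_iff_disj)
 qed (use F(2) in blast)
 then show "t \<in> T'" unfolding F_def patch_def by simp
qed

lemma Metric_space_config:
 assumes L: "Metric_space L dL" and M: "!!T. T \<in> M ==> locally_finite_config L T"
 shows "Metric_space M (config_dist dL)"
proof
 fix x y show "0 <= config_dist dL x y" by (rule config_dist_nonneg)
 have "config_close dL e x y \<longleftrightarrow> config_close dL e y x" for e
  using config_close_commute[OF L] by blast
 then show "config_dist dL x y = config_dist dL y x" unfolding config_dist_def by simp
next
 fix x y assume xy: "x \<in> M" "y \<in> M"
 show "config_dist dL x y = 0 \<longleftrightarrow> x = y"
 proof
  assume "config_dist dL x y = 0"
  then have c: "config_close dL e x y" if "0 < e" "e < 1" for e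
   using config_dist_less_imp_close[of dL x y e] that config_close_mono
   by (metis less_eq_real_def)
  then show "x = y"
   using config_close_all_imp_subset[OF L M[OF xy(1)] M[OF xy(2)]] config_close_commute[OF L]
    config_close_all_imp_subset[OF L M[OF xy(2)] M[OF xy(1)]] by blast
 next
  assume "x = y"
  have "config_close dL e x x" if "0 < e" for e
   unfolding config_close_def
  proof (rule exI[of _ x], rule exI[of _ x], rule exI[of _ id], intro conjI ballI)
   fix t assume "t \<in> x"
   then show "tile_dist dL t (id t) <= e"
    using that tile_dist_self[OF L, of t] M[OF xy(1)] unfolding locally_finite_config_def by auto
  qed (auto simp: patch_def)
  then have "config_dist dL x x <= e" if "0 < e" for e using config_dist_le that by metis
  then show "config_dist dL x y = 0" unfolding \<open>x = y\<close>[symmetric]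
   by (metis config_dist_nonneg antisym field_le_epsilon add_0)
 qed
next
 fix x y z assume xyz: "x \<in> M" "y \<in> M" "z \<in> M"
 have C: "\<forall>t\<in>x. ctile L t" "\<forall>t\<in>y. ctile L t" "\<forall>t\<in>z. ctile L t"
  using M xyz unfolding locally_finite_config_def by auto
 show "config_dist dL x z <= config_dist dL x y + config_dist dL y z"
 proof (cases "config_dist dL x y + config_dist dL y z < 1")
  case True
  show ?thesis
  proof (rule field_le_epsilon)
   fix e :: real assume e: "0 < e"
   define k where "k = min e (1 - (config_dist dL x y + config_dist dL y z))"
   have k: "0 < k" "k <= e" "config_dist dL x y + config_dist dL y z + k <= 1"
    unfolding k_def using True e by auto
   have n: "0 <= config_dist dL x y" "0 <= config_dist dL y z" by (auto intro: config_dist_nonneg)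
   obtain a where a: "0 < a" "a < config_dist dL x y + k/2" "config_close dL a x y"
    using config_dist_less_imp_close[of dL x y "config_dist dL x y + k/2"] k n by auto
   obtain b where b: "0 < b" "b < config_dist dL y z + k/2" "config_close dL b y z"
    using config_dist_less_imp_close[of dL y z "config_dist dL y z + k/2"] k n by auto
   have "config_close dL (a+b) x z"
    using a b k by (intro config_close_trans[OF L C]) auto
   then have "config_dist dL x z <= a + b" using a b by (intro config_dist_le) auto
   then show "config_dist dL x z <= config_dist dL x y + config_dist dL y z + e" using a b k by linarith
  qed
 qed (use config_dist_le_1[of dL x z] in linarith)
qed

lemma config_dist_match:
 assumes "config_dist dL T T' < e" "e <= 1"
 obtains P P' f where "patch T 0 (1 / e) \<subseteq> P" "P \<subseteq> T" "patch T' 0 (1 / e) \<subseteq> P'" "P' \<subseteq> T'"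
  "bij_betw f P P'" "!!t. t \<in> P ==> tile_dist dL t (f t) < e"
proof -
 obtain e' where e': "0 < e'" "e' < e" "config_close dL e' T T'"
  using config_dist_less_imp_close[OF assms] .
 then obtain P P' f where f: "patch T 0 (1 / e') \<subseteq> P" "P \<subseteq> T" "patch T' 0 (1 / e') \<subseteq> P'" "P' \<subseteq> T'"
    "bij_betw f P P'" "\<forall>t\<in>P. tile_dist dL t (f t) <= e'"
  unfolding config_close_def by blast
 have "1 / e <= 1 / e'" using e' by (simp add: frac_le)
 then have "patch T 0 (1 / e) \<subseteq> P" "patch T' 0 (1 / e) \<subseteq> P'"
  using f patch_mono by (metis order_trans)+
 moreover have "tile_dist dL t (f t) < e" if "t \<in> P" for t using f(6) e' that by fastforce
 ultimately show ?thesis using f that by blast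
qed

lemma config_dist_leI:
 assumes "patch T 0 (1 / e) \<subseteq> P" "P \<subseteq> T" "patch T' 0 (1 / e) \<subseteq> P'" "P' \<subseteq> T'"
  "bij_betw f P P'" "!!t. t \<in> P ==> tile_dist dL t (f t) <= e" "0 < e"
 shows "config_dist dL T T' <= e"
proof (rule config_dist_le)
 show "config_close dL e T T'" unfolding config_close_def
  by (intro exI[of _ P] exI[of _ P'] exI[of _ f] conjI ballI assms)
qed fact

subsection \<open>Translations\<close>

definition translate_tile :: "'a::real_normed_vector => 'a set \<times> 'l => 'a set \<times> 'l" where
 "translate_tile x t = ((\<lambda>y. y - x) ` fst t, snd t)"

lemma translate_eq_image: "translate T x = translate_tile x ` T"
 unfolding translate_def translate_tile_def by (simp add: case_prod_beta')

lemma translate_tile_add: "translate_tile y (translate_tile x t) = translate_tile (x + y) t"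
 unfolding translate_tile_def by (simp add: image_image algebra_simps)

lemma translate_tile_0 [simp]: "translate_tile 0 t = t"
 unfolding translate_tile_def by simp

lemma translate_0 [simp]: "translate T 0 = T"
 unfolding translate_eq_image by simp

lemma translate_add: "translate (translate T x) y = translate T (x + y)"
 unfolding translate_eq_image by (simp add: image_image translate_tile_add)

lemma translate_cancel [simp]:
 "translate (translate T x) (- x) = T" "translate (translate T (- x)) x = T"
 by (simp_all add: translate_add)

lemma inj_translate_tile: "inj (translate_tile x)"
 by (rule inj_on_inverseI[where g = "translate_tile (- x)"]) (simp add: translate_tile_add)

lemma translate_tile_meets_ball:
 "fst (translate_tile x t) \<inter> ball y R ~= {} \<longleftrightarrow> fst t \<inter> ball (y + x) R ~= {}"
proof -
 have "fst (translate_tile x t) \<inter> ball y R ~= {} \<longleftrightarrow> (\<exists>z\<in>fst t. dist y (z - x) < R)"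
  unfolding translate_tile_def by auto
 also have "... \<longleftrightarrow> (\<exists>z\<in>fst t. dist (y + x) z < R)" by (simp add: dist_norm algebra_simps)
 finally show ?thesis by auto
qed

lemma mem_translate_iff: "t \<in> translate T x \<longleftrightarrow> translate_tile (- x) t \<in> T"
proof
 assume "translate_tile (- x) t \<in> T"
 then have "translate_tile x (translate_tile (- x) t) \<in> translate T x"
  unfolding translate_eq_image by (rule imageI)
 then show "t \<in> translate T x" by (simp add: translate_tile_add)
qed (auto simp: translate_eq_image translate_tile_add)

lemma patch_translate:
 fixes T :: "('a::real_normed_vector, 'l) config"
 shows "patch (translate T x) y R = translate (patch T (y + x) R) x"
proof (rule set_eqI)
 fix t :: "'a set \<times> 'l"
 have "fst t \<inter> ball y R ~= {} \<longleftrightarrow> fst (translate_tile (- x) t) \<inter> ball (y + x) R ~= {}"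
  using translate_tile_meets_ball[of "- x" t "y + x" R] by simp
 then show "t \<in> patch (translate T x) y R \<longleftrightarrow> t \<in> translate (patch T (y + x) R) x"
  unfolding mem_translate_iff patch_def mem_Collect_eq by blast
qed

lemma ctile_translate_tile [simp]:
 "ctile L (translate_tile x t) \<longleftrightarrow> ctile L (t :: 'a::euclidean_space set \<times> 'l)"
 unfolding ctile_def translate_tile_def
 using compact_translation_subtract[of "fst t" x]
  compact_translation_subtract[of "(\<lambda>y. y - x) ` fst t" "-x"]
 by (auto simp: image_image)

lemma tile_dist_translates:
 assumes "Metric_space L dL" "ctile L t" "ctile L (t' :: 'a::euclidean_space set \<times> 'l)"
 shows "tile_dist dL (translate_tile x t) (translate_tile x' t') <= tile_dist dL t t' + norm (x - x')"
proof -
 have "hausdist ((\<lambda>y. y - x) ` fst t) ((\<lambda>y. y - x') ` fst t') <= hausdist (fst t) (fst t') + norm (x - x')"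
  using assms unfolding ctile_def by (intro hausdist_translates) auto
 then show ?thesis unfolding tile_dist_def translate_tile_def
  using norm_ge_zero[of "x - x'"] by (smt (verit) fst_conv snd_conv)
qed

lemma locally_finite_config_patch:
 assumes "locally_finite_config L T" shows "finite (patch T x R)"
proof (rule finite_subset)
 show "patch T x R \<subseteq> patch T 0 (norm x + R)"
 proof -
  have "ball x R \<subseteq> ball 0 (norm x + R)" by (simp add: ball_subset_ball_iff)
  then show ?thesis unfolding patch_def by auto
 qed
qed (use assms in \<open>simp add: locally_finite_config_def\<close>)

lemma locally_finite_config_translate [simp]:
 "locally_finite_config L (translate T x) \<longleftrightarrow> locally_finite_config L (T :: ('a::euclidean_space, 'l) config)"
proof -
 have *: "locally_finite_config L (translate T x)"
  if T: "locally_finite_config L T" for T :: "('a, 'l) config" and x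
  unfolding locally_finite_config_def
 proof (intro conjI allI)
  show "\<forall>t\<in>translate T x. ctile L t"
   using T unfolding locally_finite_config_def translate_eq_image by auto
  show "finite (patch (translate T x) 0 R)" for R
   unfolding patch_translate by (simp add: translate_eq_image locally_finite_config_patch[OF T])
 qed
 show ?thesis using *[of T x] *[of "translate T x" "-x"] by auto
qed

text \<open>
 A translation by x turns the ball around the origin into the ball around x, so the given
 correspondence must reach further by \<open>norm x\<close>.
\<close>

lemma config_dist_translates_le:
 assumes L: "Metric_space L dL"
  and T: "locally_finite_config L T" "locally_finite_config L (T' :: ('a::euclidean_space, 'l) config)"
  and d: "config_dist dL T T' < d" "d <= 1"
  and e: "0 < e" "d + norm (x - x') <= e" "1 / e + norm x <= 1 / d" "1 / e + norm x' <= 1 / d"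
 shows "config_dist dL (translate T x) (translate T' x') <= e"
proof -
 obtain P P' f where f: "patch T 0 (1 / d) \<subseteq> P" "P \<subseteq> T" "patch T' 0 (1 / d) \<subseteq> P'" "P' \<subseteq> T'"
  "bij_betw f P P'" "!!t. t \<in> P ==> tile_dist dL t (f t) < d"
  using config_dist_match[OF d] by metis
 have sub: "patch (translate T y) 0 (1/e) \<subseteq> translate Q y" if "1 / e + norm y <= 1 / d" "patch T 0 (1 / d) \<subseteq> Q"
  for T Q :: "('a, 'l) config" and y
 proof -
  have "ball (0 + y) (1/e) \<subseteq> ball 0 (1/d)" using that by (auto simp: ball_subset_ball_iff)
  then have "patch T (0 + y) (1/e) \<subseteq> patch T 0 (1/d)" unfolding patch_def by auto
  then have "patch T (0 + y) (1/e) \<subseteq> Q" using that by blast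
  then show ?thesis unfolding patch_translate unfolding translate_eq_image by (rule image_mono)
 qed
 show ?thesis
 proof (rule config_dist_leI)
  show "patch (translate T x) 0 (1/e) \<subseteq> translate P x" using sub e f by blast
  show "patch (translate T' x') 0 (1/e) \<subseteq> translate P' x'" using sub e f by blast
  show "translate P x \<subseteq> translate T x" "translate P' x' \<subseteq> translate T' x'"
   using f unfolding translate_eq_image by auto
  have "bij_betw (translate_tile (-x)) (translate P x) P"
   by (rule bij_betwI[where g = "translate_tile x"]) (auto simp: translate_eq_image translate_tile_add)
  moreover have "bij_betw (translate_tile x') P' (translate P' x')"
   unfolding translate_eq_image by (rule inj_on_imp_bij_betw) (rule inj_on_subset[OF inj_translate_tile], simp)
  ultimately show "bij_betw (translate_tile x' \<circ> (f \<circ> translate_tile (-x))) (translate P x) (translate P' x')"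
   using f(5) by (meson bij_betw_trans)
  fix t assume "t \<in> translate P x"
  then obtain s where s: "s \<in> P" "t = translate_tile x s" unfolding translate_eq_image by auto
  have "f s \<in> P'" using f(5) s by (auto simp: bij_betw_def)
  then have c: "ctile L s" "ctile L (f s)" using T f s unfolding locally_finite_config_def by auto
  show "tile_dist dL t ((translate_tile x' \<circ> (f \<circ> translate_tile (-x))) t) <= e"
   using tile_dist_translates[OF L c, of x x'] f(6)[OF s(1)] e s by (simp add: translate_tile_add)
 qed fact
qed

lemma config_dist_translate_continuous:
 fixes T :: "('a::euclidean_space, 'l) config"
 assumes L: "Metric_space L dL" and T: "locally_finite_config L T" and e: "0 < e"
 obtains d where "0 < d" "d <= 1"
  "!!T' x'. locally_finite_config L T' ==> config_dist dL T T' < d ==> norm (x - x') < d ==>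
    config_dist dL (translate T x) (translate T' x') < e"
proof -
 define a where "a = min e 1 / 2"
 have a: "0 < a" "a < e" "a <= 1" unfolding a_def using e by auto
 define d where "d = min (a / 2) (1 / (1 / a + norm x + 1))"
 have n: "1 / a + norm x + 1 > 0" using a by (simp add: add_nonneg_pos)
 have d: "0 < d" "2 * d <= a" "d <= 1 / (1 / a + norm x + 1)" unfolding d_def using a n by auto
 have d1: "1 / a + norm x + 1 <= 1 / d" using d n by (simp add: field_simps)
 show ?thesis
 proof (rule that)
  show "0 < d" "d <= 1" using d a by auto
  fix T' x' assume T': "locally_finite_config L T'" "config_dist dL T T' < d" "norm (x - x') < d"
  have "norm x' <= norm x + 1"
   using T'(3) d a norm_triangle_sub[of x' x] by (simp add: norm_minus_commute)
  then have "config_dist dL (translate T x) (translate T' x') <= a"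
   using T' d d1 a by (intro config_dist_translates_le[OF L T T'(1,2)]) auto
  then show "config_dist dL (translate T x) (translate T' x') < e" using a by simp
 qed
qed

subsection \<open>Delone sets\<close>

lemma uniform_discrete_finite_ball:
 fixes S :: "'a::euclidean_space set"
 assumes "uniform_discrete S" "bounded B"
 shows "finite (S \<inter> B)"
proof -
 have "closed (S \<inter> closure B)"
  using uniform_discrete_imp_closed[OF assms(1)] by (intro closed_Int) auto
 moreover have "bounded (S \<inter> closure B)" using assms(2) by (meson bounded_Int bounded_closure)
 ultimately have "compact (S \<inter> closure B)" by (simp add: compact_eq_bounded_closed)
 moreover have "Isolated.discrete (S \<inter> closure B)"
  using uniform_discrete_imp_discrete[OF assms(1)] by (rule discrete_subset) auto
 ultimately have "finite (S \<inter> closure B)" using discrete_compact_finite_iff by blast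
 then show ?thesis by (rule finite_subset[rotated]) (use closure_subset in auto)
qed

lemma patch_labelled_points:
 "patch (labelled_points \<Lambda> lab) x R = labelled_points (\<Lambda> \<inter> ball x R) lab"
 unfolding patch_def labelled_points_def by auto

lemma is_delone_imp_locally_finite:
 assumes "is_delone L T" shows "locally_finite_config L T"
proof -
 from assms obtain \<Lambda> lab where *: "uniform_discrete \<Lambda>" "lab ` \<Lambda> \<subseteq> L" "T = labelled_points \<Lambda> lab"
  unfolding is_delone_def by auto
 show ?thesis
  unfolding locally_finite_config_def *(3) patch_labelled_points
  using uniform_discrete_finite_ball[OF *(1)] *(2)
  by (auto simp: labelled_points_def ctile_def)
qed

section \<open>Continuity in the tiling metric\<close>

lemma continuous_map_metric_times_euclidean_iff:
 fixes f :: "'x => 'a::metric_space => 'b::metric_space"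
 assumes M: "Metric_space M d"
 shows "continuous_map (prod_topology (Metric_space.mtopology M d) euclidean) euclidean (\<lambda>(T, x). f T x) \<longleftrightarrow>
  (\<forall>T\<in>M. \<forall>x. \<forall>e>0. \<exists>\<delta>>0. \<forall>T'\<in>M. \<forall>x'. d T T' < \<delta> --> dist x x' < \<delta> --> dist (f T x) (f T' x') < e)"
  (is "?L \<longleftrightarrow> ?R")
proof -
 interpret M: Metric_space M d by fact
 have L: "?L \<longleftrightarrow> (\<forall>z\<in>M \<times> UNIV. \<forall>e>0. \<exists>U. openin (prod_topology M.mtopology euclidean) U \<and> z \<in> U \<and>
   (\<forall>y\<in>U. case_prod f y \<in> ball (case_prod f z) e))"
  using Met_TC.continuous_map_to_metric[of "prod_topology M.mtopology (euclidean :: 'a topology)" "case_prod f"]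
  by simp
 show ?thesis unfolding L
 proof (intro iffI strip)
  fix T and x :: 'a and e :: real
  assume *: "\<forall>z\<in>M \<times> UNIV. \<forall>e>0. \<exists>U. openin (prod_topology M.mtopology euclidean) U \<and> z \<in> U \<and>
   (\<forall>y\<in>U. case_prod f y \<in> ball (case_prod f z) e)" and T: "T \<in> M" and e: "0 < e"
  have "(T, x) \<in> M \<times> UNIV" using T by simp
  from *[THEN bspec, OF this, THEN spec, THEN mp, OF e]
  obtain U where U: "openin (prod_topology M.mtopology euclidean) U" "(T, x) \<in> U"
   "!!y. y \<in> U ==> case_prod f y \<in> ball (case_prod f (T, x)) e" by blast
  obtain V W where VW: "openin M.mtopology V" "openin euclidean W" "T \<in> V" "x \<in> W" "V \<times> W \<subseteq> U"
   using U(1)[unfolded openin_prod_topology_alt, rule_format, OF U(2)] by metis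
  obtain r where r: "r > 0" "M.mball T r \<subseteq> V" using VW(1,3) unfolding M.openin_mtopology by metis
  obtain s where s: "s > 0" "ball x s \<subseteq> W" using VW(2,4) by (auto simp: open_contains_ball)
  show "\<exists>\<delta>>0. \<forall>T'\<in>M. \<forall>x'. d T T' < \<delta> --> dist x x' < \<delta> --> dist (f T x) (f T' x') < e"
  proof (intro exI[of _ "min r s"] conjI strip)
   fix T' x' assume "T' \<in> M" "d T T' < min r s" "dist x x' < min r s"
   then have "T' \<in> M.mball T r" "x' \<in> ball x s" using T by auto
   then have "(T', x') \<in> U" using r s VW by blast
   then show "dist (f T x) (f T' x') < e" using U(3)[of "(T', x')"] by simp
  qed (use r s in auto)
 next
  fix z :: "'x \<times> 'a" and e :: real
  assume R: ?R and z: "z \<in> M \<times> UNIV" and e: "0 < e"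
  obtain T x where zz: "z = (T, x)" "T \<in> M" using z by auto
  then obtain \<delta> where \<delta>: "\<delta> > 0" "!!T' x'. T' \<in> M ==> d T T' < \<delta> ==> dist x x' < \<delta> ==> dist (f T x) (f T' x') < e"
   using R e by metis
  show "\<exists>U. openin (prod_topology M.mtopology euclidean) U \<and> z \<in> U \<and> (\<forall>y\<in>U. case_prod f y \<in> ball (case_prod f z) e)"
   by (rule exI[of _ "M.mball T \<delta> \<times> ball x \<delta>"])
    (use zz \<delta> in \<open>auto simp: openin_prod_Times_iff\<close>)
 qed
qed

lemma continuous_map_metric_euclidean_iff:
 fixes f :: "'x => 'b::metric_space"
 assumes M: "Metric_space M d"
 shows "continuous_map (Metric_space.mtopology M d) euclidean f \<longleftrightarrow>
  (\<forall>T\<in>M. \<forall>e>0. \<exists>\<delta>>0. \<forall>T'\<in>M. d T T' < \<delta> --> dist (f T) (f T') < e)"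
 using Metric_space.metric_continuous_map[OF M Met_TC.Metric_space_axioms, of f]
 by (simp add: Ball_def imp_conjL)

text \<open>
 Replacing each tile of a configuration by another tile, in a way that depends on the tile and on
 a parameter, is continuous as soon as it does not move tiles from far away close to the origin:
 then only finitely many tiles matter near the origin.
\<close>

lemma tilewise_image_continuous:
 fixes \<Phi> :: "'x => ('a::euclidean_space, 'l) config"
  and G :: "'x => 'a set \<times> 'l => 'a set \<times> 'k"
 assumes L: "Metric_space L dL"
  and lf: "!!S. S \<in> \<Omega> ==> locally_finite_config L (\<Phi> S)"
  and cont: "!!S e. S \<in> \<Omega> ==> 0 < e ==>
    \<exists>\<delta>>0. \<forall>S'\<in>\<Omega>. d S S' < \<delta> --> config_dist dL (\<Phi> S) (\<Phi> S') < e"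
  and inj: "!!S. S \<in> \<Omega> ==> inj_on (G S) (\<Phi> S)"
  and G: "!!S t e. S \<in> \<Omega> ==> t \<in> \<Phi> S ==> 0 < e ==>
    \<exists>\<delta>>0. \<forall>S'\<in>\<Omega>. \<forall>t'\<in>\<Phi> S'. d S S' < \<delta> --> tile_dist dL t t' < \<delta> --> tile_dist dL' (G S t) (G S' t') < e"
  and proper: "!!M. \<exists>\<rho>. \<forall>S\<in>\<Omega>. \<forall>t\<in>\<Phi> S. fst (G S t) \<inter> ball 0 M ~= {} --> fst t \<inter> ball 0 \<rho> ~= {}"
  and S: "S \<in> \<Omega>" and e: "0 < e"
 shows "\<exists>\<delta>>0. \<forall>S'\<in>\<Omega>. d S S' < \<delta> --> config_dist dL' (G S ` \<Phi> S) (G S' ` \<Phi> S') < e"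
proof -
 define a where "a = e / 2"
 have a: "0 < a" "a < e" unfolding a_def using e by auto
 obtain \<rho>0 where \<rho>0: "!!S t. S \<in> \<Omega> ==> t \<in> \<Phi> S ==> fst (G S t) \<inter> ball 0 (1/a) ~= {} ==> fst t \<inter> ball 0 \<rho>0 ~= {}"
  using proper[of "1/a"] by blast
 define \<rho> where "\<rho> = max \<rho>0 1"
 have \<rho>: "\<rho> \<ge> 1" "\<rho>0 <= \<rho>" unfolding \<rho>_def by auto
 define F where "F = patch (\<Phi> S) 0 (\<rho> + 1)"
 have F: "finite F" "F \<subseteq> \<Phi> S"
  unfolding F_def using lf[OF S] by (auto simp: locally_finite_config_def patch_def)
 have "\<forall>t\<in>F. \<exists>\<delta>>0. \<forall>S'\<in>\<Omega>. \<forall>t'\<in>\<Phi> S'. d S S' < \<delta> --> tile_dist dL t t' < \<delta> --> tile_dist dL' (G S t) (G S' t') < a"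
  using G[OF S _ a(1)] F by blast
 then obtain D where D: "!!t. t \<in> F ==> D t > 0"
  "!!t S' t'. t \<in> F ==> S' \<in> \<Omega> ==> t' \<in> \<Phi> S' ==> d S S' < D t ==> tile_dist dL t t' < D t ==> tile_dist dL' (G S t) (G S' t') < a"
  by metis
 define b where "b = Min (insert (1 / (\<rho> + 1)) (D ` F))"
 have b: "0 < b" "b <= 1 / (\<rho> + 1)" "!!t. t \<in> F ==> b <= D t"
  unfolding b_def using F(1) D(1) \<rho> by (auto simp: Min_gr_iff)
 have b1: "b <= 1" "\<rho> + 1 <= 1 / b" using b \<rho> by (auto simp: field_simps intro: order_trans[OF b(2)])
 obtain \<delta> where \<delta>: "\<delta> > 0" "!!S'. S' \<in> \<Omega> ==> d S S' < \<delta> ==> config_dist dL (\<Phi> S) (\<Phi> S') < b"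
  using cont[OF S b(1)] by blast
 show ?thesis
 proof (intro exI[of _ "min \<delta> b"] conjI ballI impI)
  fix S' assume S': "S' \<in> \<Omega>" "d S S' < min \<delta> b"
  then have "config_dist dL (\<Phi> S) (\<Phi> S') < b" using \<delta> by auto
  then obtain P P' f where f: "patch (\<Phi> S) 0 (1 / b) \<subseteq> P" "P \<subseteq> \<Phi> S" "patch (\<Phi> S') 0 (1 / b) \<subseteq> P'" "P' \<subseteq> \<Phi> S'"
   "bij_betw f P P'" "!!t. t \<in> P ==> tile_dist dL t (f t) < b"
   using config_dist_match[OF _ b1(1)] by metis
  have FP: "F \<subseteq> P" using f(1) patch_mono[OF b1(2)] unfolding F_def by blast
  have ct: "ctile L t" if "t \<in> \<Phi> S \<or> t \<in> \<Phi> S'" for t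
   using that lf S S' unfolding locally_finite_config_def by auto
  have sub': "patch (\<Phi> S') 0 \<rho> \<subseteq> f ` F"
  proof
   fix t' assume t': "t' \<in> patch (\<Phi> S') 0 \<rho>"
   then have "t' \<in> P'" using f(3) patch_mono[of \<rho> "1/b"] b1(2) by fastforce
   then obtain t where t: "t \<in> P" "f t = t'" using f(5) by (auto simp: bij_betw_def)
   have td: "tile_dist dL t' t <= 1" using f(6)[OF t(1)] t b1 tile_dist_commute[OF L, of t' t] by simp
   have "fst t \<inter> ball 0 (\<rho> + 1) ~= {}"
   proof (rule tile_dist_meets_ball[OF _ _ td])
    show "ctile L t'" "ctile L t" using ct t' t f(2) unfolding patch_def by blast+
    show "fst t' \<inter> ball 0 \<rho> ~= {}" using t' unfolding patch_def by blast
   qed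
   then show "t' \<in> f ` F" using t f(2) unfolding F_def patch_def by auto
  qed
  have fF: "f ` F \<subseteq> \<Phi> S'" using image_mono[OF FP, of f] f(4,5) unfolding bij_betw_def by blast
  have pat: "patch (G S ` \<Phi> S) 0 (1 / a) \<subseteq> G S ` patch (\<Phi> S) 0 \<rho>" if "S \<in> \<Omega>" for S
  proof
   fix s assume "s \<in> patch (G S ` \<Phi> S) 0 (1 / a)"
   then obtain t where t: "t \<in> \<Phi> S" "s = G S t" "fst (G S t) \<inter> ball 0 (1/a) ~= {}" unfolding patch_def by auto
   then have "fst t \<inter> ball 0 \<rho> ~= {}" using \<rho>0[OF that t(1,3)] \<rho>(2) by (auto dest: less_le_trans)
   then show "s \<in> G S ` patch (\<Phi> S) 0 \<rho>" using t unfolding patch_def by auto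
  qed
  have "config_dist dL' (G S ` \<Phi> S) (G S' ` \<Phi> S') <= a"
  proof (rule config_dist_leI)
   show "patch (G S ` \<Phi> S) 0 (1 / a) \<subseteq> G S ` F"
    using pat[OF S] patch_mono[of \<rho> "\<rho>+1"] unfolding F_def by fastforce
   show "G S ` F \<subseteq> G S ` \<Phi> S" using F by auto
   show "patch (G S' ` \<Phi> S') 0 (1 / a) \<subseteq> G S' ` f ` F" using pat[OF S'(1)] sub' by blast
   show "G S' ` f ` F \<subseteq> G S' ` \<Phi> S'" using fF by auto
   have iF: "inj_on (G S) F" using inj[OF S] F(2) by (rule inj_on_subset)
   have "bij_betw (inv_into F (G S)) (G S ` F) F"
    using iF by (simp add: bij_betw_inv_into inj_on_imp_bij_betw)
   moreover have "bij_betw f F (f ` F)" using f(5) FP by (meson bij_betw_def inj_on_subset)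
   moreover have "bij_betw (G S') (f ` F) (G S' ` f ` F)"
    using inj[OF S'(1)] fF by (meson bij_betw_def inj_on_subset)
   ultimately show "bij_betw (G S' \<circ> (f \<circ> inv_into F (G S))) (G S ` F) (G S' ` f ` F)"
    by (meson bij_betw_trans)
   fix s assume "s \<in> G S ` F"
   then obtain t where t: "t \<in> F" "s = G S t" by auto
   have "inv_into F (G S) s = t" using iF t by simp
   moreover have "tile_dist dL' (G S t) (G S' (f t)) < a"
    using t S' b(3)[OF t(1)] f(6)[of t] FP fF by (intro D(2)) auto
   ultimately show "tile_dist dL' s ((G S' \<circ> (f \<circ> inv_into F (G S))) s) <= a" using t by simp
  qed (rule a)
  then show "config_dist dL' (G S ` \<Phi> S) (G S' ` \<Phi> S') < e" using a by simp
 qed (use \<delta> b in auto)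
qed

section \<open>Centres of convex bodies\<close>

lemma integral_UNIV_eq_cbox:
 fixes f :: "'a::euclidean_space => 'b::banach"
 assumes "!!x. x \<notin> cbox a b ==> f x = 0"
 shows "integral UNIV f = integral (cbox a b) f"
proof -
 have "f = (\<lambda>x. if x \<in> cbox a b then f x else 0)" using assms by auto
 then show ?thesis using integral_restrict_UNIV[of "cbox a b" f] by simp
qed

lemma integral_UNIV_shift:
 fixes f :: "'a::euclidean_space => 'b::banach"
 assumes "bounded {x. f x ~= 0}"
 shows "integral UNIV (\<lambda>x. f (x + c)) = integral UNIV f"
proof -
 obtain a where a: "{x. f x ~= 0} \<subseteq> cbox (-a) a"
  using bounded_subset_cbox_symmetric[OF assms] by blast
 have "integral UNIV f = integral (cbox (-a) a) f"
  by (rule integral_UNIV_eq_cbox) (use a in auto)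
 also have "... = integral (cbox (-a - c) (a - c)) (\<lambda>x. f (x + c))"
  using integral_shift_cbox_plus[where a = "-a - c" and b = "a - c" and c = c and f = f]
  by (simp add: o_def add.commute[of c])
 also have "... = integral UNIV (\<lambda>x. f (x + c))"
 proof (rule integral_UNIV_eq_cbox[symmetric])
  fix x assume "x \<notin> cbox (-a - c) (a - c)"
  then have "x + c \<notin> cbox (-a) a" by (simp add: mem_box inner_diff_left inner_add_left algebra_simps)
  then show "f (x + c) = 0" using a by auto
 qed
 finally show ?thesis by simp
qed

definition convex_body :: "'a::euclidean_space set => bool" where
 "convex_body K \<longleftrightarrow> compact K \<and> convex K \<and> interior K ~= {}"

definition depth :: "'a::euclidean_space set => 'a => real" where
 "depth K x = infdist x (- K)"

lemma convex_body_ne: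
 fixes K :: "'a::euclidean_space set"
 shows "convex_body K ==> K ~= {} \<and> - K ~= {}"
 unfolding convex_body_def using not_compact_UNIV[where ?'a = 'a] interior_subset[of K]
 by (metis Compl_empty_eq double_compl subset_empty)

lemma depth_nonneg: "0 <= depth K x" unfolding depth_def by (rule infdist_nonneg)

lemma depth_outside: "x \<notin> K ==> depth K x = 0" unfolding depth_def by (simp add: infdist_zero)

lemma continuous_on_depth: "continuous_on A (depth K)"
 unfolding depth_def by (intro continuous_intros)

lemma ball_depth_subset: "ball x (depth K x) \<subseteq> K"
proof
 fix y assume "y \<in> ball x (depth K x)"
 then show "y \<in> K" unfolding depth_def using infdist_le[of y "- K" x] by (auto simp: not_le)
qed

lemma depth_ge:
 assumes "- K ~= {}" "ball x r \<subseteq> K" shows "r <= depth K x"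
proof -
 have "r <= (INF y\<in>- K. dist x y)"
  using assms by (intro cINF_greatest) (auto simp: not_less[symmetric])
 then show ?thesis unfolding depth_def infdist_def using assms(1) by simp
qed

text \<open>
 The ball of radius \<open>depth K x - hausdist K K'\<close> around x lies in K': a point y of it outside K' would
 be separated from K' by a hyperplane, and moving from x against its normal by
 \<open>norm (x - y) + hausdist K K'\<close> leads to a point of K without a point of K' near enough. Convexity
 is essential, since small holes are invisible to the Hausdorff distance.
\<close>

lemma depth_le_plus_hausdist:
 assumes K: "convex_body K" and K': "convex_body K'"
 shows "depth K x <= depth K' x + hausdist K K'"
proof -
 define h where "h = hausdist K K'"
 have cK: "compact K" "K ~= {}" "compact K'" "K' ~= {}" "convex K'"
  using K K' convex_body_ne unfolding convex_body_def by auto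
 have "ball x (depth K x - h) \<subseteq> K'"
 proof
  fix y assume y: "y \<in> ball x (depth K x - h)"
  show "y \<in> K'"
  proof (rule ccontr)
   assume "y \<notin> K'"
   then obtain a b where ab: "inner a y < b" "!!z. z \<in> K' ==> inner a z > b"
    using separating_hyperplane_closed_point[of K' y] cK compact_imp_closed by blast
   have a: "a ~= 0" using ab cK(4) by fastforce
   define s where "s = norm (x - y) + h"
   define p where "p = x - (s / norm a) *\<^sub>R a"
   have h0: "h \<ge> 0" unfolding h_def using cK by (intro hausdist_nonneg) auto
   have "dist x p = s" unfolding p_def dist_norm s_def using a h0 by simp
   then have "p \<in> ball x (depth K x)" using y unfolding s_def by (simp add: dist_norm)
   then have "p \<in> K" using ball_depth_subset by blast
   then obtain q where q: "q \<in> K'" "dist p q <= h"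
    using hausdist_nearest[OF cK(1-4)] unfolding h_def by metis
   have "inner a q <= inner a p + norm a * h"
   proof -
    have "inner a (q - p) <= norm a * norm (q - p)" by (rule norm_cauchy_schwarz)
    also have "... <= norm a * h" using q(2) by (simp add: dist_norm norm_minus_commute mult_left_mono)
    finally show ?thesis by (simp add: inner_diff_right)
   qed
   moreover have "inner a p = inner a x - s * norm a"
    unfolding p_def using a by (simp add: inner_diff_right dot_square_norm power2_eq_square)
   moreover have "inner a x - inner a y <= norm a * norm (x - y)"
    using norm_cauchy_schwarz[of a "x - y"] by (simp add: inner_diff_right)
   ultimately have "inner a q <= inner a y" unfolding s_def by (simp add: algebra_simps)
   then show False using ab(1) ab(2)[OF q(1)] by simp
  qed
 qed
 then have "depth K x - h <= depth K' x" using depth_ge convex_body_ne[OF K'] by blast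
 then show ?thesis unfolding h_def by simp
qed

lemma depth_diff_le_hausdist:
 assumes "convex_body K" "convex_body K'"
 shows "\<bar>depth K x - depth K' x\<bar> <= hausdist K K'"
 using depth_le_plus_hausdist[OF assms, of x] depth_le_plus_hausdist[OF assms(2,1), of x]
 by (simp add: hausdist_commute abs_le_iff)

text \<open>
 The centre of a convex body is its centre of mass for the density that at each point is the
 distance from the complement. Unlike the centroid, it is visibly continuous, since that
 density is 1-Lipschitz in the body.
\<close>

definition depth_mass :: "'a::euclidean_space set => real" where
 "depth_mass K = integral UNIV (depth K)"

definition centre :: "'a::euclidean_space set => 'a" where
 "centre K = integral UNIV (\<lambda>x. depth K x *\<^sub>R x) /\<^sub>R depth_mass K"

lemma depth_integrals_cbox:
 assumes "K \<subseteq> cbox a b"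
 shows "depth_mass K = integral (cbox a b) (depth K)"
  "integral UNIV (\<lambda>x. depth K x *\<^sub>R x) = integral (cbox a b) (\<lambda>x. depth K x *\<^sub>R x)"
proof -
 have "depth K x = 0" if "x \<notin> cbox a b" for x using that assms by (intro depth_outside) auto
 then show "depth_mass K = integral (cbox a b) (depth K)"
  "integral UNIV (\<lambda>x. depth K x *\<^sub>R x) = integral (cbox a b) (\<lambda>x. depth K x *\<^sub>R x)"
  unfolding depth_mass_def by (auto intro!: integral_UNIV_eq_cbox)
qed

lemma convex_body_interior_depth: "x \<in> interior K ==> - K ~= {} ==> 0 < depth K x"
 using depth_ge[of K x] unfolding mem_interior by (meson order_less_le_trans)

lemma integral_continuous_pos:
 fixes f :: "'a::euclidean_space => real"
 assumes "continuous_on UNIV f" "!!x. 0 <= f x" "!!x. x \<notin> cbox a b ==> f x = 0" "0 < f z"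
 shows "0 < integral (cbox a b) f"
proof (rule ccontr)
 have zb: "\<forall>x\<in>cbox a b. z ~= x ==> False" using assms(3)[of z] assms(4) by force
 have nn: "0 <= integral (cbox a b) f" by (rule integral_nonneg) (use assms in \<open>auto intro: integrable_continuous continuous_on_subset\<close>)
 obtain a' b' where a': "cbox a b \<subseteq> box a' b'"
  using bounded_subset_box_symmetric[OF bounded_cbox[of a b]] by blast
 have i: "integral (cbox a' b') f = integral (cbox a b) f"
  using integral_UNIV_eq_cbox[of a b f] integral_UNIV_eq_cbox[of a' b' f] assms(3) a' box_subset_cbox
  by (metis subsetD)
 assume "\<not> 0 < integral (cbox a b) f"
 then have "integral (cbox a' b') f = 0" using nn i by simp
 moreover have fi: "f integrable_on cbox a' b'" using assms(1) by (auto intro: integrable_continuous continuous_on_subset)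
 ultimately have "(f has_integral 0) (cbox a' b')" by (metis integrable_integral)
 then have "f z = 0"
  using has_integral_0_cbox_imp_0[of a' b' f z] assms a' zb box_subset_cbox
  by (metis continuous_on_subset empty_iff subsetD subset_UNIV)
 then show False using assms(4) by simp
qed

lemma depth_mass_pos:
 assumes "convex_body K" shows "0 < depth_mass K"
proof -
 obtain a where a: "K \<subseteq> cbox (-a) a"
  using assms bounded_subset_cbox_symmetric compact_imp_bounded unfolding convex_body_def by metis
 obtain z where "z \<in> interior K" using assms unfolding convex_body_def by auto
 then have "0 < depth K z" using convex_body_interior_depth convex_body_ne[OF assms] by blast
 then show ?thesis unfolding depth_integrals_cbox[OF a]
  using a depth_outside by (intro integral_continuous_pos[of _ _ _ z]) (auto intro: continuous_on_depth depth_nonneg)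
qed

text \<open>
 Otherwise a hyperplane through the centre would have the whole interior on one side, and the first
 moment of the density in the normal direction would be positive, while it vanishes about the centre.
\<close>

lemma centre_in_interior:
 assumes K: "convex_body K" shows "0 < depth K (centre K)"
proof -
 let ?c = "centre K"
 have cv: "convex (interior K)" "interior K ~= {}" using K convex_interior unfolding convex_body_def by auto
 have "?c \<in> interior K"
 proof (rule ccontr)
  assume "?c \<notin> interior K"
  then obtain v where v: "v ~= 0" "!!x. x \<in> interior K ==> 0 <= inner v (x - ?c)"
   using separating_hyperplane_set_0[of "(\<lambda>x. x - ?c) ` interior K"] cv convex_translation_subtract
   by (auto simp: image_iff)
  obtain b where b: "K \<subseteq> cbox (-b) b"
   using K bounded_subset_cbox_symmetric compact_imp_bounded unfolding convex_body_def by metis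
  define f where "f x = depth K x * inner v (x - ?c)" for x
  have f0: "0 <= f x" for x
  proof (cases "depth K x = 0")
   case False
   then have "x \<in> interior K" using ball_depth_subset[of x K] depth_nonneg[of K x] unfolding mem_interior
    by (metis less_eq_real_def)
   then show ?thesis unfolding f_def using v depth_nonneg[of K x] by (intro mult_nonneg_nonneg) auto
  qed (simp add: f_def)
  obtain z0 where z0: "z0 \<in> interior K" using cv by auto
  obtain e where e: "e > 0" "ball z0 e \<subseteq> interior K" using z0 by (meson open_contains_ball open_interior)
  define z where "z = z0 + (e / (2 * norm v)) *\<^sub>R v"
  have "z \<in> interior K" using e v unfolding z_def by (intro subsetD[OF e(2)]) (simp add: dist_norm)
  moreover have "inner v (z - ?c) > 0"
  proof -
   have "inner v (z - ?c) = inner v (z0 - ?c) + (e / (2 * norm v)) * inner v v"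
    unfolding z_def by (simp add: inner_diff_right inner_add_right)
   moreover have "inner v v > 0" using v by simp
   ultimately show ?thesis using v(2)[OF z0] e v(1) by (simp add: add_nonneg_pos)
  qed
  ultimately have fz: "0 < f z"
   unfolding f_def using convex_body_interior_depth convex_body_ne[OF K] by (intro mult_pos_pos) auto
  have "0 < integral (cbox (-b) b) f"
  proof (rule integral_continuous_pos)
   show "continuous_on UNIV f" unfolding f_def by (intro continuous_intros continuous_on_depth)
   show "f x = 0" if "x \<notin> cbox (-b) b" for x
   proof -
    have "depth K x = 0" using that b by (intro depth_outside) auto
    then show ?thesis unfolding f_def by simp
   qed
  qed (use f0 fz in auto)
  moreover have "integral (cbox (-b) b) f = 0"
  proof -
   have i1: "(\<lambda>x. depth K x *\<^sub>R x) integrable_on cbox (-b) b" "depth K integrable_on cbox (-b) b"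
    by (intro integrable_continuous continuous_intros continuous_on_depth)+
   have i2: "(\<lambda>x. depth K x *\<^sub>R ?c) integrable_on cbox (-b) b"
    by (intro integrable_continuous continuous_intros continuous_on_depth)
   have f: "f = (\<lambda>x. inner v (depth K x *\<^sub>R x - depth K x *\<^sub>R ?c))"
    unfolding f_def by (simp add: fun_eq_iff inner_diff_right algebra_simps)
   have "integral (cbox (-b) b) f = inner v (integral (cbox (-b) b) (\<lambda>x. depth K x *\<^sub>R x - depth K x *\<^sub>R ?c))"
    unfolding f using integral_linear[OF integrable_diff[OF i1(1) i2] bounded_linear_inner_right[of v]]
    by (simp add: o_def)
   also have "integral (cbox (-b) b) (\<lambda>x. depth K x *\<^sub>R x - depth K x *\<^sub>R ?c)
    = integral (cbox (-b) b) (\<lambda>x. depth K x *\<^sub>R x) - integral (cbox (-b) b) (depth K) *\<^sub>R ?c"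
    using integral_linear[OF i1(2) bounded_linear_scaleR_left[of ?c]]
    by (simp add: integral_diff[OF i1(1) i2] o_def)
   also have "... = 0"
    using depth_mass_pos[OF K] unfolding centre_def depth_integrals_cbox[OF b] by simp
   finally show ?thesis by simp
  qed
  ultimately show False by simp
 qed
 then show ?thesis using convex_body_interior_depth convex_body_ne[OF K] by blast
qed

lemma convex_body_translate: "convex_body ((\<lambda>y. y + x) ` K) \<longleftrightarrow> convex_body K"
proof -
 have *: "convex_body ((\<lambda>y. y + x) ` K)" if "convex_body K" for K :: "'a set" and x
  using that unfolding convex_body_def add.commute[of _ x]
  by (auto simp: compact_translation interior_translation)
 show ?thesis using *[of K x] *[of "(\<lambda>y. y + x) ` K" "-x"] by (auto simp: image_image)
qed

lemma depth_translate: "depth ((\<lambda>y. y + x) ` K) (z + x) = depth K z"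
proof -
 have "- (\<lambda>y. y + x) ` K = (\<lambda>y. y + x) ` (- K)"
  by (rule bij_image_Compl_eq[symmetric]) (simp add: bij_plus_right)
 then show ?thesis unfolding depth_def infdist_def by (simp add: image_image)
qed

lemma centre_translate:
 assumes K: "convex_body K" shows "centre ((\<lambda>y. y + x) ` K) = centre K + x"
proof -
 let ?K = "(\<lambda>y. y + x) ` K"
 have bK: "bounded K" "bounded ?K" using K convex_body_translate[of x K] compact_imp_bounded
  unfolding convex_body_def by auto
 have bs: "bounded {z. depth ?K z ~= 0}" "bounded {z. depth ?K z *\<^sub>R z ~= 0}"
  using depth_outside by (auto intro!: bounded_subset[OF bK(2)])
 obtain a where a: "K \<subseteq> cbox (-a) a" using bounded_subset_cbox_symmetric[OF bK(1)] by blast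
 have m: "depth_mass ?K = depth_mass K"
  unfolding depth_mass_def using integral_UNIV_shift[OF bs(1), of x] by (simp add: depth_translate)
 have i: "depth K integrable_on cbox (-a) a" "(\<lambda>z. depth K z *\<^sub>R z) integrable_on cbox (-a) a"
   "(\<lambda>z. depth K z *\<^sub>R x) integrable_on cbox (-a) a"
  by (intro integrable_continuous continuous_intros continuous_on_depth)+
 have "integral UNIV (\<lambda>z. depth ?K z *\<^sub>R z) = integral UNIV (\<lambda>z. depth K z *\<^sub>R (z + x))"
  using integral_UNIV_shift[OF bs(2), of x] by (simp add: depth_translate)
 also have "... = integral (cbox (-a) a) (\<lambda>z. depth K z *\<^sub>R (z + x))"
 proof (rule integral_UNIV_eq_cbox)
  fix z assume "z \<notin> cbox (-a) a"
  then have "depth K z = 0" using a by (intro depth_outside) auto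
  then show "depth K z *\<^sub>R (z + x) = 0" by simp
 qed
 also have "... = integral UNIV (\<lambda>z. depth K z *\<^sub>R z) + depth_mass K *\<^sub>R x"
  unfolding depth_integrals_cbox[OF a]
  using integral_linear[OF i(1) bounded_linear_scaleR_left[of x]]
  by (simp add: scaleR_add_right integral_add[OF i(2,3)] o_def)
 finally show ?thesis unfolding centre_def m using depth_mass_pos[OF K] by (simp add: scaleR_add_right)
qed

lemma centre_continuous:
 assumes K: "convex_body K" and e: "0 < e"
 shows "\<exists>\<delta>>0. \<forall>K'. convex_body K' --> hausdist K K' < \<delta> --> dist (centre K) (centre K') < e"
proof -
 have cK: "compact K" "K ~= {}" using K convex_body_ne unfolding convex_body_def by auto
 obtain R where R: "R > 0" "K \<subseteq> ball 0 R" using cK compact_imp_bounded bounded_subset_ballD by blast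
 obtain a :: 'a where a: "ball 0 (R + 1) \<subseteq> cbox (-a) a" using bounded_subset_cbox_symmetric[OF bounded_ball] by blast
 obtain B where B: "B > 0" "!!x. x \<in> cbox (-a) a ==> norm x <= B" using bounded_cbox[of "-a" a] bounded_pos by blast
 define V where "V K = integral UNIV (\<lambda>x. depth K x *\<^sub>R x)" for K :: "'a set"
 define c where "c = measure lborel (cbox (-a) a) * max B 1"
 have c0: "c \<ge> 0" unfolding c_def by (simp add: le_max_iff_disj)
 have est: "norm (V K - V K') <= c * hausdist K K'" "\<bar>depth_mass K - depth_mass K'\<bar> <= c * hausdist K K'"
  if K': "convex_body K'" and h: "hausdist K K' < 1" for K'
 proof -
  have cK': "compact K'" "K' ~= {}" using K' convex_body_ne unfolding convex_body_def by auto
  have "K' \<subseteq> ball 0 (R + 1)"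
  proof
   fix y assume "y \<in> K'"
   then obtain x where x: "x \<in> K" "dist y x < 1"
    using hausdist_nearest[OF cK' cK] h by (metis hausdist_commute order_le_less_trans)
   then have "norm x < R" using R by auto
   moreover have "norm y <= norm x + dist y x" by (metis dist_norm norm_triangle_sub)
   ultimately show "y \<in> ball 0 (R + 1)" using x by simp
  qed
  then have sub: "K' \<subseteq> cbox (-a) a" using a by auto
  have "ball (0 :: 'a) R \<subseteq> ball 0 (R + 1)" by (rule subset_ball) simp
  then have sub: "K \<subseteq> cbox (-a) a" "K' \<subseteq> cbox (-a) a" using sub a R(2) by blast+
  have i: "depth C integrable_on cbox (-a) a" "(\<lambda>x. depth C x *\<^sub>R x) integrable_on cbox (-a) a" for C
   by (intro integrable_continuous continuous_intros continuous_on_depth)+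
  have h0: "0 <= hausdist K K'" using cK cK' by (intro hausdist_nonneg)
  have "norm (V K - V K') <= (hausdist K K' * max B 1) * measure lborel (cbox (-a) a)"
   unfolding V_def depth_integrals_cbox[OF sub(1)] depth_integrals_cbox[OF sub(2)]
    integral_diff[OF i(2) i(2), symmetric]
  proof (rule integrable_bound)
   fix x assume x: "x \<in> cbox (-a) a"
   have "norm (depth K x *\<^sub>R x - depth K' x *\<^sub>R x) = \<bar>depth K x - depth K' x\<bar> * norm x"
    by (simp flip: scaleR_diff_left)
   also have "... <= hausdist K K' * max B 1"
    using depth_diff_le_hausdist[OF K K', of x] B(2)[OF x] h0 by (intro mult_mono) auto
   finally show "norm (depth K x *\<^sub>R x - depth K' x *\<^sub>R x) <= hausdist K K' * max B 1" .
  qed (use h0 i in \<open>auto intro!: integrable_diff mult_nonneg_nonneg\<close>)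
  then show "norm (V K - V K') <= c * hausdist K K'" unfolding c_def by (simp add: mult.commute mult.left_commute)
  have "norm (depth_mass K - depth_mass K') <= (hausdist K K' * max B 1) * measure lborel (cbox (-a) a)"
   unfolding depth_integrals_cbox[OF sub(1)] depth_integrals_cbox[OF sub(2)]
    integral_diff[OF i(1) i(1), symmetric]
  proof (rule integrable_bound)
   fix x assume x: "x \<in> cbox (-a) a"
   have "\<bar>depth K x - depth K' x\<bar> <= hausdist K K' * max B 1"
    using mult_mono[OF depth_diff_le_hausdist[OF K K', of x], of 1 "max B 1"] h0 by simp
   then show "norm (depth K x - depth K' x) <= hausdist K K' * max B 1" by simp
  qed (use h0 i in \<open>auto intro!: integrable_diff mult_nonneg_nonneg\<close>)
  then show "\<bar>depth_mass K - depth_mass K'\<bar> <= c * hausdist K K'" unfolding c_def by (simp add: mult.commute mult.left_commute)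
 qed
 have "((\<lambda>z. fst z /\<^sub>R snd z) \<longlongrightarrow> V K /\<^sub>R depth_mass K) (at (V K, depth_mass K))"
  using depth_mass_pos[OF K] by (auto intro!: tendsto_eq_intros)
 then have "isCont (\<lambda>z. fst z /\<^sub>R snd z) (V K, depth_mass K)" unfolding isCont_def by simp
 then obtain \<eta> where \<eta>: "\<eta> > 0" "!!z. dist z (V K, depth_mass K) < \<eta> ==> dist (fst z /\<^sub>R snd z) (V K /\<^sub>R depth_mass K) < e"
  using e unfolding continuous_at_eps_delta by fastforce
 show ?thesis
 proof (intro exI[of _ "min 1 (\<eta> / (2 * c + 1))"] conjI strip)
  show "0 < min 1 (\<eta> / (2 * c + 1))" using \<eta> c0 by simp
  fix K' assume K': "convex_body K'" "hausdist K K' < min 1 (\<eta> / (2 * c + 1))"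
  have "hausdist K K' * (2 * c + 1) < \<eta>" using K'(2) c0 by (simp add: pos_less_divide_eq)
  moreover have "0 <= hausdist K K'"
   using cK K'(1) convex_body_ne unfolding convex_body_def by (intro hausdist_nonneg) auto
  ultimately have "2 * (c * hausdist K K') < \<eta>" by (simp add: algebra_simps)
  moreover have "dist (V K', depth_mass K') (V K, depth_mass K) <= norm (V K' - V K) + \<bar>depth_mass K' - depth_mass K\<bar>"
   unfolding dist_prod_def dist_norm by (simp add: sqrt_sum_squares_le_sum_abs[THEN order_trans])
  ultimately have "dist (V K', depth_mass K') (V K, depth_mass K) < \<eta>"
   using est[OF K'(1)] K'(2) by (auto simp: norm_minus_commute abs_minus_commute)
  from \<eta>(2)[OF this] show "dist (centre K) (centre K') < e"
   unfolding centre_def V_def by (simp add: dist_commute)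
 qed
qed

section \<open>Tiling spaces and associated Delone sets\<close>

lemma is_tile_convex_body: "is_tile L t ==> convex_body (fst t)"
 unfolding is_tile_def convex_body_def by (auto simp: polytope_imp_compact polytope_imp_convex)

lemma Metric_space_tiles:
 assumes L: "Metric_space L dL"
 shows "Metric_space {t :: 'a::euclidean_space set \<times> 'l. is_tile L t} (tile_dist dL)"
proof
 fix x y z :: "'a set \<times> 'l"
 show "0 <= tile_dist dL x y" using tile_dist_nonneg[OF L] .
 show "tile_dist dL x y = tile_dist dL y x" using tile_dist_commute[OF L] .
 show "tile_dist dL x y = 0 \<longleftrightarrow> x = y" if "x \<in> {t. is_tile L t}" "y \<in> {t. is_tile L t}"
  using that tile_dist_zero_imp_eq[OF L, of x y] tile_dist_self[OF L, of x] is_tile_imp_ctile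
  by (metis mem_Collect_eq order_refl)
 show "tile_dist dL x z <= tile_dist dL x y + tile_dist dL y z"
  if "x \<in> {t. is_tile L t}" "y \<in> {t. is_tile L t}" "z \<in> {t. is_tile L t}"
  using that tile_dist_triangle[OF L, of x y z] is_tile_imp_ctile by blast
qed

text \<open>By compactness of the set of prototiles, tiles are neither too thin nor too large.\<close>

lemma prototiles_bounds:
 fixes L :: "'l set" and \<P> :: "('a::euclidean_space set \<times> 'l) set"
 assumes L: "Metric_space L dL" and P: "compactin (tile_topology L dL) \<P>"
 shows "\<exists>r>0. \<exists>D>0. \<forall>(K, l)\<in>\<P>. r <= depth K (centre K) \<and> K \<subseteq> cball (centre K) D"
proof (cases "\<P> = {}")
 case False
 interpret M: Metric_space "{t :: 'a set \<times> 'l. is_tile L t}" "tile_dist dL"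
  by (rule Metric_space_tiles[OF L])
 have P: "compactin M.mtopology \<P>" using P unfolding tile_topology_def .
 define f where "f t = depth (fst t) (centre (fst t))" for t :: "'a set \<times> 'l"
 have "continuous_map M.mtopology euclidean f"
  unfolding continuous_map_metric_euclidean_iff[OF M.Metric_space_axioms]
 proof (intro strip)
  fix t :: "'a set \<times> 'l" and e :: real assume t: "t \<in> {t. is_tile L t}" and e: "0 < e"
  have K: "convex_body (fst t)" using t is_tile_convex_body by blast
  obtain d where d: "d > 0" "!!K'. convex_body K' ==> hausdist (fst t) K' < d ==> dist (centre (fst t)) (centre K') < e/2"
   using centre_continuous[OF K, of "e/2"] e by auto
  show "\<exists>\<delta>>0. \<forall>t'\<in>{t. is_tile L t}. tile_dist dL t t' < \<delta> --> dist (f t) (f t') < e"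
  proof (intro exI[of _ "min d (e/2)"] conjI strip)
   fix t' :: "'a set \<times> 'l" assume t': "t' \<in> {t. is_tile L t}" "tile_dist dL t t' < min d (e/2)"
   have K': "convex_body (fst t')" using t' is_tile_convex_body by blast
   have h: "hausdist (fst t) (fst t') < min d (e/2)" using t'(2) unfolding tile_dist_def by auto
   have "\<bar>depth (fst t) (centre (fst t)) - depth (fst t') (centre (fst t))\<bar> < e/2"
    using depth_diff_le_hausdist[OF K K', of "centre (fst t)"] h by simp
   moreover have "\<bar>depth (fst t') (centre (fst t)) - depth (fst t') (centre (fst t'))\<bar> < e/2"
    using infdist_triangle_abs[of "centre (fst t)" "- fst t'" "centre (fst t')"] d(2)[OF K'] h
    unfolding depth_def by simp
   ultimately show "dist (f t) (f t') < e" unfolding f_def dist_real_def by linarith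
  qed (use d e in auto)
 qed
 then have "compact (f ` \<P>)" using image_compactin[OF P] by fastforce
 then obtain t0 where t0: "t0 \<in> \<P>" "!!t. t \<in> \<P> ==> f t0 <= f t"
  using False compact_attains_inf[of "f ` \<P>"] by auto
 have Pt: "is_tile L t" if "t \<in> \<P>" for t using compactin_subset_topspace[OF P] that by auto
 have r: "0 < f t0" unfolding f_def using centre_in_interior Pt[OF t0(1)] is_tile_convex_body by blast
 obtain c B where B: "\<P> \<subseteq> M.mcball c B"
  using M.compactin_imp_mbounded[OF P] unfolding M.mbounded_def by blast
 then have c: "is_tile L c" using t0(1) by auto
 then have cc: "compact (fst c)" "fst c ~= {}"
  using is_tile_convex_body[OF c] convex_body_ne unfolding convex_body_def by auto
 obtain C where C: "C > 0" "!!x. x \<in> fst c ==> norm x <= C"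
  using cc compact_imp_bounded bounded_pos by metis
 define D where "D = 2 * (C + max B 0)"
 have D: "K \<subseteq> cball (centre K) D" if Kl: "(K, l) \<in> \<P>" for K l
 proof -
  have K: "convex_body K" using Pt[OF Kl] is_tile_convex_body by fastforce
  have "tile_dist dL c (K, l) <= B" using B Kl by auto
  then have h: "hausdist K (fst c) <= B"
   unfolding tile_dist_def by (simp add: hausdist_commute)
  have "norm x <= C + max B 0" if xK: "x \<in> K" for x
  proof -
   obtain y where y: "y \<in> fst c" "dist x y <= hausdist K (fst c)"
    using hausdist_nearest[OF _ _ cc xK] K convex_body_ne[OF K] unfolding convex_body_def by metis
   show ?thesis using C(2)[OF y(1)] y(2) h norm_triangle_sub[of x y] by (simp add: dist_norm)
  qed
  moreover have "centre K \<in> K" using centre_in_interior[OF K] depth_outside by force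
  ultimately have n: "norm x <= C + max B 0" "norm (centre K) <= C + max B 0" if "x \<in> K" for x
   using that by blast+
  show ?thesis
  proof (rule subsetI)
   fix x assume "x \<in> K"
   from n[OF this] show "x \<in> cball (centre K) D"
    unfolding D_def using norm_triangle_ineq4[of "centre K" x] by (simp add: dist_norm)
  qed
 qed
 have "0 < f t0" "0 < D" using r C unfolding D_def by auto
 moreover have "\<forall>(K, l)\<in>\<P>. f t0 <= depth K (centre K) \<and> K \<subseteq> cball (centre K) D"
   using t0(2) D unfolding f_def by fastforce
 ultimately show ?thesis by blast
qed (auto intro: exI[of _ 1])

definition centred_tiling :: "'l set => real => real => ('a::euclidean_space, 'l) config => bool" where
 "centred_tiling L r D T \<longleftrightarrow> \<Union> (fst ` T) = UNIV \<and>
   (\<forall>t\<in>T. is_tile L t \<and> ball (centre (fst t)) r \<subseteq> fst t \<and> fst t \<subseteq> cball (centre (fst t)) D) \<and>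
   (\<forall>t\<in>T. \<forall>t'\<in>T. t ~= t' --> r <= dist (centre (fst t)) (centre (fst t')))"

text \<open>
 Every tile contains a ball of fixed radius around its centre, and tiles meet along their frontiers
 only, so the centres of different tiles are separated by that radius.
\<close>

lemma tiling_centres:
 assumes \<Omega>: "tiling_space L dL \<Omega>" and nd: "\<not> (\<forall>T\<in>\<Omega>. is_delone L T)"
 shows "\<exists>r>0. \<exists>D>0. \<forall>T\<in>\<Omega>. centred_tiling L r D T"
proof -
 have "(\<forall>T\<in>\<Omega>. is_tiling L T) \<and> (\<exists>\<P>. compactin (tile_topology L dL) \<P> \<and>
     (\<forall>T\<in>\<Omega>. \<forall>(K, l)\<in>T. \<exists>K0 x. (K0, l) \<in> \<P> \<and> K = (\<lambda>y. y + x) ` K0))"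
  using \<Omega> nd unfolding tiling_space_def by argo
 note * = this
 have til: "is_tiling L T" if "T \<in> \<Omega>" for T using *[THEN conjunct1] that by blast
 obtain \<P> where **: "compactin (tile_topology L dL) \<P> \<and>
  (\<forall>T\<in>\<Omega>. \<forall>(K, l)\<in>T. \<exists>K0 x. (K0, l) \<in> \<P> \<and> K = (\<lambda>y. y + x) ` K0)"
  using *[THEN conjunct2] by (rule exE)
 note P = **[THEN conjunct1] and P2 = **[THEN conjunct2]
 have L: "Metric_space L dL" using \<Omega> unfolding tiling_space_def by simp
 obtain r D :: real where rD: "0 < r" "0 < D"
  "\<forall>(K, l)\<in>\<P>. r <= depth K (centre K) \<and> K \<subseteq> cball (centre K) D"
  using prototiles_bounds[OF L P] by (elim exE conjE)
 have tile: "is_tile L t" if "T \<in> \<Omega>" "t \<in> T" for T t using til that unfolding is_tiling_def by auto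
 have bounds: "r <= depth (fst t) (centre (fst t)) \<and> fst t \<subseteq> cball (centre (fst t)) D"
  if Tt: "T \<in> \<Omega>" "t \<in> T" for T t
 proof -
  obtain K0 x where K0: "(K0, snd t) \<in> \<P>" "fst t = (\<lambda>y. y + x) ` K0" using bspec[OF bspec[OF P2 Tt(1)] Tt(2)] by (auto simp: case_prod_beta)
  have K: "convex_body K0"
   using is_tile_convex_body[OF tile[OF Tt]] unfolding K0(2) convex_body_translate .
  show ?thesis using bspec[OF rD(3) K0(1)] unfolding K0(2) prod.case centre_translate[OF K] depth_translate
   by (auto simp: dist_norm)
 qed
 have ball: "ball (centre (fst t)) r \<subseteq> fst t" if "T \<in> \<Omega>" "t \<in> T" for T t
  using bounds[OF that] ball_depth_subset[of "centre (fst t)" "fst t"] subset_ball by (metis order_trans)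
 show ?thesis unfolding centred_tiling_def
 proof (rule exI[of _ r], rule conjI[OF rD(1)], rule exI[of _ D], rule conjI[OF rD(2)], intro conjI ballI impI tile)
  fix T t t' assume t: "T \<in> \<Omega>" "t \<in> T" "t' \<in> T" "t ~= t'"
  show "r <= dist (centre (fst t)) (centre (fst t'))"
  proof (rule ccontr)
   assume "\<not> r <= dist (centre (fst t)) (centre (fst t'))"
   then have c': "centre (fst t') \<in> ball (centre (fst t)) r" by simp
   then have "centre (fst t') \<in> interior (fst t)"
    using ball[OF t(1,2)] interior_maximal[OF _ open_ball] by blast
   moreover have "centre (fst t') \<in> fst t'" using ball[OF t(1,3)] rD(1) by (meson centre_in_ball subsetD)
   moreover have "centre (fst t') \<in> fst t" using c' ball[OF t(1,2)] by blast
   ultimately show False using til[OF t(1)] t unfolding is_tiling_def frontier_def by blast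
  qed
 qed (use bounds ball til in \<open>auto simp: is_tiling_def\<close>)
qed

lemma tiling_space_locally_finite:
 assumes \<Omega>: "tiling_space L dL \<Omega>" and T: "T \<in> \<Omega>"
 shows "locally_finite_config L T"
proof (cases "\<forall>T\<in>\<Omega>. is_delone L T")
 case True then show ?thesis using T is_delone_imp_locally_finite by blast
next
 case False
 obtain r D :: real where rD: "0 < r" "0 < D"
  and tc: "\<forall>T\<in>\<Omega>. centred_tiling L r D T"
  using tiling_centres[OF \<Omega> False] by (elim exE conjE)
 have tile: "is_tile L t" and b: "ball (centre (fst t)) r \<subseteq> fst t \<and> fst t \<subseteq> cball (centre (fst t)) D"
  if "T \<in> \<Omega>" "t \<in> T" for T t using tc[unfolded centred_tiling_def] that by blast+
 have sep: "r <= dist (centre (fst t)) (centre (fst t'))" if "T \<in> \<Omega>" "t \<in> T" "t' \<in> T" "t ~= t'" for T t t'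
  using tc[unfolded centred_tiling_def] that by blast
 note tile = tile[OF T] and b = b[OF T] and sep = sep[OF T]
 show ?thesis unfolding locally_finite_config_def
 proof (intro conjI ballI allI)
  show "ctile L t" if "t \<in> T" for t using tile[OF that] by (rule is_tile_imp_ctile)
  fix R
  let ?c = "\<lambda>t. centre (fst t)"
  have inj: "inj_on ?c T" by (rule inj_onI) (metis sep rD(1) dist_self not_le)
  have "uniform_discrete (?c ` T)"
   unfolding uniform_discrete_def using rD(1) sep
   by (intro exI[of _ r]) (auto simp: not_le[symmetric])
  then have "finite (?c ` T \<inter> ball 0 (R + D))" using uniform_discrete_finite_ball bounded_ball by blast
  moreover have "?c ` patch T 0 R \<subseteq> ?c ` T \<inter> ball 0 (R + D)"
  proof
   fix c assume "c \<in> ?c ` patch T 0 R"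
   then obtain t where t0: "t \<in> T" "c = ?c t" "fst t \<inter> ball 0 R ~= {}" unfolding patch_def by blast
   then obtain x where t: "t \<in> T" "c = ?c t" "x \<in> fst t" "norm x < R" by auto
   then have "dist c x <= D" using b[OF t(1)] by auto
   then have "norm c < R + D" using t(4) norm_triangle_sub[of c x] by (simp add: dist_norm)
   then show "c \<in> ?c ` T \<inter> ball 0 (R + D)" using t by simp
  qed
  ultimately have "finite (?c ` patch T 0 R)" by (rule finite_subset[rotated])
  then show "finite (patch T 0 R)"
   by (rule finite_imageD) (rule inj_on_subset[OF inj patch_subset])
 qed
qed

lemma tiling_space_labels: "tiling_space L dL \<Omega> ==> Metric_space L dL"
 unfolding tiling_space_def by simp

lemma tiling_space_Metric_space:
 assumes "tiling_space L dL \<Omega>" shows "Metric_space \<Omega> (config_dist dL)"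
 by (rule Metric_space_config[OF tiling_space_labels[OF assms] tiling_space_locally_finite[OF assms]])

lemma tiling_space_compact: "tiling_space L dL \<Omega> ==> compact_space (Metric_space.mtopology \<Omega> (config_dist dL))"
 unfolding tiling_space_def config_topology_def by simp

lemma tiling_space_translate: "tiling_space L dL \<Omega> ==> T \<in> \<Omega> ==> translate T x \<in> \<Omega>"
 unfolding tiling_space_def by simp

lemma tiling_space_translate_continuous:
 assumes \<Omega>: "tiling_space L dL \<Omega>" and T: "T \<in> \<Omega>" and e: "0 < e"
 shows "\<exists>d>0. \<forall>T'\<in>\<Omega>. \<forall>x'. config_dist dL T T' < d --> norm (x - x') < d -->
    config_dist dL (translate T x) (translate T' x') < e"
proof -
 obtain d where "0 < d" "!!T' x'. locally_finite_config L T' ==> config_dist dL T T' < d ==> norm (x - x') < d ==>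
    config_dist dL (translate T x) (translate T' x') < e"
  using config_dist_translate_continuous[OF tiling_space_labels[OF \<Omega>] tiling_space_locally_finite[OF \<Omega> T] e]
  by metis
 then show ?thesis using tiling_space_locally_finite[OF \<Omega>] by (intro exI[of _ d]) auto
qed

lemma Metric_space_unit: "Metric_space UNIV unit_dist"
 by unfold_locales auto

text \<open>
 A continuous image of a compact space is compact. Closure under translations is stated for the image
 as a whole, because a deformation translates images by the values of a cocycle.
\<close>

lemma tiling_space_delone_image:
 fixes \<Omega> :: "('a::euclidean_space, 'l) config set" and \<Phi> :: "('a, 'l) config => ('a, 'k) config"
 assumes \<Omega>: "tiling_space L dL \<Omega>"
  and L': "Metric_space L' dL'" "compact_space (Metric_space.mtopology L' dL')"
  and del: "!!T. T \<in> \<Omega> ==> is_delone L' (\<Phi> T)"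
  and inv: "!!T x. T \<in> \<Omega> ==> translate (\<Phi> T) x \<in> \<Phi> ` \<Omega>"
  and cont: "!!T e. T \<in> \<Omega> ==> 0 < e ==>
    \<exists>\<delta>>0. \<forall>T'\<in>\<Omega>. config_dist dL T T' < \<delta> --> config_dist dL' (\<Phi> T) (\<Phi> T') < e"
 shows "continuous_map (config_topology dL \<Omega>) (config_topology dL' (\<Phi> ` \<Omega>)) \<Phi>"
  "tiling_space L' dL' (\<Phi> ` \<Omega>)"
proof -
 interpret M: Metric_space \<Omega> "config_dist dL" by (rule tiling_space_Metric_space[OF \<Omega>])
 have M': "Metric_space (\<Phi> ` \<Omega>) (config_dist dL')"
  using del is_delone_imp_locally_finite by (intro Metric_space_config[OF L'(1)]) blast
 show c: "continuous_map (config_topology dL \<Omega>) (config_topology dL' (\<Phi> ` \<Omega>)) \<Phi>"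
  unfolding config_topology_def M.metric_continuous_map[OF M'] using cont by blast
 have "compact_space (config_topology dL' (\<Phi> ` \<Omega>))"
  using image_compactin[OF _ c, of \<Omega>] tiling_space_compact[OF \<Omega>] M' Metric_space.topspace_mtopology[OF M']
   M.topspace_mtopology
  unfolding compact_space_def config_topology_def by simp
 then show "tiling_space L' dL' (\<Phi> ` \<Omega>)"
  unfolding tiling_space_def using L' del inv by auto
qed

lemma compact_space_finite_metric:
 assumes "Metric_space L d" "finite L" shows "compact_space (Metric_space.mtopology L d)"
 unfolding compact_space_def
 by (rule finite_imp_compactin) (simp_all add: Metric_space.topspace_mtopology[OF assms(1)] assms(2))

abbreviation unlabelled :: "'a set => ('a, unit) config" where
 "unlabelled \<Lambda> \<equiv> labelled_points \<Lambda> (\<lambda>_. ())"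

lemma unlabelled_inject [simp]: "unlabelled A = unlabelled B \<longleftrightarrow> A = B"
proof
 assume "unlabelled A = unlabelled B"
 then have "\<Union> (fst ` unlabelled A) = \<Union> (fst ` unlabelled B)" by simp
 then show "A = B" unfolding labelled_points_def by (simp add: image_image)
qed simp

lemma translate_labelled_points:
 "translate (labelled_points \<Lambda> lab) x = labelled_points ((\<lambda>p. p - x) ` \<Lambda>) (\<lambda>p. lab (p + x))"
 unfolding translate_eq_image labelled_points_def translate_tile_def by (simp add: image_image)

lemma delone_space_unlabelled:
 fixes \<Omega> :: "('a::euclidean_space, 'l) config set" and \<Lambda> :: "('a, 'l) config => 'a set"
 assumes \<Omega>: "tiling_space L dL \<Omega>"
  and del: "!!T. T \<in> \<Omega> ==> uniform_discrete (\<Lambda> T) \<and> relatively_dense (\<Lambda> T)"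
  and equi: "!!T x. T \<in> \<Omega> ==> \<Lambda> (translate T x) = (\<lambda>p. p - x) ` \<Lambda> T"
  and cont: "!!T e. T \<in> \<Omega> ==> 0 < e ==>
    \<exists>\<delta>>0. \<forall>T'\<in>\<Omega>. config_dist dL T T' < \<delta> --> config_dist unit_dist (unlabelled (\<Lambda> T)) (unlabelled (\<Lambda> T')) < e"
 shows "delone_space ((\<lambda>T. unlabelled (\<Lambda> T)) ` \<Omega>)"
  "factor_map dL \<Omega> unit_dist ((\<lambda>T. unlabelled (\<Lambda> T)) ` \<Omega>) (\<lambda>T. unlabelled (\<Lambda> T))"
  "associated_delone_sets dL \<Omega> \<Lambda>"
proof -
 let ?\<Phi> = "\<lambda>T. unlabelled (\<Lambda> T)"
 have d: "is_delone UNIV (?\<Phi> T)" if "T \<in> \<Omega>" for T unfolding is_delone_def using del[OF that] by blast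
 have eq: "?\<Phi> (translate T x) = translate (?\<Phi> T) x" if "T \<in> \<Omega>" for T x
  unfolding translate_labelled_points equi[OF that] ..
 have inv: "translate (?\<Phi> T) x \<in> ?\<Phi> ` \<Omega>" if "T \<in> \<Omega>" for T x
  using eq[OF that, of x] tiling_space_translate[OF \<Omega> that] by (metis imageI)
 note * = tiling_space_delone_image[OF \<Omega> Metric_space_unit compact_space_finite_metric[OF Metric_space_unit] d inv cont]
 show 1: "delone_space (?\<Phi> ` \<Omega>)" "factor_map dL \<Omega> unit_dist (?\<Phi> ` \<Omega>) ?\<Phi>"
  unfolding delone_space_def factor_map_def using * d eq by auto
 show "associated_delone_sets dL \<Omega> \<Lambda>" unfolding associated_delone_sets_def using 1 by blast
qed

text \<open>A point chosen inside each tile cannot come from far away, so tilewise replacement is continuous.\<close>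

lemma tilewise_points_continuous:
 fixes \<Omega> :: "('a::euclidean_space, 'l) config set" and c :: "'a set => 'a"
 assumes \<Omega>: "tiling_space L dL \<Omega>"
  and inj: "!!S. S \<in> \<Omega> ==> inj_on (\<lambda>t. c (fst t)) S"
  and c: "!!S t e. S \<in> \<Omega> ==> t \<in> S ==> 0 < e ==>
    \<exists>\<delta>>0. \<forall>S'\<in>\<Omega>. \<forall>t'\<in>S'. hausdist (fst t) (fst t') < \<delta> --> dist (c (fst t)) (c (fst t')) < e"
  and mem: "!!S t. S \<in> \<Omega> ==> t \<in> S ==> c (fst t) \<in> fst t"
  and S: "S \<in> \<Omega>" and e: "0 < e"
 shows "\<exists>\<delta>>0. \<forall>S'\<in>\<Omega>. config_dist dL S S' < \<delta> -->
   config_dist unit_dist (unlabelled ((\<lambda>t. c (fst t)) ` S)) (unlabelled ((\<lambda>t. c (fst t)) ` S')) < e"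
proof -
 have u: "unlabelled ((\<lambda>t. c (fst t)) ` S) = (\<lambda>t. ({c (fst t)}, ())) ` S" for S :: "('a, 'l) config"
  unfolding labelled_points_def by (simp add: image_image)
 show ?thesis unfolding u
 proof (rule tilewise_image_continuous[where \<Phi> = "\<lambda>S. S" and G = "\<lambda>S t. ({c (fst t)}, ())",
    OF tiling_space_labels[OF \<Omega>] tiling_space_locally_finite[OF \<Omega>] _ _ _ _ S e])
  show "inj_on (\<lambda>t. ({c (fst t)}, ())) S" if "S \<in> \<Omega>" for S
   using inj[OF that] unfolding inj_on_def by simp
  show "\<exists>\<delta>>0. \<forall>S'\<in>\<Omega>. \<forall>t'\<in>S'. config_dist dL S S' < \<delta> --> tile_dist dL t t' < \<delta> -->
    tile_dist unit_dist ({c (fst t)}, ()) ({c (fst t')}, ()) < e"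
   if t: "S \<in> \<Omega>" "t \<in> S" "0 < e" for S t e
  proof -
   obtain \<delta> where \<delta>: "\<delta> > 0" "!!S' t'. S' \<in> \<Omega> ==> t' \<in> S' ==> hausdist (fst t) (fst t') < \<delta> ==> dist (c (fst t)) (c (fst t')) < e"
    using c[OF t] by metis
   show ?thesis
    by (rule exI[of _ \<delta>]) (use \<delta> t in \<open>auto simp: tile_dist_def\<close>)
  qed
  show "\<exists>\<rho>. \<forall>S\<in>\<Omega>. \<forall>t\<in>S. fst ({c (fst t)}, ()) \<inter> ball 0 M ~= {} --> fst t \<inter> ball 0 \<rho> ~= {}" for M
   using mem by (intro exI[of _ M]) fastforce
 qed auto
qed

lemma translate_points_image:
 assumes "!!t. t \<in> T ==> c ((\<lambda>y. y - x) ` fst t) = c (fst t) - x"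
 shows "(\<lambda>t. c (fst t)) ` translate T x = (\<lambda>p. p - x) ` (\<lambda>t. c (fst t)) ` T"
 unfolding translate_eq_image image_image translate_tile_def using assms by simp

text \<open>Tiles are represented by their centres, points of labelled Delone sets by themselves.\<close>

theorem associated_delone_sets_exist:
 fixes \<Omega> :: "('a::euclidean_space, 'l) config set"
 assumes \<Omega>: "tiling_space L dL \<Omega>"
 shows "\<exists>\<Lambda>. associated_delone_sets dL \<Omega> \<Lambda>"
proof (cases "\<forall>T\<in>\<Omega>. is_delone L T")
 case True
 let ?c = "\<lambda>K :: 'a set. the_elem K"
 define \<Lambda> where "\<Lambda> T = (\<lambda>t. ?c (fst t)) ` T" for T :: "('a, 'l) config"
 have D: "\<exists>P lab. uniform_discrete P \<and> relatively_dense P \<and> T = labelled_points P lab \<and> \<Lambda> T = P" if T: "T \<in> \<Omega>" for T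
 proof -
  obtain P and lab :: "'a => 'l" where P: "uniform_discrete P" "relatively_dense P" "T = labelled_points P lab"
   using True T unfolding is_delone_def by metis
  moreover have "\<Lambda> T = P" unfolding \<Lambda>_def P(3) labelled_points_def by (simp add: image_image)
  ultimately show ?thesis by metis
 qed
 have single: "\<exists>p. fst t = {p}" if Tt: "T \<in> \<Omega>" "t \<in> T" for T t
 proof -
  obtain P lab where "T = labelled_points P lab" using D[OF Tt(1)] by metis
  then show ?thesis using Tt(2) unfolding labelled_points_def by auto
 qed
 have "associated_delone_sets dL \<Omega> \<Lambda>"
 proof (rule delone_space_unlabelled(3)[OF \<Omega>, where \<Lambda> = \<Lambda>], goal_cases)
  case (1 T) then show ?case using D[OF 1] by (elim exE conjE) simp
 next
  case (2 T x) show ?case unfolding \<Lambda>_def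
   by (rule translate_points_image) (use single[OF 2] in force)
 next
  case (3 T e) show ?case unfolding \<Lambda>_def
  proof (rule tilewise_points_continuous[OF \<Omega> _ _ _ 3], goal_cases)
   case (1 S)
   obtain P lab where "S = labelled_points P lab" using D[OF 1] by metis
   then show ?case by (auto simp: inj_on_def labelled_points_def)
  next
   case (2 S t e) show ?case
   proof (intro exI[of _ e] conjI ballI impI)
    fix S' t' assume t': "S' \<in> \<Omega>" "t' \<in> S'" "hausdist (fst t) (fst t') < e"
    obtain p q where "fst t = {p}" "fst t' = {q}" using single 2 t' by metis
    then show "dist (the_elem (fst t)) (the_elem (fst t')) < e" using t'(3) by simp
   qed (rule 2)
  next
   case (3 S t) then show ?case using single by fastforce
  qed
 qed
 then show ?thesis by (rule exI[of _ \<Lambda>])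
next
 case False
 obtain r D :: real where rD: "0 < r" "0 < D"
  and tc: "\<forall>T\<in>\<Omega>. centred_tiling L r D T"
  using tiling_centres[OF \<Omega> False] by (elim exE conjE)
 have tile: "is_tile L t" and b: "ball (centre (fst t)) r \<subseteq> fst t \<and> fst t \<subseteq> cball (centre (fst t)) D"
  if "T \<in> \<Omega>" "t \<in> T" for T t using tc[unfolded centred_tiling_def] that by simp_all
 have sep: "r <= dist (centre (fst t)) (centre (fst t'))" if "T \<in> \<Omega>" "t \<in> T" "t' \<in> T" "t ~= t'" for T t t'
  using tc[unfolded centred_tiling_def] that by simp
 have cov: "\<Union> (fst ` T) = UNIV" if "T \<in> \<Omega>" for T using tc[unfolded centred_tiling_def] that by simp
 define \<Lambda> where "\<Lambda> T = (\<lambda>t. centre (fst t)) ` T" for T :: "('a, 'l) config"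
 have "associated_delone_sets dL \<Omega> \<Lambda>"
 proof (rule delone_space_unlabelled(3)[OF \<Omega>, where \<Lambda> = \<Lambda>], goal_cases)
  case (1 T)
  have "uniform_discrete (\<Lambda> T)"
   unfolding uniform_discrete_def \<Lambda>_def using rD(1) sep[OF 1]
   by (intro exI[of _ r]) (auto simp: not_le[symmetric])
  moreover have "\<exists>p\<in>\<Lambda> T. dist x p <= D" for x
  proof -
   have "x \<in> \<Union> (fst ` T)" using cov[OF 1] by simp
   then obtain t where t: "t \<in> T" "x \<in> fst t" by blast
   then have "dist x (centre (fst t)) <= D" using b[OF 1 t(1)] by (auto simp: dist_commute)
   then show ?thesis unfolding \<Lambda>_def using t(1) by blast
  qed
  ultimately show ?case unfolding relatively_dense_def by blast
 next
  case (2 T x) show ?case unfolding \<Lambda>_def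
  proof (rule translate_points_image)
   show "centre ((\<lambda>y. y - x) ` fst t) = centre (fst t) - x" if "t \<in> T" for t
    using centre_translate[OF is_tile_convex_body[OF tile[OF 2 that]], of "-x"] by simp
  qed
 next
  case (3 T e) show ?case unfolding \<Lambda>_def
  proof (rule tilewise_points_continuous[OF \<Omega> _ _ _ 3], goal_cases)
   case (1 S) show ?case by (rule inj_onI) (metis sep[OF 1] rD(1) dist_self not_le)
  next
   case (2 S t e)
   then show ?case using centre_continuous[OF is_tile_convex_body[OF tile[OF 2(1,2)]] 2(3)] tile
    is_tile_convex_body by metis
  next
   case (3 S t) then show ?case using b rD(1) by (meson centre_in_ball subsetD)
  qed
 qed
 then show ?thesis by (rule exI[of _ \<Lambda>])
qed

section \<open>Limits of probability measures on a compact space\<close>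

definition borel_of :: "'x topology => 'x measure" where
 "borel_of X = sigma (topspace X) {U. openin X U}"

lemma space_borel_of [simp]: "space (borel_of X) = topspace X"
 unfolding borel_of_def by (rule space_measure_of) (use openin_subset in auto)

lemma sets_borel_of: "sets (borel_of X) = sigma_sets (topspace X) {U. openin X U}"
 unfolding borel_of_def by (rule sets_measure_of) (use openin_subset in auto)

lemma borel_of_open: "openin X U ==> U \<in> sets (borel_of X)"
 unfolding sets_borel_of by auto

lemma borel_of_closed: "closedin X K ==> K \<in> sets (borel_of X)"
 using sets.compl_sets[OF borel_of_open[of X "topspace X - K"]] closedin_subset[of X K]
 by (auto simp: closedin_def double_diff)

lemma continuous_map_measurable:
 assumes "continuous_map X Y f" shows "f \<in> measurable (borel_of X) (borel_of Y)"
proof -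
 have "f \<in> measurable (borel_of X) (sigma (topspace Y) {U. openin Y U})"
 proof (rule measurable_sigma_sets[OF _ _ _ ])
  show "sets (sigma (topspace Y) {U. openin Y U}) = sigma_sets (topspace Y) {U. openin Y U}"
   by (rule sets_measure_of) (use openin_subset in auto)
  show "f \<in> space (borel_of X) \<rightarrow> topspace Y" using assms unfolding continuous_map_def by auto
  show "f -` A \<inter> space (borel_of X) \<in> sets (borel_of X)" if "A \<in> {U. openin Y U}" for A
  proof -
   have "f -` A \<inter> space (borel_of X) = {x \<in> topspace X. f x \<in> A}" by auto
   then show ?thesis using that assms unfolding continuous_map_def by (auto intro!: borel_of_open)
  qed
 qed (use openin_subset in auto)
 then show ?thesis unfolding borel_of_def by simp
qed

lemma borel_of_euclidean: "borel_of (euclidean :: 'a::topological_space topology) = borel"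
 unfolding borel_of_def borel_def by (simp add: open_openin[symmetric])

lemma continuous_map_borel_measurable:
 "continuous_map X euclidean f ==> f \<in> borel_measurable (borel_of X)"
 using continuous_map_measurable[of X euclidean f] by (simp add: borel_of_euclidean)

text \<open>A content on the closed subsets of a compact normal space induces a Borel measure.\<close>

locale closed_content =
 fixes X :: "'x topology" and lam :: "'x set => real"
 assumes compact: "compact_space X" and normal: "normal_space X"
  and nonneg: "!!K. 0 <= lam K"
  and lam_empty: "lam {} = 0"
  and mono: "!!K L. closedin X K ==> closedin X L ==> K \<subseteq> L ==> lam K <= lam L"
  and subadd: "!!K L. closedin X K ==> closedin X L ==> lam (K \<union> L) <= lam K + lam L"
  and add: "!!K L. closedin X K ==> closedin X L ==> K \<inter> L = {} ==> lam (K \<union> L) = lam K + lam L"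
begin

definition inner :: "'x set => ennreal" where
 "inner U = (SUP K\<in>{K. closedin X K \<and> K \<subseteq> U}. ennreal (lam K))"

definition outer :: "'x set => ennreal" where
 "outer E = (INF U\<in>{U. openin X U \<and> E \<subseteq> U}. inner U)"

lemma inner_ge: "closedin X K ==> K \<subseteq> U ==> ennreal (lam K) <= inner U"
 unfolding inner_def by (rule SUP_upper) auto

lemma inner_le: "(!!K. closedin X K ==> K \<subseteq> U ==> ennreal (lam K) <= c) ==> inner U <= c"
 unfolding inner_def by (rule SUP_least) auto

lemma inner_mono: "U \<subseteq> V ==> inner U <= inner V"
 by (rule inner_le, rule inner_ge) auto

lemma outer_open: "openin X U ==> outer U = inner U"
 unfolding outer_def by (rule antisym) (auto intro: INF_lower INF_greatest inner_mono)

lemma outer_mono: "E \<subseteq> F ==> outer E <= outer F"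
 unfolding outer_def by (rule INF_superset_mono) auto

lemma outer_le_inner: "openin X U ==> E \<subseteq> U ==> outer E <= inner U"
 unfolding outer_def by (rule INF_lower) auto

text \<open>
 Normality separates the parts of K outside U and outside V; each part of the splitting omits one
 of the two separating neighbourhoods.
\<close>

lemma split_closed:
 assumes K: "closedin X K" "K \<subseteq> U \<union> V" and U: "openin X U" "openin X V"
 obtains K1 K2 where "closedin X K1" "closedin X K2" "K1 \<subseteq> U" "K2 \<subseteq> V" "K = K1 \<union> K2"
proof -
 have c: "closedin X (K - U)" "closedin X (K - V)" using K U by (auto intro: closedin_diff)
 have "disjnt (K - U) (K - V)" using K(2) by (auto simp: disjnt_def)
 then obtain A B where AB: "openin X A" "openin X B" "K - U \<subseteq> A" "K - V \<subseteq> B" "disjnt A B"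
  using normal c unfolding normal_space_def by metis
 show ?thesis
  by (rule that[of "K - A" "K - B"]) (use AB K in \<open>auto intro: closedin_diff simp: disjnt_iff\<close>)
qed

lemma lam_le_sum_inner:
 assumes "finite I" "!!i. i \<in> I ==> openin X (U i)" "closedin X K" "K \<subseteq> (\<Union>i\<in>I. U i)"
 shows "ennreal (lam K) <= (\<Sum>i\<in>I. inner (U i))"
 using assms
proof (induction I arbitrary: K rule: finite_induct)
 case empty
 then show ?case by (simp add: lam_empty)
next
 case (insert i I)
 have o: "openin X (U i)" "openin X (\<Union>i\<in>I. U i)" using insert.prems by auto
 obtain K1 K2 where K: "closedin X K1" "closedin X K2" "K1 \<subseteq> U i" "K2 \<subseteq> (\<Union>i\<in>I. U i)" "K = K1 \<union> K2"
  by (rule split_closed[OF insert.prems(2) _ o]) (use insert.prems in auto)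
 have "ennreal (lam K) <= ennreal (lam K1) + ennreal (lam K2)"
  unfolding K(5) using subadd[OF K(1,2)] nonneg by (simp flip: ennreal_plus)
 also have "... <= inner (U i) + (\<Sum>i\<in>I. inner (U i))"
  using inner_ge[OF K(1,3)] insert.IH[OF _ K(2,4)] insert.prems by (intro add_mono) auto
 finally show ?case using insert.hyps by simp
qed

lemma inner_countably_subadditive:
 assumes U: "!!i::nat. openin X (U i)"
 shows "inner (\<Union>i. U i) <= (\<Sum>i. inner (U i))"
proof (rule inner_le)
 fix K assume K: "closedin X K" "K \<subseteq> (\<Union>i. U i)"
 have "compactin X K" using K(1) compact by (simp add: closedin_compact_space)
 then obtain F where F: "finite F" "F \<subseteq> range U" "K \<subseteq> \<Union> F"
  using K(2) U unfolding compactin_def by (metis (no_types, lifting) imageE)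
 then obtain I where I: "finite I" "F = U ` I" by (meson finite_subset_image)
 have "ennreal (lam K) <= (\<Sum>i\<in>I. inner (U i))"
  using F I U K by (intro lam_le_sum_inner) auto
 also have "... <= (\<Sum>i. inner (U i))" using I(1) by (intro sum_le_suminf) auto
 finally show "ennreal (lam K) <= (\<Sum>i. inner (U i))" .
qed

lemma outer_countably_subadditive: "countably_subadditive (Pow (topspace X)) outer"
 unfolding countably_subadditive_def
proof (intro allI impI)
 fix A :: "nat => 'x set" assume A: "range A \<subseteq> Pow (topspace X)"
 show "outer (\<Union>i. A i) <= (\<Sum>n. outer (A n))"
 proof (rule ennreal_le_epsilon)
  fix e :: real assume e: "0 < e" "(\<Sum>n. outer (A n)) < top"
  then have *: "outer (A n) < outer (A n) + e * (1/2)^Suc n" for n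
   by (auto simp add: less_top dest!: ennreal_suminf_lessD)
  have "\<exists>U. openin X U \<and> A n \<subseteq> U \<and> inner U <= outer (A n) + e * (1/2)^Suc n" for n
   using *[of n] unfolding outer_def[of "A n"] INF_less_iff by (auto intro: less_imp_le)
  then obtain U where U: "!!n. openin X (U n)" "!!n. A n \<subseteq> U n"
   "!!n. inner (U n) <= outer (A n) + e * (1/2)^Suc n" by metis
  have "outer (\<Union>i. A i) <= inner (\<Union>i. U i)"
   using U by (intro outer_le_inner) auto
  also have "... <= (\<Sum>i. inner (U i))" using U(1) by (rule inner_countably_subadditive)
  also have "... <= (\<Sum>n. outer (A n) + e * (1/2) ^ Suc n)"
   by (intro suminf_le U(3)) auto
  also have "... = (\<Sum>n. outer (A n)) + (\<Sum>n. ennreal e * ennreal ((1/2) ^ Suc n))"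
   using \<open>0 < e\<close> by (subst suminf_add[symmetric])
            (auto simp del: ennreal_suminf_cmult simp add: ennreal_mult[symmetric])
  also have "... = (\<Sum>n. outer (A n)) + e"
   unfolding ennreal_suminf_cmult
   by (subst suminf_ennreal_eq[OF zero_le_power power_half_series]) auto
  finally show "outer (\<Union>i. A i) <= (\<Sum>n. outer (A n)) + e" .
 qed
qed

lemma outer_empty: "outer {} = 0"
proof -
 have "inner {} = 0" using inner_le[of "{}" 0] by (auto simp: lam_empty)
 then show ?thesis using outer_open[of "{}"] by simp
qed

lemma outer_measure_space_outer: "outer_measure_space (Pow (topspace X)) outer"
 unfolding outer_measure_space_def positive_def increasing_def
 using outer_empty outer_mono outer_countably_subadditive by auto

text \<open>
 This is Caratheodory's condition for open sets. Exhaust \<open>V \<inter> U\<close> by closed sets K; then \<open>V - U\<close>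
 lies in the open set \<open>V - K\<close>, whose closed subsets are disjoint from K, so that the content adds up.
\<close>

lemma inner_split:
 assumes "openin X U" "openin X V"
 shows "inner (V \<inter> U) + outer (V - U) <= inner V"
proof -
 have ne: "{K. closedin X K \<and> K \<subseteq> V \<inter> U} ~= {}" using closedin_empty by blast
 have "ennreal (lam K) + outer (V - U) <= inner V" if K: "closedin X K" "K \<subseteq> V \<inter> U" for K
 proof -
  have ne: "{L. closedin X L \<and> L \<subseteq> V - K} ~= {}" using closedin_empty by blast
  have "outer (V - U) <= inner (V - K)" using assms K by (intro outer_le_inner openin_diff) auto
  then have "ennreal (lam K) + outer (V - U) <= ennreal (lam K) + inner (V - K)" by (rule add_left_mono)
  also have "... = (SUP L\<in>{L. closedin X L \<and> L \<subseteq> V - K}. ennreal (lam K) + ennreal (lam L))"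
   unfolding inner_def using ne by (simp add: ennreal_SUP_add_right)
  also have "... <= inner V"
  proof (rule SUP_least)
   fix L assume L: "L \<in> {L. closedin X L \<and> L \<subseteq> V - K}"
   have "ennreal (lam K) + ennreal (lam L) = ennreal (lam (K \<union> L))"
   proof -
    have "K \<inter> L = {}" using L by auto
    then show ?thesis using add[OF K(1), of L] L nonneg by (subst ennreal_plus[symmetric]) auto
   qed
   also have "... <= inner V" using K L by (intro inner_ge) auto
   finally show "ennreal (lam K) + ennreal (lam L) <= inner V" .
  qed
  finally show ?thesis .
 qed
 then show ?thesis unfolding inner_def[of "V \<inter> U"]
  by (subst ennreal_SUP_add_left[symmetric, OF ne]) (auto intro: SUP_least)
qed

lemma open_in_lambda_system:
 assumes U: "openin X U" shows "U \<in> lambda_system (topspace X) (Pow (topspace X)) outer"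
 unfolding algebra.lambda_system_eq[OF algebra_Pow]
proof (intro CollectI conjI ballI antisym)
 show "U \<in> Pow (topspace X)" using U openin_subset by auto
 fix x assume x: "x \<in> Pow (topspace X)"
 have "subadditive (Pow (topspace X)) outer"
  using ring_of_sets.countably_subadditive_subadditive[OF ring_of_sets_Pow _ outer_countably_subadditive]
   outer_empty unfolding positive_def by auto
 from subadditiveD[OF this, of "x \<inter> U" "x - U"] x
 show "outer x <= outer (x \<inter> U) + outer (x - U)" by (auto simp: Int_Diff_Un)
 show "outer (x \<inter> U) + outer (x - U) <= outer x"
  unfolding outer_def[of x]
 proof (rule INF_greatest)
  fix V assume V: "V \<in> {V. openin X V \<and> x \<subseteq> V}"
  have "outer (x \<inter> U) + outer (x - U) <= inner (V \<inter> U) + outer (V - U)"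
   using U V by (intro add_mono outer_le_inner outer_mono) auto
  also have "... <= inner V" using U V by (intro inner_split) auto
  finally show "outer (x \<inter> U) + outer (x - U) <= inner V" .
 qed
qed

definition induced_measure :: "'x measure" where
 "induced_measure = measure_of (topspace X) {U. openin X U} outer"

lemma sets_induced_measure [simp]: "sets induced_measure = sets (borel_of X)"
 unfolding induced_measure_def sets_borel_of by (rule sets_measure_of) (use openin_subset in auto)

lemma space_induced_measure [simp]: "space induced_measure = topspace X"
 unfolding induced_measure_def by (rule space_measure_of) (use openin_subset in auto)

lemma emeasure_induced_measure:
 assumes "B \<in> sets (borel_of X)" shows "emeasure induced_measure B = outer B"
proof -
 let ?L = "lambda_system (topspace X) (Pow (topspace X)) outer"
 let ?S = "sigma_sets (topspace X) {U. openin X U}"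
 have L: "measure_space (topspace X) ?L outer"
  by (rule sigma_algebra.caratheodory_lemma[OF sigma_algebra_Pow outer_measure_space_outer])
 then have "sigma_algebra (topspace X) ?L" unfolding measure_space_def by simp
 then have "?S \<subseteq> ?L" by (rule sigma_algebra.sigma_sets_subset) (use open_in_lambda_system in auto)
 moreover have sS: "sigma_algebra (topspace X) ?S"
  by (rule sigma_algebra_sigma_sets) (use openin_subset in auto)
 ultimately have "measure_space (topspace X) ?S outer" using measure_down[OF L] by blast
 then have "positive (sets induced_measure) outer" "countably_additive (sets induced_measure) outer"
  unfolding measure_space_def sets_induced_measure sets_borel_of by auto
 then show ?thesis
  using assms openin_subset[of X] by (intro emeasure_measure_of[OF induced_measure_def]) auto
qed

text \<open>
 The outer measure is an infimum over neighbourhoods, each of which contains K as a closed subset. As in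
 the portmanteau theorem, equality can fail, but it holds for the whole space.
\<close>

lemma emeasure_induced_closed:
 assumes "closedin X K" shows "ennreal (lam K) <= emeasure induced_measure K"
 unfolding emeasure_induced_measure[OF borel_of_closed[OF assms]] outer_def
 by (rule INF_greatest) (use inner_ge assms in auto)

lemma emeasure_induced_space: "emeasure induced_measure (topspace X) = ennreal (lam (topspace X))"
proof (rule antisym)
 show "emeasure induced_measure (topspace X) <= ennreal (lam (topspace X))"
  unfolding emeasure_induced_measure[OF borel_of_open[OF openin_topspace]] outer_open[OF openin_topspace]
  by (rule inner_le, rule ennreal_leI, rule mono) auto
qed (rule emeasure_induced_closed, simp)

text \<open>The outer measure is built from the content and the topology alone, so it inherits symmetries.\<close>

lemma emeasure_induced_homeo:
 assumes h: "homeomorphic_map X X h" and inv: "!!K. closedin X K ==> lam (h ` K) = lam K"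
  and B: "B \<in> sets (borel_of X)" "h ` B \<in> sets (borel_of X)"
 shows "emeasure induced_measure (h ` B) = emeasure induced_measure B"
proof -
 have hX: "inj_on h (topspace X)" "h ` topspace X = topspace X"
  using h by (auto simp: homeomorphic_imp_injective_map homeomorphic_imp_surjective_map)
 have cl: "closedin X (h ` K) \<longleftrightarrow> closedin X K" if "K \<subseteq> topspace X" for K
  using homeomorphic_map_closedness[OF h that] .
 have op: "openin X (h ` K) \<longleftrightarrow> openin X K" if "K \<subseteq> topspace X" for K
  using homeomorphic_map_openness[OF h that] .
 have surj: "\<exists>K. K \<subseteq> topspace X \<and> L = h ` K" if "L \<subseteq> topspace X" for L
  using that hX(2) by (metis subset_imageE)
 have inj: "h ` A \<subseteq> h ` B \<longleftrightarrow> A \<subseteq> B" if "A \<subseteq> topspace X" "B \<subseteq> topspace X" for A B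
  using hX(1) that by (simp add: inj_on_image_subset_iff)
 have inner: "inner (h ` U) = inner U" if U: "U \<subseteq> topspace X" for U
 proof -
  have "{K. closedin X K \<and> K \<subseteq> h ` U} = (\<lambda>K. h ` K) ` {K. closedin X K \<and> K \<subseteq> U}"
   using cl surj inj[OF _ U] closedin_subset[of X] by (auto simp: image_iff) (metis)+
  then show ?thesis unfolding inner_def by (simp add: image_image) (rule SUP_cong, auto simp: inv)
 qed
 have "outer (h ` E) = outer E" if E: "E \<subseteq> topspace X" for E
 proof -
  have "{U. openin X U \<and> h ` E \<subseteq> U} = (\<lambda>K. h ` K) ` {U. openin X U \<and> E \<subseteq> U}"
   using op surj inj[OF E] openin_subset[of X] by (auto simp: image_iff) (metis)+
  then show ?thesis unfolding outer_def using inner openin_subset[of X]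
   by (auto simp: image_image intro!: INF_cong)
 qed
 then show ?thesis using B sets.sets_into_space[OF B(1)] by (simp add: emeasure_induced_measure)
qed

end

text \<open>Set functions with values in the unit interval form a compact space, whence cluster points.\<close>

lemma setwise_cluster_filter:
 fixes M :: "nat => 'i => real"
 assumes M: "!!n B. M n B \<in> {0..1}"
 obtains F :: "nat filter" and lam where "F ~= bot" "F <= sequentially" "!!B. ((\<lambda>n. M n B) \<longlongrightarrow> lam B) F"
proof -
 have "compactin euclidean (PiE UNIV (\<lambda>_::'i. {0..1::real}))"
  unfolding euclidean_product_topology[symmetric] compactin_PiE by simp
 then have "compact (PiE UNIV (\<lambda>_::'i. {0..1::real}))" by simp
 moreover have "filtermap M sequentially ~= bot" by (simp add: filtermap_bot_iff)
 moreover have "eventually (\<lambda>x. x \<in> PiE UNIV (\<lambda>_::'i. {0..1::real})) (filtermap M sequentially)"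
  using M by (simp add: eventually_filtermap PiE_UNIV_domain)
 ultimately obtain lam where lam: "inf (nhds lam) (filtermap M sequentially) ~= bot"
  unfolding compact_filter by blast
 define F where "F = inf sequentially (filtercomap M (nhds lam))"
 have "F ~= bot"
 proof
  assume "F = bot"
  then have "eventually (\<lambda>_. False) F" by simp
  then obtain P Q where PQ: "eventually P sequentially" "eventually Q (nhds lam)" "!!n. P n ==> Q (M n) ==> False"
   unfolding F_def eventually_inf eventually_filtercomap by blast
  have "eventually (\<lambda>n. \<not> Q (M n)) sequentially" using PQ(1) by (rule eventually_mono) (use PQ(3) in blast)
  then have "eventually (\<lambda>x. \<not> Q x) (filtermap M sequentially)" by (simp add: eventually_filtermap)
  with PQ(2) have "eventually (\<lambda>_. False) (inf (nhds lam) (filtermap M sequentially))"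
   unfolding eventually_inf by blast
  then show False using lam by (simp add: trivial_limit_def)
 qed
 moreover have "F <= sequentially" unfolding F_def by simp
 moreover have "((\<lambda>n. M n B) \<longlongrightarrow> lam B) F" for B
 proof -
  have "filterlim M (nhds lam) F"
   unfolding F_def by (rule filterlim_mono[OF filterlim_filtercomap order_refl]) simp
  from continuous_on_tendsto_compose[OF continuous_on_product_coordinates[of B] this]
  show ?thesis by simp
 qed
 ultimately show ?thesis by (rule that)
qed

lemma layer_sum_bounds:
 fixes y :: real and N :: nat
 assumes y: "0 <= y" "y <= 1" and N: "0 < N"
 shows "(\<Sum>i=1..N. if real i / N <= y then 1 else 0) / N <= y"
  "y <= (\<Sum>i=1..N. if real i / N <= y then 1 else 0) / N + 1 / N"
proof -
 have fl: "nat \<lfloor>N * y\<rfloor> <= N"   proof -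
  have "real N * y <= real N" using y N by (simp add: mult_left_le)
  then show ?thesis by (simp add: nat_le_iff floor_le_iff)
 qed
 have "{i\<in>{1..N}. real i / N <= y} = {1..nat \<lfloor>N * y\<rfloor>}"
 proof -
  have "real i / N <= y \<longleftrightarrow> i <= nat \<lfloor>N * y\<rfloor>" for i
   using y N by (simp add: le_nat_iff le_floor_iff divide_le_eq mult.commute)
  then show ?thesis using fl by (intro set_eqI) (metis (no_types, lifting) atLeastAtMost_iff mem_Collect_eq order_trans)
 qed
 then have *: "(\<Sum>i=1..N. if real i / N <= y then 1 else (0::real)) = real (nat \<lfloor>N * y\<rfloor>)"
  by (simp add: sum.If_cases Int_def Collect_conj_eq[symmetric])
 have n: "0 <= N * y" using y by simp
 have "real (nat \<lfloor>N * y\<rfloor>) = of_int \<lfloor>N * y\<rfloor>" using n by simp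
 then have b: "real (nat \<lfloor>N * y\<rfloor>) <= N * y" "N * y <= real (nat \<lfloor>N * y\<rfloor>) + 1" by linarith+
 have "real (nat \<lfloor>N * y\<rfloor>) / N <= y" using b(1) N by (simp add: divide_le_eq mult.commute)
 then show "(\<Sum>i=1..N. if real i / N <= y then 1 else 0) / N <= y" unfolding * .
 have "y * N <= real (nat \<lfloor>N * y\<rfloor>) + 1" using b(2) by (simp add: mult.commute)
 then have "y <= (real (nat \<lfloor>N * y\<rfloor>) + 1) / N" using N by (simp add: le_divide_eq)
 then show "y <= (\<Sum>i=1..N. if real i / N <= y then 1 else 0) / N + 1 / N"
  unfolding * by (simp add: add_divide_distrib)
qed

text \<open>
 The layer-cake formula with N layers: the superlevel sets of a continuous function are closed, so
 control of measures of closed sets becomes control of integrals.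
\<close>

lemma layer_integral_bounds:
 fixes g :: "'x => real" and N :: nat
 assumes P: "prob_space P" and sP: "sets P = sets (borel_of X)"
  and g: "continuous_map X euclidean g" "!!x. x \<in> topspace X ==> 0 <= g x \<and> g x <= 1" and N: "0 < N"
 defines "S \<equiv> (\<Sum>i=1..N. measure P {x \<in> topspace X. real i / N <= g x}) / N"
 shows "S <= (\<integral>x. g x \<partial>P)" "(\<integral>x. g x \<partial>P) <= S + 1 / N"
proof -
 interpret prob_space P by fact
 have sp: "space P = topspace X" using sets_eq_imp_space_eq[OF sP] by simp
 have mg: "g \<in> borel_measurable P"
  using continuous_map_borel_measurable[OF g(1)] unfolding measurable_cong_sets[OF sP refl] .
 define K where "K i = {x \<in> topspace X. real i / N <= g x}" for i
 have K: "K i \<in> sets P" for i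
 proof -
  have "K i = g -` {real i / N..} \<inter> space P" unfolding K_def sp by auto
  then show ?thesis using mg by (simp add: measurable_sets)
 qed
 define s where "s x = (\<Sum>i=1..N. indicator (K i) x) / real N" for x
 have sx: "s x = (\<Sum>i=1..N. if real i / N <= g x then 1 else 0) / N" if "x \<in> topspace X" for x
  unfolding s_def K_def using that by (intro arg_cong2[where f = "(/)"] sum.cong) (auto simp: indicator_def)
 have intS: "integrable P s" unfolding s_def 
  by (intro integrable_divide Bochner_Integration.integrable_sum integrable_real_indicator K)
   (simp add: emeasure_eq_measure)
 have ig: "integrable P g"
  by (rule integrable_const_bound[where B = 1]) (use mg g(2) sp in \<open>auto intro!: AE_I2\<close>)
 have int_s: "(\<integral>x. s x \<partial>P) = S" unfolding s_def S_def K_def[symmetric] using K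
  by (subst integral_divide_zero, subst Bochner_Integration.integral_sum)
   (auto intro!: integrable_real_indicator K simp: emeasure_eq_measure)
 show "S <= (\<integral>x. g x \<partial>P)" unfolding int_s[symmetric]
  by (rule integral_mono[OF intS ig]) (use layer_sum_bounds(1)[OF _ _ N] g(2) sp sx in simp)
 have "(\<integral>x. g x \<partial>P) <= (\<integral>x. s x + 1 / N \<partial>P)"
 proof (rule integral_mono[OF ig])
  show "g x <= s x + 1 / N" if "x \<in> space P" for x
   using that layer_sum_bounds(2)[OF _ _ N, of "g x"] g(2) sp sx by simp
 qed (use intS in simp)
 then show "(\<integral>x. g x \<partial>P) <= S + 1 / N" using intS by (simp add: int_s prob_space)
qed

text \<open>
 A setwise cluster point of the measures is only finitely additive, but its values on closed sets
 form a content. The measure induced by the content dominates it on closed sets and has total mass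
 one. The layers of g therefore bound the limit of the integrals of g by the integral of g for the
 induced measure, and the same bound for \<open>- g\<close> gives equality. A filter replaces a subsequence, since
 the cluster point comes from the compactness of an uncountable product.
\<close>

theorem weak_limit_of_probabilities:
 fixes X :: "'x topology" and m :: "nat => 'x measure"
 assumes X: "compact_space X" "normal_space X"
  and m: "!!n. prob_space (m n)" "!!n. sets (m n) = sets (borel_of X)"
 shows "\<exists>(F :: nat filter) \<nu>. F ~= bot \<and> F <= sequentially \<and> prob_space \<nu> \<and> sets \<nu> = sets (borel_of X) \<and>
  (\<forall>g :: 'x => real. continuous_map X euclidean g --> ((\<lambda>n. \<integral>x. g x \<partial>m n) \<longlongrightarrow> (\<integral>x. g x \<partial>\<nu>)) F) \<and>
  (\<forall>h B. homeomorphic_map X X h -->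
    (\<forall>K. closedin X K --> (\<lambda>n. measure (m n) (h ` K) - measure (m n) K) \<longlonglongrightarrow> 0) -->
    B \<in> sets (borel_of X) --> h ` B \<in> sets (borel_of X) --> emeasure \<nu> (h ` B) = emeasure \<nu> B)"
proof -
 have M01: "measure (m n) B \<in> {0..1}" for n B using prob_space.prob_le_1[OF m(1)] by auto
 obtain F lam where F: "F ~= bot" "F <= sequentially" and lim: "!!B. ((\<lambda>n. measure (m n) B) \<longlongrightarrow> lam B) F"
  using setwise_cluster_filter[of "\<lambda>n. measure (m n)", OF M01] by metis
 have sp: "space (m n) = topspace X" for n using sets_eq_imp_space_eq[OF m(2)] by simp
 have cl: "K \<in> sets (m n)" if "closedin X K" for K n using that m(2) borel_of_closed by blast
 have fm: "finite_measure (m n)" for n using m(1) unfolding prob_space_def by simp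
 interpret closed_content X lam
 proof
  show "0 <= lam K" for K using tendsto_lowerbound[OF lim _ F(1)] by simp
  show "lam {} = 0" using tendsto_unique[OF F(1) lim, of "{}" 0] by simp
  show "lam K <= lam L" if "closedin X K" "closedin X L" "K \<subseteq> L" for K L
   by (rule tendsto_le[OF F(1) lim lim]) (use that cl finite_measure.finite_measure_mono[OF fm] in auto)
  show "lam (K \<union> L) <= lam K + lam L" if "closedin X K" "closedin X L" for K L
  proof (rule tendsto_le[OF F(1) tendsto_add[OF lim lim] lim])
   have "measure (m n) (K \<union> L) <= measure (m n) K + measure (m n) L" for n
    using finite_measure.finite_measure_Union[OF fm, of K n "L - K"]
     finite_measure.finite_measure_mono[OF fm, of "L - K" L n] that cl by (simp add: sets.Diff Un_Diff_cancel)
   then show "eventually (\<lambda>n. measure (m n) (K \<union> L) <= measure (m n) K + measure (m n) L) F" by simp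
  qed
  show "lam (K \<union> L) = lam K + lam L" if "closedin X K" "closedin X L" "K \<inter> L = {}" for K L
  proof (rule tendsto_unique[OF F(1) lim])
   have "measure (m n) (K \<union> L) = measure (m n) K + measure (m n) L" for n
    using that cl by (intro finite_measure.finite_measure_Union[OF fm]) auto
   then show "((\<lambda>n. measure (m n) (K \<union> L)) \<longlongrightarrow> lam K + lam L) F" by (simp add: tendsto_add lim)
  qed
 qed (rule X)+
 let ?nu = "induced_measure"
 have lam1: "lam (topspace X) = 1"
  using tendsto_unique[OF F(1) lim, of "topspace X" 1] prob_space.prob_space[OF m(1)] sp by simp
 have nu: "prob_space ?nu" by (rule prob_spaceI) (simp add: emeasure_induced_space lam1)
 then have fnu: "finite_measure ?nu" unfolding prob_space_def by simp
 have nu_closed: "lam K <= measure ?nu K" if "closedin X K" for K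
  using emeasure_induced_closed[OF that] nonneg[of K]
  by (simp add: finite_measure.emeasure_eq_measure[OF fnu])
 have upper: "eventually (\<lambda>n. (\<integral>x. g x \<partial>m n) < (\<integral>x. g x \<partial>?nu) + e) F"
  if g: "continuous_map X euclidean g" "!!x. x \<in> topspace X ==> 0 <= g x \<and> g x <= 1" and e: "0 < e"
  for g :: "'x => real" and e
 proof -
  obtain N :: nat where N: "0 < N" "1 / real N < e" using e
   by (metis gr_zeroI inverse_eq_divide of_nat_0_less_iff reals_Archimedean zero_less_Suc)
  define K where "K i = {x \<in> topspace X. real i / N <= g x}" for i
  have K: "closedin X (K i)" for i
  proof -
   have "K i = {x \<in> topspace X. g x \<in> {real i / N..}}" unfolding K_def by auto
   then show ?thesis using closedin_continuous_map_preimage[OF g(1), of "{real i / N..}"] by simp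
  qed
  have "((\<lambda>n. (\<Sum>i=1..N. measure (m n) (K i)) / N) \<longlongrightarrow> (\<Sum>i=1..N. lam (K i)) / N) F"
   using N by (intro tendsto_intros lim) auto
  moreover have "(\<Sum>i=1..N. lam (K i)) / N < (\<integral>x. g x \<partial>?nu) + (e - 1 / N)"
  proof -
   have "(\<Sum>i=1..N. lam (K i)) / N <= (\<Sum>i=1..N. measure ?nu (K i)) / N"
    using K nu_closed by (intro divide_right_mono sum_mono) auto
   also have "... <= (\<integral>x. g x \<partial>?nu)"
    using layer_integral_bounds(1)[OF nu sets_induced_measure g N(1)] unfolding K_def .
   finally show ?thesis using N by simp
  qed
  ultimately have "eventually (\<lambda>n. (\<Sum>i=1..N. measure (m n) (K i)) / N < (\<integral>x. g x \<partial>?nu) + (e - 1 / N)) F"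
   by (rule order_tendstoD(2))
  then show ?thesis
  proof (rule eventually_mono)
   fix n assume "(\<Sum>i=1..N. measure (m n) (K i)) / N < (\<integral>x. g x \<partial>?nu) + (e - 1 / N)"
   then show "(\<integral>x. g x \<partial>m n) < (\<integral>x. g x \<partial>?nu) + e"
    using layer_integral_bounds(2)[OF m g N(1), of n] unfolding K_def by simp
  qed
 qed
 have int: "integrable P g" if P: "prob_space P" "sets P = sets (borel_of X)"
   and g: "continuous_map X euclidean g" "!!x. x \<in> topspace X ==> \<bar>g x\<bar> <= B" for P and g :: "'x => real" and B
 proof -
  have sP: "space P = topspace X" using sets_eq_imp_space_eq[OF P(2)] by simp
  have mg: "g \<in> borel_measurable P"
   using continuous_map_borel_measurable[OF g(1)] unfolding measurable_cong_sets[OF P(2) refl] .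
  have "finite_measure P" using P(1) unfolding prob_space_def by simp
  then show ?thesis
   by (rule finite_measure.integrable_const_bound[where B = B]) (use mg g(2) sP in \<open>auto intro!: AE_I2\<close>)
 qed
 have conv: "((\<lambda>n. \<integral>x. g x \<partial>m n) \<longlongrightarrow> (\<integral>x. g x \<partial>?nu)) F" if g: "continuous_map X euclidean g" for g :: "'x => real"
 proof -
  have "compactin euclidean (g ` topspace X)" using image_compactin[OF _ g] X(1) unfolding compact_space_def by blast
  then obtain B where B: "B > 0" "!!x. x \<in> topspace X ==> \<bar>g x\<bar> <= B"
   using compact_imp_bounded bounded_pos by (metis compactin_euclidean_iff imageI real_norm_def)
  have *: "eventually (\<lambda>n. (\<integral>x. f x \<partial>m n) < (\<integral>x. f x \<partial>?nu) + e) F"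
   if f: "continuous_map X euclidean f" "!!x. x \<in> topspace X ==> \<bar>f x\<bar> <= B" and e: "e > 0" for f :: "'x => real" and e
  proof -
   define f' where "f' x = (f x + B) / (2 * B)" for x
   have f': "continuous_map X euclidean f'" unfolding f'_def
    using f(1) B(1) by (intro continuous_intros) auto
   have b: "0 <= f' x \<and> f' x <= 1" if "x \<in> topspace X" for x
    using f(2)[OF that] B(1) unfolding f'_def by (auto simp: field_simps abs_le_iff)
   have i: "(\<integral>x. f' x \<partial>P) = ((\<integral>x. f x \<partial>P) + B) / (2 * B)"
    if P: "prob_space P" "sets P = sets (borel_of X)" for P
   proof -
    interpret P: prob_space P by (rule P(1))
    show ?thesis unfolding f'_def using int[OF P f] P.prob_space by simp
   qed
   have "eventually (\<lambda>n. (\<integral>x. f' x \<partial>m n) < (\<integral>x. f' x \<partial>?nu) + e / (2 * B)) F"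
    using B(1) e by (intro upper f' b) auto
   then show ?thesis
    unfolding i[OF m] i[OF nu sets_induced_measure]
    by (rule eventually_mono) (use B(1) in \<open>simp add: add_divide_distrib[symmetric] divide_less_cancel\<close>)
  qed
  show ?thesis
  proof (rule tendstoI)
   fix e :: real assume e: "e > 0"
   have a: "eventually (\<lambda>n. (\<integral>x. g x \<partial>m n) < (\<integral>x. g x \<partial>?nu) + e) F" using * g B(2) e by blast
   have "eventually (\<lambda>n. (\<integral>x. - g x \<partial>m n) < (\<integral>x. - g x \<partial>?nu) + e) F"
    using g B(2) e by (intro *) (auto intro: continuous_map_minus)
   with a show "eventually (\<lambda>n. dist (\<integral>x. g x \<partial>m n) (\<integral>x. g x \<partial>?nu) < e) F"
    by eventually_elim (simp add: dist_real_def abs_less_iff)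
  qed
 qed
 have homeo: "emeasure ?nu (h ` B) = emeasure ?nu B"
  if h: "homeomorphic_map X X h" "!!K. closedin X K ==> (\<lambda>n. measure (m n) (h ` K) - measure (m n) K) \<longlonglongrightarrow> 0"
   and B: "B \<in> sets (borel_of X)" "h ` B \<in> sets (borel_of X)" for h B
 proof (rule emeasure_induced_homeo[OF h(1) _ B])
  fix K assume K: "closedin X K"
  have "((\<lambda>n. measure (m n) (h ` K) - measure (m n) K) \<longlongrightarrow> 0) F"
   using h(2)[OF K] F(2) by (rule filterlim_mono[OF _ order_refl])
  moreover have "((\<lambda>n. measure (m n) (h ` K) - measure (m n) K) \<longlongrightarrow> lam (h ` K) - lam K) F"
   by (intro tendsto_diff lim)
  ultimately have "lam (h ` K) - lam K = 0" using tendsto_unique[OF F(1)] by blast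
  then show "lam (h ` K) = lam K" by simp
 qed
 show ?thesis
  by (intro exI[of _ F] exI[of _ ?nu] conjI allI impI F nu sets_induced_measure conv homeo) blast+
qed

section \<open>Smooth bump functions and mollification\<close>

text \<open>The functions P(1/t) exp(-1/t) on the positive half-line, extended by zero, are closed under differentiation.\<close>

definition flat :: "real poly => real => real" where
 "flat P t = (if 0 < t then poly P (inverse t) * exp (- inverse t) else 0)"

lemma poly_times_exp_minus_tendsto_0: "((\<lambda>x. x ^ k * poly P x * exp (- x)) \<longlongrightarrow> (0::real)) at_top"
proof (induction P arbitrary: k)
 case 0 then show ?case by simp
next
 case (pCons a P)
 have "((\<lambda>x. a * (x ^ k / exp x) + x ^ Suc k * poly P x * exp (- x)) \<longlongrightarrow> a * 0 + 0) at_top"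
  by (intro tendsto_add tendsto_mult tendsto_const tendsto_power_div_exp_0 pCons.IH)
 then show ?case by (simp add: algebra_simps exp_minus field_simps)
qed

lemma flat_has_derivative: "(flat P has_real_derivative flat ([:0, 0, 1:] * (P - pderiv P)) t) (at t)"
proof -
 consider "t > 0" | "t < 0" | "t = 0" by linarith
 then show ?thesis
 proof cases
  case 1
  have "((\<lambda>t. poly P (inverse t) * exp (- inverse t)) has_real_derivative
    flat ([:0, 0, 1:] * (P - pderiv P)) t) (at t)"
   using 1 by (auto intro!: derivative_eq_intros poly_DERIV[THEN DERIV_chain2]
     simp: flat_def algebra_simps power2_eq_square)
  moreover have "eventually (\<lambda>s. s > 0) (nhds t)" using 1 by (simp add: eventually_nhds_in_open[of "{0<..}", simplified])
  then have "eventually (\<lambda>s. flat P s = poly P (inverse s) * exp (- inverse s)) (nhds t)"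
   by (rule eventually_mono) (simp add: flat_def)
  ultimately show ?thesis by (subst DERIV_cong_ev[OF refl _ refl])
 next
  case 2
  have "eventually (\<lambda>s. s < 0) (nhds t)" using 2 by (simp add: eventually_nhds_in_open[of "{..<0}", simplified])
  then have "eventually (\<lambda>s. flat P s = 0) (nhds t)"
   by (rule eventually_mono) (simp add: flat_def)
  then have "(flat P has_real_derivative 0) (at t)" by (subst DERIV_cong_ev[OF refl _ refl]) auto
  then show ?thesis using 2 by (simp add: flat_def)
 next
  case 3
  have "((\<lambda>h. flat P h / h) \<longlongrightarrow> 0) (at 0)"
  proof (rule filterlim_split_at)
   have "eventually (\<lambda>h. flat P h / h = 0) (at_left (0::real))"
    by (auto simp: eventually_at_filter flat_def intro: always_eventually)
   then show "((\<lambda>h. flat P h / h) \<longlongrightarrow> 0) (at_left 0)" by (rule tendsto_eventually)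
   have "((\<lambda>x. (inverse x) ^ 1 * poly P (inverse x) * exp (- inverse x)) \<longlongrightarrow> 0) (at_right 0)"
    by (rule filterlim_compose[OF poly_times_exp_minus_tendsto_0 filterlim_inverse_at_top_right])
   moreover have "eventually (\<lambda>h. (inverse h) ^ 1 * poly P (inverse h) * exp (- inverse h) = flat P h / h) (at_right (0::real))"
    by (auto simp: eventually_at_filter flat_def field_simps intro: always_eventually)
   ultimately show "((\<lambda>h. flat P h / h) \<longlongrightarrow> 0) (at_right 0)" by (rule Lim_transform_eventually)
  qed
  then show ?thesis using 3 by (simp add: has_field_derivative_iff flat_def)
 qed
qed

text \<open>
 The functions \<open>flat P (1 + t) * flat Q (1 - t)\<close> vanish to infinite order at \<open>-1\<close> and 1. Their span is
 closed under differentiation, which provides all derivatives at once.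
\<close>

inductive bump :: "(real => real) => bool" where
 bump_flat: "bump (\<lambda>t. flat P (1 + t) * flat Q (1 - t))"
| bump_add: "bump f ==> bump g ==> bump (\<lambda>t. f t + g t)"
| bump_scale: "bump f ==> bump (\<lambda>t. c * f t)"

lemma bump_derivative: "bump f ==> \<exists>f'. bump f' \<and> (\<forall>t. (f has_real_derivative f' t) (at t))"
proof (induction rule: bump.induct)
 case (bump_flat P Q)
 let ?D = "\<lambda>P. [:0, 0, 1:] * (P - pderiv P)"
 let ?f' = "\<lambda>t. flat (?D P) (1 + t) * flat Q (1 - t) + (- 1) * (flat P (1 + t) * flat (?D Q) (1 - t))"
 have "bump ?f'" by (intro bump.intros)
 moreover have "((\<lambda>t. flat P (1 + t) * flat Q (1 - t)) has_real_derivative ?f' t) (at t)" for t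
  by (auto intro!: derivative_eq_intros flat_has_derivative[THEN DERIV_chain2] simp: algebra_simps)
 ultimately show ?case by blast
next
 case (bump_add f g)
 then obtain f' g' where "bump f'" "bump g'" "\<forall>t. (f has_real_derivative f' t) (at t)" "\<forall>t. (g has_real_derivative g' t) (at t)"
  by metis
 then show ?case by (intro exI[of _ "\<lambda>t. f' t + g' t"]) (auto intro: bump.intros derivative_intros)
next
 case (bump_scale f c)
 then obtain f' where "bump f'" "\<forall>t. (f has_real_derivative f' t) (at t)" by metis
 then show ?case by (intro exI[of _ "\<lambda>t. c * f' t"]) (auto intro!: bump.intros DERIV_cmult)
qed

lemma bump_deriv: "bump f ==> bump (deriv f)"
 and bump_DERIV: "bump f ==> (f has_real_derivative deriv f t) (at t)"
proof -
 assume "bump f"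
 then obtain f' where f': "bump f'" "!!t. (f has_real_derivative f' t) (at t)" using bump_derivative by blast
 then have "deriv f = f'" using DERIV_imp_deriv by blast
 then show "bump (deriv f)" "(f has_real_derivative deriv f t) (at t)" using f' by auto
qed

lemma bump_outside: "bump f ==> 1 <= \<bar>t\<bar> ==> f t = 0"
 by (induction rule: bump.induct) (auto simp: flat_def abs_if split: if_splits)

lemma bump_continuous: "bump f ==> continuous_on A f"
 using bump_DERIV by (meson DERIV_continuous_on has_field_derivative_at_within)

text \<open>
 A family of one-dimensional bumps, one per coordinate, so that a partial derivative of the product
 is again a product of the same kind.
\<close>

definition bump_prod :: "('n::finite => real => real) => real ^ 'n => real" where
 "bump_prod \<phi> u = (\<Prod>i\<in>UNIV. \<phi> i (u $ i))"

definition bumps :: "('n::finite => real => real) => bool" where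
 "bumps \<phi> \<longleftrightarrow> (\<forall>i. bump (\<phi> i))"

definition bump_d :: "'n => ('n::finite => real => real) => 'n => real => real" where
 "bump_d j \<phi> = \<phi>(j := deriv (\<phi> j))"

lemma bumps_d: "bumps \<phi> ==> bumps (bump_d j \<phi>)"
 unfolding bumps_def bump_d_def by (simp add: bump_deriv)

lemma bump_d_commute: "bump_d j (bump_d k \<phi>) = bump_d k (bump_d j \<phi>)"
 unfolding bump_d_def by (auto simp: fun_upd_twist)

lemma bump_prod_outside: "bumps \<phi> ==> u \<notin> cbox (- 1) 1 ==> bump_prod \<phi> u = 0"
proof -
 assume b: "bumps \<phi>" and u: "u \<notin> cbox (- 1) 1"
 then obtain i where "\<not> (- 1 <= u $ i \<and> u $ i <= 1)" unfolding mem_box_cart by auto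
 then have "1 <= \<bar>u $ i\<bar>" by auto
 then have "\<phi> i (u $ i) = 0" using b bump_outside unfolding bumps_def by blast
 then show ?thesis unfolding bump_prod_def by (meson UNIV_I finite prod_zero)
qed

lemma continuous_bump_prod [continuous_intros]:
 assumes "bumps \<phi>" "continuous_on A f" shows "continuous_on A (\<lambda>x. bump_prod \<phi> (f x))"
 unfolding bump_prod_def
proof (rule continuous_on_prod)
 fix i
 have "continuous_on A (\<lambda>x. f x $ i)" using assms(2) by (intro continuous_intros)
 then show "continuous_on A (\<lambda>x. \<phi> i (f x $ i))"
  using continuous_on_compose2[OF bump_continuous[of "\<phi> i" UNIV]] assms(1) unfolding bumps_def by blast
qed

lemma bump_prod_has_derivative:
 assumes "bumps \<phi>"
 shows "(bump_prod \<phi> has_derivative (\<lambda>h. \<Sum>j\<in>UNIV. h $ j * bump_prod (bump_d j \<phi>) u)) (at u)"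
proof -
 have 1: "((\<lambda>u. \<phi> i (u $ i)) has_derivative (\<lambda>h. deriv (\<phi> i) (u $ i) * h $ i)) (at u)" for i
 proof -
  have "(\<phi> i has_derivative (\<lambda>h. deriv (\<phi> i) (u $ i) * h)) (at (u $ i))"
   using bump_DERIV assms unfolding bumps_def has_field_derivative_def by blast
  moreover have "((\<lambda>u. u $ i) has_derivative (\<lambda>h. h $ i)) (at u)"
   by (rule bounded_linear_imp_has_derivative) (rule bounded_linear_vec_nth)
  ultimately show ?thesis using has_derivative_compose by fastforce
 qed
 have "(bump_prod \<phi> has_derivative (\<lambda>h. \<Sum>i\<in>UNIV. deriv (\<phi> i) (u $ i) * h $ i * (\<Prod>j\<in>UNIV - {i}. \<phi> j (u $ j)))) (at u)"
  unfolding bump_prod_def[abs_def] by (rule has_derivative_prod) (rule 1)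
 moreover have "deriv (\<phi> i) (u $ i) * h $ i * (\<Prod>j\<in>UNIV - {i}. \<phi> j (u $ j)) = h $ i * bump_prod (bump_d i \<phi>) u" for i h
 proof -
  have "bump_prod (bump_d i \<phi>) u = bump_d i \<phi> i (u $ i) * (\<Prod>j\<in>UNIV - {i}. bump_d i \<phi> j (u $ j))"
   unfolding bump_prod_def by (simp add: prod.remove)
  also have "... = deriv (\<phi> i) (u $ i) * (\<Prod>j\<in>UNIV - {i}. \<phi> j (u $ j))"
   unfolding bump_d_def by (auto intro: prod.cong)
  finally show ?thesis by simp
 qed
 ultimately show ?thesis by simp
qed

text \<open>Convolution with a rescaled bump; the function is precomposed with the dilation by r.\<close>

definition moll :: "('n::finite => real => real) => real => (real ^ 'n => real) => real ^ 'n => real" where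
 "moll \<phi> r g x = integral UNIV (\<lambda>u. bump_prod \<phi> (u - (1 / r) *\<^sub>R x) * g u)"

lemma moll_eq_cbox:
 assumes "bumps \<phi>" "!!u. u - (1 / r) *\<^sub>R x \<in> cbox (- 1) 1 ==> u \<in> cbox a b"
 shows "moll \<phi> r g x = integral (cbox a b) (\<lambda>u. bump_prod \<phi> (u - (1 / r) *\<^sub>R x) * g u)"
 unfolding moll_def using bump_prod_outside[OF assms(1)] assms(2)
 by (intro integral_UNIV_eq_cbox) auto

text \<open>The differentiation falls on the bump, and g itself is merely continuous.\<close>

lemma moll_has_derivative:
 fixes \<phi> :: "'n::finite => real => real"
 assumes \<phi>: "bumps \<phi>" and g: "continuous_on UNIV g"
 shows "(moll \<phi> r g has_derivative (\<lambda>h. \<Sum>j\<in>UNIV. h $ j * (- (1 / r) * moll (bump_d j \<phi>) r g x))) (at x)"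
proof -
 let ?U = "ball x 1"
 have "bounded ((\<lambda>(u, y). u + (1 / r) *\<^sub>R y) ` (cbox (- 1) 1 \<times> cball x 1) :: (real ^ 'n) set)"
  by (intro compact_imp_bounded compact_continuous_image compact_Times compact_cbox compact_cball)
   (auto simp: case_prod_beta intro!: continuous_intros)
 then obtain a where a: "(\<lambda>(u, y). u + (1 / r) *\<^sub>R y) ` (cbox (- 1) 1 \<times> cball x 1) \<subseteq> cbox (- a) a"
  using bounded_subset_cbox_symmetric by blast
 have mem: "u \<in> cbox (- a) a" if "u - (1 / r) *\<^sub>R y \<in> cbox (- 1) 1" "y \<in> ?U" for u y
 proof -
  have "(\<lambda>(u, y). u + (1 / r) *\<^sub>R y) (u - (1 / r) *\<^sub>R y, y) \<in> cbox (- a) a"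
   using that by (intro subsetD[OF a] imageI) auto
  then show ?thesis by simp
 qed
 have g': "continuous_on A g" for A using g continuous_on_subset by blast
 have gs: "continuous_on A (\<lambda>p. g (snd p))" for A :: "((real ^ 'n) \<times> (real ^ 'n)) set"
  by (rule continuous_on_compose2[OF g]) (auto intro: continuous_intros)
 define c where "c j y u = - (1 / r) * bump_prod (bump_d j \<phi>) (u - (1 / r) *\<^sub>R y) * g u" for j y u
 define fx where "fx y u = (\<Sum>j\<in>UNIV. c j y u *\<^sub>R blinfun_inner_right (axis j 1 :: real ^ 'n))" for y u
 have app: "blinfun_apply (fx y u) h = (\<Sum>j\<in>UNIV. c j y u * h $ j)" for y u h
  unfolding fx_def blinfun.sum_left blinfun.scaleR_left
  by (simp add: inner_axis' )
 have d: "((\<lambda>y. integral (cbox (- a) a) (\<lambda>u. bump_prod \<phi> (u - (1 / r) *\<^sub>R y) * g u)) has_derivative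
   integral (cbox (- a) a) (fx x)) (at x within ?U)"
 proof (rule leibniz_rule)
  show "((\<lambda>y. bump_prod \<phi> (u - (1 / r) *\<^sub>R y) * g u) has_derivative blinfun_apply (fx y u)) (at y within ?U)" for y u
  proof -
   have "((\<lambda>y. u - (1 / r) *\<^sub>R y) has_derivative (\<lambda>h. - ((1 / r) *\<^sub>R h))) (at y within ?U)"
    by (auto intro!: derivative_eq_intros)
   from has_derivative_compose[OF this bump_prod_has_derivative[OF \<phi>]]
   have "((\<lambda>y. bump_prod \<phi> (u - (1 / r) *\<^sub>R y)) has_derivative
     (\<lambda>h. \<Sum>j\<in>UNIV. (- ((1 / r) *\<^sub>R h)) $ j * bump_prod (bump_d j \<phi>) (u - (1 / r) *\<^sub>R y))) (at y within ?U)" .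
   from has_derivative_mult_left[OF this, of "g u"] show ?thesis
    unfolding app c_def by (simp add: sum_distrib_left sum_distrib_right sum_divide_distrib sum_negf algebra_simps)
  qed
  show "(\<lambda>u. bump_prod \<phi> (u - (1 / r) *\<^sub>R y) * g u) integrable_on cbox (- a) a" for y
   by (intro integrable_continuous continuous_intros \<phi> g')
  show "continuous_on (?U \<times> cbox (- a) a) (\<lambda>(y, u). fx y u)"
   unfolding fx_def c_def case_prod_beta by (intro continuous_intros bumps_d \<phi> gs)
 qed auto
 have ci: "c j x integrable_on cbox (- a) a" for j
  unfolding c_def by (intro integrable_continuous continuous_intros bumps_d \<phi> g')
 have fi: "fx x integrable_on cbox (- a) a"
  unfolding fx_def c_def by (intro integrable_continuous continuous_intros bumps_d \<phi> g')
 have "blinfun_apply (integral (cbox (- a) a) (fx x)) h =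
   (\<Sum>j\<in>UNIV. h $ j * (- (1 / r) * moll (bump_d j \<phi>) r g x))" for h
 proof -
  have m: "moll (bump_d j \<phi>) r g x = integral (cbox (- a) a) (\<lambda>u. bump_prod (bump_d j \<phi>) (u - (1 / r) *\<^sub>R x) * g u)" for j
   by (rule moll_eq_cbox[OF bumps_d[OF \<phi>]]) (use mem in auto)
  have "blinfun_apply (integral (cbox (- a) a) (fx x)) h = integral (cbox (- a) a) (\<lambda>u. \<Sum>j\<in>UNIV. c j x u * h $ j)"
   unfolding blinfun_apply_integral[OF fi] app ..
  also have "... = (\<Sum>j\<in>UNIV. integral (cbox (- a) a) (\<lambda>u. c j x u * h $ j))"
   using ci by (intro integral_sum) (auto intro: integrable_on_mult_left)
  also have "... = (\<Sum>j\<in>UNIV. h $ j * (- (1 / r) * moll (bump_d j \<phi>) r g x))"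
  proof (rule sum.cong)
   fix j
   have "(\<lambda>u. c j x u * h $ j) = (\<lambda>u. (h $ j * - (1 / r)) * (bump_prod (bump_d j \<phi>) (u - (1 / r) *\<^sub>R x) * g u))"
    unfolding c_def by (simp add: fun_eq_iff)
   then show "integral (cbox (- a) a) (\<lambda>u. c j x u * h $ j) = h $ j * (- (1 / r) * moll (bump_d j \<phi>) r g x)"
    unfolding m by (simp only: integral_mult_right mult.assoc)
  qed simp
  finally show ?thesis .
 qed
 then have "blinfun_apply (integral (cbox (- a) a) (fx x)) = (\<lambda>h. \<Sum>j\<in>UNIV. h $ j * (- (1 / r) * moll (bump_d j \<phi>) r g x))"
  by (rule ext)
 from d[unfolded this] have "((\<lambda>y. integral (cbox (- a) a) (\<lambda>u. bump_prod \<phi> (u - (1 / r) *\<^sub>R y) * g u)) has_derivative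
   (\<lambda>h. \<Sum>j\<in>UNIV. h $ j * (- (1 / r) * moll (bump_d j \<phi>) r g x))) (at x)"
  by (simp only: at_within_open[of x ?U] centre_in_ball open_ball zero_less_one)
 then show ?thesis
 proof (rule has_derivative_transform_within_open[where s = ?U])
  show "integral (cbox (- a) a) (\<lambda>u. bump_prod \<phi> (u - (1 / r) *\<^sub>R y) * g u) = moll \<phi> r g y" if "y \<in> ?U" for y
   by (rule moll_eq_cbox[OF \<phi>, symmetric]) (use mem that in auto)
 qed auto
qed

lemma partial_deriv_of_has_derivative:
 assumes "(f has_derivative (\<lambda>h. \<Sum>j\<in>UNIV. h $ j * c j)) (at x)"
 shows "partial_deriv k f x = c k"
proof -
 have l: "((\<lambda>t. x + t *\<^sub>R axis k 1) has_derivative (\<lambda>t. t *\<^sub>R axis k 1)) (at (0::real))"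
  by (auto intro!: derivative_eq_intros)
 have d: "((\<lambda>t. f (x + t *\<^sub>R axis k 1)) has_derivative (\<lambda>t. \<Sum>j\<in>UNIV. (t *\<^sub>R axis k 1) $ j * c j)) (at (0::real))"
  using has_derivative_compose[OF l, of f "\<lambda>h. \<Sum>j\<in>UNIV. h $ j * c j"] assms by simp
 have s: "(\<Sum>j\<in>UNIV. (t *\<^sub>R axis k 1) $ j * c j) = t * c k" for t :: real
  by (subst sum.remove[of _ k]) (auto simp: axis_def intro!: sum.neutral)
 have "((\<lambda>t. f (x + t *\<^sub>R axis k 1)) has_real_derivative c k) (at 0)"
 proof -
  have eq: "(*) (c k) = (\<lambda>t. t * c k)" by (simp add: fun_eq_iff)
  show ?thesis using d unfolding has_field_derivative_def eq s .
 qed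
 then show ?thesis unfolding partial_deriv_def by (rule DERIV_imp_deriv)
qed

lemma cmult_moll_has_derivative:
 assumes "bumps \<phi>" "continuous_on UNIV g"
 shows "((\<lambda>x. c * moll \<phi> r g x) has_derivative
  (\<lambda>h. \<Sum>j\<in>UNIV. h $ j * (- (c / r) * moll (bump_d j \<phi>) r g x))) (at x)"
 using has_derivative_mult_right[OF moll_has_derivative[OF assms], of c r x]
 by (simp add: sum_distrib_left algebra_simps)

lemma partial_deriv_moll:
 assumes "bumps \<phi>" "continuous_on UNIV g"
 shows "partial_deriv k (\<lambda>x. c * moll \<phi> r g x) = (\<lambda>x. - (c / r) * moll (bump_d k \<phi>) r g x)"
 using partial_deriv_of_has_derivative[OF cmult_moll_has_derivative[OF assms]] by blast

lemma iterated_partial_moll: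
 assumes "bumps \<phi>" "continuous_on UNIV g"
 shows "\<exists>c' \<phi>'. bumps \<phi>' \<and> (\<phi>' = \<phi> \<or> (\<exists>k \<phi>''. bumps \<phi>'' \<and> \<phi>' = bump_d k \<phi>'')) \<and>
  iterated_partial ks (\<lambda>x. c * moll \<phi> r g x) = (\<lambda>x. c' * moll \<phi>' r g x)"
proof (induction ks)
 case Nil then show ?case using assms by (auto simp: iterated_partial_def)
next
 case (Cons k ks)
 then obtain c' \<phi>' where c': "bumps \<phi>'" "iterated_partial ks (\<lambda>x. c * moll \<phi> r g x) = (\<lambda>x. c' * moll \<phi>' r g x)"
  by blast
 have "iterated_partial (k # ks) (\<lambda>x. c * moll \<phi> r g x) = (\<lambda>x. - (c' / r) * moll (bump_d k \<phi>') r g x)"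
  unfolding iterated_partial_def foldr.simps o_def using c'(2) partial_deriv_moll[OF c'(1) assms(2)]
  unfolding iterated_partial_def by simp
 then show ?case using c'(1) bumps_d by blast
qed

lemma smooth_fun_moll:
 assumes "bumps \<phi>" "continuous_on UNIV g"
 shows "smooth_fun (\<lambda>x. c * moll \<phi> r g x)"
 unfolding smooth_fun_def
proof (intro allI)
 fix ks x
 obtain c' \<phi>' where *: "bumps \<phi>'" "iterated_partial ks (\<lambda>x. c * moll \<phi> r g x) = (\<lambda>x. c' * moll \<phi>' r g x)"
  using iterated_partial_moll[OF assms] by blast
 show "iterated_partial ks (\<lambda>x. c * moll \<phi> r g x) differentiable (at x)"
  unfolding *(2) differentiable_def using cmult_moll_has_derivative[OF *(1) assms(2)] by blast
qed

lemma moll_shift: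
 assumes \<phi>: "bumps \<phi>"
 shows "moll \<phi> r g x = integral (cbox (- 1) 1) (\<lambda>u. bump_prod \<phi> u * g (u + (1 / r) *\<^sub>R x))"
proof -
 let ?f = "\<lambda>u. bump_prod \<phi> (u - (1 / r) *\<^sub>R x) * g u"
 have "bounded {u. ?f u ~= 0}"
 proof (rule bounded_subset)
  show "bounded ((\<lambda>u. (1 / r) *\<^sub>R x + u) ` cbox (- 1) 1)" by (intro bounded_translation bounded_cbox)
  show "{u. ?f u ~= 0} \<subseteq> (\<lambda>u. (1 / r) *\<^sub>R x + u) ` cbox (- 1) 1"
  proof
   fix u assume "u \<in> {u. ?f u ~= 0}"
   then have "u - (1 / r) *\<^sub>R x \<in> cbox (- 1) 1" using bump_prod_outside[OF \<phi>] by fastforce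
   then show "u \<in> (\<lambda>u. (1 / r) *\<^sub>R x + u) ` cbox (- 1) 1" by (rule rev_image_eqI) simp
  qed
 qed
 from integral_UNIV_shift[OF this, of "(1 / r) *\<^sub>R x"]
 have "moll \<phi> r g x = integral UNIV (\<lambda>u. bump_prod \<phi> u * g (u + (1 / r) *\<^sub>R x))"
  unfolding moll_def by simp
 also have "... = integral (cbox (- 1) 1) (\<lambda>u. bump_prod \<phi> u * g (u + (1 / r) *\<^sub>R x))"
  using bump_prod_outside[OF \<phi>] by (intro integral_UNIV_eq_cbox) auto
 finally show ?thesis .
qed

text \<open>The convolution of a bump with the constant 1 is constant, and its derivative is this integral.\<close>

lemma integral_bump_d_zero:
 assumes \<phi>: "bumps \<phi>" shows "integral (cbox (- 1) 1) (bump_prod (bump_d k \<phi>)) = 0"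
proof -
 have c: "moll \<psi> 1 (\<lambda>_. 1) x = integral (cbox (- 1) 1) (bump_prod \<psi>)" if "bumps \<psi>" for \<psi> :: "'a => _" and x
  using moll_shift[OF that, of 1 "\<lambda>_. 1" x] by simp
 have "(moll \<phi> 1 (\<lambda>_. 1) has_derivative (\<lambda>h. \<Sum>j\<in>UNIV. h $ j * 0)) (at 0)"
  unfolding c[OF \<phi>, abs_def] by simp
 then have "partial_deriv k (moll \<phi> 1 (\<lambda>_. 1)) 0 = 0" by (rule partial_deriv_of_has_derivative)
 moreover have "partial_deriv k (moll \<phi> 1 (\<lambda>_. 1)) 0 = - (1 / 1) * moll (bump_d k \<phi>) 1 (\<lambda>_. 1) 0"
  by (rule partial_deriv_of_has_derivative[OF moll_has_derivative[OF \<phi>]]) simp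
 ultimately show ?thesis using c[OF bumps_d[OF \<phi>]] by simp
qed

text \<open>Normalisation rescales a single factor of the product.\<close>

lemma bump_density_exists:
 obtains \<phi> :: "'n::finite => real => real" where "bumps \<phi>" "!!u. 0 <= bump_prod \<phi> u"
  "integral (cbox (- 1) 1) (bump_prod \<phi>) = 1"
proof -
 define f :: "real => real" where "f t = flat 1 (1 + t) * flat 1 (1 - t)" for t
 have f: "bump f" unfolding f_def by (rule bump_flat)
 have f0: "0 <= f t" "0 < f 0" for t unfolding f_def flat_def by auto
 define I where "I = integral (cbox (- 1) 1) (bump_prod (\<lambda>_::'n. f))"
 have b: "bumps (\<lambda>_::'n. f)" unfolding bumps_def using f by simp
 have "0 < I" unfolding I_def
 proof (rule integral_continuous_pos)
  show "continuous_on UNIV (bump_prod (\<lambda>_::'n. f))" using b by (intro continuous_bump_prod[of _ _ "\<lambda>x. x"]) auto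
  show "0 < bump_prod (\<lambda>_::'n. f) 0" unfolding bump_prod_def using f0(2) by (intro prod_pos) auto
 qed (use b bump_prod_outside f0 in \<open>auto simp: bump_prod_def intro: prod_nonneg\<close>)
 \<comment> \<open>Any fixed coordinate will do.\<close>
 define \<phi> where "\<phi> = (\<lambda>_::'n. f)(undefined := \<lambda>t. (1 / I) * f t)"
 have bp: "bump_prod \<phi> u = (1 / I) * bump_prod (\<lambda>_. f) u" for u
 proof -
  have "bump_prod \<phi> u = \<phi> undefined (u $ undefined) * (\<Prod>j\<in>UNIV - {undefined}. \<phi> j (u $ j))"
   unfolding bump_prod_def by (simp add: prod.remove)
  also have "(\<Prod>j\<in>UNIV - {undefined}. \<phi> j (u $ j)) = (\<Prod>j\<in>UNIV - {undefined}. f (u $ j))"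
   unfolding \<phi>_def by (intro prod.cong) auto
  also have "\<phi> undefined (u $ undefined) * ... = (1 / I) * (f (u $ undefined) * (\<Prod>j\<in>UNIV - {undefined}. f (u $ j)))"
   unfolding \<phi>_def by simp
  also have "f (u $ undefined) * (\<Prod>j\<in>UNIV - {undefined}. f (u $ j)) = bump_prod (\<lambda>_. f) u"
   unfolding bump_prod_def by (simp add: prod.remove)
  finally show ?thesis .
 qed
 show ?thesis
 proof (rule that)
  show "bumps \<phi>" unfolding bumps_def \<phi>_def using f bump_scale[OF f, of "1 / I"] by auto
  show "0 <= bump_prod \<phi> u" for u unfolding bp using \<open>0 < I\<close> f0(1) by (auto simp: bump_prod_def intro!: divide_nonneg_pos prod_nonneg)
  have "bump_prod \<phi> = (\<lambda>u. (1 / I) * bump_prod (\<lambda>_. f) u)" using bp by blast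
  then have "integral (cbox (- 1) 1) (bump_prod \<phi>) = (1 / I) * I" unfolding I_def by simp
  then show "integral (cbox (- 1) 1) (bump_prod \<phi>) = 1" using \<open>0 < I\<close> by simp
 qed
qed

section \<open>Weak cocycles and their smoothing\<close>

lemma weak_cocycle_continuous:
 assumes "tiling_space L dL \<Omega>" "weak_cocycle dL \<Omega> \<beta>" "T \<in> \<Omega>" "0 < e"
 shows "\<exists>\<delta>>0. \<forall>T'\<in>\<Omega>. \<forall>x'. config_dist dL T T' < \<delta> --> dist x x' < \<delta> --> dist (\<beta> T x) (\<beta> T' x') < e"
 using assms continuous_map_metric_times_euclidean_iff[OF tiling_space_Metric_space[OF assms(1)], of \<beta>]
 unfolding weak_cocycle_def config_topology_def by blast

lemma weak_cocycle_add:
 "weak_cocycle dL \<Omega> \<beta> ==> T \<in> \<Omega> ==> \<beta> T (x + y) = \<beta> T x + \<beta> (translate T x) y"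
 unfolding weak_cocycle_def by simp

lemma weak_cocycle_0: "weak_cocycle dL \<Omega> \<beta> ==> T \<in> \<Omega> ==> \<beta> T 0 = 0"
 using weak_cocycle_add[of dL \<Omega> \<beta> T 0 0] by simp

lemma weak_cocycle_translate:
 "weak_cocycle dL \<Omega> \<beta> ==> T \<in> \<Omega> ==> \<beta> (translate T x) y = \<beta> T (x + y) - \<beta> T x"
 using weak_cocycle_add[of dL \<Omega> \<beta> T x y] by simp

lemma weak_cocycle_continuous_on:
 assumes "tiling_space L dL \<Omega>" "weak_cocycle dL \<Omega> \<beta>" "T \<in> \<Omega>"
 shows "continuous_on A (\<beta> T)"
 unfolding continuous_on_iff
proof (intro ballI allI impI)
 fix x and e :: real assume "e > 0"
 from weak_cocycle_continuous[OF assms this, of x]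
 obtain \<delta> where "\<delta> > 0" "!!T' x'. T' \<in> \<Omega> ==> config_dist dL T T' < \<delta> ==> dist x x' < \<delta> ==> dist (\<beta> T x) (\<beta> T' x') < e"
  by blast
 moreover have "config_dist dL T T = 0"
  using Metric_space.mdist_zero[OF tiling_space_Metric_space[OF assms(1)] assms(3)] .
 ultimately show "\<exists>d>0. \<forall>x'\<in>A. dist x' x < d --> dist (\<beta> T x') (\<beta> T x) < e"
  using assms(3) by (intro exI[of _ \<delta>]) (auto simp: dist_commute)
qed

lemma weak_cocycle_dilated_continuous:
 fixes \<Omega> :: "(real ^ 'n, 'l) config set"
 assumes "tiling_space L dL \<Omega>" "weak_cocycle dL \<Omega> \<beta>" "T \<in> \<Omega>"
 shows "continuous_on A (\<lambda>u. \<beta> T (r *\<^sub>R u) $ i)"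
proof -
 have "continuous_on A (\<lambda>u. r *\<^sub>R u)" by (intro continuous_on_scaleR continuous_on_const continuous_on_id)
 from continuous_on_compose2[OF weak_cocycle_continuous_on[OF assms, of UNIV] this]
 show ?thesis by (intro continuous_on_component) simp
qed

lemma weak_cocycle_bounded:
 fixes \<Omega> :: "('a::euclidean_space, 'l) config set"
 assumes "tiling_space L dL \<Omega>" "weak_cocycle dL \<Omega> \<beta>"
 shows "\<exists>B>0. \<forall>T\<in>\<Omega>. \<forall>x. norm x <= R --> norm (\<beta> T x) <= B"
proof -
 have M: "Metric_space \<Omega> (config_dist dL)" by (rule tiling_space_Metric_space[OF assms(1)])
 have "compactin (config_topology dL \<Omega>) \<Omega>"
  using tiling_space_compact[OF assms(1)] Metric_space.topspace_mtopology[OF M]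
  unfolding compact_space_def config_topology_def by simp
 then have "compactin (prod_topology (config_topology dL \<Omega>) euclidean) (\<Omega> \<times> cball (0 :: 'a) R)"
  using compact_cball[of "0 :: 'a" R] by (simp add: compactin_Times)
 from image_compactin[OF this, of euclidean "\<lambda>(T, x). \<beta> T x"]
 have "compact ((\<lambda>(T, x). \<beta> T x) ` (\<Omega> \<times> cball (0 :: 'a) R))"
  using assms(2) unfolding weak_cocycle_def by simp
 then obtain B where "B > 0" "\<forall>y\<in>(\<lambda>(T, x). \<beta> T x) ` (\<Omega> \<times> cball 0 R). norm y <= B"
  using compact_imp_bounded bounded_pos by blast
 then show ?thesis by (intro exI[of _ B]) force
qed

lemma uniform_continuity_over_compact:
 fixes f :: "'x => 'a::metric_space => 'b::metric_space"
 assumes f: "!!x e. 0 < e ==> \<exists>\<delta>>0. \<forall>T'\<in>M. \<forall>x'. d T T' < \<delta> --> dist x x' < \<delta> --> dist (f T x) (f T' x') < e"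
  and T: "T \<in> M" "d T T = 0" and K: "compact K" and e: "0 < e"
 shows "\<exists>\<delta>>0. \<forall>T'\<in>M. \<forall>x\<in>K. d T T' < \<delta> --> dist (f T x) (f T' x) < e"
proof -
 have "\<forall>x. \<exists>\<delta>>0. \<forall>T'\<in>M. \<forall>x'. d T T' < \<delta> --> dist x x' < \<delta> --> dist (f T x) (f T' x') < e/2"
  using f[of "e/2"] e by simp
 then obtain D where D: "!!x. D x > 0"
  "!!x T' x'. T' \<in> M ==> d T T' < D x ==> dist x x' < D x ==> dist (f T x) (f T' x') < e/2" by metis
 obtain F where F: "F \<subseteq> K" "finite F" "K \<subseteq> (\<Union>x\<in>F. ball x (D x))"
  by (rule compactE_image[OF K, of K "\<lambda>x. ball x (D x)"]) (use D(1) in force)+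
 define \<delta> where "\<delta> = Min (insert 1 (D ` F))"
 have \<delta>: "\<delta> > 0" "!!x. x \<in> F ==> \<delta> <= D x" unfolding \<delta>_def using F(2) D(1) by (auto simp: Min_gr_iff)
 show ?thesis
 proof (intro exI[of _ \<delta>] conjI ballI impI)
  fix T' x assume T': "T' \<in> M" "x \<in> K" "d T T' < \<delta>"
  then obtain y where y: "y \<in> F" "dist y x < D y" using F(3) by auto
  have "dist (f T y) (f T' x) < e/2" using D(2)[OF T'(1) _ y(2)] \<delta>(2)[OF y(1)] T'(3) by simp
  moreover have "dist (f T y) (f T x) < e/2" using D(2)[OF T(1) _ y(2)] T(2) D(1)[of y] by simp
  ultimately show "dist (f T x) (f T' x) < e" by (metis dist_triangle_half_r)
 qed (rule \<delta>)
qed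

text \<open>
 The weighted average of a cocycle over a box of size r, a function on the tiling space. Adding its
 coboundary to the cocycle is the smoothing procedure.
\<close>

definition smoothing ::
 "('n::finite => real => real) => real => (real ^ 'n, 'l) cochain => (real ^ 'n, 'l) config => real ^ 'n" where
 "smoothing \<phi> r \<beta> T = (\<chi> i. integral (cbox (- 1) 1) (\<lambda>u. bump_prod \<phi> u * \<beta> T (r *\<^sub>R u) $ i))"

definition smooth_cocycle ::
 "('n::finite => real => real) => real => (real ^ 'n, 'l) cochain => (real ^ 'n, 'l) cochain" where
 "smooth_cocycle \<phi> r \<beta> T v = \<beta> T v + smoothing \<phi> r \<beta> (translate T v) - smoothing \<phi> r \<beta> T"

text \<open>
 The derivative of the smoothed cocycle at the origin: an average of difference quotients \<open>\<beta> T (r u) / r\<close>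
 against the derivatives of the bump.
\<close>

definition smooth_deriv ::
 "('n::finite => real => real) => real => (real ^ 'n, 'l) cochain => (real ^ 'n, 'l) config => real ^ 'n ^ 'n" where
 "smooth_deriv \<phi> r \<beta> T = (\<chi> i j. - (1 / r) * smoothing (bump_d j \<phi>) r \<beta> T $ i)"

lemma norm_vec_le_sum: "norm (x :: real ^ 'n) <= (\<Sum>i\<in>UNIV. \<bar>x $ i\<bar>)" for x :: "real ^ 'n::finite"
 by (rule norm_le_l1_cart)

lemma integral_bump_bound:
 fixes g :: "real ^ 'n::finite => real"
 assumes \<phi>: "bumps \<phi>" and g: "continuous_on UNIV g" "!!u. u \<in> cbox (- 1) 1 ==> \<bar>g u\<bar> <= e"
 shows "\<bar>integral (cbox (- 1) 1) (\<lambda>u. bump_prod \<phi> u * g u)\<bar> <= integral (cbox (- 1) 1) (\<lambda>u. \<bar>bump_prod \<phi> u\<bar>) * e"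
proof -
 have c: "continuous_on A (bump_prod \<phi>)" for A using \<phi> by (intro continuous_bump_prod[of _ _ "\<lambda>x. x"]) auto
 have "norm (integral (cbox (- 1) 1) (\<lambda>u. bump_prod \<phi> u * g u)) <= integral (cbox (- 1) 1) (\<lambda>u. \<bar>bump_prod \<phi> u\<bar> * e)"
 proof (rule integral_norm_bound_integral)
  show "(\<lambda>u. bump_prod \<phi> u * g u) integrable_on cbox (- 1) 1" "(\<lambda>u. \<bar>bump_prod \<phi> u\<bar> * e) integrable_on cbox (- 1) 1"
   using continuous_on_subset[OF g(1)] by (auto intro!: integrable_continuous continuous_intros c)
  show "norm (bump_prod \<phi> u * g u) <= \<bar>bump_prod \<phi> u\<bar> * e" if "u \<in> cbox (- 1) 1" for u
   using g(2)[OF that] by (simp add: abs_mult mult_left_mono)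
 qed
 then show ?thesis by simp
qed

lemma smoothing_continuous:
 fixes \<Omega> :: "(real ^ 'n::finite, 'l) config set"
 assumes \<Omega>: "tiling_space L dL \<Omega>" and \<beta>: "weak_cocycle dL \<Omega> \<beta>" and \<phi>: "bumps \<phi>"
  and T: "T \<in> \<Omega>" and e: "0 < e"
 shows "\<exists>\<delta>>0. \<forall>T'\<in>\<Omega>. config_dist dL T T' < \<delta> --> dist (smoothing \<phi> r \<beta> T) (smoothing \<phi> r \<beta> T') < e"
proof -
 define I where "I = integral (cbox (- 1) 1) (\<lambda>u. \<bar>bump_prod \<phi> u\<bar>)"
 have c: "continuous_on A (bump_prod \<phi>)" for A using \<phi> by (intro continuous_bump_prod[of _ _ "\<lambda>x. x"]) auto
 have I: "0 <= I" unfolding I_def by (rule integral_nonneg) (auto intro!: integrable_continuous continuous_intros c)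
 define e' where "e' = e / (2 * (real CARD('n) * (I + 1)))"
 have pos: "0 < real CARD('n) * (I + 1)" using I by simp
 have e': "0 < e'" unfolding e'_def using e pos by simp
 have "\<exists>\<delta>>0. \<forall>T'\<in>\<Omega>. \<forall>x\<in>(\<lambda>u. r *\<^sub>R u) ` cbox (- 1) 1. config_dist dL T T' < \<delta> --> dist (\<beta> T x) (\<beta> T' x) < e'"
  using weak_cocycle_continuous[OF \<Omega> \<beta> T] T e' Metric_space.mdist_zero[OF tiling_space_Metric_space[OF \<Omega>] T]
  by (intro uniform_continuity_over_compact) (auto intro!: compact_continuous_image continuous_intros)
 then obtain \<delta> where \<delta>: "\<delta> > 0"
  "!!T' u. T' \<in> \<Omega> ==> u \<in> cbox (- 1) 1 ==> config_dist dL T T' < \<delta> ==> dist (\<beta> T (r *\<^sub>R u)) (\<beta> T' (r *\<^sub>R u)) < e'"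
  by auto
 show ?thesis
 proof (intro exI[of _ \<delta>] conjI ballI impI)
  fix T' assume T': "T' \<in> \<Omega>" "config_dist dL T T' < \<delta>"
  have gc: "continuous_on A (\<lambda>u. \<beta> S (r *\<^sub>R u) $ i)" if "S \<in> \<Omega>" for S A i
   by (rule weak_cocycle_dilated_continuous[OF \<Omega> \<beta> that])
  have "\<bar>(smoothing \<phi> r \<beta> T - smoothing \<phi> r \<beta> T') $ i\<bar> <= I * e'" for i
  proof -
   have "(smoothing \<phi> r \<beta> T - smoothing \<phi> r \<beta> T') $ i =
     integral (cbox (- 1) 1) (\<lambda>u. bump_prod \<phi> u * (\<beta> T (r *\<^sub>R u) $ i - \<beta> T' (r *\<^sub>R u) $ i))"
    unfolding smoothing_def right_diff_distrib
    by (subst integral_diff) (auto intro!: integrable_continuous continuous_intros c gc T T')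
   also have "\<bar>...\<bar> <= I * e'" unfolding I_def
   proof (rule integral_bump_bound[OF \<phi>])
    show "continuous_on UNIV (\<lambda>u. \<beta> T (r *\<^sub>R u) $ i - \<beta> T' (r *\<^sub>R u) $ i)" by (intro continuous_intros gc T T')
    fix u :: "real ^ 'n" assume u: "u \<in> cbox (- 1) 1"
    have "\<bar>\<beta> T (r *\<^sub>R u) $ i - \<beta> T' (r *\<^sub>R u) $ i\<bar> <= dist (\<beta> T (r *\<^sub>R u)) (\<beta> T' (r *\<^sub>R u))"
     using component_le_norm_cart[of "\<beta> T (r *\<^sub>R u) - \<beta> T' (r *\<^sub>R u)" i] by (simp add: dist_norm)
    then show "\<bar>\<beta> T (r *\<^sub>R u) $ i - \<beta> T' (r *\<^sub>R u) $ i\<bar> <= e'" using \<delta>(2)[OF T'(1) u T'(2)] by simp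
   qed
   finally show ?thesis .
  qed
  then have "norm (smoothing \<phi> r \<beta> T - smoothing \<phi> r \<beta> T') <= (\<Sum>i\<in>(UNIV::'n set). I * e')"
   by (intro order_trans[OF norm_vec_le_sum] sum_mono)
  also have "... = real CARD('n) * (I * e')" by simp
  also have "... <= (real CARD('n) * (I + 1)) * e'" using e' by (simp add: algebra_simps)
  also have "... = e / 2"
  proof -
   have "c * (e / (2 * c)) = e / 2" if "0 < c" for c using that by (simp add: field_simps)
   then show ?thesis unfolding e'_def using pos by blast
  qed
  also have "... < e" using e by simp
  finally show "dist (smoothing \<phi> r \<beta> T) (smoothing \<phi> r \<beta> T') < e" by (simp add: dist_norm)
 qed (rule \<delta>)
qed

lemma smoothing_continuous_map:
 assumes \<Omega>: "tiling_space L dL \<Omega>" and \<beta>: "weak_cocycle dL \<Omega> \<beta>" and \<phi>: "bumps \<phi>"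
 shows "continuous_map (config_topology dL \<Omega>) euclidean (smoothing \<phi> r \<beta>)"
 unfolding config_topology_def continuous_map_metric_euclidean_iff[OF tiling_space_Metric_space[OF \<Omega>]]
 using smoothing_continuous[OF assms] by blast

lemma weak_cocycle_add_coboundary:
 assumes \<Omega>: "tiling_space L dL \<Omega>" and \<beta>: "weak_cocycle dL \<Omega> \<beta>"
  and s: "!!T e. T \<in> \<Omega> ==> 0 < e ==> \<exists>\<delta>>0. \<forall>T'\<in>\<Omega>. config_dist dL T T' < \<delta> --> dist (s T) (s T') < e"
 shows "weak_cocycle dL \<Omega> (\<lambda>T v. \<beta> T v + s (translate T v) - s T)"
proof -
 note M = tiling_space_Metric_space[OF \<Omega>]
 show ?thesis unfolding weak_cocycle_def config_topology_def continuous_map_metric_times_euclidean_iff[OF M]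
 proof (intro conjI ballI allI impI)
  fix T x and e :: real assume T: "T \<in> \<Omega>" and e: "0 < e"
  obtain d1 where d1: "d1 > 0" "!!T' x'. T' \<in> \<Omega> ==> config_dist dL T T' < d1 ==> dist x x' < d1 ==> dist (\<beta> T x) (\<beta> T' x') < e/3"
   using weak_cocycle_continuous[OF \<Omega> \<beta> T, of "e/3" x] e by auto
  obtain d2 where d2: "d2 > 0" "!!T'. T' \<in> \<Omega> ==> config_dist dL T T' < d2 ==> dist (s T) (s T') < e/3"
   using s[OF T, of "e/3"] e by auto
  obtain d3 where d3: "d3 > 0" "!!T'. T' \<in> \<Omega> ==> config_dist dL (translate T x) T' < d3 ==> dist (s (translate T x)) (s T') < e/3"
   using s[OF tiling_space_translate[OF \<Omega> T, of x], of "e/3"] e by auto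
  obtain d4 where d4: "d4 > 0" "!!T' x'. T' \<in> \<Omega> ==> config_dist dL T T' < d4 ==> norm (x - x') < d4 ==>
    config_dist dL (translate T x) (translate T' x') < d3"
   using tiling_space_translate_continuous[OF \<Omega> T d3(1), of x] by auto
  show "\<exists>\<delta>>0. \<forall>T'\<in>\<Omega>. \<forall>x'. config_dist dL T T' < \<delta> --> dist x x' < \<delta> -->
   dist (\<beta> T x + s (translate T x) - s T) (\<beta> T' x' + s (translate T' x') - s T') < e"
  proof (intro exI[of _ "min (min d1 d2) d4"] conjI ballI allI impI)
   fix T' x' assume T': "T' \<in> \<Omega>" "config_dist dL T T' < min (min d1 d2) d4" "dist x x' < min (min d1 d2) d4"
   have "dist (\<beta> T x) (\<beta> T' x') < e/3" "dist (s T) (s T') < e/3" using d1 d2 T' by auto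
   moreover have "dist (s (translate T x)) (s (translate T' x')) < e/3"
    using d3(2)[OF tiling_space_translate[OF \<Omega> T'(1)] d4(2)[OF T'(1)]] T' by (simp add: dist_norm)
   ultimately show "dist (\<beta> T x + s (translate T x) - s T) (\<beta> T' x' + s (translate T' x') - s T') < e"
    by norm
  qed (use d1 d2 d4 in auto)
 next
  fix T x y assume T: "T \<in> \<Omega>"
  show "\<beta> T x + s (translate T x) - s T + (\<beta> (translate T x) y + s (translate (translate T x) y) - s (translate T x)) =
    \<beta> T (x + y) + s (translate T (x + y)) - s T"
   by (simp add: weak_cocycle_add[OF \<beta> T] translate_add)
 qed
qed

text \<open>
 By the cocycle equation \<open>\<beta> T (x + r u) = \<beta> T x + \<beta> (T - x) (r u)\<close>. Hence for a bump of integral one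
 the smoothed cocycle differs by a constant from a convolution of \<open>\<beta> T\<close>, and for a bump of integral
 zero, such as a derivative, the convolution is a function of \<open>T - x\<close>.
\<close>

lemma moll_cocycle:
 fixes \<beta> :: "(real ^ 'n::finite, 'l) cochain"
 assumes \<Omega>: "tiling_space L dL \<Omega>" and \<beta>: "weak_cocycle dL \<Omega> \<beta>" and \<phi>: "bumps \<phi>" and T: "T \<in> \<Omega>" and r: "r > 0"
 shows "moll \<phi> r (\<lambda>u. \<beta> T (r *\<^sub>R u) $ i) x =
   \<beta> T x $ i * integral (cbox (- 1) 1) (bump_prod \<phi>) + smoothing \<phi> r \<beta> (translate T x) $ i"
proof -
 have c: "continuous_on A (bump_prod \<phi>)" for A using \<phi> by (intro continuous_bump_prod[of _ _ "\<lambda>x. x"]) auto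
 have Tx: "translate T x \<in> \<Omega>" using tiling_space_translate[OF \<Omega> T] .
 have gc: "continuous_on A (\<lambda>u. \<beta> (translate T x) (r *\<^sub>R u) $ i)" for A
  by (rule weak_cocycle_dilated_continuous[OF \<Omega> \<beta> Tx])
 have "\<beta> T (r *\<^sub>R (u + (1 / r) *\<^sub>R x)) $ i = \<beta> T x $ i + \<beta> (translate T x) (r *\<^sub>R u) $ i" for u
  using weak_cocycle_add[OF \<beta> T, of x "r *\<^sub>R u"] r by (simp add: scaleR_add_right add.commute)
 then have "moll \<phi> r (\<lambda>u. \<beta> T (r *\<^sub>R u) $ i) x =
   integral (cbox (- 1) 1) (\<lambda>u. \<beta> T x $ i * bump_prod \<phi> u + bump_prod \<phi> u * \<beta> (translate T x) (r *\<^sub>R u) $ i)"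
  unfolding moll_shift[OF \<phi>] by (simp add: algebra_simps)
 also have "... = integral (cbox (- 1) 1) (\<lambda>u. \<beta> T x $ i * bump_prod \<phi> u)
   + integral (cbox (- 1) 1) (\<lambda>u. bump_prod \<phi> u * \<beta> (translate T x) (r *\<^sub>R u) $ i)"
  by (rule integral_add) (auto intro!: integrable_continuous continuous_intros c gc)
 finally show ?thesis by (simp add: smoothing_def)
qed

context
 fixes \<Omega> :: "(real ^ 'n::finite, 'l) config set" and L :: "'l set" and dL \<beta> T and \<phi> :: "'n => real => real" and r :: real
 assumes \<Omega>: "tiling_space L dL \<Omega>" and \<beta>: "weak_cocycle dL \<Omega> \<beta>" and \<phi>: "bumps \<phi>"
  and T: "T \<in> \<Omega>" and r: "r > 0"
begin

lemma smooth_deriv_moll: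
 "smooth_deriv \<phi> r \<beta> (translate T x) $ i $ j = - (1 / r) * moll (bump_d j \<phi>) r (\<lambda>u. \<beta> T (r *\<^sub>R u) $ i) x"
 unfolding smooth_deriv_def moll_cocycle[OF \<Omega> \<beta> bumps_d[OF \<phi>] T r] by (simp add: integral_bump_d_zero[OF \<phi>])

lemma smooth_form_smooth_deriv: "smooth_form (\<lambda>x. smooth_deriv \<phi> r \<beta> (translate T x))"
 unfolding smooth_form_def smooth_deriv_moll
 by (intro allI smooth_fun_moll bumps_d \<phi> weak_cocycle_dilated_continuous[OF \<Omega> \<beta> T])

text \<open>Partial derivatives of bumps commute.\<close>

lemma closed_form_smooth_deriv: "closed_form (\<lambda>x. smooth_deriv \<phi> r \<beta> (translate T x))"
 unfolding closed_form_def smooth_deriv_moll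
  partial_deriv_moll[OF bumps_d[OF \<phi>] weak_cocycle_dilated_continuous[OF \<Omega> \<beta> T]]
 by (simp add: bump_d_commute)

text \<open>
 All partial derivatives of the coefficients are convolutions with derivatives of the bump, hence
 continuous functions of \<open>T - x\<close>.
\<close>

lemma weakly_PE_smooth_deriv: "weakly_PE_form dL \<Omega> T (\<lambda>x. smooth_deriv \<phi> r \<beta> (translate T x))"
 unfolding weakly_PE_form_def
proof (intro conjI allI)
 fix ks i j
 let ?g = "\<lambda>u. \<beta> T (r *\<^sub>R u) $ i"
 obtain c' \<phi>' where c': "bumps \<phi>'" "\<phi>' = bump_d j \<phi> \<or> (\<exists>k \<phi>''. bumps \<phi>'' \<and> \<phi>' = bump_d k \<phi>'')"
  "iterated_partial ks (\<lambda>x. - (1 / r) * moll (bump_d j \<phi>) r ?g x) = (\<lambda>x. c' * moll \<phi>' r ?g x)"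
  using iterated_partial_moll[OF bumps_d[OF \<phi>] weak_cocycle_dilated_continuous[OF \<Omega> \<beta> T]] by metis
 have z: "integral (cbox (- 1) 1) (bump_prod \<phi>') = 0" using c'(2) \<phi> integral_bump_d_zero by blast
 have eq: "iterated_partial ks (\<lambda>x. smooth_deriv \<phi> r \<beta> (translate T x) $ i $ j) =
   (\<lambda>x. c' * smoothing \<phi>' r \<beta> (translate T x) $ i)"
  unfolding smooth_deriv_moll c'(3) moll_cocycle[OF \<Omega> \<beta> c'(1) T r] z by simp
 have "continuous_map (config_topology dL \<Omega>) euclidean (\<lambda>S. c' * smoothing \<phi>' r \<beta> S $ i)"
  using continuous_map_compose[OF smoothing_continuous_map[OF \<Omega> \<beta> c'(1), of r], of euclidean "\<lambda>v. c' * v $ i"]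
  by (simp add: o_def continuous_on_mult_left continuous_on_component continuous_on_id)
 then show "weakly_PE dL \<Omega> T (iterated_partial ks (\<lambda>x. smooth_deriv \<phi> r \<beta> (translate T x) $ i $ j))"
  unfolding weakly_PE_def eq by blast
qed (rule smooth_form_smooth_deriv)

lemma smooth_cocycle_has_derivative:
 assumes I: "integral (cbox (- 1) 1) (bump_prod \<phi>) = 1"
 shows "(smooth_cocycle \<phi> r \<beta> T has_derivative (\<lambda>h. smooth_deriv \<phi> r \<beta> (translate T x) *v h)) (at x)"
proof -
 have "((\<lambda>x. smooth_cocycle \<phi> r \<beta> T x $ i) has_derivative (\<lambda>h. (smooth_deriv \<phi> r \<beta> (translate T x) *v h) $ i)) (at x)" for i
 proof -
  let ?g = "\<lambda>u. \<beta> T (r *\<^sub>R u) $ i"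
  have e: "smooth_cocycle \<phi> r \<beta> T y $ i = 1 * moll \<phi> r ?g y - smoothing \<phi> r \<beta> T $ i" for y
   unfolding smooth_cocycle_def moll_cocycle[OF \<Omega> \<beta> \<phi> T r] I by simp
  have "((\<lambda>y. 1 * moll \<phi> r ?g y - smoothing \<phi> r \<beta> T $ i) has_derivative
    (\<lambda>h. (\<Sum>j\<in>UNIV. h $ j * (- (1 / r) * moll (bump_d j \<phi>) r ?g x)) - 0)) (at x)"
   by (intro has_derivative_diff cmult_moll_has_derivative \<phi> weak_cocycle_dilated_continuous[OF \<Omega> \<beta> T] has_derivative_const)
  then show ?thesis
   unfolding e by (simp add: matrix_vector_mult_def smooth_deriv_moll mult.commute)
 qed
 then show ?thesis by (subst has_derivative_componentwise_within) (auto simp: Basis_vec_def cart_eq_inner_axis[symmetric])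
qed

end

section \<open>Uniform averages under unique ergodicity\<close>

lemma bump_prod_bounded:
 assumes \<phi>: "bumps \<phi>" obtains B where "0 < B" "!!u. \<bar>bump_prod \<phi> u\<bar> <= B"
proof -
 have "compact (bump_prod \<phi> ` cbox (- 1) 1)"
  using \<phi> by (intro compact_continuous_image continuous_bump_prod[of _ _ "\<lambda>x. x"]) auto
 then obtain B where "0 < B" "\<forall>y\<in>bump_prod \<phi> ` cbox (- 1) 1. norm y <= B"
  using compact_imp_bounded bounded_pos by blast
 then have B: "0 < B" "!!u. u \<in> cbox (- 1) 1 ==> \<bar>bump_prod \<phi> u\<bar> <= B" by auto
 have "\<bar>bump_prod \<phi> u\<bar> <= B" for u
  using B bump_prod_outside[OF \<phi>, of u] by (cases "u \<in> cbox (- 1) 1") auto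
 then show ?thesis using that B(1) by blast
qed

lemma bump_prod_measurable [measurable]:
 assumes "bumps \<phi>" shows "bump_prod \<phi> \<in> borel_measurable borel"
 using assms by (intro borel_measurable_continuous_onI continuous_bump_prod[of _ _ "\<lambda>x. x"]) auto

lemma bump_times_integrable:
 fixes h :: "real ^ 'n::finite => real"
 assumes \<phi>: "bumps \<phi>" and h: "h \<in> borel_measurable borel" "!!u. \<bar>h u\<bar> <= C"
 shows "integrable lborel (\<lambda>u. bump_prod \<phi> u * h u)"
proof -
 obtain B where B: "0 < B" "!!u. \<bar>bump_prod \<phi> u\<bar> <= B" using bump_prod_bounded[OF \<phi>] by blast
 have C: "0 <= C" using h(2)[of 0] by simp
 show ?thesis
 proof (rule Bochner_Integration.integrable_bound)
  show "integrable lborel (\<lambda>u. (B * C) * indicator (cbox (- 1) (1 :: real ^ 'n)) u :: real)"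
   by (intro integrable_mult_right integrable_real_indicator) (auto simp: emeasure_lborel_cbox_eq)
  show "(\<lambda>u. bump_prod \<phi> u * h u) \<in> borel_measurable lborel" using \<phi> h(1) by simp
  have "norm (bump_prod \<phi> u * h u) <= norm ((B * C) * indicator (cbox (- 1) 1) u :: real)" for u
  proof (cases "u \<in> cbox (- 1) 1")
   case True
   have "\<bar>bump_prod \<phi> u\<bar> * \<bar>h u\<bar> <= B * C" using B h(2) by (intro mult_mono) auto
   then show ?thesis using True B C by (simp add: abs_mult)
  qed (simp add: bump_prod_outside[OF \<phi>])
  then show "AE u in lborel. norm (bump_prod \<phi> u * h u) <= norm ((B * C) * indicator (cbox (- 1) 1) u :: real)" by simp
 qed
qed

text \<open>
 Averages over large regions are asymptotically invariant: after rescaling by \<open>n + 1\<close>, a fixed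
 translation v becomes negligible.
\<close>

lemma bump_translation_L1:
 fixes v :: "real ^ 'n::finite"
 assumes \<phi>: "bumps \<phi>"
 shows "(\<lambda>n. \<integral>u. \<bar>bump_prod \<phi> (u + (1 / real (Suc n)) *\<^sub>R v) - bump_prod \<phi> u\<bar> \<partial>lborel) \<longlonglongrightarrow> 0"
proof -
 obtain B where B: "0 < B" "!!u. \<bar>bump_prod \<phi> u\<bar> <= B" using bump_prod_bounded[OF \<phi>] by blast
 let ?R = "1 + norm v"
 let ?K = "cbox (\<chi> i. - ?R) (\<chi> i. ?R) :: (real ^ 'n) set"
 have c: "continuous_on UNIV (bump_prod \<phi>)" using \<phi> by (intro continuous_bump_prod[of _ _ "\<lambda>x. x"]) auto
 have "(\<lambda>n. \<integral>u. \<bar>bump_prod \<phi> (u + (1 / real (Suc n)) *\<^sub>R v) - bump_prod \<phi> u\<bar> \<partial>lborel) \<longlonglongrightarrow> (\<integral>u. 0 \<partial>(lborel :: (real ^ 'n) measure))"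
 proof (rule integral_dominated_convergence[where w = "\<lambda>u. 2 * B * indicator ?K u"])
  show "(\<lambda>u. \<bar>bump_prod \<phi> (u + (1 / real (Suc n)) *\<^sub>R v) - bump_prod \<phi> u\<bar>) \<in> borel_measurable lborel" for n
   using \<phi> by (auto intro!: borel_measurable_continuous_onI continuous_intros)
  show "integrable lborel (\<lambda>u. 2 * B * indicator ?K u)"
   by (intro integrable_mult_right integrable_real_indicator) (auto simp: emeasure_lborel_cbox_eq)
  have "(\<lambda>n. \<bar>bump_prod \<phi> (u + (1 / real (Suc n)) *\<^sub>R v) - bump_prod \<phi> u\<bar>) \<longlonglongrightarrow> 0" for u
  proof -
   have "(\<lambda>n. u + (1 / real (Suc n)) *\<^sub>R v) \<longlonglongrightarrow> u + 0 *\<^sub>R v"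
    by (intro tendsto_intros LIMSEQ_Suc[OF lim_1_over_n])
   from continuous_on_tendsto_compose[OF c this]
   have "(\<lambda>n. bump_prod \<phi> (u + (1 / real (Suc n)) *\<^sub>R v)) \<longlonglongrightarrow> bump_prod \<phi> u" by simp
   then show ?thesis using tendsto_rabs_zero[OF LIM_zero] by blast
  qed
  then show "AE u in lborel. (\<lambda>n. \<bar>bump_prod \<phi> (u + (1 / real (Suc n)) *\<^sub>R v) - bump_prod \<phi> u\<bar>) \<longlonglongrightarrow> 0" by simp
  have "norm \<bar>bump_prod \<phi> (u + (1 / real (Suc n)) *\<^sub>R v) - bump_prod \<phi> u\<bar> <= 2 * B * indicator ?K u" for n u
  proof (cases "u \<in> ?K")
   case True
   then show ?thesis using B(2)[of u] B(2)[of "u + (1 / real (Suc n)) *\<^sub>R v"] by simp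
  next
   case False
   then obtain i where "\<not> (- ?R <= u $ i \<and> u $ i <= ?R)" unfolding mem_box_cart by auto
   then have i: "?R < \<bar>u $ i\<bar>" by linarith
   have "\<bar>((1 / real (Suc n)) *\<^sub>R v) $ i\<bar> <= norm v"
   proof -
    have "\<bar>((1 / real (Suc n)) *\<^sub>R v) $ i\<bar> <= (1 / real (Suc n)) * norm v"
     using component_le_norm_cart[of "(1 / real (Suc n)) *\<^sub>R v" i] by simp
    also have "... <= 1 * norm v" by (intro mult_right_mono) (auto simp: divide_le_eq)
    finally show ?thesis by simp
   qed
   moreover have "(u + (1 / real (Suc n)) *\<^sub>R v) $ i = u $ i + ((1 / real (Suc n)) *\<^sub>R v) $ i"
    by (rule vector_add_component)
   ultimately have "1 < \<bar>(u + (1 / real (Suc n)) *\<^sub>R v) $ i\<bar>" "1 < \<bar>u $ i\<bar>"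
    using i norm_ge_zero[of v] by linarith+
   then have "u + (1 / real (Suc n)) *\<^sub>R v \<notin> cbox (- 1) 1" "u \<notin> cbox (- 1) 1"
    unfolding mem_box_cart by (auto simp del: vector_add_component intro!: exI[of _ i])
   then show ?thesis using bump_prod_outside[OF \<phi>] False by simp
  qed
  then show "AE u in lborel. norm \<bar>bump_prod \<phi> (u + (1 / real (Suc n)) *\<^sub>R v) - bump_prod \<phi> u\<bar> <= 2 * B * indicator ?K u" for n by simp
 qed simp
 then show ?thesis by simp
qed

lemma integral_lborel_shift:
 fixes f :: "'a::euclidean_space => real"
 assumes "f \<in> borel_measurable borel"
 shows "(\<integral>u. f u \<partial>lborel) = (\<integral>u. f (u + c) \<partial>lborel)"
proof -
 have "(\<integral>u. f u \<partial>lborel) = (\<integral>u. f u \<partial>distr lborel borel ((+) c))" by (simp add: lborel_distr_plus)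
 also have "... = (\<integral>u. f (c + u) \<partial>lborel)" using assms by (intro integral_distr) auto
 finally show ?thesis by (simp add: add.commute)
qed

lemma translate_continuous_map:
 fixes \<Omega> :: "('a::euclidean_space, 'l) config set"
 assumes \<Omega>: "tiling_space L dL \<Omega>" and S: "S \<in> \<Omega>"
 shows "continuous_map euclidean (config_topology dL \<Omega>) (\<lambda>u. translate S (r *\<^sub>R u))"
proof -
 note M = tiling_space_Metric_space[OF \<Omega>]
 have "continuous_map Met_TC.mtopology (Metric_space.mtopology \<Omega> (config_dist dL)) (translate S)"
  unfolding Met_TC.metric_continuous_map[OF M]
 proof (intro conjI ballI allI impI)
  show "range (translate S) \<subseteq> \<Omega>" using tiling_space_translate[OF \<Omega> S] by auto
  fix a and e :: real assume "0 < e"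
  from tiling_space_translate_continuous[OF \<Omega> S this, of a]
  show "\<exists>\<delta>>0. \<forall>x. x \<in> UNIV \<and> dist a x < \<delta> --> config_dist dL (translate S a) (translate S x) < e"
   using S Metric_space.mdist_zero[OF M S] by (auto simp: dist_norm)
 qed
 moreover have "continuous_map euclidean Met_TC.mtopology (\<lambda>u :: 'a. r *\<^sub>R u)"
  by (auto intro!: continuous_intros)
 ultimately have "continuous_map euclidean (Metric_space.mtopology \<Omega> (config_dist dL)) (translate S \<circ> (\<lambda>u. r *\<^sub>R u))"
  using continuous_map_compose by blast
 then show ?thesis unfolding config_topology_def by (simp add: o_def)
qed

lemma translate_homeomorphic_map:
 assumes \<Omega>: "tiling_space L dL \<Omega>"
 shows "homeomorphic_map (config_topology dL \<Omega>) (config_topology dL \<Omega>) (\<lambda>T. translate T x)"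
proof -
 note M = tiling_space_Metric_space[OF \<Omega>]
 have c: "continuous_map (config_topology dL \<Omega>) (config_topology dL \<Omega>) (\<lambda>T. translate T x)" for x
  unfolding config_topology_def Metric_space.metric_continuous_map[OF M M]
 proof (intro conjI ballI allI impI)
  show "(\<lambda>T. translate T x) ` \<Omega> \<subseteq> \<Omega>" using tiling_space_translate[OF \<Omega>] by auto
  fix T and e :: real assume T: "T \<in> \<Omega>" and e: "0 < e"
  from tiling_space_translate_continuous[OF \<Omega> T e, of x]
  obtain d where "d > 0" "\<forall>T'\<in>\<Omega>. \<forall>x'. config_dist dL T T' < d --> norm (x - x') < d -->
    config_dist dL (translate T x) (translate T' x') < e" by blast
  then show "\<exists>\<delta>>0. \<forall>T'. T' \<in> \<Omega> \<and> config_dist dL T T' < \<delta> --> config_dist dL (translate T x) (translate T' x) < e"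
   by (intro exI[of _ d]) simp
 qed
 have "homeomorphic_maps (config_topology dL \<Omega>) (config_topology dL \<Omega>) (\<lambda>T. translate T x) (\<lambda>T. translate T (- x))"
  unfolding homeomorphic_maps_def using c[of x] c[of "- x"] by simp
 then show ?thesis by (rule homeomorphic_maps_imp_map)
qed

lemma topspace_config_topology:
 assumes \<Omega>: "tiling_space L dL \<Omega>" shows "topspace (config_topology dL \<Omega>) = \<Omega>"
 unfolding config_topology_def using Metric_space.topspace_mtopology[OF tiling_space_Metric_space[OF \<Omega>]] .

text \<open>
 The distribution of \<open>S - r u\<close> where u has the bump as its density: a smooth average over the
 orbit of S at scale r.
\<close>

definition orbit_measure ::
 "('n::finite => real => real) => real => ('l => 'l => real) => (real ^ 'n, 'l) config set => (real ^ 'n, 'l) config =>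
  (real ^ 'n, 'l) config measure" where
 "orbit_measure \<phi> r dL \<Omega> S = distr (density lborel (\<lambda>u. ennreal (bump_prod \<phi> u))) (borel_of (config_topology dL \<Omega>))
   (\<lambda>u. translate S (r *\<^sub>R u))"

context
 fixes \<Omega> :: "(real ^ 'n::finite, 'l) config set" and L :: "'l set" and dL S and \<phi> :: "'n => real => real"
 assumes \<Omega>: "tiling_space L dL \<Omega>" and S: "S \<in> \<Omega>"
  and \<phi>: "bumps \<phi>" "!!u. 0 <= bump_prod \<phi> u" "integral (cbox (- 1) 1) (bump_prod \<phi>) = 1"
begin

lemma translate_measurable: "(\<lambda>u. translate S (r *\<^sub>R u)) \<in> measurable borel (borel_of (config_topology dL \<Omega>))"
 using continuous_map_measurable[OF translate_continuous_map[OF \<Omega> S, of r]] by (simp add: borel_of_euclidean)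

lemma integral_orbit_measure:
 assumes "f \<in> borel_measurable (borel_of (config_topology dL \<Omega>))"
 shows "(\<integral>T. f T \<partial>orbit_measure \<phi> r dL \<Omega> S) = (\<integral>u. bump_prod \<phi> u * f (translate S (r *\<^sub>R u)) \<partial>lborel)"
 unfolding orbit_measure_def using translate_measurable[of r] assms \<phi>(1)
 by (subst integral_distr) (auto simp: integral_density \<phi>(2) measurable_compose[OF translate_measurable])

lemma integral_bump_lborel: "(\<integral>u. bump_prod \<phi> u \<partial>lborel) = 1" "integrable lborel (bump_prod \<phi>)"
proof -
 show i: "integrable lborel (bump_prod \<phi>)" using bump_times_integrable[OF \<phi>(1), of "\<lambda>_. 1" 1] by simp
 have "(\<integral>u. bump_prod \<phi> u \<partial>lborel) = integral UNIV (bump_prod \<phi>)" using integral_lborel[OF i] by simp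
 also have "... = 1" using integral_UNIV_eq_cbox[of "- 1" 1 "bump_prod \<phi>"] bump_prod_outside[OF \<phi>(1)] \<phi>(3) by simp
 finally show "(\<integral>u. bump_prod \<phi> u \<partial>lborel) = 1" .
qed

lemma prob_space_orbit_measure: "prob_space (orbit_measure \<phi> r dL \<Omega> S)"
proof -
 have "prob_space (density lborel (\<lambda>u. ennreal (bump_prod \<phi> u)))"
 proof (rule prob_spaceI)
  show "emeasure (density lborel (\<lambda>u. ennreal (bump_prod \<phi> u))) (space (density lborel (\<lambda>u. ennreal (bump_prod \<phi> u)))) = 1"
   using nn_integral_eq_integral[OF integral_bump_lborel(2)] \<phi>(1,2) integral_bump_lborel(1)
   by (simp add: emeasure_density)
 qed
 then show ?thesis unfolding orbit_measure_def
  by (rule prob_space.prob_space_distr) (use translate_measurable in simp)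
qed

lemma sets_orbit_measure: "sets (orbit_measure \<phi> r dL \<Omega> S) = sets (borel_of (config_topology dL \<Omega>))"
 unfolding orbit_measure_def by simp

lemma integral_orbit_measure_continuous:
 assumes f: "continuous_map (config_topology dL \<Omega>) euclidean f"
 shows "(\<integral>T. f T \<partial>orbit_measure \<phi> r dL \<Omega> S) =
  integral (cbox (- 1) 1) (\<lambda>u. bump_prod \<phi> u * f (translate S (r *\<^sub>R u)))"
proof -
 have c: "continuous_on A (\<lambda>u. f (translate S (r *\<^sub>R u)))" for A
  using continuous_map_compose[OF translate_continuous_map[OF \<Omega> S, of r] f]
  by (simp add: o_def) (meson continuous_on_subset subset_UNIV)
 let ?h = "\<lambda>u. bump_prod \<phi> u * f (translate S (r *\<^sub>R u))"
 have "(\<integral>u. ?h u \<partial>lborel) = (LINT u:cbox (- 1) 1|lborel. ?h u)"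
  unfolding set_lebesgue_integral_def using bump_prod_outside[OF \<phi>(1)]
  by (intro Bochner_Integration.integral_cong) (auto simp: indicator_def)
 also have "... = integral (cbox (- 1) 1) ?h"
 proof (rule set_borel_integral_eq_integral)
  show "set_integrable lborel (cbox (- 1) 1) ?h"
   unfolding set_integrable_def by (intro borel_integrable_compact compact_cbox continuous_intros \<phi> c)
 qed
 finally show ?thesis by (simp add: integral_orbit_measure continuous_map_borel_measurable[OF f])
qed

lemma orbit_measure_translate_estimate:
 assumes K: "closedin (config_topology dL \<Omega>) K" and r: "r > 0"
 shows "\<bar>measure (orbit_measure \<phi> r dL \<Omega> S) ((\<lambda>T. translate T v) ` K) - measure (orbit_measure \<phi> r dL \<Omega> S) K\<bar>
  <= (\<integral>u. \<bar>bump_prod \<phi> (u + (1 / r) *\<^sub>R v) - bump_prod \<phi> u\<bar> \<partial>lborel)"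
proof -
 let ?X = "config_topology dL \<Omega>" and ?m = "orbit_measure \<phi> r dL \<Omega> S"
 have h: "closedin ?X ((\<lambda>T. translate T v) ` K)"
  using homeomorphic_map_closedness[OF translate_homeomorphic_map[OF \<Omega>]] K closedin_subset[OF K] by blast
 have meas: "measure ?m B = (\<integral>u. bump_prod \<phi> u * indicator B (translate S (r *\<^sub>R u)) \<partial>lborel)" if "closedin ?X B" for B
 proof -
  have B: "B \<in> sets (borel_of ?X)" using borel_of_closed[OF that] .
  then have "measure ?m B = (\<integral>T. indicator B T \<partial>?m)"
   using sets.sets_into_space[OF B] sets_eq_imp_space_eq[OF sets_orbit_measure] by (simp add: Int_absorb2)
  then show ?thesis using integral_orbit_measure[OF borel_measurable_indicator[OF B]] by simp
 qed
 let ?ind = "\<lambda>u. indicator K (translate S (r *\<^sub>R u)) :: real"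
 have m1: "?ind \<in> borel_measurable borel"
  using measurable_compose[OF translate_measurable borel_measurable_indicator[OF borel_of_closed[OF K]]] .
 have m2: "(\<lambda>u. indicator ((\<lambda>T. translate T v) ` K) (translate S (r *\<^sub>R u)) :: real) \<in> borel_measurable borel"
  using measurable_compose[OF translate_measurable borel_measurable_indicator[OF borel_of_closed[OF h]]] .
 have im: "indicator ((\<lambda>T. translate T v) ` K) (translate S (r *\<^sub>R (u + (1 / r) *\<^sub>R v))) = ?ind u" for u
 proof -
  have "translate S (r *\<^sub>R (u + (1 / r) *\<^sub>R v)) = translate (translate S (r *\<^sub>R u)) v"
   using r by (simp add: translate_add scaleR_add_right)
  moreover have "translate P v \<in> (\<lambda>T. translate T v) ` K \<longleftrightarrow> P \<in> K" for P :: "(real ^ 'n, 'l) config"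
   by (metis (no_types, lifting) image_iff translate_cancel(1))
  ultimately show ?thesis by (simp add: indicator_def)
 qed
 have i1: "integrable lborel (\<lambda>u. bump_prod \<phi> u * ?ind u)"
  by (rule bump_times_integrable[OF \<phi>(1) m1, of 1]) (simp add: indicator_def)
 have i2: "integrable lborel (\<lambda>u. bump_prod \<phi> (u + (1 / r) *\<^sub>R v) * ?ind u)"
 proof -
  have "integrable lborel (\<lambda>u. bump_prod \<phi> u * ?ind (u - (1 / r) *\<^sub>R v))"
   by (rule bump_times_integrable[OF \<phi>(1), of _ 1]) (use m1 in \<open>auto simp: indicator_def\<close>)
  then have "integrable (distr lborel borel ((+) ((1 / r) *\<^sub>R v))) (\<lambda>u. bump_prod \<phi> u * ?ind (u - (1 / r) *\<^sub>R v))"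
   by (simp add: lborel_distr_plus)
  then show ?thesis using m1 \<phi>(1) by (subst (asm) integrable_distr_eq) (auto simp: add.commute)
 qed
 have "measure ?m ((\<lambda>T. translate T v) ` K) = (\<integral>u. bump_prod \<phi> (u + (1 / r) *\<^sub>R v) * ?ind u \<partial>lborel)"
  unfolding meas[OF h] using m2 \<phi>(1) by (subst integral_lborel_shift[where c = "(1 / r) *\<^sub>R v"]) (auto simp: im)
 then have "measure ?m ((\<lambda>T. translate T v) ` K) - measure ?m K =
   (\<integral>u. (bump_prod \<phi> (u + (1 / r) *\<^sub>R v) - bump_prod \<phi> u) * ?ind u \<partial>lborel)"
  unfolding meas[OF K] using Bochner_Integration.integral_diff[OF i2 i1] by (simp add: left_diff_distrib)
 also have "\<bar>...\<bar> <= (\<integral>u. \<bar>bump_prod \<phi> (u + (1 / r) *\<^sub>R v) - bump_prod \<phi> u\<bar> \<partial>lborel)"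
 proof -
  have ib: "integrable lborel (\<lambda>u. bump_prod \<phi> (u + (1 / r) *\<^sub>R v))"
  proof -
   have "integrable (distr lborel borel ((+) ((1 / r) *\<^sub>R v))) (bump_prod \<phi>)"
    using integral_bump_lborel(2) by (simp add: lborel_distr_plus)
   then show ?thesis using \<phi>(1) by (subst (asm) integrable_distr_eq) (auto simp: add.commute)
  qed
  have "norm (\<integral>u. (bump_prod \<phi> (u + (1 / r) *\<^sub>R v) - bump_prod \<phi> u) * ?ind u \<partial>lborel) <=
   (\<integral>u. norm ((bump_prod \<phi> (u + (1 / r) *\<^sub>R v) - bump_prod \<phi> u) * ?ind u) \<partial>lborel)"
   by (rule integral_norm_bound)
  also have "... <= (\<integral>u. \<bar>bump_prod \<phi> (u + (1 / r) *\<^sub>R v) - bump_prod \<phi> u\<bar> \<partial>lborel)"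
  proof (rule integral_mono)
   show "integrable lborel (\<lambda>u. norm ((bump_prod \<phi> (u + (1 / r) *\<^sub>R v) - bump_prod \<phi> u) * ?ind u))"
    using Bochner_Integration.integrable_diff[OF i2 i1] by (intro integrable_norm) (simp add: left_diff_distrib)
   show "integrable lborel (\<lambda>u. \<bar>bump_prod \<phi> (u + (1 / r) *\<^sub>R v) - bump_prod \<phi> u\<bar>)"
    using Bochner_Integration.integrable_diff[OF ib integral_bump_lborel(2)] by (rule integrable_abs)
  qed (simp add: indicator_def)
  finally show ?thesis by simp
 qed
 finally show ?thesis .
qed

end

text \<open>
 If the averages around base points \<open>S n\<close> stayed away from the integral, a weak limit of the
 corresponding orbit measures would be an invariant probability other than \<open>\<mu>\<close>. Letting the base
 point vary with n gives uniformity over the space, and treating finitely many functions together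
 gives one scale for all of them.
\<close>

theorem uniform_ergodic_averages:
 fixes \<Omega> :: "(real ^ 'n::finite, 'l) config set" and \<phi> :: "'n => real => real"
  and f :: "'k => (real ^ 'n, 'l) config => real"
 assumes \<Omega>: "tiling_space L dL \<Omega>" and ue: "uniquely_ergodic dL \<Omega>" and \<mu>: "invariant_probability dL \<Omega> \<mu>"
  and \<phi>: "bumps \<phi>" "!!u. 0 <= bump_prod \<phi> u" "integral (cbox (- 1) 1) (bump_prod \<phi>) = 1"
  and K: "finite K" "!!k. k \<in> K ==> continuous_map (config_topology dL \<Omega>) euclidean (f k)" and e: "0 < e"
 shows "\<exists>n::nat. \<forall>S\<in>\<Omega>. \<forall>k\<in>K.
  \<bar>integral (cbox (- 1) 1) (\<lambda>u. bump_prod \<phi> u * f k (translate S (real (Suc n) *\<^sub>R u))) - (\<integral>T. f k T \<partial>\<mu>)\<bar> <= e"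
proof (rule ccontr)
 let ?X = "config_topology dL \<Omega>"
 define P where "P n S k \<longleftrightarrow>
  \<bar>integral (cbox (- 1) 1) (\<lambda>u. bump_prod \<phi> u * f k (translate S (real (Suc n) *\<^sub>R u))) - (\<integral>T. f k T \<partial>\<mu>)\<bar> <= e"
  for n S k
 assume "\<not> ?thesis"
 then have "\<forall>n. \<exists>S\<in>\<Omega>. \<exists>k\<in>K. \<not> P n S k" unfolding P_def by blast
 then obtain S k where Sk: "!!n. S n \<in> \<Omega>" "!!n. k n \<in> K" "!!n. \<not> P n (S n) (k n)" by metis
 define m where "m n = orbit_measure \<phi> (real (Suc n)) dL \<Omega> (S n)" for n
 note M = tiling_space_Metric_space[OF \<Omega>]
 have X: "compact_space ?X" "normal_space ?X"
  using tiling_space_compact[OF \<Omega>] Metric_space.normal_space_mtopology[OF M] unfolding config_topology_def by auto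
 have m: "prob_space (m n)" "sets (m n) = sets (borel_of ?X)" for n
  unfolding m_def using prob_space_orbit_measure[OF \<Omega> Sk(1) \<phi>] sets_orbit_measure[OF \<Omega> Sk(1) \<phi>] by auto
 obtain F :: "nat filter" and \<nu> where F: "F ~= bot" "F <= sequentially"
  and \<nu>: "prob_space \<nu>" "sets \<nu> = sets (borel_of ?X)"
  and lim: "\<forall>g :: _ => real. continuous_map ?X euclidean g --> ((\<lambda>n. \<integral>x. g x \<partial>m n) \<longlongrightarrow> (\<integral>x. g x \<partial>\<nu>)) F"
  and inv: "\<forall>h B. homeomorphic_map ?X ?X h -->
    (\<forall>K. closedin ?X K --> (\<lambda>n. measure (m n) (h ` K) - measure (m n) K) \<longlonglongrightarrow> 0) -->
    B \<in> sets (borel_of ?X) --> h ` B \<in> sets (borel_of ?X) --> emeasure \<nu> (h ` B) = emeasure \<nu> B"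
  using weak_limit_of_probabilities[of ?X m, OF X m] by (elim exE conjE) (rule that)
 have "invariant_probability dL \<Omega> \<nu>" unfolding invariant_probability_def
 proof (intro conjI allI ballI)
  show "sets \<nu> = sets (sigma \<Omega> {U. openin ?X U})"
   using \<nu>(2) unfolding borel_of_def topspace_config_topology[OF \<Omega>] .
  fix x B assume B: "B \<in> sets \<nu>"
  let ?h = "\<lambda>T :: (real ^ 'n, 'l) config. translate T x"
  have hB: "?h ` B \<in> sets (borel_of ?X)"
  proof -
   have "B \<subseteq> \<Omega>" using sets.sets_into_space[of B "borel_of ?X"] B \<nu>(2) topspace_config_topology[OF \<Omega>] by auto
   then have "?h ` B = (\<lambda>T. translate T (- x)) -` B \<inter> space (borel_of ?X)"
    using tiling_space_translate[OF \<Omega>] topspace_config_topology[OF \<Omega>]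
    by (auto simp: translate_add) (metis image_eqI translate_cancel(2))
   moreover have "(\<lambda>T. translate T (- x)) \<in> measurable (borel_of ?X) (borel_of ?X)"
    using translate_homeomorphic_map[OF \<Omega>, of "- x"] homeomorphic_imp_continuous_map continuous_map_measurable by blast
   ultimately show ?thesis using B unfolding \<nu>(2) by (metis measurable_sets)
  qed
  have "(\<lambda>n. measure (m n) (?h ` K) - measure (m n) K) \<longlonglongrightarrow> 0" if K: "closedin ?X K" for K
  proof (rule Lim_null_comparison[OF always_eventually bump_translation_L1[OF \<phi>(1), of x]], rule allI)
   show "norm (measure (m n) (?h ` K) - measure (m n) K) <=
    (\<integral>u. \<bar>bump_prod \<phi> (u + (1 / real (Suc n)) *\<^sub>R x) - bump_prod \<phi> u\<bar> \<partial>lborel)" for n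
    unfolding m_def using orbit_measure_translate_estimate[OF \<Omega> Sk(1) \<phi> K, of "real (Suc n)"] by simp
  qed
  then show "emeasure \<nu> (?h ` B) = emeasure \<nu> B"
   using inv translate_homeomorphic_map[OF \<Omega>] hB B \<nu>(2) by blast
 qed (rule \<nu>)
 then have "\<nu> = \<mu>" using ue \<mu> unfolding uniquely_ergodic_def by blast
 have "eventually (\<lambda>n. \<forall>k\<in>K. dist (\<integral>T. f k T \<partial>m n) (\<integral>T. f k T \<partial>\<mu>) < e) F"
  using K lim e unfolding \<open>\<nu> = \<mu>\<close> by (intro eventually_ball_finite ballI tendstoD) auto
 then obtain n where "\<forall>k\<in>K. dist (\<integral>T. f k T \<partial>m n) (\<integral>T. f k T \<partial>\<mu>) < e"
  using F(1) eventually_happens' by blast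
 then have "dist (\<integral>T. f (k n) T \<partial>m n) (\<integral>T. f (k n) T \<partial>\<mu>) < e" using Sk(2) by blast
 then show False
  using Sk(3)[of n, unfolded P_def] integral_orbit_measure_continuous[OF \<Omega> Sk(1)[of n] \<phi> K(2)[OF Sk(2)[of n]], of "real (Suc n)"]
  unfolding m_def dist_real_def by simp
qed

section \<open>Asymptotic linearity and near-linear smoothings\<close>

text \<open>
 The vector v is the end of an axis-parallel path. Unit steps along it contribute at most e each,
 and on each of its legs a fractional remainder contributes at most B.
\<close>

lemma additive_cocycle_growth:
 fixes \<gamma> :: "(real ^ 'n::finite, 'l) cochain"
 assumes \<Omega>: "!!T x. T \<in> \<Omega> ==> translate T x \<in> \<Omega>"
  and add: "!!T x y. T \<in> \<Omega> ==> \<gamma> T (x + y) = \<gamma> T x + \<gamma> (translate T x) y"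
  and unit: "!!T j. T \<in> \<Omega> ==> norm (\<gamma> T (axis j 1)) <= e"
  and small: "!!T x. T \<in> \<Omega> ==> norm x <= 1 ==> norm (\<gamma> T x) <= B"
  and e: "0 <= e" and T: "T \<in> \<Omega>"
 shows "norm (\<gamma> T v) <= real CARD('n) * (e * norm v + B)"
proof -
 have nat: "norm (\<gamma> T (real k *\<^sub>R axis j 1)) <= real k * e" if "T \<in> \<Omega>" for T k j
  using that
 proof (induction k)
  case 0
  have "\<gamma> T 0 = 0" using add[OF 0, of 0 0] by simp
  then show ?case by simp
 next
  case (Suc k)
  have "\<gamma> T (real (Suc k) *\<^sub>R axis j 1) = \<gamma> T (real k *\<^sub>R axis j 1) + \<gamma> (translate T (real k *\<^sub>R axis j 1)) (axis j 1)"
   using add[OF Suc.prems, of "real k *\<^sub>R axis j 1" "axis j 1"] by (simp add: algebra_simps)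
  then show ?case
   using Suc.IH[OF Suc.prems] unit[OF \<Omega>[OF Suc.prems], of "real k *\<^sub>R axis j 1" j]
    norm_triangle_ineq[of "\<gamma> T (real k *\<^sub>R axis j 1)" "\<gamma> (translate T (real k *\<^sub>R axis j 1)) (axis j 1)"]
   by (simp add: algebra_simps)
 qed
 have pos: "norm (\<gamma> T (t *\<^sub>R axis j 1)) <= t * e + B" if T: "T \<in> \<Omega>" and t: "0 <= t" for T t j
 proof -
  define k where "k = nat \<lfloor>t\<rfloor>"
  have k: "real k <= t" "t - real k <= 1" unfolding k_def using t by linarith+
  have "\<gamma> T (t *\<^sub>R axis j 1) = \<gamma> T (real k *\<^sub>R axis j 1) + \<gamma> (translate T (real k *\<^sub>R axis j 1)) ((t - real k) *\<^sub>R axis j 1)"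
   using add[OF T, of "real k *\<^sub>R axis j 1" "(t - real k) *\<^sub>R axis j 1"] by (simp flip: scaleR_add_left)
  moreover have "norm (\<gamma> T (real k *\<^sub>R axis j 1)) <= t * e"
   using nat[OF T, of k j] mult_right_mono[OF k(1) e] by linarith
  moreover have "norm (\<gamma> (translate T (real k *\<^sub>R axis j 1)) ((t - real k) *\<^sub>R axis j 1)) <= B"
   using k by (intro small \<Omega> T) simp
  ultimately show ?thesis by (metis add_mono norm_triangle_le)
 qed
 have axis: "norm (\<gamma> T (t *\<^sub>R axis j 1)) <= \<bar>t\<bar> * e + B" if T: "T \<in> \<Omega>" for T t j
 proof (cases "0 <= t")
  case False
  let ?x = "t *\<^sub>R axis j 1 :: real ^ 'n"
  have "\<gamma> T 0 = 0" using add[OF T, of 0 0] by simp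
  then have "\<gamma> T ?x = - \<gamma> (translate T ?x) ((- t) *\<^sub>R axis j 1)"
   using add[OF T, of ?x "(- t) *\<^sub>R axis j 1"] by (simp add: eq_neg_iff_add_eq_0)
  then show ?thesis using pos[OF \<Omega>[OF T], of "- t" ?x j] False by simp
 qed (use pos[OF T, of t j] in simp)
 have B: "0 <= B" using small[OF T, of 0] norm_ge_zero[of "\<gamma> T 0"] by (simp del: norm_ge_zero)
 have sum: "norm (\<gamma> T (\<Sum>j\<in>J. (v $ j) *\<^sub>R axis j 1)) <= real (card J) * (e * norm v + B)" if "finite J" for J
  using that
 proof (induction J rule: finite_induct)
  case empty
  have "\<gamma> T 0 = 0" using add[OF T, of 0 0] by simp
  then show ?case by simp
 next
  case (insert j J)
  let ?y = "\<Sum>j\<in>J. (v $ j) *\<^sub>R axis j 1 :: real ^ 'n"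
  have "\<gamma> T (\<Sum>j\<in>insert j J. (v $ j) *\<^sub>R axis j 1) = \<gamma> T ?y + \<gamma> (translate T ?y) ((v $ j) *\<^sub>R axis j 1)"
   using add[OF T, of ?y "(v $ j) *\<^sub>R axis j 1"] insert.hyps by (simp add: add.commute)
  moreover have "norm (\<gamma> (translate T ?y) ((v $ j) *\<^sub>R axis j 1)) <= e * norm v + B"
   using axis[OF \<Omega>[OF T], of ?y "v $ j" j] mult_left_mono[OF component_le_norm_cart[of v j] e]
   by (simp add: mult.commute)
  ultimately show ?case
   using insert norm_triangle_ineq[of "\<gamma> T ?y" "\<gamma> (translate T ?y) ((v $ j) *\<^sub>R axis j 1)"]
   by (simp add: algebra_simps)
 qed
 have "(\<Sum>j\<in>UNIV. (v $ j) *\<^sub>R axis j 1) = v"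
  using basis_expansion[of v] by (simp add: scalar_mult_eq_scaleR)
 then show ?thesis using sum[of UNIV] by simp
qed

lemma smoothing_bounded:
 assumes \<Omega>: "tiling_space L dL \<Omega>" and \<beta>: "weak_cocycle dL \<Omega> \<beta>" and \<phi>: "bumps \<phi>"
 shows "\<exists>B>0. \<forall>T\<in>\<Omega>. norm (smoothing \<phi> r \<beta> T) <= B"
proof -
 have "compactin (config_topology dL \<Omega>) \<Omega>"
  using tiling_space_compact[OF \<Omega>] topspace_config_topology[OF \<Omega>] unfolding compact_space_def config_topology_def by simp
 from image_compactin[OF this smoothing_continuous_map[OF assms, of r]]
 have "compact (smoothing \<phi> r \<beta> ` \<Omega>)" by simp
 then show ?thesis using compact_imp_bounded bounded_pos by (metis imageI)
qed

text \<open>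
 Read in the other order, a component of the smoothed cocycle is an orbit average of the function
 \<open>S \<mapsto> \<beta> S v\<close>.
\<close>

lemma smooth_cocycle_component:
 assumes \<Omega>: "tiling_space L dL \<Omega>" and \<beta>: "weak_cocycle dL \<Omega> \<beta>" and \<phi>: "bumps \<phi>"
  and I: "integral (cbox (- 1) 1) (bump_prod \<phi>) = 1" and T: "T \<in> \<Omega>"
 shows "smooth_cocycle \<phi> r \<beta> T v $ i = integral (cbox (- 1) 1) (\<lambda>u. bump_prod \<phi> u * \<beta> (translate T (r *\<^sub>R u)) v $ i)"
proof -
 note c = continuous_bump_prod[OF \<phi>, of _ "\<lambda>x. x"]
 note Tv = tiling_space_translate[OF \<Omega> T]
 have i: "(\<lambda>u. bump_prod \<phi> u * \<beta> S (r *\<^sub>R u) $ i) integrable_on cbox (- 1) 1" if "S \<in> \<Omega>" for S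
  by (intro integrable_continuous continuous_intros \<phi> weak_cocycle_dilated_continuous[OF \<Omega> \<beta> that])
 have i1: "(\<lambda>u. \<beta> T v $ i * bump_prod \<phi> u) integrable_on cbox (- 1) 1"
  by (intro integrable_continuous continuous_intros \<phi>)
 have eq: "\<beta> (translate T (r *\<^sub>R u)) v = \<beta> T v + \<beta> (translate T v) (r *\<^sub>R u) - \<beta> T (r *\<^sub>R u)" for u
  unfolding weak_cocycle_translate[OF \<beta> T] by (simp add: add.commute)
 have "bump_prod \<phi> u * \<beta> (translate T (r *\<^sub>R u)) v $ i =
   (\<beta> T v $ i * bump_prod \<phi> u + bump_prod \<phi> u * \<beta> (translate T v) (r *\<^sub>R u) $ i)
    - bump_prod \<phi> u * \<beta> T (r *\<^sub>R u) $ i" for u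
  unfolding eq by (simp add: algebra_simps)
 then have "integral (cbox (- 1) 1) (\<lambda>u. bump_prod \<phi> u * \<beta> (translate T (r *\<^sub>R u)) v $ i) =
   integral (cbox (- 1) 1) (\<lambda>u. (\<beta> T v $ i * bump_prod \<phi> u + bump_prod \<phi> u * \<beta> (translate T v) (r *\<^sub>R u) $ i)
    - bump_prod \<phi> u * \<beta> T (r *\<^sub>R u) $ i)"
  by (simp only:)
 also have "... = \<beta> T v $ i + smoothing \<phi> r \<beta> (translate T v) $ i - smoothing \<phi> r \<beta> T $ i"
  unfolding integral_diff[OF integrable_add[OF i1 i[OF Tv]] i[OF T]] integral_add[OF i1 i[OF Tv]]
  by (simp add: I smoothing_def)
 finally show ?thesis unfolding smooth_cocycle_def by simp
qed

text \<open>
 Smoothing at a large scale changes the cocycle by a bounded amount and brings its values on the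
 basis vectors uniformly close to their means. Following axis-parallel unit steps, the errors grow at
 most linearly with a small slope.
\<close>

theorem cocycle_growth:
 fixes \<Omega> :: "(real ^ 'n::finite, 'l) config set"
 assumes \<Omega>: "tiling_space L dL \<Omega>" and ue: "uniquely_ergodic dL \<Omega>" and \<mu>: "invariant_probability dL \<Omega> \<mu>"
  and \<beta>: "weak_cocycle dL \<Omega> \<beta>" and e: "0 < e"
 shows "\<exists>B. \<forall>T\<in>\<Omega>. \<forall>v. norm (\<beta> T v - (\<chi> i j. \<integral>T. \<beta> T (axis j 1) $ i \<partial>\<mu>) *v v) <= e * norm v + B"
proof -
 obtain \<phi> :: "'n => real => real" where \<phi>: "bumps \<phi>" "!!u. 0 <= bump_prod \<phi> u" "integral (cbox (- 1) 1) (bump_prod \<phi>) = 1"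
  using bump_density_exists by blast
 define C :: "real ^ 'n ^ 'n" where "C = (\<chi> i j. \<integral>T. \<beta> T (axis j 1) $ i \<partial>\<mu>)"
 define N where "N = real CARD('n)"
 have N: "N > 0" unfolding N_def by simp
 \<comment> \<open>The N entries of a column and the N axis-parallel legs of a path each cost a factor N.\<close>
 define a where "a = e / (N * N)"
 have a: "a > 0" unfolding a_def using e N by simp
 have cont: "continuous_map (config_topology dL \<Omega>) euclidean (\<lambda>T. \<beta> T (axis (snd k) 1) $ fst k)" for k :: "'n \<times> 'n"
  unfolding config_topology_def continuous_map_metric_euclidean_iff[OF tiling_space_Metric_space[OF \<Omega>]]
 proof (intro ballI allI impI)
  fix T and b :: real assume T: "T \<in> \<Omega>" and b: "0 < b"
  obtain d where d: "d > 0" "!!T' x'. T' \<in> \<Omega> ==> config_dist dL T T' < d ==> dist (axis (snd k) 1) x' < d ==>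
    dist (\<beta> T (axis (snd k) 1)) (\<beta> T' x') < b"
   using weak_cocycle_continuous[OF \<Omega> \<beta> T b, of "axis (snd k) 1"] by blast
  show "\<exists>d>0. \<forall>T'\<in>\<Omega>. config_dist dL T T' < d --> dist (\<beta> T (axis (snd k) 1) $ fst k) (\<beta> T' (axis (snd k) 1) $ fst k) < b"
  proof (intro exI[of _ d] conjI ballI impI)
   fix T' assume "T' \<in> \<Omega>" "config_dist dL T T' < d"
   then have "dist (\<beta> T (axis (snd k) 1)) (\<beta> T' (axis (snd k) 1)) < b" using d by simp
   then show "dist (\<beta> T (axis (snd k) 1) $ fst k) (\<beta> T' (axis (snd k) 1) $ fst k) < b"
    using dist_vec_nth_le order_le_less_trans by blast
  qed (rule d)
 qed
 obtain n :: nat where n: "\<forall>S\<in>\<Omega>. \<forall>k\<in>UNIV.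
  \<bar>integral (cbox (- 1) 1) (\<lambda>u. bump_prod \<phi> u * \<beta> (translate S (real (Suc n) *\<^sub>R u)) (axis (snd k) 1) $ fst k)
   - (\<integral>T. \<beta> T (axis (snd k) 1) $ fst k \<partial>\<mu>)\<bar> <= a"
  using uniform_ergodic_averages[OF \<Omega> ue \<mu> \<phi>, of UNIV "\<lambda>k T. \<beta> T (axis (snd k) 1) $ fst k" a, OF finite cont a] by blast
 define r where "r = real (Suc n)"
 define \<gamma> where "\<gamma> T v = smooth_cocycle \<phi> r \<beta> T v - C *v v" for T v
 obtain B1 where B1: "B1 > 0" "!!T. T \<in> \<Omega> ==> norm (smoothing \<phi> r \<beta> T) <= B1"
  using smoothing_bounded[OF \<Omega> \<beta> \<phi>(1)] by blast
 obtain B2 where B2: "B2 > 0" "!!T x. T \<in> \<Omega> ==> norm x <= 1 ==> norm (\<beta> T x) <= B2"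
  using weak_cocycle_bounded[OF \<Omega> \<beta>, of 1] by blast
 obtain c where c: "c > 0" "!!v. norm (C *v v) <= norm v * c"
  using bounded_linear.pos_bounded[OF matrix_vector_mul_bounded_linear[of C]] by auto
 have diff: "norm (smooth_cocycle \<phi> r \<beta> T v - \<beta> T v) <= 2 * B1" if "T \<in> \<Omega>" for T v
  using B1(2)[OF that] B1(2)[OF tiling_space_translate[OF \<Omega> that], of v] unfolding smooth_cocycle_def
  by norm
 have \<gamma>: "norm (\<gamma> T v) <= N * (N * a * norm v + (2 * B1 + B2 + c))" if T: "T \<in> \<Omega>" for T v
  unfolding N_def
 proof (rule additive_cocycle_growth[of \<Omega> \<gamma>, OF tiling_space_translate[OF \<Omega>] _ _ _ _ T])
  fix T x y assume T: "T \<in> \<Omega>"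
  show "\<gamma> T (x + y) = \<gamma> T x + \<gamma> (translate T x) y"
   unfolding \<gamma>_def smooth_cocycle_def weak_cocycle_add[OF \<beta> T] matrix_vector_right_distrib
   by (simp add: translate_add)
 next
  fix T j assume T: "T \<in> \<Omega>"
  have "\<bar>\<gamma> T (axis j 1) $ i\<bar> <= a" for i
  proof -
   have "(C *v axis j 1) $ i = C $ i $ j" by (simp add: matrix_vector_mult_basis column_def)
   then show ?thesis
    using n[rule_format, OF T, of "(i, j)"] unfolding \<gamma>_def r_def C_def
    by (simp add: smooth_cocycle_component[OF \<Omega> \<beta> \<phi>(1,3) T])
  qed
  then have "norm (\<gamma> T (axis j 1)) <= (\<Sum>i\<in>(UNIV :: 'n set). a)"
   by (intro order_trans[OF norm_vec_le_sum] sum_mono)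
  then show "norm (\<gamma> T (axis j 1)) <= real CARD('n) * a" by simp
 next
  fix T x assume T: "T \<in> \<Omega>" and x: "norm (x :: real ^ 'n) <= 1"
  have "norm (C *v x) <= c" using c(2)[of x] mult_right_mono[OF x, of c] c(1) by (simp only: mult_1) linarith
  moreover have "norm (\<gamma> T x) <= norm (smooth_cocycle \<phi> r \<beta> T x - \<beta> T x) + norm (\<beta> T x) + norm (C *v x)"
   unfolding \<gamma>_def by norm
  ultimately show "norm (\<gamma> T x) <= 2 * B1 + B2 + c"
   using diff[OF T, of x] B2(2)[OF T x] by linarith
 next
  show "0 <= real CARD('n) * a" using a by (intro mult_nonneg_nonneg) auto
 qed
 show ?thesis
 proof (intro exI[of _ "N * (2 * B1 + B2 + c) + 2 * B1"] ballI allI)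
  fix T and v :: "real ^ 'n" assume T: "T \<in> \<Omega>"
  have "N * (N * a * norm v + (2 * B1 + B2 + c)) = e * norm v + N * (2 * B1 + B2 + c)"
   unfolding a_def using N by (simp add: algebra_simps)
  then have g: "norm (\<gamma> T v) <= e * norm v + N * (2 * B1 + B2 + c)" using \<gamma>[OF T, of v] by simp
  show "norm (\<beta> T v - (\<chi> i j. \<integral>T. \<beta> T (axis j 1) $ i \<partial>\<mu>) *v v) <= e * norm v + (N * (2 * B1 + B2 + c) + 2 * B1)"
  proof -
   have "norm (\<beta> T v - C *v v) <= norm (\<gamma> T v) + norm (smooth_cocycle \<phi> r \<beta> T v - \<beta> T v)"
    unfolding \<gamma>_def by norm
   then show ?thesis unfolding C_def[symmetric] using diff[OF T, of v] g by linarith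
  qed
 qed
qed

lemma linear_weak_cocycle:
 fixes \<Omega> :: "(real ^ 'n::finite, 'l) config set" and C :: "real ^ 'n ^ 'n"
 assumes \<Omega>: "tiling_space L dL \<Omega>"
 shows "weak_cocycle dL \<Omega> (\<lambda>_ v. C *v v)"
 unfolding weak_cocycle_def config_topology_def continuous_map_metric_times_euclidean_iff[OF tiling_space_Metric_space[OF \<Omega>]]
proof (intro conjI ballI allI impI)
 fix x and e :: real assume e: "0 < e"
 have "isCont (\<lambda>v. C *v v) x"
  by (rule linear_continuous_at) (rule matrix_vector_mul_bounded_linear)
 then obtain d where "d > 0" "!!x'. dist x' x < d ==> dist (C *v x') (C *v x) < e"
  using e unfolding continuous_at_eps_delta by blast
 then show "\<exists>\<delta>>0. \<forall>T'\<in>\<Omega>. \<forall>x'. config_dist dL T T' < \<delta> --> dist x x' < \<delta> --> dist (C *v x) (C *v x') < e" for T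
  by (intro exI[of _ d]) (auto simp: dist_commute)
qed (simp add: matrix_vector_right_distrib)

text \<open>A linear cocycle is its own smoothing, so the derivative of its smoothing is the linear map itself.\<close>

lemma smooth_deriv_linear:
 fixes \<Omega> :: "(real ^ 'n::finite, 'l) config set" and C :: "real ^ 'n ^ 'n"
 assumes \<Omega>: "tiling_space L dL \<Omega>" and \<phi>: "bumps \<phi>" "integral (cbox (- 1) 1) (bump_prod \<phi>) = 1"
  and T: "T \<in> \<Omega>" and r: "r > 0"
 shows "smooth_deriv \<phi> r (\<lambda>_ v. C *v v) T = C"
proof -
 let ?\<beta> = "\<lambda>(_ :: (real ^ 'n, 'l) config) v. C *v v"
 have "smooth_cocycle \<phi> r ?\<beta> T = (\<lambda>v. C *v v)"
  unfolding smooth_cocycle_def smoothing_def by auto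
 then have "((\<lambda>v. C *v v) has_derivative (\<lambda>h. smooth_deriv \<phi> r ?\<beta> T *v h)) (at 0)"
  using smooth_cocycle_has_derivative[OF \<Omega> linear_weak_cocycle[OF \<Omega>] \<phi>(1) T r \<phi>(2), of C 0] by simp
 moreover have "((\<lambda>v. C *v v) has_derivative (\<lambda>h. C *v h)) (at 0)"
  by (rule bounded_linear_imp_has_derivative) (rule matrix_vector_mul_bounded_linear)
 ultimately have "(\<lambda>h. smooth_deriv \<phi> r ?\<beta> T *v h) = (\<lambda>h. C *v h)" by (rule has_derivative_unique)
 then show ?thesis by (simp add: matrix_eq fun_eq_iff)
qed

lemma norm_cbox_1: "u \<in> cbox (- 1) (1 :: real ^ 'n::finite) ==> norm u <= real CARD('n)"
proof -
 assume "u \<in> cbox (- 1) 1"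
 then have "\<bar>u $ i\<bar> <= 1" for i unfolding mem_box_cart by (auto simp: abs_le_iff minus_le_iff)
 then have "norm u <= (\<Sum>i\<in>(UNIV :: 'n set). 1)" by (intro order_trans[OF norm_vec_le_sum] sum_mono)
 then show ?thesis by simp
qed

lemma norm_matrix_vector_le:
 fixes M :: "real ^ 'n::finite ^ 'n"
 assumes "!!i j. \<bar>M $ i $ j\<bar> <= b"
 shows "norm (M *v h) <= real CARD('n) * real CARD('n) * b * norm h"
proof -
 have b: "0 <= b" using assms[of undefined undefined] by simp
 have "\<bar>(M *v h) $ i\<bar> <= real CARD('n) * (b * norm h)" for i
 proof -
  have "\<bar>(M *v h) $ i\<bar> <= (\<Sum>j\<in>UNIV. \<bar>M $ i $ j * h $ j\<bar>)"
   unfolding matrix_vector_mult_def by (simp add: sum_abs)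
  also have "... <= (\<Sum>j\<in>(UNIV :: 'n set). b * norm h)"
   unfolding abs_mult by (intro sum_mono mult_mono assms component_le_norm_cart b) auto
  finally show ?thesis by simp
 qed
 then have "norm (M *v h) <= (\<Sum>i\<in>(UNIV :: 'n set). real CARD('n) * (b * norm h))"
  by (intro order_trans[OF norm_vec_le_sum] sum_mono)
 then show ?thesis by (simp add: mult.assoc)
qed

text \<open>
 The deviation of the cocycle from C over a box of size r is at most \<open>b * (r * N) + B\<close>, and the
 derivative of the smoothing divides it by r. The slope b is chosen first and then r, each to
 contribute half of the permitted error to an entry of the matrix.
\<close>

lemma smooth_deriv_near_linear:
 fixes \<Omega> :: "(real ^ 'n::finite, 'l) config set" and C :: "real ^ 'n ^ 'n"
 assumes \<Omega>: "tiling_space L dL \<Omega>" and \<beta>: "weak_cocycle dL \<Omega> \<beta>"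
  and growth: "!!e. 0 < e ==> \<exists>B. \<forall>T\<in>\<Omega>. \<forall>v. norm (\<beta> T v - C *v v) <= e * norm v + B"
  and \<phi>: "bumps \<phi>" "integral (cbox (- 1) 1) (bump_prod \<phi>) = 1" and e: "0 < e"
 shows "\<exists>r>0. \<forall>T\<in>\<Omega>. \<forall>h. norm (smooth_deriv \<phi> r \<beta> T *v h - C *v h) <= e * norm h"
proof -
 define N where "N = real CARD('n)"
 have N: "N > 0" unfolding N_def by simp
 define I where "I = 1 + (\<Sum>j\<in>UNIV. integral (cbox (- 1) 1) (\<lambda>u. \<bar>bump_prod (bump_d j \<phi>) u\<bar>))"
 have Ij0: "0 <= integral (cbox (- 1) 1) (\<lambda>u. \<bar>bump_prod (bump_d j \<phi>) u\<bar>)" for j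
  by (rule integral_nonneg) (auto intro!: integrable_continuous continuous_intros bumps_d \<phi> continuous_bump_prod[of _ _ "\<lambda>x. x"])
 have Ij: "integral (cbox (- 1) 1) (\<lambda>u. \<bar>bump_prod (bump_d j \<phi>) u\<bar>) <= I" for j
  unfolding I_def using member_le_sum[of j UNIV "\<lambda>j. integral (cbox (- 1) 1) (\<lambda>u. \<bar>bump_prod (bump_d j \<phi>) u\<bar>)"] Ij0
  by fastforce
 have I: "I > 0" unfolding I_def using Ij0 by (simp add: add_pos_nonneg sum_nonneg)
 define a where "a = e / (N * N)"
 have a: "a > 0" unfolding a_def using e N by simp
 define b where "b = a / (2 * (I * N))"
 have b: "b > 0" unfolding b_def using a I N by simp
 obtain B where B: "!!T v. T \<in> \<Omega> ==> norm (\<beta> T v - C *v v) <= b * norm v + B" using growth[OF b] by blast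
 define r where "r = 2 * I * max B 1 / a"
 have r: "r > 0" unfolding r_def using I a by simp
 show ?thesis
 proof (intro exI[of _ r] conjI ballI allI)
  fix T h assume T: "T \<in> \<Omega>"
  let ?C = "\<lambda>(_ :: (real ^ 'n, 'l) config) v. C *v v"
  have "\<bar>(smooth_deriv \<phi> r \<beta> T - C) $ i $ j\<bar> <= a" for i j
  proof -
   note cont = weak_cocycle_dilated_continuous[OF \<Omega> \<beta> T] weak_cocycle_dilated_continuous[OF \<Omega> linear_weak_cocycle[OF \<Omega>] T]
   have "(smooth_deriv \<phi> r \<beta> T - C) $ i $ j = (smooth_deriv \<phi> r \<beta> T - smooth_deriv \<phi> r ?C T) $ i $ j"
    using smooth_deriv_linear[OF \<Omega> \<phi> T r] by simp
   also have "... = - (1 / r) * integral (cbox (- 1) 1) (\<lambda>u. bump_prod (bump_d j \<phi>) u * (\<beta> T (r *\<^sub>R u) $ i - (C *v (r *\<^sub>R u)) $ i))"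
    unfolding right_diff_distrib
    by (subst integral_diff)
     (auto simp: smooth_deriv_def smoothing_def algebra_simps intro!: integrable_continuous continuous_intros bumps_d \<phi> cont)
   also have "\<bar>...\<bar> <= (1 / r) * (I * (b * (r * N) + max B 1))"
   proof -
    have "\<bar>integral (cbox (- 1) 1) (\<lambda>u. bump_prod (bump_d j \<phi>) u * (\<beta> T (r *\<^sub>R u) $ i - (C *v (r *\<^sub>R u)) $ i))\<bar>
     <= integral (cbox (- 1) 1) (\<lambda>u. \<bar>bump_prod (bump_d j \<phi>) u\<bar>) * (b * (r * N) + max B 1)"
    proof (rule integral_bump_bound[OF bumps_d[OF \<phi>(1)]])
     show "continuous_on UNIV (\<lambda>u. \<beta> T (r *\<^sub>R u) $ i - (C *v (r *\<^sub>R u)) $ i)" by (intro continuous_intros cont)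
     fix u :: "real ^ 'n" assume u: "u \<in> cbox (- 1) 1"
     have "\<bar>\<beta> T (r *\<^sub>R u) $ i - (C *v (r *\<^sub>R u)) $ i\<bar> <= norm (\<beta> T (r *\<^sub>R u) - C *v (r *\<^sub>R u))"
      using component_le_norm_cart[of "\<beta> T (r *\<^sub>R u) - C *v (r *\<^sub>R u)" i] by simp
     also have "... <= b * norm (r *\<^sub>R u) + B" by (rule B[OF T])
     also have "... <= b * (r * N) + max B 1"
      using norm_cbox_1[OF u] r b unfolding N_def by (intro add_mono mult_left_mono) auto
     finally show "\<bar>\<beta> T (r *\<^sub>R u) $ i - (C *v (r *\<^sub>R u)) $ i\<bar> <= b * (r * N) + max B 1" .
    qed
    also have "... <= I * (b * (r * N) + max B 1)"
     using Ij[of j] b r N by (intro mult_right_mono) auto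
    finally show ?thesis using r by (simp add: abs_mult divide_right_mono)
   qed
   also have "... = a"
   proof -
    have "I * (b * N) = a / 2" unfolding b_def using I N by simp
    moreover have "I * max B 1 / r = a / 2" unfolding r_def using I a by (simp add: max_def)
    moreover have "(1 / r) * (I * (b * (r * N) + max B 1)) = I * (b * N) + I * max B 1 / r"
     using r by (simp add: field_simps)
    ultimately show ?thesis by simp
   qed
   finally show ?thesis .
  qed
  from norm_matrix_vector_le[OF this, of h]
  have "norm ((smooth_deriv \<phi> r \<beta> T - C) *v h) <= e * norm h"
   unfolding a_def N_def[symmetric] using N by simp
  then show "norm (smooth_deriv \<phi> r \<beta> T *v h - C *v h) <= e * norm h" by (simp add: matrix_vector_mult_diff_rdistrib)
 qed (rule r)
qed

text \<open>
 Composition with D turns A into a perturbation of the identity with Lipschitz constant 1/2. This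
 gives the lower bound, and the contraction principle solves \<open>A x = y\<close>.
\<close>

lemma near_linear_homeomorphism:
 fixes A :: "real ^ 'n::finite => real ^ 'n" and C D :: "real ^ 'n ^ 'n"
 assumes CD: "C ** D = mat 1" "D ** C = mat 1" and k: "0 < k" "!!v. norm (D *v v) <= k * norm v"
  and A: "!!x y. norm (A x - A y - C *v (x - y)) <= 1 / (2 * k) * norm (x - y)"
 shows "norm (x - y) <= 2 * k * norm (A x - A y)" "surj A" "homeomorphic_map euclidean euclidean A"
proof -
 have DC: "D *v (C *v v) = v" "C *v (D *v v) = v" for v
  using CD by (simp_all add: matrix_vector_mul_assoc matrix_vector_mul_lid)
 have lb: "norm (x - y) <= 2 * k * norm (A x - A y)" for x y
 proof -
  have "norm (x - y) <= k * norm (C *v (x - y))" using k(2)[of "C *v (x - y)"] by (simp add: DC)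
  also have "... <= k * (norm (A x - A y) + 1 / (2 * k) * norm (x - y))"
   using k(1) A[of x y] norm_triangle_sub[of "C *v (x - y)" "A x - A y"]
   by (intro mult_left_mono) (auto simp: norm_minus_commute)
  also have "... = k * norm (A x - A y) + norm (x - y) / 2" using k(1) by (simp add: field_simps)
  finally show ?thesis by simp
 qed
 then show "norm (x - y) <= 2 * k * norm (A x - A y)" .
 have inj: "inj A"
 proof (rule injI)
  fix x y assume "A x = A y"
  then show "x = y" using lb[of x y] by simp
 qed
 show surj: "surj A"
  unfolding surj_def
 proof
  fix y
  define G where "G x = x - D *v (A x - y)" for x
  have "dist (G x) (G x') <= (1/2) * dist x x'" for x x'
  proof -
   have "D *v (A x - A x') = D *v (A x - A x' - C *v (x - x')) + (x - x')"
    by (simp add: matrix_vector_mult_diff_distrib DC)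
   then have "G x - G x' = - (D *v (A x - A x' - C *v (x - x')))"
    unfolding G_def by (simp add: matrix_vector_mult_diff_distrib DC)
   then have "norm (G x - G x') <= k * norm (A x - A x' - C *v (x - x'))" using k(2) by (simp del: add_uminus_conv_diff)
   also have "... <= k * (1 / (2 * k) * norm (x - x'))" using k(1) A by (intro mult_left_mono) auto
   also have "... = (1/2) * norm (x - x')" using k(1) by simp
   finally show ?thesis by (simp add: dist_norm)
  qed
  then have "\<exists>!x. G x = x" by (intro banach_fix_type[of "1/2"]) auto
  then obtain x where "G x = x" by blast
  then have "C *v (D *v (A x - y)) = 0" unfolding G_def by simp
  then have "A x = y" unfolding DC by simp
  then show "\<exists>x. y = A x" by blast
 qed
 obtain c where c: "c > 0" "!!v. norm (C *v v) <= norm v * c"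
  using bounded_linear.pos_bounded[OF matrix_vector_mul_bounded_linear[of C]] by auto
 have up: "dist (A x) (A y) <= (c + 1 / (2 * k)) * dist x y" for x y
  using A[of x y] c(2)[of "x - y"] norm_triangle_sub[of "A x - A y" "C *v (x - y)"]
  by (simp add: dist_norm algebra_simps)
 have cA: "continuous_on UNIV A"
  by (rule lipschitz_on_continuous_on[of "c + 1 / (2 * k)"], rule lipschitz_onI) (use up c k in auto)
 have inv: "dist (inv A x) (inv A y) <= 2 * k * dist x y" for x y
  using lb[of "inv A x" "inv A y"] surj by (simp add: surj_f_inv_f dist_norm)
 have cI: "continuous_on UNIV (inv A)"
  by (rule lipschitz_on_continuous_on[of "2 * k"], rule lipschitz_onI) (use inv k in auto)
 have "homeomorphic_maps euclidean euclidean A (inv A)"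
  unfolding homeomorphic_maps_def using cA cI inj surj by (simp add: surj_f_inv_f)
 then show "homeomorphic_map euclidean euclidean A" by (rule homeomorphic_maps_imp_map)
qed

text \<open>The mean value inequality for the difference with the linear map.\<close>

lemma smooth_cocycle_near_linear:
 fixes \<Omega> :: "(real ^ 'n::finite, 'l) config set" and C :: "real ^ 'n ^ 'n"
 assumes \<Omega>: "tiling_space L dL \<Omega>" and \<beta>: "weak_cocycle dL \<Omega> \<beta>"
  and \<phi>: "bumps \<phi>" "integral (cbox (- 1) 1) (bump_prod \<phi>) = 1" and r: "r > 0"
  and near: "!!T h. T \<in> \<Omega> ==> norm (smooth_deriv \<phi> r \<beta> T *v h - C *v h) <= e * norm h"
  and T: "T \<in> \<Omega>"
 shows "norm (smooth_cocycle \<phi> r \<beta> T x - smooth_cocycle \<phi> r \<beta> T y - C *v (x - y)) <= e * norm (x - y)"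
proof -
 let ?f = "\<lambda>x. smooth_cocycle \<phi> r \<beta> T x - C *v x"
 have "norm (?f x - ?f y) <= e * norm (x - y)"
 proof (rule differentiable_bound[of UNIV ?f "\<lambda>x h. smooth_deriv \<phi> r \<beta> (translate T x) *v h - C *v h"])
  fix z
  have "((\<lambda>x. C *v x) has_derivative (\<lambda>h. C *v h)) (at z)"
   by (rule bounded_linear_imp_has_derivative) (rule matrix_vector_mul_bounded_linear)
  from has_derivative_diff[OF smooth_cocycle_has_derivative[OF \<Omega> \<beta> \<phi>(1) T r \<phi>(2), of z] this]
  show "(?f has_derivative (\<lambda>h. smooth_deriv \<phi> r \<beta> (translate T z) *v h - C *v h)) (at z within UNIV)" by simp
  show "onorm (\<lambda>h. smooth_deriv \<phi> r \<beta> (translate T z) *v h - C *v h) <= e"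
   by (rule onorm_le) (rule near[OF tiling_space_translate[OF \<Omega> T]])
 qed auto
 then show ?thesis by (simp add: matrix_vector_mult_diff_distrib algebra_simps)
qed

lemma form_integral_smooth_deriv:
 assumes \<Omega>: "tiling_space L dL \<Omega>" and \<beta>: "weak_cocycle dL \<Omega> \<beta>"
  and \<phi>: "bumps \<phi>" "integral (cbox (- 1) 1) (bump_prod \<phi>) = 1" and r: "r > 0" and T: "T \<in> \<Omega>"
 shows "form_integral (\<lambda>x. smooth_deriv \<phi> r \<beta> (translate T x)) x y = smooth_cocycle \<phi> r \<beta> T y - smooth_cocycle \<phi> r \<beta> T x"
proof -
 let ?A = "smooth_cocycle \<phi> r \<beta> T" and ?\<omega> = "\<lambda>x. smooth_deriv \<phi> r \<beta> (translate T x)"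
 have "((\<lambda>t. ?\<omega> (x + t *\<^sub>R (y - x)) *v (y - x)) has_integral ?A (x + 1 *\<^sub>R (y - x)) - ?A (x + 0 *\<^sub>R (y - x))) {0..1}"
 proof (rule fundamental_theorem_of_calculus)
  fix t :: real
  have "((\<lambda>t. x + t *\<^sub>R (y - x)) has_derivative (\<lambda>t. t *\<^sub>R (y - x))) (at t within {0..1})"
   by (auto intro!: derivative_eq_intros)
  from has_derivative_compose[OF this smooth_cocycle_has_derivative[OF \<Omega> \<beta> \<phi>(1) T r \<phi>(2)]]
  show "((\<lambda>t. ?A (x + t *\<^sub>R (y - x))) has_vector_derivative ?\<omega> (x + t *\<^sub>R (y - x)) *v (y - x)) (at t within {0..1})"
   unfolding has_vector_derivative_def by (simp add: matrix_vector_mult_scaleR)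
 qed simp
 then show ?thesis unfolding form_integral_def by (simp add: integral_unique)
qed

section \<open>Deformations of labelled Delone sets\<close>

text \<open>
 Associated sets are determined by the factor map, so uniform discreteness, equivariance and
 continuity are recovered from the target space.
\<close>

lemma associated_delone_setsD:
 fixes \<Omega> :: "('a::euclidean_space, 'l) config set"
 assumes "associated_delone_sets dL \<Omega> \<Lambda>" and \<Omega>: "tiling_space L dL \<Omega>" and T: "T \<in> \<Omega>"
 shows "uniform_discrete (\<Lambda> T)" "relatively_dense (\<Lambda> T)" "\<Lambda> (translate T x) = (\<lambda>p. p - x) ` \<Lambda> T"
  "0 < e ==> \<exists>\<delta>>0. \<forall>T'\<in>\<Omega>. config_dist dL T T' < \<delta> --> config_dist unit_dist (unlabelled (\<Lambda> T)) (unlabelled (\<Lambda> T')) < e"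
proof -
 obtain \<Omega>0 where \<Omega>0: "delone_space \<Omega>0" "factor_map dL \<Omega> unit_dist \<Omega>0 (\<lambda>T. unlabelled (\<Lambda> T))"
  using assms(1) unfolding associated_delone_sets_def by blast
 have mem: "unlabelled (\<Lambda> T) \<in> \<Omega>0" using \<Omega>0(2) T unfolding factor_map_def by blast
 then have "is_delone UNIV (unlabelled (\<Lambda> T))" using \<Omega>0(1) unfolding delone_space_def by blast
 then obtain P and lab :: "'a => unit" where P: "uniform_discrete P" "relatively_dense P" "unlabelled (\<Lambda> T) = labelled_points P lab"
  unfolding is_delone_def by blast
 have "lab = (\<lambda>_. ())" by (simp add: fun_eq_iff)
 then have "\<Lambda> T = P" using P(3) by simp
 then show "uniform_discrete (\<Lambda> T)" "relatively_dense (\<Lambda> T)" using P by auto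
 have "unlabelled (\<Lambda> (translate T x)) = translate (unlabelled (\<Lambda> T)) x"
  using \<Omega>0(2) T unfolding factor_map_def by blast
 then show "\<Lambda> (translate T x) = (\<lambda>p. p - x) ` \<Lambda> T" unfolding translate_labelled_points unlabelled_inject .
 show "\<exists>\<delta>>0. \<forall>T'\<in>\<Omega>. config_dist dL T T' < \<delta> --> config_dist unit_dist (unlabelled (\<Lambda> T)) (unlabelled (\<Lambda> T')) < e" if "0 < e"
 proof -
  have "Metric_space \<Omega>0 (config_dist unit_dist)"
   using \<Omega>0(1) tiling_space_Metric_space unfolding delone_space_def by blast
  from Metric_space.metric_continuous_map[OF tiling_space_Metric_space[OF \<Omega>] this, of "\<lambda>T. unlabelled (\<Lambda> T)"]
  have "\<forall>a\<in>\<Omega>. \<forall>e>0. \<exists>\<delta>>0. \<forall>x. x \<in> \<Omega> \<and> config_dist dL a x < \<delta> --> config_dist unit_dist (unlabelled (\<Lambda> a)) (unlabelled (\<Lambda> x)) < e"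
   using \<Omega>0(2) unfolding factor_map_def config_topology_def by simp
  from this[rule_format, OF T that] show ?thesis by blast
 qed
qed

text \<open>
 The points of an associated Delone set are moved by a cocycle that expands distances up to a
 constant factor, and keep labels that depend continuously and equivariantly on the configuration.
 Labels may be whole configurations or patches.
\<close>

locale deformation =
 fixes \<Omega> :: "('a::euclidean_space, 'l) config set" and L :: "'l set" and dL :: "'l => 'l => real"
  and \<Lambda> :: "('a, 'l) config => 'a set" and \<gamma> :: "('a, 'l) cochain" and K :: real
  and L' :: "'k set" and dL' :: "'k => 'k => real" and lab :: "('a, 'l) config => 'a => 'k"
 assumes \<Omega>: "tiling_space L dL \<Omega>" and \<Lambda>: "associated_delone_sets dL \<Omega> \<Lambda>"
  and \<gamma>: "weak_cocycle dL \<Omega> \<gamma>" and K: "0 < K"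
  and expand: "!!T x y. T \<in> \<Omega> ==> norm (x - y) <= K * norm (\<gamma> T x - \<gamma> T y)"
  and surj: "!!T. T \<in> \<Omega> ==> surj (\<gamma> T)"
  and L': "Metric_space L' dL'" "compact_space (Metric_space.mtopology L' dL')"
  and lab_mem: "!!T p. T \<in> \<Omega> ==> p \<in> \<Lambda> T ==> lab T p \<in> L'"
  and lab_translate: "!!T p x. T \<in> \<Omega> ==> p \<in> \<Lambda> T ==> lab (translate T x) (p - x) = lab T p"
  and lab_continuous: "!!T p e. T \<in> \<Omega> ==> p \<in> \<Lambda> T ==> 0 < e ==>
    \<exists>\<delta>>0. \<forall>T'\<in>\<Omega>. \<forall>p'\<in>\<Lambda> T'. config_dist dL T T' < \<delta> --> dist p p' < \<delta> --> dL' (lab T p) (lab T' p') < e"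
begin

definition deform :: "('a, 'l) config => ('a, 'k) config" where
 "deform T = (\<lambda>p. ({\<gamma> T p}, lab T p)) ` \<Lambda> T"

lemma inj_\<gamma>: "T \<in> \<Omega> ==> inj (\<gamma> T)"
proof (rule injI)
 fix x y assume "T \<in> \<Omega>" "\<gamma> T x = \<gamma> T y"
 then show "x = y" using expand[of T x y] by simp
qed

lemma deform_labelled_points:
 assumes "T \<in> \<Omega>" shows "deform T = labelled_points (\<gamma> T ` \<Lambda> T) (\<lambda>w. lab T (inv (\<gamma> T) w))"
 unfolding deform_def labelled_points_def image_image using inj_\<gamma>[OF assms] by simp

text \<open>
 Expansion keeps the points apart. They stay relatively dense because the cocycle is onto and, by
 compactness, bounded over bounded sets uniformly in the configuration.
\<close>

lemma is_delone_deform: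
 assumes T: "T \<in> \<Omega>" shows "is_delone L' (deform T)"
proof -
 have "uniform_discrete (\<gamma> T ` \<Lambda> T)"
 proof -
  obtain e where e: "e > 0" "!!p q. p \<in> \<Lambda> T ==> q \<in> \<Lambda> T ==> dist p q < e ==> p = q"
   using associated_delone_setsD(1)[OF \<Lambda> \<Omega> T] unfolding uniform_discrete_def by blast
  have "\<gamma> T p = \<gamma> T q" if "p \<in> \<Lambda> T" "q \<in> \<Lambda> T" "dist (\<gamma> T p) (\<gamma> T q) < e / K" for p q
  proof -
   have "norm (p - q) <= K * norm (\<gamma> T p - \<gamma> T q)" by (rule expand[OF T])
   also have "... < e" using that(3) K by (simp add: dist_norm pos_less_divide_eq mult.commute)
   finally show ?thesis using e(2)[OF that(1,2)] by (simp add: dist_norm)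
  qed
  then show ?thesis unfolding uniform_discrete_def using e K by (intro exI[of _ "e / K"]) auto
 qed
 moreover have "relatively_dense (\<gamma> T ` \<Lambda> T)"
 proof -
  obtain R where R: "!!x. \<exists>p\<in>\<Lambda> T. dist x p <= R"
   using associated_delone_setsD(2)[OF \<Lambda> \<Omega> T] unfolding relatively_dense_def by blast
  obtain B where B: "!!S x. S \<in> \<Omega> ==> norm x <= R ==> norm (\<gamma> S x) <= B"
   using weak_cocycle_bounded[OF \<Omega> \<gamma>] by blast
  have "\<exists>w\<in>\<gamma> T ` \<Lambda> T. dist y w <= B" for y
  proof -
   obtain x where x: "y = \<gamma> T x" using surj[OF T] by (metis surjD)
   obtain p where p: "p \<in> \<Lambda> T" "dist x p <= R" using R by blast
   have "norm (\<gamma> (translate T x) (p - x)) <= B"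
    using p(2) by (intro B tiling_space_translate[OF \<Omega> T]) (simp add: dist_norm norm_minus_commute)
   then have "dist y (\<gamma> T p) <= B"
    unfolding x weak_cocycle_translate[OF \<gamma> T] by (simp add: dist_norm norm_minus_commute)
   then show ?thesis using p(1) by blast
  qed
  then show ?thesis unfolding relatively_dense_def by blast
 qed
 moreover have "(\<lambda>w. lab T (inv (\<gamma> T) w)) ` \<gamma> T ` \<Lambda> T \<subseteq> L'"
  using lab_mem[OF T] inj_\<gamma>[OF T] by auto
 ultimately show ?thesis unfolding is_delone_def deform_labelled_points[OF T] by blast
qed

text \<open>The cocycle equation says that seen from x the moved points are displaced by \<open>\<gamma> T x\<close>.\<close>

lemma deform_translate:
 assumes T: "T \<in> \<Omega>" shows "deform (translate T x) = translate (deform T) (\<gamma> T x)"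
 unfolding deform_def translate_eq_image associated_delone_setsD(3)[OF \<Lambda> \<Omega> T, unfolded translate_eq_image] image_image
 unfolding translate_eq_image[symmetric]
proof (rule image_cong)
 fix p assume "p \<in> \<Lambda> T"
 then show "({\<gamma> (translate T x) (p - x)}, lab (translate T x) (p - x)) = translate_tile (\<gamma> T x) ({\<gamma> T p}, lab T p)"
  unfolding translate_tile_def weak_cocycle_translate[OF \<gamma> T] by (simp add: lab_translate[OF T])
qed simp

text \<open>Expansion ensures that points moved close to the origin come from a bounded region.\<close>

lemma deform_continuous:
 assumes T: "T \<in> \<Omega>" and e: "0 < e"
 shows "\<exists>\<delta>>0. \<forall>T'\<in>\<Omega>. config_dist dL T T' < \<delta> --> config_dist dL' (deform T) (deform T') < e"
proof -
 let ?G = "\<lambda>T t. ({\<gamma> T (the_elem (fst t))}, lab T (the_elem (fst (t :: 'a set \<times> unit))))"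
 have d: "deform T = ?G T ` unlabelled (\<Lambda> T)" for T
  unfolding deform_def labelled_points_def by (simp add: image_image)
 show ?thesis unfolding d
 proof (rule tilewise_image_continuous[where \<Phi> = "\<lambda>T. unlabelled (\<Lambda> T)" and G = ?G, OF Metric_space_unit _ _ _ _ _ T e])
  fix S assume S: "S \<in> \<Omega>"
  show "locally_finite_config UNIV (unlabelled (\<Lambda> S))"
   by (rule is_delone_imp_locally_finite) (use associated_delone_setsD(1,2)[OF \<Lambda> \<Omega> S] in \<open>auto simp: is_delone_def\<close>)
  show "inj_on (?G S) (unlabelled (\<Lambda> S))"
   using inj_\<gamma>[OF S] unfolding labelled_points_def by (auto simp: inj_on_def)
 next
  fix S and e :: real assume "S \<in> \<Omega>" "0 < e"
  then show "\<exists>\<delta>>0. \<forall>S'\<in>\<Omega>. config_dist dL S S' < \<delta> --> config_dist unit_dist (unlabelled (\<Lambda> S)) (unlabelled (\<Lambda> S')) < e"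
   by (rule associated_delone_setsD(4)[OF \<Lambda> \<Omega>])
 next
  fix S and t :: "'a set \<times> unit" and e :: real assume S: "S \<in> \<Omega>" and t: "t \<in> unlabelled (\<Lambda> S)" and e: "0 < e"
  obtain p where p: "p \<in> \<Lambda> S" "t = ({p}, ())" using t unfolding labelled_points_def by auto
  obtain d1 where d1: "d1 > 0" "!!T' x'. T' \<in> \<Omega> ==> config_dist dL S T' < d1 ==> dist p x' < d1 ==> dist (\<gamma> S p) (\<gamma> T' x') < e"
   using weak_cocycle_continuous[OF \<Omega> \<gamma> S e, of p] by blast
  obtain d2 where d2: "d2 > 0" "!!T' p'. T' \<in> \<Omega> ==> p' \<in> \<Lambda> T' ==> config_dist dL S T' < d2 ==> dist p p' < d2 ==> dL' (lab S p) (lab T' p') < e"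
   using lab_continuous[OF S p(1) e] by blast
  show "\<exists>\<delta>>0. \<forall>S'\<in>\<Omega>. \<forall>t'\<in>unlabelled (\<Lambda> S'). config_dist dL S S' < \<delta> --> tile_dist unit_dist t t' < \<delta> -->
    tile_dist dL' (?G S t) (?G S' t') < e"
  proof (intro exI[of _ "min d1 d2"] conjI ballI impI)
   fix S' t' assume S': "S' \<in> \<Omega>" "t' \<in> unlabelled (\<Lambda> S')" "config_dist dL S S' < min d1 d2" "tile_dist unit_dist t t' < min d1 d2"
   obtain p' where p': "p' \<in> \<Lambda> S'" "t' = ({p'}, ())" using S'(2) unfolding labelled_points_def by auto
   have "dist p p' < min d1 d2" using S'(4) unfolding p p' tile_dist_def by simp
   then show "tile_dist dL' (?G S t) (?G S' t') < e"
    using d1(2)[OF S'(1)] d2(2)[OF S'(1) p'(1)] S'(3) unfolding p p' tile_dist_def by simp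
  qed (use d1 d2 in auto)
 next
  fix M
  show "\<exists>\<rho>. \<forall>S\<in>\<Omega>. \<forall>t\<in>unlabelled (\<Lambda> S). fst (?G S t) \<inter> ball 0 M ~= {} --> fst t \<inter> ball 0 \<rho> ~= {}"
  proof (intro exI[of _ "K * M"] ballI impI)
   fix S and t :: "'a set \<times> unit" assume S: "S \<in> \<Omega>" "t \<in> unlabelled (\<Lambda> S)" "fst (?G S t) \<inter> ball 0 M ~= {}"
   obtain p where p: "t = ({p}, ())" using S(2) unfolding labelled_points_def by auto
   have "norm (\<gamma> S p) < M" using S(3) unfolding p by simp
   moreover have "norm p <= K * norm (\<gamma> S p)" using expand[OF S(1), of p 0] by (simp add: weak_cocycle_0[OF \<gamma> S(1)])
   ultimately have "norm p < K * M" using K by (meson le_less_trans mult_strict_left_mono)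
   then show "fst t \<inter> ball 0 (K * M) ~= {}" unfolding p by simp
  qed
 qed
qed

lemma translate_deform_mem: "T \<in> \<Omega> ==> translate (deform T) w \<in> deform ` \<Omega>"
proof -
 assume T: "T \<in> \<Omega>"
 obtain x where "w = \<gamma> T x" using surj[OF T] by (metis surjD)
 then have "translate (deform T) w = deform (translate T x)" using deform_translate[OF T] by simp
 then show ?thesis using tiling_space_translate[OF \<Omega> T] by simp
qed

lemma tiling_space_deform:
 "continuous_map (config_topology dL \<Omega>) (config_topology dL' (deform ` \<Omega>)) deform"
 "tiling_space L' dL' (deform ` \<Omega>)"
 using tiling_space_delone_image[OF \<Omega> L' is_delone_deform translate_deform_mem deform_continuous] by blast+

lemma deform_orbit:
 assumes T: "T \<in> \<Omega>" shows "deform ` translation_orbit T = translation_orbit (deform T)"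
proof -
 have "deform ` translation_orbit T = (\<lambda>x. translate (deform T) (\<gamma> T x)) ` UNIV"
  unfolding translation_orbit_def image_image deform_translate[OF T] ..
 also have "... = translate (deform T) ` range (\<gamma> T)" by (simp add: image_image)
 finally show ?thesis unfolding translation_orbit_def surj[OF T] .
qed

text \<open>
 The image of the space is compact, hence closed among all labelled Delone sets, and it contains the
 orbit of the deformed element as a dense subset, because the original orbit is dense and the cocycle
 is onto.
\<close>

lemma orbit_closure_deform:
 assumes min: "minimal_space dL \<Omega>" and T: "T \<in> \<Omega>"
 shows "orbit_closure L' dL' (deform T) = deform ` \<Omega>"
proof -
 let ?D = "{S :: ('a, 'k) config. is_delone L' S}"
 let ?X = "config_topology dL \<Omega>" and ?Y = "config_topology dL' ?D"
 interpret M: Metric_space \<Omega> "config_dist dL" by (rule tiling_space_Metric_space[OF \<Omega>])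
 have D: "Metric_space ?D (config_dist dL')"
  by (rule Metric_space_config[OF L'(1)]) (simp add: is_delone_imp_locally_finite)
 interpret D: Metric_space ?D "config_dist dL'" by (rule D)
 have tX: "topspace ?X = \<Omega>" unfolding config_topology_def by simp
 have c: "continuous_map ?X ?Y deform"
  unfolding config_topology_def M.metric_continuous_map[OF D]
 proof (intro conjI ballI allI impI)
  show "deform ` \<Omega> \<subseteq> ?D" using is_delone_deform by auto
  fix S and e :: real assume "S \<in> \<Omega>" "0 < e"
  from deform_continuous[OF this] show "\<exists>\<delta>>0. \<forall>x. x \<in> \<Omega> \<and> config_dist dL S x < \<delta> -->
    config_dist dL' (deform S) (deform x) < e" by auto
 qed
 have "compactin ?Y (deform ` \<Omega>)"
  using image_compactin[OF _ c, of \<Omega>] tiling_space_compact[OF \<Omega>] tX unfolding compact_space_def config_topology_def by simp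
 then have cl: "closedin ?Y (deform ` \<Omega>)"
  using D.Hausdorff_space_mtopology unfolding config_topology_def by (rule compactin_imp_closedin[rotated])
 have "translation_orbit (deform T) \<subseteq> deform ` \<Omega>"
  unfolding translation_orbit_def using translate_deform_mem[OF T] by blast
 then have "?Y closure_of translation_orbit (deform T) \<subseteq> deform ` \<Omega>" using cl by (rule closure_of_minimal)
 moreover have "deform ` \<Omega> \<subseteq> ?Y closure_of translation_orbit (deform T)"
  using continuous_map_image_closure_subset[OF c, of "translation_orbit T"] min T
  unfolding minimal_space_def deform_orbit[OF T, symmetric] by auto
 ultimately show ?thesis unfolding orbit_closure_def by blast
qed

context
 assumes inj: "inj_on deform \<Omega>"
begin

lemma homeomorphic_map_deform:
 "homeomorphic_map (config_topology dL \<Omega>) (config_topology dL' (deform ` \<Omega>)) deform"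
proof (rule continuous_imp_homeomorphic_map[OF tiling_space_deform(1)])
 interpret M: Metric_space \<Omega> "config_dist dL" by (rule tiling_space_Metric_space[OF \<Omega>])
 interpret M': Metric_space "deform ` \<Omega>" "config_dist dL'" by (rule tiling_space_Metric_space[OF tiling_space_deform(2)])
 show "compact_space (config_topology dL \<Omega>)" using tiling_space_compact[OF \<Omega>] unfolding config_topology_def .
 show "Hausdorff_space (config_topology dL' (deform ` \<Omega>))" unfolding config_topology_def by (rule M'.Hausdorff_space_mtopology)
 show "deform ` topspace (config_topology dL \<Omega>) = topspace (config_topology dL' (deform ` \<Omega>))"
  "inj_on deform (topspace (config_topology dL \<Omega>))"
  unfolding config_topology_def using inj by auto
qed

lemma orbit_equivalence_deform: "orbit_equivalence dL \<Omega> dL' (deform ` \<Omega>) deform"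
 unfolding orbit_equivalence_def using homeomorphic_map_deform deform_orbit by blast

lemma aperiodic_deform:
 assumes "aperiodic \<Omega>" shows "aperiodic (deform ` \<Omega>)"
 unfolding aperiodic_def
proof (intro ballI allI impI)
 fix T' w assume "T' \<in> deform ` \<Omega>" and w: "translate T' w = T'"
 then obtain T where T: "T \<in> \<Omega>" "T' = deform T" by blast
 obtain x where x: "w = \<gamma> T x" using surj[OF T(1)] by (metis surjD)
 have "deform (translate T x) = deform T" using w unfolding T(2) x deform_translate[OF T(1)] .
 then have "translate T x = T" using inj tiling_space_translate[OF \<Omega> T(1)] T(1) by (meson inj_onD)
 then have "x = 0" using assms T(1) unfolding aperiodic_def by blast
 then show "w = 0" unfolding x using weak_cocycle_0[OF \<gamma> T(1)] by simp
qed

text \<open>Aperiodicity of the image makes the displacement unique.\<close>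

lemma orbit_displacement_deform:
 assumes "aperiodic \<Omega>" "T \<in> \<Omega>" shows "orbit_displacement deform T x = \<gamma> T x"
 unfolding orbit_displacement_def
proof (rule the_equality)
 show "deform (translate T x) = translate (deform T) (\<gamma> T x)" by (rule deform_translate[OF assms(2)])
 fix w assume "deform (translate T x) = translate (deform T) w"
 then have "translate (deform T) w = translate (deform T) (\<gamma> T x)" unfolding deform_translate[OF assms(2)] by simp
 then have "translate (translate (deform T) w) (- w) = translate (translate (deform T) (\<gamma> T x)) (- w)" by simp
 then have "translate (deform T) (\<gamma> T x - w) = deform T" by (simp add: translate_add)
 then show "w = \<gamma> T x" using aperiodic_deform[OF assms(1)] assms(2) unfolding aperiodic_def by force
qed

end

end

section \<open>Weak classes\<close>

text \<open>One scale r serves all elements of the space, since the growth estimate is uniform.\<close>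

lemma near_linear_smoothing:
 fixes \<Omega> :: "(real ^ 'n::finite, 'l) config set" and C :: "real ^ 'n ^ 'n"
 assumes \<Omega>: "tiling_space L dL \<Omega>" and \<beta>: "weak_cocycle dL \<Omega> \<beta>" and C: "invertible C"
  and growth: "!!e. 0 < e ==> \<exists>B. \<forall>T\<in>\<Omega>. \<forall>v. norm (\<beta> T v - C *v v) <= e * norm v + B"
 shows "\<exists>\<phi> r K. bumps \<phi> \<and> integral (cbox (- 1) 1) (bump_prod \<phi>) = 1 \<and> 0 < r \<and> 0 < K \<and>
  (\<forall>T\<in>\<Omega>. (\<forall>x y. norm (x - y) <= K * norm (smooth_cocycle \<phi> r \<beta> T x - smooth_cocycle \<phi> r \<beta> T y)) \<and>
    surj (smooth_cocycle \<phi> r \<beta> T) \<and> homeomorphic_map euclidean euclidean (smooth_cocycle \<phi> r \<beta> T))"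
proof -
 obtain D where D: "C ** D = mat 1" "D ** C = mat 1" using C unfolding invertible_def by blast
 obtain k where k: "0 < k" "!!v. norm (D *v v) <= norm v * k"
  using bounded_linear.pos_bounded[OF matrix_vector_mul_bounded_linear[of D]] by auto
 then have k': "norm (D *v v) <= k * norm v" for v by (simp add: mult.commute)
 obtain \<phi> :: "'n => real => real" where \<phi>: "bumps \<phi>" "integral (cbox (- 1) 1) (bump_prod \<phi>) = 1"
  using bump_density_exists by blast
 obtain r where r: "r > 0" "!!T h. T \<in> \<Omega> ==> norm (smooth_deriv \<phi> r \<beta> T *v h - C *v h) <= 1 / (2 * k) * norm h"
  using smooth_deriv_near_linear[OF \<Omega> \<beta> growth \<phi>, of "1 / (2 * k)"] k(1) by auto
 have near: "norm (smooth_cocycle \<phi> r \<beta> T x - smooth_cocycle \<phi> r \<beta> T y - C *v (x - y)) <= 1 / (2 * k) * norm (x - y)"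
  if "T \<in> \<Omega>" for T x y
  by (rule smooth_cocycle_near_linear[OF \<Omega> \<beta> \<phi> r that])
 show ?thesis
  by (intro exI[of _ \<phi>] exI[of _ r] exI[of _ "2 * k"])
   (use \<phi> r(1) k(1) near_linear_homeomorphism[OF D k(1) k' near] in auto)
qed

lemma smooth_weak_cocycle:
 assumes \<Omega>: "tiling_space L dL \<Omega>" and \<beta>: "weak_cocycle dL \<Omega> \<beta>" and \<phi>: "bumps \<phi>"
 shows "weak_cocycle dL \<Omega> (smooth_cocycle \<phi> r \<beta>)"
 using weak_cocycle_add_coboundary[OF \<Omega> \<beta> smoothing_continuous[OF \<Omega> \<beta> \<phi>], of r]
 unfolding smooth_cocycle_def[abs_def] by simp

lemma weak_cocycle_cong:
 assumes \<Omega>: "tiling_space L dL \<Omega>" and \<beta>: "weak_cocycle dL \<Omega> \<beta>" and eq: "!!T x. T \<in> \<Omega> ==> \<alpha> T x = \<beta> T x"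
 shows "weak_cocycle dL \<Omega> \<alpha>"
proof -
 have "continuous_map (prod_topology (config_topology dL \<Omega>) euclidean) euclidean (\<lambda>(T, x). \<alpha> T x)"
  by (rule continuous_map_eq[of _ _ "\<lambda>(T, x). \<beta> T x"])
   (use \<beta> eq in \<open>auto simp: weak_cocycle_def topspace_config_topology[OF \<Omega>]\<close>)
 then show ?thesis using \<beta> eq tiling_space_translate[OF \<Omega>] unfolding weak_cocycle_def by simp
qed

lemma continuous_map_diff_config:
 fixes s t :: "_ => 'b::real_normed_vector"
 assumes "continuous_map X euclidean s" "continuous_map X euclidean t"
 shows "continuous_map X euclidean (\<lambda>T. s T - t T)" "continuous_map X euclidean (\<lambda>T. s T + t T)"
  "continuous_map X euclidean (\<lambda>T. - s T)"
 using assms by (auto intro: continuous_map_diff continuous_map_add continuous_map_minus)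

text \<open>Sums and negatives of continuous functions are continuous, so coboundaries form a group.\<close>

lemma equiv_weak_rel: "equiv {\<alpha>. weak_cocycle dL \<Omega> \<alpha>} (weak_rel dL \<Omega>)"
proof (rule equivI)
 show "weak_rel dL \<Omega> \<subseteq> {\<alpha>. weak_cocycle dL \<Omega> \<alpha>} \<times> {\<alpha>. weak_cocycle dL \<Omega> \<alpha>}" unfolding weak_rel_def by auto
 show "refl_on {\<alpha>. weak_cocycle dL \<Omega> \<alpha>} (weak_rel dL \<Omega>)"
  unfolding refl_on_def weak_rel_def weak_coboundary_def by (auto intro!: exI[of _ "\<lambda>_. 0"])
 show "sym (weak_rel dL \<Omega>)"
 proof (rule symI)
  fix \<alpha> \<beta> assume "(\<alpha>, \<beta>) \<in> weak_rel dL \<Omega>"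
  then obtain s where s: "weak_cocycle dL \<Omega> \<alpha>" "weak_cocycle dL \<Omega> \<beta>" "continuous_map (config_topology dL \<Omega>) euclidean s"
   "\<forall>T\<in>\<Omega>. \<forall>v. \<alpha> T v - \<beta> T v = s (translate T v) - s T" unfolding weak_rel_def weak_coboundary_def by blast
  have "\<forall>T\<in>\<Omega>. \<forall>v. \<beta> T v - \<alpha> T v = (\<lambda>T. - s T) (translate T v) - (\<lambda>T. - s T) T"
   using s(4) by (metis (no_types, lifting) minus_diff_eq minus_diff_minus)
  then show "(\<beta>, \<alpha>) \<in> weak_rel dL \<Omega>"
   unfolding weak_rel_def weak_coboundary_def using s(1,2) continuous_map_diff_config(3)[OF s(3,3)] by blast
 qed
 show "trans (weak_rel dL \<Omega>)"
 proof (rule transI)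
  fix \<alpha> \<beta> \<delta> assume "(\<alpha>, \<beta>) \<in> weak_rel dL \<Omega>" "(\<beta>, \<delta>) \<in> weak_rel dL \<Omega>"
  then obtain s t where s: "weak_cocycle dL \<Omega> \<alpha>" "weak_cocycle dL \<Omega> \<delta>" "continuous_map (config_topology dL \<Omega>) euclidean s"
   "continuous_map (config_topology dL \<Omega>) euclidean t"
   "\<forall>T\<in>\<Omega>. \<forall>v. \<alpha> T v - \<beta> T v = s (translate T v) - s T" "\<forall>T\<in>\<Omega>. \<forall>v. \<beta> T v - \<delta> T v = t (translate T v) - t T"
   unfolding weak_rel_def weak_coboundary_def by blast
  have "\<forall>T\<in>\<Omega>. \<forall>v. \<alpha> T v - \<delta> T v = (\<lambda>T. s T + t T) (translate T v) - (\<lambda>T. s T + t T) T"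
  proof (intro ballI allI)
   fix T v assume "T \<in> \<Omega>"
   then have "\<alpha> T v - \<beta> T v = s (translate T v) - s T" "\<beta> T v - \<delta> T v = t (translate T v) - t T" using s by auto
   then have "(\<alpha> T v - \<beta> T v) + (\<beta> T v - \<delta> T v) = (s (translate T v) - s T) + (t (translate T v) - t T)" by simp
   then show "\<alpha> T v - \<delta> T v = (\<lambda>T. s T + t T) (translate T v) - (\<lambda>T. s T + t T) T" by (simp add: algebra_simps)
  qed
  then show "(\<alpha>, \<delta>) \<in> weak_rel dL \<Omega>"
   unfolding weak_rel_def weak_coboundary_def using s(1,2) continuous_map_diff_config(2)[OF s(3,4)] by blast
 qed
qed

lemma smooth_cocycle_weak_rel:
 assumes \<Omega>: "tiling_space L dL \<Omega>" and \<beta>: "weak_cocycle dL \<Omega> \<beta>" and \<phi>: "bumps \<phi>"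
  and eq: "!!T x. T \<in> \<Omega> ==> \<alpha> T x = smooth_cocycle \<phi> r \<beta> T x"
 shows "(\<alpha>, \<beta>) \<in> weak_rel dL \<Omega>"
proof -
 have "weak_coboundary dL \<Omega> (\<lambda>T v. \<alpha> T v - \<beta> T v)"
  unfolding weak_coboundary_def using smoothing_continuous_map[OF \<Omega> \<beta> \<phi>, of r] eq
  by (intro exI[of _ "smoothing \<phi> r \<beta>"]) (auto simp: smooth_cocycle_def)
 then show ?thesis unfolding weak_rel_def
  using \<beta> weak_cocycle_cong[OF \<Omega> smooth_weak_cocycle[OF \<Omega> \<beta> \<phi>, of r] eq] by simp
qed

text \<open>Integrals over the space commute with taking components.\<close>

lemma ruelle_sullivan_components:
 assumes \<Omega>: "tiling_space L dL \<Omega>" and \<mu>: "invariant_probability dL \<Omega> \<mu>" and \<beta>: "weak_cocycle dL \<Omega> \<beta>"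
 shows "ruelle_sullivan \<mu> \<beta> = (\<chi> i j. \<integral>T. \<beta> T (axis j 1) $ i \<partial>\<mu>)"
proof -
 have s\<mu>: "sets \<mu> = sets (borel_of (config_topology dL \<Omega>))" "prob_space \<mu>"
  using \<mu> unfolding invariant_probability_def borel_of_def topspace_config_topology[OF \<Omega>] by auto
 have sp: "space \<mu> = \<Omega>" using sets_eq_imp_space_eq[OF s\<mu>(1)] topspace_config_topology[OF \<Omega>] by simp
 have "integrable \<mu> (\<lambda>T. \<beta> T v)" for v
 proof -
  obtain B where B: "!!T x. T \<in> \<Omega> ==> norm x <= norm v ==> norm (\<beta> T x) <= B"
   using weak_cocycle_bounded[OF \<Omega> \<beta>, of "norm v"] by blast
  have c: "continuous_map (config_topology dL \<Omega>) (prod_topology (config_topology dL \<Omega>) euclidean) (\<lambda>T. (T, v))"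
   by (intro continuous_map_pairedI) auto
  from continuous_map_compose[OF c, of euclidean "\<lambda>(T, x). \<beta> T x"] \<beta>
  have "continuous_map (config_topology dL \<Omega>) euclidean (\<lambda>T. \<beta> T v)"
   unfolding weak_cocycle_def by (simp add: o_def)
  then have m: "(\<lambda>T. \<beta> T v) \<in> borel_measurable \<mu>"
   using continuous_map_borel_measurable measurable_cong_sets[OF s\<mu>(1) refl] by blast
  have "finite_measure \<mu>" using s\<mu>(2) unfolding prob_space_def by simp
  then show ?thesis
   by (rule finite_measure.integrable_const_bound[where B = B]) (use m B sp in \<open>auto intro!: AE_I2\<close>)
 qed
 then show ?thesis unfolding ruelle_sullivan_def matrix_def
  by (simp add: vec_eq_iff integral_bounded_linear[OF bounded_linear_vec_nth])
qed

text \<open>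
 Any representative of the class grows linearly, with the Ruelle-Sullivan matrix as its slope, so a
 smoothing of it at large scale deforms the space. The label at a single point already is the
 element up to translation, which leaves only that translation to be determined: if the elements
 \<open>S\<close> and \<open>S - (p - q)\<close> have the same image, then \<open>\<gamma> S (p - q) = 0\<close> and therefore \<open>p = q\<close>.
\<close>

theorem weak_deformation_exists:
 fixes \<Omega> :: "(real ^ 'n::finite, 'l) config set"
 assumes \<Omega>: "tiling_space L dL \<Omega>" and min: "minimal_space dL \<Omega>" and ap: "aperiodic \<Omega>"
  and ue: "uniquely_ergodic dL \<Omega>" and \<mu>: "invariant_probability dL \<Omega> \<mu>"
  and c: "c \<in> H1_weak dL \<Omega>" and inv: "invertible (ruelle_sullivan_class \<mu> c)"
  and \<Lambda>: "associated_delone_sets dL \<Omega> \<Lambda>" and T: "T \<in> \<Omega>"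
 shows "\<exists>\<omega> \<Omega>' h. tiling_space \<Omega> (config_dist dL) \<Omega>' \<and> aperiodic \<Omega>' \<and> weakly_PE_form dL \<Omega> T \<omega> \<and>
  weak_shape_deformation dL \<Omega> T (\<Lambda> T) \<omega> \<Omega>' h \<and> orbit_equivalence dL \<Omega> (config_dist dL) \<Omega>' h \<and>
  weak_class dL \<Omega> h = c"
proof -
 \<comment> \<open>The matrix of the class is computed from this representative.\<close>
 define \<beta> where "\<beta> = (SOME \<alpha>. \<alpha> \<in> c)"
 obtain \<beta>0 where \<beta>0: "weak_cocycle dL \<Omega> \<beta>0" "c = weak_rel dL \<Omega> `` {\<beta>0}"
  using c unfolding H1_weak_def by (auto elim!: quotientE)
 have "\<beta>0 \<in> c" unfolding \<beta>0(2) using equiv_class_self[OF equiv_weak_rel] \<beta>0(1) by blast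
 then have "\<beta> \<in> c" unfolding \<beta>_def by (metis someI)
 then have \<beta>rel: "(\<beta>0, \<beta>) \<in> weak_rel dL \<Omega>" unfolding \<beta>0(2) by simp
 then have \<beta>: "weak_cocycle dL \<Omega> \<beta>" and c\<beta>: "c = weak_rel dL \<Omega> `` {\<beta>}"
  using equiv_class_eq[OF equiv_weak_rel \<beta>rel] \<beta>0(2) unfolding weak_rel_def by auto
 have C: "invertible (ruelle_sullivan \<mu> \<beta>)" using inv unfolding ruelle_sullivan_class_def \<beta>_def .
 have growth: "\<exists>B. \<forall>T\<in>\<Omega>. \<forall>v. norm (\<beta> T v - ruelle_sullivan \<mu> \<beta> *v v) <= e * norm v + B" if "0 < e" for e
  unfolding ruelle_sullivan_components[OF \<Omega> \<mu> \<beta>] by (rule cocycle_growth[OF \<Omega> ue \<mu> \<beta> that])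
 obtain \<phi> r K where \<phi>: "bumps \<phi>" "integral (cbox (- 1) 1) (bump_prod \<phi>) = 1" and r: "0 < r" and K: "0 < K"
  and g: "\<forall>T\<in>\<Omega>. (\<forall>x y. norm (x - y) <= K * norm (smooth_cocycle \<phi> r \<beta> T x - smooth_cocycle \<phi> r \<beta> T y)) \<and>
    surj (smooth_cocycle \<phi> r \<beta> T) \<and> homeomorphic_map euclidean euclidean (smooth_cocycle \<phi> r \<beta> T)"
  using near_linear_smoothing[OF \<Omega> \<beta> C] growth by metis
 define \<gamma> where "\<gamma> = smooth_cocycle \<phi> r \<beta>"
 define \<omega> where "\<omega> = (\<lambda>x. smooth_deriv \<phi> r \<beta> (translate T x))"
 have \<gamma>: "weak_cocycle dL \<Omega> \<gamma>" unfolding \<gamma>_def by (rule smooth_weak_cocycle[OF \<Omega> \<beta> \<phi>(1)])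
 interpret deformation \<Omega> L dL \<Lambda> \<gamma> K \<Omega> "config_dist dL" translate
 proof (rule deformation.intro)
  show "norm (x - y) <= K * norm (\<gamma> S x - \<gamma> S y)" if "S \<in> \<Omega>" for S x y
   using g that unfolding \<gamma>_def by blast
  show "surj (\<gamma> S)" if "S \<in> \<Omega>" for S
   using g that unfolding \<gamma>_def by blast
  show "Metric_space \<Omega> (config_dist dL)" by (rule tiling_space_Metric_space[OF \<Omega>])
  show "compact_space (Metric_space.mtopology \<Omega> (config_dist dL))" by (rule tiling_space_compact[OF \<Omega>])
  show "translate S p \<in> \<Omega>" if "S \<in> \<Omega>" for S p using tiling_space_translate[OF \<Omega> that] .
  show "translate (translate S x) (p - x) = translate S p" for S :: "(real ^ 'n, 'l) config" and x p by (simp add: translate_add)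
  show "\<exists>\<delta>>0. \<forall>T'\<in>\<Omega>. \<forall>p'\<in>\<Lambda> T'. config_dist dL S T' < \<delta> --> dist p p' < \<delta> -->
   config_dist dL (translate S p) (translate T' p') < e" if "S \<in> \<Omega>" "0 < e" for S p e
   using tiling_space_translate_continuous[OF \<Omega> that, of p] unfolding dist_norm by blast
 qed (fact \<Omega> \<Lambda> \<gamma> K)+
 have inj: "inj_on deform \<Omega>"
 proof (rule inj_onI)
  fix S S' assume S: "S \<in> \<Omega>" "S' \<in> \<Omega>" "deform S = deform S'"
  obtain p where p: "p \<in> \<Lambda> S" using associated_delone_setsD(2)[OF \<Lambda> \<Omega> S(1)] unfolding relatively_dense_def by blast
  then have "({\<gamma> S p}, translate S p) \<in> deform S" unfolding deform_def by (rule imageI)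
  then have "({\<gamma> S p}, translate S p) \<in> deform S'" unfolding S(3) .
  then obtain q where q: "\<gamma> S p = \<gamma> S' q" "translate S p = translate S' q" unfolding deform_def by auto
  have S': "S' = translate S (p - q)"
  proof -
   have "translate (translate S p) (- q) = S'" unfolding q(2) by simp
   then show ?thesis by (simp add: translate_add)
  qed
  have "\<gamma> S p = \<gamma> S p - \<gamma> S (p - q)"
   using q(1) weak_cocycle_translate[OF \<gamma> S(1), of "p - q" q] unfolding S' by simp
  then have "\<gamma> S (p - q) = \<gamma> S 0" using weak_cocycle_0[OF \<gamma> S(1)] by simp
  then have "p - q = 0" using inj_\<gamma>[OF S(1)] by (simp add: inj_eq)
  then show "S = S'" unfolding S' by simp
 qed
 have "weak_class dL \<Omega> deform = c"
 proof -
  have "(orbit_displacement deform, \<beta>) \<in> weak_rel dL \<Omega>"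
   using orbit_displacement_deform[OF inj ap] unfolding \<gamma>_def by (rule smooth_cocycle_weak_rel[OF \<Omega> \<beta> \<phi>(1)])
  then show ?thesis unfolding weak_class_def c\<beta> by (rule equiv_class_eq[OF equiv_weak_rel])
 qed
 moreover have PE: "weakly_PE_form dL \<Omega> T \<omega>" unfolding \<omega>_def by (rule weakly_PE_smooth_deriv[OF \<Omega> \<beta> \<phi>(1) T r])
 moreover have "weak_shape_deformation dL \<Omega> T (\<Lambda> T) \<omega> (deform ` \<Omega>) deform"
 proof -
  have A: "form_integral \<omega> 0 = \<gamma> T"
   unfolding \<omega>_def \<gamma>_def form_integral_smooth_deriv[OF \<Omega> \<beta> \<phi> r T]
   using weak_cocycle_0[OF \<gamma> T] unfolding \<gamma>_def by auto
  have T': "(\<lambda>p. ({\<gamma> T p}, translate T p)) ` \<Lambda> T = deform T" unfolding deform_def ..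
  show ?thesis
   unfolding weak_shape_deformation_def shape_deformation_def Let_def A T'
   using PE closed_form_smooth_deriv[OF \<Omega> \<beta> \<phi>(1) T r] g T orbit_closure_deform[OF min T] tiling_space_deform(1)
    deform_translate[OF T] unfolding \<omega>_def \<gamma>_def by auto
 qed
 ultimately show ?thesis
  using tiling_space_deform(2) aperiodic_deform[OF inj ap] orbit_equivalence_deform[OF inj] by blast
qed

section \<open>Rigidity of spaces of finite local complexity\<close>

lemma ball_subset_origin:
 fixes x :: "'a::real_normed_vector"
 assumes "norm x + M <= N" shows "ball x M \<subseteq> ball 0 N"
proof
 fix y assume "y \<in> ball x M"
 then have "norm (y - x) < M" by (simp add: dist_norm norm_minus_commute)
 then show "y \<in> ball 0 N" using norm_triangle_sub[of y x] assms by simp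
qed

lemma patch_eq_at:
 assumes "patch S 0 N = patch S' 0 N" "norm x + M <= N"
 shows "patch S x M = patch S' x M"
proof -
 have "ball x M \<subseteq> ball 0 N" using assms(2) by (rule ball_subset_origin)
 then have *: "patch T x M = {t \<in> patch T 0 N. fst t \<inter> ball x M ~= {}}" for T :: "('a, 'b) config"
  unfolding patch_def by blast
 show ?thesis using assms(1) *[of S] *[of S'] by simp
qed

lemma patch_eq_translate:
 assumes "patch S 0 N = patch S' 0 N" "norm x + M <= N"
 shows "patch (translate S x) 0 M = patch (translate S' x) 0 M"
 unfolding patch_translate using patch_eq_at[OF assms] by simp

lemma patch_eq_le: "patch S 0 N = patch S' 0 N ==> M <= N ==> patch S 0 M = patch S' 0 M"
 using patch_eq_at[of S N S' 0 M] by simp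

definition patch_determined :: "('a::real_normed_vector, 'l) config set => real => (('a, 'l) config => 'b) => bool" where
 "patch_determined \<Omega> N f \<longleftrightarrow> (\<forall>S\<in>\<Omega>. \<forall>S'\<in>\<Omega>. patch S 0 N = patch S' 0 N --> f S = f S')"

lemma patch_determinedD:
 assumes "patch_determined \<Omega> N f" "S \<in> \<Omega>" "S' \<in> \<Omega>" "patch S 0 M = patch S' 0 M" "N <= M"
 shows "f S = f S'"
 using assms(1-3) patch_eq_le[OF assms(4,5)] unfolding patch_determined_def by blast

lemma patch_determined_mono: "patch_determined \<Omega> N f ==> N <= M ==> patch_determined \<Omega> M f"
 using patch_eq_le unfolding patch_determined_def by blast

text \<open>
 Equality of large patches up to a small translation implies closeness. In spaces of finite local
 complexity the converse holds as well, which is the subject of this section.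
\<close>

lemma config_dist_patch_eq:
 fixes S :: "('a::euclidean_space, 'l) config"
 assumes L: "Metric_space L dL" and S: "locally_finite_config L S"
  and eq: "patch (translate S' z) 0 r = patch S 0 r" and z: "norm z <= e" and e: "0 < e" "1 / e + e <= r"
 shows "config_dist dL S S' <= e"
proof (rule config_dist_leI[where P = "patch S 0 r" and P' = "translate (patch S 0 r) (- z)" and f = "translate_tile (- z)"])
 have mono: "A \<subseteq> B ==> translate A x \<subseteq> translate B x" for A B :: "('a, 'l) config" and x
  unfolding translate_eq_image by blast
 show "patch S 0 (1 / e) \<subseteq> patch S 0 r" using e by (intro patch_mono) linarith
 show "patch S' 0 (1 / e) \<subseteq> translate (patch S 0 r) (- z)"
 proof -
  have "patch (translate S' z) (- z) (1 / e) \<subseteq> patch (translate S' z) 0 r"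
  proof -
   have "ball (- z) (1 / e) \<subseteq> ball 0 r"
    using z e(2) by (intro ball_subset_origin) simp
   then show ?thesis unfolding patch_def by blast
  qed
  then have "translate (patch S' 0 (1 / e)) z \<subseteq> patch S 0 r" unfolding eq by (simp add: patch_translate)
  from mono[OF this, of "- z"] show ?thesis by simp
 qed
 show "translate (patch S 0 r) (- z) \<subseteq> S'"
  using mono[OF patch_subset[of "translate S' z" 0 r], of "- z"] unfolding eq by simp
 show "bij_betw (translate_tile (- z)) (patch S 0 r) (translate (patch S 0 r) (- z))"
  unfolding translate_eq_image by (rule inj_on_imp_bij_betw) (rule inj_on_subset[OF inj_translate_tile], simp)
 fix t assume "t \<in> patch S 0 r"
 then have t: "ctile L t" using S patch_subset unfolding locally_finite_config_def by blast
 show "tile_dist dL t (translate_tile (- z) t) <= e"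
  using tile_dist_translates[OF L t t, of 0 "- z"] tile_dist_self[OF L t] z by simp
qed (use patch_subset e in auto)

lemma tiling_space_nonempty:
 assumes \<Omega>: "tiling_space L dL \<Omega>" and T: "T \<in> \<Omega>" shows "T ~= {}"
proof -
 have "is_delone L T \<or> is_tiling L T" using \<Omega> T unfolding tiling_space_def by blast
 then show ?thesis
 proof
  assume "is_delone L T"
  then obtain \<Lambda> lab where "relatively_dense \<Lambda>" "T = labelled_points \<Lambda> lab" unfolding is_delone_def by blast
  then show ?thesis unfolding relatively_dense_def labelled_points_def by blast
 qed (auto simp: is_tiling_def)
qed

text \<open>One unit of room around the ball accommodates the displacement of a tile.\<close>

lemma config_dist_nearby_tile:
 fixes S :: "('a::euclidean_space, 'l) config"
 assumes S: "locally_finite_config L S" "locally_finite_config L X"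
  and d: "config_dist dL S X < e" "e <= 1" "N <= 1 / e" and t: "t \<in> S" "fst t \<inter> ball 0 N ~= {}"
 shows "\<exists>t'\<in>X. tile_dist dL t t' < e \<and> fst t' \<inter> ball 0 (N + 1) ~= {}"
proof -
 obtain P P' f where P: "patch S 0 (1 / e) \<subseteq> P" "P' \<subseteq> X" "bij_betw f P P'" "!!t. t \<in> P ==> tile_dist dL t (f t) < e"
  using config_dist_match[OF d(1,2)] by metis
 have "t \<in> patch S 0 N" using t unfolding patch_def by simp
 then have tP: "t \<in> P" using P(1) patch_mono[OF d(3)] by blast
 then have "f t \<in> X" using P(2,3) bij_betwE by blast
 then have "ctile L t" "ctile L (f t)" "f t \<in> X" using S t(1) unfolding locally_finite_config_def by auto
 then show ?thesis
  using tile_dist_meets_ball[of L t "f t" dL 1 N] t(2) P(4)[OF tP] d(2) by (intro bexI[of _ "f t"]) auto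
qed

locale flc_space =
 fixes \<Omega> :: "('a::euclidean_space, 'l) config set" and L :: "'l set" and dL :: "'l => 'l => real"
 assumes space: "tiling_space L dL \<Omega>" and flc: "FLC \<Omega>"
begin

sublocale M: Metric_space \<Omega> "config_dist dL" by (rule tiling_space_Metric_space[OF space])

lemmas labels = tiling_space_labels[OF space]
lemmas lf = tiling_space_locally_finite[OF space]
lemmas translate_mem [simp] = tiling_space_translate[OF space]

lemma tiles: "S \<in> \<Omega> ==> t \<in> S ==> ctile L t"
 using lf unfolding locally_finite_config_def by blast

lemma finite_patch_types:
 "\<exists>\<F>. finite \<F> \<and> (\<forall>F\<in>\<F>. finite F \<and> (\<forall>t\<in>F. ctile L t)) \<and> (\<forall>T\<in>\<Omega>. \<exists>F\<in>\<F>. \<exists>y. patch T 0 R = translate F y)"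
proof -
 let ?A = "{patch T x R | T x. T \<in> \<Omega>}"
 have "finite ((\<lambda>P. range (translate P)) ` ?A)" using flc unfolding FLC_def by blast
 from finite_subset_image[OF this subset_refl]
 obtain \<F> where \<F>: "\<F> \<subseteq> ?A" "finite \<F>" "(\<lambda>P. range (translate P)) ` ?A = (\<lambda>P. range (translate P)) ` \<F>"
  by (elim exE conjE)
 have "\<exists>F\<in>\<F>. \<exists>y. patch T 0 R = translate F y" if T: "T \<in> \<Omega>" for T
 proof -
  have "range (translate (patch T 0 R)) \<in> (\<lambda>P. range (translate P)) ` \<F>" unfolding \<F>(3)[symmetric] using T by blast
  then obtain F where F: "F \<in> \<F>" "range (translate (patch T 0 R)) = range (translate F)" by blast
  have "patch T 0 R \<in> range (translate F)" unfolding F(2)[symmetric] using rangeI[of "translate (patch T 0 R)" 0] by simp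
  then show ?thesis using F(1) by blast
 qed
 moreover have "finite F \<and> (\<forall>t\<in>F. ctile L t)" if "F \<in> \<F>" for F
  using that \<F>(1) locally_finite_config_patch[OF lf] tiles patch_subset by blast
 ultimately show ?thesis using \<F>(2) by (intro exI[of _ \<F>]) simp
qed

text \<open>
 Elements \<open>X n\<close> converging to S show finitely many types of patches, so infinitely many of these
 patches are translates \<open>F0 - y n\<close> of one patch. The vectors \<open>y n\<close> are bounded, since a tile of S near
 the origin must have a partner in them, and after passing to a subsequence they converge to some \<open>y0\<close>.
 The tiles of \<open>F0 - y0\<close> and of S near the origin approximate each other arbitrarily well; as both patches are
 finite, they are equal, and \<open>z = y0 - y n\<close> is the small translation required.
\<close>

lemma patch_rigidity_large:
 assumes S: "S \<in> \<Omega>" and e: "0 < e" and N: "0 < N" "patch S 0 N ~= {}"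
 shows "\<exists>\<delta>>0. \<forall>S'\<in>\<Omega>. config_dist dL S S' < \<delta> --> (\<exists>z. norm z < e \<and> patch (translate S' z) 0 N = patch S 0 N)"
proof (rule ccontr)
 assume no: "\<not> ?thesis"
 define bad where "bad S' \<longleftrightarrow> \<not> (\<exists>z. norm z < e \<and> patch (translate S' z) 0 N = patch S 0 N)" for S'
 \<comment> \<open>The margin absorbs the displacements of tiles from S to a nearby element and back.\<close>
 define R where "R = N + 2"
 have "\<exists>X\<in>\<Omega>. config_dist dL S X < inverse (real (Suc n)) \<and> bad X" for n
  using no unfolding bad_def by (metis inverse_positive_iff_positive of_nat_0_less_iff zero_less_Suc)
 then obtain X where X: "!!n. X n \<in> \<Omega>" "!!n. config_dist dL S (X n) < inverse (real (Suc n))" "!!n. bad (X n)" by metis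
 obtain \<F> where \<F>: "finite \<F>" "\<forall>F\<in>\<F>. finite F \<and> (\<forall>t\<in>F. ctile L t)" "\<forall>T\<in>\<Omega>. \<exists>F\<in>\<F>. \<exists>y. patch T 0 R = translate F y"
  using finite_patch_types[of R] by blast
 have "\<forall>n. \<exists>F. F \<in> \<F> \<and> (\<exists>y. patch (X n) 0 R = translate F y)" using \<F>(3) X(1) by blast
 from choice[OF this] obtain F where F: "!!n. F n \<in> \<F>" "\<forall>n. \<exists>y. patch (X n) 0 R = translate (F n) y" by blast
 from choice[OF F(2)] obtain y where y: "!!n. patch (X n) 0 R = translate (F n) (y n)" by blast
 have "finite (range F)" using F(1) \<F>(1) by (meson finite_subset image_subsetI)
 from pigeonhole_infinite[OF infinite_UNIV_nat this] obtain n0 where "infinite {n. F n = F n0}" by auto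
 from infinite_enumerate[OF this] obtain r :: "nat => nat" where r: "strict_mono r" "!!n. F (r n) = F n0" by auto
 define F0 where "F0 = F n0"
 have F0: "finite F0" "!!t. t \<in> F0 ==> ctile L t" using \<F>(2) F(1)[of n0] unfolding F0_def by auto
 have eq: "patch (X (r n)) 0 R = translate F0 (y (r n))" for n using y[of "r n"] r(2) unfolding F0_def by simp
 obtain t0 where t0: "t0 \<in> S" "fst t0 \<inter> ball 0 N ~= {}" using N unfolding patch_def by blast
 have "bounded (\<Union>t\<in>F0. fst t)" using F0 unfolding ctile_def by (intro bounded_UN) (auto intro: compact_imp_bounded)
 then obtain b where b: "!!t w. t \<in> F0 ==> w \<in> fst t ==> norm w <= b" unfolding bounded_iff by blast
 obtain m where m: "inverse (real (Suc m)) < 1 / (N + 1)" using reals_Archimedean[of "1 / (N + 1)"] N(1) by auto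
 have yb: "norm (y (r n)) <= b + R" if n: "m <= n" for n
 proof -
  have "inverse (real (Suc (r n))) <= inverse (real (Suc m))" using n seq_suble[OF r(1), of n] by simp
  then have d: "config_dist dL S (X (r n)) < 1 / (N + 1)" using X(2)[of "r n"] m by linarith
  obtain t' where t': "t' \<in> X (r n)" "fst t' \<inter> ball 0 (N + 1) ~= {}"
   using config_dist_nearby_tile[OF lf[OF S] lf[OF X(1)] d _ _ t0] N(1) by auto
  then have t'P: "t' \<in> patch (X (r n)) 0 R" using subset_ball[of "N + 1" R "0 :: 'a"] unfolding patch_def R_def by fastforce
  then obtain t where t: "t \<in> F0" "t' = translate_tile (y (r n)) t" unfolding eq translate_eq_image by blast
  obtain w where w: "w \<in> fst t" "norm (w - y (r n)) < R"
   using t'P unfolding patch_def t(2) translate_tile_def by auto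
  show ?thesis using b[OF t(1) w(1)] w(2) norm_triangle_sub[of "y (r n)" w] by (simp add: norm_minus_commute)
 qed
 have "bounded (range (\<lambda>n. y (r (n + m))))" unfolding bounded_iff using yb by (intro exI[of _ "b + R"]) auto
 then obtain y0 q where q: "strict_mono q" "(\<lambda>n. y (r (q n + m))) \<longlonglongrightarrow> y0"
  using bounded_imp_convergent_subsequence[of "\<lambda>n. y (r (n + m))"] by (auto simp: o_def)
 have key: "\<exists>X\<in>\<Omega>. \<exists>z. norm z < \<eta> \<and> config_dist dL S X < \<eta> \<and> patch X 0 R = translate F0 (y0 - z) \<and> bad X"
  if \<eta>: "0 < \<eta>" for \<eta>
 proof -
  obtain n1 where n1: "!!n. n1 <= n ==> dist (y (r (q n + m))) y0 < \<eta>" using q(2) \<eta> unfolding lim_sequentially by blast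
  obtain n2 where n2: "inverse (real (Suc n2)) < \<eta>" using reals_Archimedean[OF \<eta>] by blast
  define n where "n = max n1 n2"
  let ?k = "r (q n + m)"
  have "n2 <= ?k" using seq_suble[OF r(1), of "q n + m"] seq_suble[OF q(1), of n] unfolding n_def by linarith
  then have "inverse (real (Suc ?k)) <= inverse (real (Suc n2))" by simp
  then have "config_dist dL S (X ?k) < \<eta>" using X(2)[of ?k] n2 by linarith
  moreover have "norm (y0 - y ?k) < \<eta>" using n1[of n] unfolding n_def by (simp add: dist_norm norm_minus_commute)
  ultimately show ?thesis using X(1,3) eq
   by (intro bexI[of _ "X ?k"] exI[of _ "y0 - y ?k"]) auto
 qed
 have scale: "\<exists>\<eta>>0. \<eta> <= 1 \<and> 2 * \<eta> <= c \<and> N + 1 <= 1 / \<eta>" if c: "0 < c" for c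
 proof (intro exI[of _ "min (1 / (N + 1)) (c / 2)"] conjI)
  show "min (1 / (N + 1)) (c / 2) <= 1" using N(1) by (simp add: min_le_iff_disj)
  have "1 / (1 / (N + 1)) <= 1 / min (1 / (N + 1)) (c / 2)" using N(1) c by (intro divide_left_mono) auto
  then show "N + 1 <= 1 / min (1 / (N + 1)) (c / 2)" by simp
 qed (use N(1) c in auto)
 have F0': "finite (translate F0 y0)" "!!u. u \<in> translate F0 y0 ==> ctile L u"
  using F0 unfolding translate_eq_image by auto
 have "patch (translate F0 y0) 0 N = patch S 0 N"
 proof (intro equalityI subsetI)
  fix t assume "t \<in> patch S 0 N"
  then have t: "t \<in> S" "fst t \<inter> ball 0 N ~= {}" unfolding patch_def by auto
  have "t \<in> translate F0 y0"
  proof (rule tile_in_finite_set[OF labels F0' tiles[OF S t(1)]])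
   fix c :: real assume "0 < c"
   then obtain \<eta> where \<eta>: "0 < \<eta>" "\<eta> <= 1" "2 * \<eta> <= c" "N + 1 <= 1 / \<eta>" using scale by blast
   obtain X z where X: "X \<in> \<Omega>" "norm z < \<eta>" "config_dist dL S X < \<eta>" "patch X 0 R = translate F0 (y0 - z)"
    using key[OF \<eta>(1)] by blast
   obtain t' where t': "t' \<in> X" "tile_dist dL t t' < \<eta>" "fst t' \<inter> ball 0 (N + 1) ~= {}"
    using config_dist_nearby_tile[OF lf[OF S] lf[OF X(1)] X(3) \<eta>(2) _ t] \<eta>(4) by auto
   then have "t' \<in> patch X 0 R" using subset_ball[of "N + 1" R "0 :: 'a"] unfolding patch_def R_def by fastforce
   then have "translate_tile z t' \<in> translate F0 y0" unfolding X(4) by (auto simp: translate_eq_image translate_tile_add)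
   moreover have "tile_dist dL t (translate_tile z t') <= c"
    using tile_dist_translates[OF labels tiles[OF S t(1)] tiles[OF X(1) t'(1)], of 0 z] t'(2) X(2) \<eta>(3) by simp
   ultimately show "\<exists>u\<in>translate F0 y0. tile_dist dL t u <= c" by blast
  qed
  then show "t \<in> patch (translate F0 y0) 0 N" using t unfolding patch_def by simp
 next
  fix u assume "u \<in> patch (translate F0 y0) 0 N"
  then have u: "u \<in> translate F0 y0" "fst u \<inter> ball 0 N ~= {}" unfolding patch_def by auto
  have cu: "ctile L u" using F0'(2)[OF u(1)] .
  have "u \<in> patch S 0 R"
  proof (rule tile_in_finite_set[OF labels locally_finite_config_patch[OF lf[OF S]] _ cu])
   fix c :: real assume "0 < c"
   then obtain \<eta> where \<eta>: "0 < \<eta>" "\<eta> <= 1" "2 * \<eta> <= c" "N + 1 <= 1 / \<eta>" using scale by blast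
   obtain X z where X: "X \<in> \<Omega>" "norm z < \<eta>" "config_dist dL S X < \<eta>" "patch X 0 R = translate F0 (y0 - z)"
    using key[OF \<eta>(1)] by blast
   let ?u = "translate_tile (- z) u"
   have "?u \<in> translate F0 (y0 - z)" using u(1) by (auto simp: translate_eq_image translate_tile_add)
   then have uX: "?u \<in> X" unfolding X(4)[symmetric] using patch_subset by blast
   have meets: "fst ?u \<inter> ball 0 (N + 1) ~= {}"
    using tile_dist_meets_ball[OF cu _ _ u(2), of "translate_tile (- z) u" dL 1]
     tile_dist_translates[OF labels cu cu, of 0 "- z"] tile_dist_self[OF labels cu] X(2) \<eta>(2) cu by simp
   have d: "config_dist dL X S < \<eta>" using X(3) M.commute[of X S] by simp
   obtain t where t: "t \<in> S" "tile_dist dL ?u t < \<eta>" "fst t \<inter> ball 0 (N + 1 + 1) ~= {}"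
    using config_dist_nearby_tile[OF lf[OF X(1)] lf[OF S] d \<eta>(2,4) uX meets] by blast
   then have "t \<in> patch S 0 R" unfolding patch_def R_def by (simp add: add.assoc)
   moreover have "tile_dist dL u t <= c"
    using tile_dist_translates[OF labels _ tiles[OF S t(1)], of ?u z 0] cu t(2) X(2) \<eta>(3) by (simp add: translate_tile_add)
   ultimately show "\<exists>t\<in>patch S 0 R. tile_dist dL u t <= c" by blast
  qed (use tiles[OF S] patch_subset in blast)
  then show "u \<in> patch S 0 N" using u(2) unfolding patch_def by simp
 qed
 moreover obtain X z where X: "X \<in> \<Omega>" "norm z < min e 1" "patch X 0 R = translate F0 (y0 - z)" "bad X"
  using key[of "min e 1"] e by auto
 have "patch (translate X z) 0 N = patch (translate (patch X 0 R) z) 0 N"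
 proof (rule patch_eq_translate[of X R])
  show "patch X 0 R = patch (patch X 0 R) 0 R" unfolding patch_def by auto
  show "norm z + N <= R" using X(2) unfolding R_def by simp
 qed
 then have "patch (translate X z) 0 N = patch (translate F0 y0) 0 N" unfolding X(3) by (simp add: translate_add)
 ultimately show False using X(2,4) unfolding bad_def by auto
qed

text \<open>A larger radius guarantees a tile that pins down the translations.\<close>

lemma patch_rigidity:
 assumes S: "S \<in> \<Omega>" and e: "0 < e"
 shows "\<exists>\<delta>>0. \<forall>S'\<in>\<Omega>. config_dist dL S S' < \<delta> --> (\<exists>z. norm z < e \<and> patch (translate S' z) 0 N = patch S 0 N)"
proof -
 obtain t where t: "t \<in> S" using tiling_space_nonempty[OF space S] by blast
 then obtain w where w: "w \<in> fst t" using tiles[OF S t] unfolding ctile_def by blast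
 define N' where "N' = max N (norm w + 1)"
 have "t \<in> patch S 0 N'" using t w unfolding patch_def N'_def by (auto intro!: exI[of _ w])
 moreover have "0 < N'" unfolding N'_def by (smt (verit) norm_ge_zero)
 ultimately obtain \<delta> where "\<delta> > 0" "\<forall>S'\<in>\<Omega>. config_dist dL S S' < \<delta> --> (\<exists>z. norm z < e \<and> patch (translate S' z) 0 N' = patch S 0 N')"
  using patch_rigidity_large[OF S e, of N'] by blast
 then show ?thesis using patch_eq_le[where M = N and N = N'] unfolding N'_def by (meson max.cobounded1)
qed

text \<open>Compactness, for balls whose radii depend on their centres.\<close>

lemma finite_cover:
 assumes "!!S. S \<in> \<Omega> ==> 0 < \<delta> S"
 shows "\<exists>\<S>. finite \<S> \<and> \<S> \<subseteq> \<Omega> \<and> (\<forall>S'\<in>\<Omega>. \<exists>S\<in>\<S>. config_dist dL S S' < \<delta> S)"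
proof -
 have "compactin M.mtopology \<Omega>" using tiling_space_compact[OF space] unfolding compact_space_def by simp
 moreover have "\<Omega> \<subseteq> \<Union> ((\<lambda>S. M.mball S (\<delta> S)) ` \<Omega>)" using assms by auto
 ultimately obtain \<F> where \<F>: "finite \<F>" "\<F> \<subseteq> (\<lambda>S. M.mball S (\<delta> S)) ` \<Omega>" "\<Omega> \<subseteq> \<Union> \<F>"
  unfolding compactin_def by (metis (no_types, lifting) M.openin_mball imageE)
 obtain \<S> where \<S>: "\<S> \<subseteq> \<Omega>" "finite \<S>" "\<F> = (\<lambda>S. M.mball S (\<delta> S)) ` \<S>" using finite_subset_image[OF \<F>(1,2)] by blast
 show ?thesis
 proof (intro exI conjI ballI)
  fix S' assume "S' \<in> \<Omega>"
  then obtain S where "S \<in> \<S>" "S' \<in> M.mball S (\<delta> S)" using \<F>(3) unfolding \<S>(3) by blast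
  then show "\<exists>S\<in>\<S>. config_dist dL S S' < \<delta> S" by auto
 qed (fact \<S>)+
qed

text \<open>Rigidity and compactness combined; the radius may be chosen to suit each element of the finite set.\<close>

lemma finite_patch_cover:
 assumes e: "0 < e"
 shows "\<exists>\<S>. finite \<S> \<and> \<S> \<subseteq> \<Omega> \<and>
  (\<forall>S'\<in>\<Omega>. \<exists>S\<in>\<S>. \<exists>z. norm z < e \<and> patch (translate S' z) 0 (N S) = patch S 0 (N S))"
proof -
 have "\<forall>S. \<exists>\<delta>. S \<in> \<Omega> --> 0 < \<delta> \<and> (\<forall>S'\<in>\<Omega>. config_dist dL S S' < \<delta> --> (\<exists>z. norm z < e \<and> patch (translate S' z) 0 (N S) = patch S 0 (N S)))"
  using patch_rigidity[OF _ e] by metis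
 then obtain \<delta> where \<delta>: "!!S. S \<in> \<Omega> ==> 0 < \<delta> S"
  "!!S S'. S \<in> \<Omega> ==> S' \<in> \<Omega> ==> config_dist dL S S' < \<delta> S ==> \<exists>z. norm z < e \<and> patch (translate S' z) 0 (N S) = patch S 0 (N S)"
  by metis
 obtain \<S> where "finite \<S>" "\<S> \<subseteq> \<Omega>" "\<forall>S'\<in>\<Omega>. \<exists>S\<in>\<S>. config_dist dL S S' < \<delta> S" using finite_cover[of \<delta>] \<delta>(1) by blast
 then show ?thesis using \<delta>(2) by (meson subsetD)
qed

end

section \<open>Local point sets and transversals\<close>

lemma range_translate_translate: "range (translate (translate P x)) = range (translate P)"
proof (intro equalityI subsetI)
 fix Q assume "Q \<in> range (translate (translate P x))"
 then show "Q \<in> range (translate P)" by (auto simp: translate_add)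
next
 fix Q assume "Q \<in> range (translate P)"
 then obtain y where "Q = translate P y" by blast
 then have "Q = translate (translate P x) (y - x)" by (simp add: translate_add)
 then show "Q \<in> range (translate (translate P x))" by blast
qed

context flc_space
begin

text \<open>
 A local map may respect translations only up to a bounded change of the vector, as deformations do.
 Finitely many elements show all patches up to small translations, and their images show all
 patches of the image after a translation by at most B.
\<close>

lemma FLC_local_image:
 fixes \<Phi> :: "('a, 'l) config => ('a, 'k) config"
 assumes inv: "!!T x. T \<in> \<Omega> ==> translate (\<Phi> T) x \<in> \<Phi> ` \<Omega>"
  and fin: "!!T r. T \<in> \<Omega> ==> finite (patch (\<Phi> T) 0 r)"
  and equi: "!!T z. T \<in> \<Omega> ==> norm z < 1 ==> \<exists>w. norm w <= B \<and> \<Phi> (translate T z) = translate (\<Phi> T) w"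
  and loc: "!!r. \<exists>R. patch_determined \<Omega> R (\<lambda>T. patch (\<Phi> T) 0 r)"
 shows "FLC (\<Phi> ` \<Omega>)"
 unfolding FLC_def
proof
 fix R
 obtain N where N: "patch_determined \<Omega> N (\<lambda>T. patch (\<Phi> T) 0 (R + B))" using loc[of "R + B"] by blast
 obtain \<S> where \<S>: "finite \<S>" "\<S> \<subseteq> \<Omega>"
  "!!S'. S' \<in> \<Omega> ==> \<exists>S\<in>\<S>. \<exists>z. norm z < 1 \<and> patch (translate S' z) 0 N = patch S 0 N"
  using finite_patch_cover[of 1 "\<lambda>_. N"] by auto
 define \<F> where "\<F> = (\<Union>S\<in>\<S>. Pow (patch (\<Phi> S) 0 (R + B)))"
 have "finite \<F>" unfolding \<F>_def using \<S>(1,2) fin by blast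
 moreover have "range (translate (patch T x R)) \<in> (\<lambda>P. range (translate P)) ` \<F>" if "T \<in> \<Phi> ` \<Omega>" for T x
 proof -
  obtain T0 where T0: "T0 \<in> \<Omega>" "\<Phi> T0 = translate T x" using inv \<open>T \<in> \<Phi> ` \<Omega>\<close> by force
  obtain S z where S: "S \<in> \<S>" "norm z < 1" "patch (translate T0 z) 0 N = patch S 0 N" using \<S>(3)[OF T0(1)] by blast
  obtain w where w: "norm w <= B" "\<Phi> (translate T0 z) = translate (\<Phi> T0) w" using equi[OF T0(1) S(2)] by blast
  have eq: "patch (translate (\<Phi> T0) w) 0 (R + B) = patch (\<Phi> S) 0 (R + B)"
   using patch_determinedD[OF N translate_mem[OF T0(1)] _ S(3) order_refl] S(1) \<S>(2) unfolding w(2) by blast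
  define G where "G = patch (translate (\<Phi> T0) w) (- w) R"
  have "G \<subseteq> patch (translate (\<Phi> T0) w) 0 (R + B)"
   unfolding G_def patch_def using ball_subset_origin[of "- w" R "R + B"] w(1) by auto
  then have "G \<in> \<F>" unfolding eq \<F>_def using S(1) by blast
  moreover have "G = translate (translate (patch T x R) x) w" unfolding G_def T0(2) patch_translate by simp
  then have "range (translate (patch T x R)) = range (translate G)" by (simp add: range_translate_translate)
  ultimately show ?thesis by blast
 qed
 then have "(\<lambda>P. range (translate P)) ` {patch T x R | T x. T \<in> \<Phi> ` \<Omega>} \<subseteq> (\<lambda>P. range (translate P)) ` \<F>" by auto
 ultimately show "finite ((\<lambda>P. range (translate P)) ` {patch T x R |T x. T \<in> \<Phi> ` \<Omega>})"
  by (meson finite_imageI finite_subset)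
qed

text \<open>Delone sets defined by local rules; their canonical transversals are exactly the FLC transversals.\<close>

definition local_points :: "(('a, 'l) config => 'a set) => bool" where
 "local_points P \<longleftrightarrow>
  (\<forall>T\<in>\<Omega>. P T ~= {} \<and> (\<forall>r. finite (P T \<inter> ball 0 r)) \<and> (\<forall>x. P (translate T x) = (\<lambda>p. p - x) ` P T)) \<and>
  (\<forall>r. \<exists>R. patch_determined \<Omega> R (\<lambda>T. P T \<inter> ball 0 r))"

lemma local_points_D:
 assumes "local_points P" "T \<in> \<Omega>"
 shows "P T ~= {}" "finite (P T \<inter> ball 0 r)" "P (translate T x) = (\<lambda>p. p - x) ` P T" "p \<in> P (translate T x) \<longleftrightarrow> p + x \<in> P T"
proof -
 show "P T ~= {}" "finite (P T \<inter> ball 0 r)" and *: "P (translate T x) = (\<lambda>p. p - x) ` P T"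
  using assms unfolding local_points_def by auto
 show "p \<in> P (translate T x) \<longleftrightarrow> p + x \<in> P T" unfolding * by force
qed

lemma local_points_local:
 assumes "local_points P" shows "\<exists>R. patch_determined \<Omega> R (\<lambda>T. P T \<inter> ball 0 r)"
 using assms unfolding local_points_def by blast

text \<open>
 Up to small translations only finitely many local arrangements of points occur, so there are
 finitely many distances below 1.
\<close>

lemma local_points_separated:
 assumes P: "local_points P"
 shows "\<exists>e>0. \<forall>T\<in>\<Omega>. \<forall>p\<in>P T. \<forall>q\<in>P T. p ~= q --> e <= dist p q"
proof -
 obtain R where R: "patch_determined \<Omega> R (\<lambda>T. P T \<inter> ball 0 2)"
  using local_points_local[OF P, of 2] by blast
 obtain \<S> where \<S>: "finite \<S>" "\<S> \<subseteq> \<Omega>"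
  "!!S'. S' \<in> \<Omega> ==> \<exists>S\<in>\<S>. \<exists>z. norm z < 1 \<and> patch (translate S' z) 0 R = patch S 0 R"
  using finite_patch_cover[of 1 "\<lambda>_. R"] by auto
 define V where "V = (\<Union>S\<in>\<S>. P S \<inter> ball 0 2)"
 define D where "D = (\<lambda>(p, q). dist p q) ` (V \<times> V) - {0}"
 have V: "finite V" unfolding V_def using \<S>(1,2) local_points_D(2)[OF P] by blast
 then have D: "finite D" "!!d. d \<in> D ==> 0 < d" unfolding D_def by auto
 show ?thesis
 proof (intro exI[of _ "Min (insert 1 D)"] conjI ballI impI)
  show "0 < Min (insert 1 D)" using D by simp
  fix T p q assume T: "T \<in> \<Omega>" and pq: "p \<in> P T" "q \<in> P T" "p ~= q"
  show "Min (insert 1 D) <= dist p q"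
  proof (cases "dist p q < 1")
   case True
   obtain S z where S: "S \<in> \<S>" "norm z < 1" "patch (translate (translate T p) z) 0 R = patch S 0 R"
    using \<S>(3)[OF translate_mem[OF T, of p]] by blast
   have S': "S \<in> \<Omega>" using S(1) \<S>(2) by blast
   have eq: "P (translate T (p + z)) \<inter> ball 0 2 = P S \<inter> ball 0 2"
    using patch_determinedD[OF R _ S' S(3)] T by (simp add: translate_add)
   have "- z \<in> P (translate T (p + z)) \<inter> ball 0 2" using pq S(2) by (simp add: local_points_D(4)[OF P T])
   moreover have "norm (q - p - z) < 2"
    using True S(2) norm_triangle_ineq4[of "q - p" z] by (simp add: dist_norm norm_minus_commute)
   then have "q - p - z \<in> P (translate T (p + z)) \<inter> ball 0 2" using pq by (simp add: local_points_D(4)[OF P T])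
   ultimately have "(- z, q - p - z) \<in> V \<times> V" unfolding eq V_def using S(1) by blast
   then have "dist (- z) (q - p - z) \<in> (\<lambda>(p, q). dist p q) ` (V \<times> V)" by (intro image_eqI[of _ _ "(- z, q - p - z)"]) simp_all
   moreover have "dist (- z) (q - p - z) = dist p q" by (simp add: dist_norm)
   ultimately have "dist p q \<in> D" unfolding D_def using pq(3) by simp
   then show ?thesis using D(1) by simp
  qed (use D(1) in \<open>simp add: Min_le_iff\<close>)
 qed
qed

text \<open>
 For each of finitely many elements choose a point and a radius at which the patch exhibits it;
 up to a small translation every element contains one of these points.
\<close>

lemma local_points_dense:
 assumes P: "local_points P"
 shows "\<exists>\<rho>>0. \<forall>T\<in>\<Omega>. \<forall>x. \<exists>p\<in>P T. dist x p <= \<rho>"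
proof -
 define a where "a S = (SOME p. p \<in> P S)" for S
 have a: "a S \<in> P S" if "S \<in> \<Omega>" for S unfolding a_def using local_points_D(1)[OF P that] by (simp add: some_in_eq)
 have "\<forall>S. \<exists>R. patch_determined \<Omega> R (\<lambda>T. P T \<inter> ball 0 (norm (a S) + 1))"
  using local_points_local[OF P] by blast
 from choice[OF this] obtain R where R: "!!S. patch_determined \<Omega> (R S) (\<lambda>T. P T \<inter> ball 0 (norm (a S) + 1))" by blast
 obtain \<S> where \<S>: "finite \<S>" "\<S> \<subseteq> \<Omega>"
  "!!S'. S' \<in> \<Omega> ==> \<exists>S\<in>\<S>. \<exists>z. norm z < 1 \<and> patch (translate S' z) 0 (R S) = patch S 0 (R S)"
  using finite_patch_cover[of 1 R] by auto
 define \<rho> where "\<rho> = (\<Sum>S\<in>\<S>. norm (a S)) + 1"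
 show ?thesis
 proof (intro exI[of _ \<rho>] conjI ballI allI)
  show "0 < \<rho>" unfolding \<rho>_def by (simp add: sum_nonneg add_nonneg_pos)
  fix T x assume T: "T \<in> \<Omega>"
  obtain S z where S: "S \<in> \<S>" "norm z < 1" "patch (translate (translate T x) z) 0 (R S) = patch S 0 (R S)"
   using \<S>(3)[OF translate_mem[OF T, of x]] by blast
  have S': "S \<in> \<Omega>" using S(1) \<S>(2) by blast
  have "P (translate T (x + z)) \<inter> ball 0 (norm (a S) + 1) = P S \<inter> ball 0 (norm (a S) + 1)"
   using patch_determinedD[OF R _ S' S(3)] T by (simp add: translate_add)
  moreover have "a S \<in> P S \<inter> ball 0 (norm (a S) + 1)" using a[OF S'] by simp
  ultimately have p: "a S + (x + z) \<in> P T" using local_points_D(4)[OF P T] by blast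
  have "norm (a S) <= (\<Sum>S\<in>\<S>. norm (a S))" using \<S>(1) S(1) by (intro member_le_sum) auto
  moreover have "dist x (a S + (x + z)) = norm (a S + z)" unfolding dist_norm by (subst norm_minus_commute) simp
  ultimately have "dist x (a S + (x + z)) <= \<rho>"
   using norm_triangle_ineq[of "a S" z] S(2) unfolding \<rho>_def by linarith
  then show "\<exists>p\<in>P T. dist x p <= \<rho>" using p by blast
 qed
qed

lemma local_points_delone:
 assumes P: "local_points P" and T: "T \<in> \<Omega>"
 shows "uniform_discrete (P T)" "relatively_dense (P T)"
 using local_points_separated[OF P] local_points_dense[OF P] T unfolding uniform_discrete_def relatively_dense_def
 by (meson linorder_not_less)+

text \<open>By rigidity a nearby element shows the same points near the origin up to a small translation.\<close>

lemma local_points_continuous: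
 assumes P: "local_points P" and T: "T \<in> \<Omega>" and e: "0 < e"
 shows "\<exists>\<delta>>0. \<forall>T'\<in>\<Omega>. config_dist dL T T' < \<delta> --> config_dist unit_dist (unlabelled (P T)) (unlabelled (P T')) < e"
proof -
 obtain R where R: "patch_determined \<Omega> R (\<lambda>T. P T \<inter> ball 0 (1 / (e / 2) + e / 2))"
  using local_points_local[OF P, of "1 / (e / 2) + e / 2"] by blast
 obtain \<delta> where \<delta>: "\<delta> > 0" "!!T'. T' \<in> \<Omega> ==> config_dist dL T T' < \<delta> ==> \<exists>z. norm z < e / 2 \<and> patch (translate T' z) 0 R = patch T 0 R"
  using patch_rigidity[OF T, of "e / 2" R] e by auto
 have "config_dist unit_dist (unlabelled (P T)) (unlabelled (P T')) < e" if T': "T' \<in> \<Omega>" "config_dist dL T T' < \<delta>" for T'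
 proof -
  obtain z where z: "norm z < e / 2" "patch (translate T' z) 0 R = patch T 0 R" using \<delta>(2)[OF T'] by blast
  have "config_dist unit_dist (unlabelled (P T)) (unlabelled (P T')) <= e / 2"
  proof (rule config_dist_patch_eq[OF Metric_space_unit _ _ _ _ order_refl])
   show "locally_finite_config UNIV (unlabelled (P T))"
    by (rule is_delone_imp_locally_finite) (use local_points_delone[OF P T] in \<open>auto simp: is_delone_def\<close>)
   have "translate (unlabelled (P T')) z = unlabelled (P (translate T' z))"
    unfolding translate_labelled_points local_points_D(3)[OF P T'(1)] by simp
   then show "patch (translate (unlabelled (P T')) z) 0 (1 / (e / 2) + e / 2) = patch (unlabelled (P T)) 0 (1 / (e / 2) + e / 2)"
    using patch_determinedD[OF R translate_mem[OF T'(1)] T z(2)] by (simp only: patch_labelled_points order_refl)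
  qed (use z e in auto)
  then show ?thesis using e by linarith
 qed
 then show ?thesis using \<delta>(1) by blast
qed

lemma local_points_associated:
 assumes P: "local_points P" shows "associated_delone_sets dL \<Omega> P"
 using delone_space_unlabelled(3)[OF space _ local_points_D(3)[OF P] local_points_continuous[OF P]]
  local_points_delone[OF P] by blast

lemma local_points_derivation:
 assumes P: "local_points P"
 shows "delone_space ((\<lambda>T. unlabelled (P T)) ` \<Omega>)"
  "local_derivation L dL \<Omega> UNIV unit_dist ((\<lambda>T. unlabelled (P T)) ` \<Omega>) (\<lambda>T. unlabelled (P T))"
proof -
 let ?\<Phi> = "\<lambda>T. unlabelled (P T)"
 have *: "delone_space (?\<Phi> ` \<Omega>)" "factor_map dL \<Omega> unit_dist (?\<Phi> ` \<Omega>) ?\<Phi>"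
  using delone_space_unlabelled(1,2)[OF space _ local_points_D(3)[OF P] local_points_continuous[OF P]] local_points_delone[OF P]
  by blast+
 show "delone_space (?\<Phi> ` \<Omega>)" by (rule *)
 have loc: "\<exists>R. patch_determined \<Omega> R (\<lambda>T. patch (?\<Phi> T) 0 r)" for r
  unfolding patch_labelled_points using local_points_local[OF P, of r] unfolding patch_determined_def by metis
 have eq: "?\<Phi> (translate T x) = translate (?\<Phi> T) x" if "T \<in> \<Omega>" for T x using *(2) that unfolding factor_map_def by blast
 have "FLC (?\<Phi> ` \<Omega>)"
 proof (rule FLC_local_image[where B = 1, OF _ _ _ loc])
  show "translate (?\<Phi> T) x \<in> ?\<Phi> ` \<Omega>" if "T \<in> \<Omega>" for T x using eq[OF that, of x] translate_mem[OF that] by (metis imageI)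
  show "finite (patch (?\<Phi> T) 0 r)" if "T \<in> \<Omega>" for T r
   unfolding patch_labelled_points unfolding labelled_points_def using local_points_D(2)[OF P that] by simp
  show "\<exists>w. norm w <= 1 \<and> ?\<Phi> (translate T z) = translate (?\<Phi> T) w" if "T \<in> \<Omega>" "norm z < 1" for T z
   using eq[OF that(1)] that(2) by (intro exI[of _ z]) simp
 qed
 moreover have "\<exists>R>0. \<forall>T\<in>\<Omega>. \<forall>T'\<in>\<Omega>. patch T 0 R = patch T' 0 R --> patch (?\<Phi> T) 0 r = patch (?\<Phi> T') 0 r" for r
 proof -
  obtain R where R: "patch_determined \<Omega> R (\<lambda>T. patch (?\<Phi> T) 0 r)" using loc by blast
  have "\<forall>T\<in>\<Omega>. \<forall>T'\<in>\<Omega>. patch T 0 (max R 1) = patch T' 0 (max R 1) --> patch (?\<Phi> T) 0 r = patch (?\<Phi> T') 0 r"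
   using patch_determinedD[OF R _ _ _ max.cobounded1] by blast
  then show ?thesis by (intro exI[of _ "max R 1"] conjI) (simp_all only: less_max_iff_disj zero_less_one simp_thms)
 qed
 ultimately show "local_derivation L dL \<Omega> UNIV unit_dist (?\<Phi> ` \<Omega>) ?\<Phi>"
  unfolding local_derivation_def using space flc * unfolding delone_space_def by blast
qed

lemma points_unlabelled [simp]: "points (unlabelled A) = A"
 unfolding points_def labelled_points_def by (simp add: image_image)

text \<open>
 This replaces local derivations onto other spaces by point sets read off from patches, so
 that transversals can be handled by rigidity.
\<close>

lemma FLC_transversal_iff: "FLC_transversal L dL \<Omega> \<Xi> \<longleftrightarrow> (\<exists>P. local_points P \<and> \<Xi> = {T \<in> \<Omega>. 0 \<in> P T})"
proof
 assume "\<exists>P. local_points P \<and> \<Xi> = {T \<in> \<Omega>. 0 \<in> P T}"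
 then obtain P where P: "local_points P" "\<Xi> = {T \<in> \<Omega>. 0 \<in> P T}" by blast
 show "FLC_transversal L dL \<Omega> \<Xi>"
  unfolding FLC_transversal_def using local_points_derivation[OF P(1)] P(2)
  by (intro exI[of _ "(\<lambda>T. unlabelled (P T)) ` \<Omega>"] exI[of _ "\<lambda>T. unlabelled (P T)"]) simp
next
 assume "FLC_transversal L dL \<Omega> \<Xi>"
 then obtain \<Omega>0 \<D> where D: "delone_space \<Omega>0" "local_derivation L dL \<Omega> UNIV unit_dist \<Omega>0 \<D>" "\<Xi> = {T \<in> \<Omega>. 0 \<in> points (\<D> T)}"
  unfolding FLC_transversal_def by blast
 define P where "P T = points (\<D> T)" for T
 have fm: "\<D> T \<in> \<Omega>0" "\<D> (translate T x) = translate (\<D> T) x" if "T \<in> \<Omega>" for T x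
  using D(2) that unfolding local_derivation_def factor_map_def by auto
 have PT: "\<D> T = unlabelled (P T) \<and> uniform_discrete (P T) \<and> relatively_dense (P T)" if T: "T \<in> \<Omega>" for T
 proof -
  have "is_delone UNIV (\<D> T)" using D(1) fm(1)[OF T] unfolding delone_space_def by blast
  then obtain \<Lambda> and lab :: "'a => unit" where \<Lambda>: "uniform_discrete \<Lambda>" "relatively_dense \<Lambda>" "\<D> T = labelled_points \<Lambda> lab"
   unfolding is_delone_def by blast
  have "lab = (\<lambda>_. ())" by (simp add: fun_eq_iff)
  then have "\<D> T = unlabelled \<Lambda>" "P T = \<Lambda>" using \<Lambda>(3) unfolding P_def by auto
  then show ?thesis using \<Lambda> by simp
 qed
 have "local_points P"
  unfolding local_points_def
 proof (intro conjI ballI allI)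
  fix T assume T: "T \<in> \<Omega>"
  show "P T ~= {}" using PT[OF T] unfolding relatively_dense_def by blast
  show "finite (P T \<inter> ball 0 r)" for r using PT[OF T] by (intro uniform_discrete_finite_ball) auto
  show "P (translate T x) = (\<lambda>p. p - x) ` P T" for x
  proof -
   have "unlabelled (P (translate T x)) = unlabelled ((\<lambda>p. p - x) ` P T)"
    using PT[OF translate_mem[OF T, of x]] fm(2)[OF T, of x] PT[OF T] translate_labelled_points[of "P T" "\<lambda>_. ()" x] by simp
   then show ?thesis unfolding unlabelled_inject .
  qed
 next
  fix r
  obtain R where R: "\<forall>T\<in>\<Omega>. \<forall>T'\<in>\<Omega>. patch T 0 R = patch T' 0 R --> patch (\<D> T) 0 (max r 1) = patch (\<D> T') 0 (max r 1)"
   using D(2) unfolding local_derivation_def by (meson less_max_iff_disj zero_less_one)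
  have "P T \<inter> ball 0 r = P T' \<inter> ball 0 r" if "T \<in> \<Omega>" "T' \<in> \<Omega>" "patch T 0 R = patch T' 0 R" for T T'
  proof -
   have "patch (unlabelled (P T)) 0 r = patch (unlabelled (P T')) 0 r"
    using patch_eq_le[of "\<D> T" "max r 1" "\<D> T'" r] R[rule_format, OF that] PT[OF that(1)] PT[OF that(2)] by simp
   then show ?thesis unfolding patch_labelled_points by simp
  qed
  then show "\<exists>R. patch_determined \<Omega> R (\<lambda>T. P T \<inter> ball 0 r)" unfolding patch_determined_def by blast
 qed
 then show "\<exists>P. local_points P \<and> \<Xi> = {T \<in> \<Omega>. 0 \<in> P T}" using D(3) unfolding P_def by blast
qed

text \<open>On a transversal the small translation of rigidity has to vanish.\<close>

lemma transversal_rigidity: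
 assumes P: "local_points P" and S: "S \<in> \<Omega>" "0 \<in> P S"
 shows "\<exists>\<delta>>0. \<forall>S'\<in>\<Omega>. 0 \<in> P S' --> config_dist dL S S' < \<delta> --> patch S' 0 N = patch S 0 N"
proof -
 obtain e where e: "e > 0" "!!T p q. T \<in> \<Omega> ==> p \<in> P T ==> q \<in> P T ==> p ~= q ==> e <= dist p q"
  using local_points_separated[OF P] by blast
 obtain R where R: "patch_determined \<Omega> R (\<lambda>T. P T \<inter> ball 0 1)" using local_points_local[OF P, of 1] by blast
 obtain \<delta> where \<delta>: "\<delta> > 0" "!!S'. S' \<in> \<Omega> ==> config_dist dL S S' < \<delta> ==>
  \<exists>z. norm z < e \<and> patch (translate S' z) 0 (max N R) = patch S 0 (max N R)" using patch_rigidity[OF S(1) e(1)] by blast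
 show ?thesis
 proof (intro exI[of _ \<delta>] conjI ballI impI)
  fix S' assume S': "S' \<in> \<Omega>" "0 \<in> P S'" "config_dist dL S S' < \<delta>"
  obtain z where z: "norm z < e" "patch (translate S' z) 0 (max N R) = patch S 0 (max N R)" using \<delta>(2)[OF S'(1,3)] by blast
  have "P (translate S' z) \<inter> ball 0 1 = P S \<inter> ball 0 1"
   by (rule patch_determinedD[OF R translate_mem[OF S'(1)] S(1) z(2)]) simp
  moreover have "0 \<in> P S \<inter> ball 0 1" using S(2) by simp
  ultimately have "0 \<in> P (translate S' z)" by blast
  then have "z \<in> P S'" using local_points_D(4)[OF P S'(1)] by simp
  then have "z = 0" using e(2)[OF S'(1,2), of z] z(1) by fastforce
  then show "patch S' 0 N = patch S 0 N" using patch_eq_le[OF z(2), of N] by simp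
 qed (rule \<delta>(1))
qed

text \<open>
 By rigidity an element off the transversal has a neighbourhood that misses it, hence the
 transversal inherits compactness.
\<close>

lemma transversal_cover:
 assumes P: "local_points P"
 shows "\<exists>\<S>. finite \<S> \<and> \<S> \<subseteq> \<Omega> \<and> (\<forall>S\<in>\<S>. 0 \<in> P S) \<and>
  (\<forall>S'\<in>\<Omega>. 0 \<in> P S' --> (\<exists>S\<in>\<S>. patch S' 0 (N S) = patch S 0 (N S)))"
proof -
 have "\<exists>\<delta>>0. \<forall>S'\<in>\<Omega>. 0 \<in> P S' --> config_dist dL S S' < \<delta> --> 0 \<in> P S \<and> patch S' 0 (N S) = patch S 0 (N S)" if S: "S \<in> \<Omega>" for S
 proof (cases "0 \<in> P S")
  case True
  then show ?thesis using transversal_rigidity[OF P S True, of "N S"] by simp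
 next
  case False
  obtain R where R: "patch_determined \<Omega> R (\<lambda>T. P T \<inter> ball 0 1)" using local_points_local[OF P, of 1] by blast
  have fin: "finite (P S \<inter> ball 0 1)" by (rule local_points_D(2)[OF P S])
  define e where "e = Min (insert 1 (norm ` (P S \<inter> ball 0 1)))"
  have "0 < norm p" if "p \<in> P S \<inter> ball 0 1" for p
  proof -
   have "p ~= 0" using that False by blast
   then show ?thesis by simp
  qed
  then have e: "0 < e" "e <= 1" "!!p. p \<in> P S \<inter> ball 0 1 ==> e <= norm p" unfolding e_def using fin by simp_all
  obtain \<delta> where \<delta>: "\<delta> > 0" "!!S'. S' \<in> \<Omega> ==> config_dist dL S S' < \<delta> ==> \<exists>z. norm z < e \<and> patch (translate S' z) 0 R = patch S 0 R"
   using patch_rigidity[OF S e(1)] by blast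
  have "\<not> config_dist dL S S' < \<delta>" if S': "S' \<in> \<Omega>" "0 \<in> P S'" for S'
  proof
   assume "config_dist dL S S' < \<delta>"
   then obtain z where z: "norm z < e" "patch (translate S' z) 0 R = patch S 0 R" using \<delta>(2)[OF S'(1)] by blast
   have "- z \<in> P (translate S' z) \<inter> ball 0 1" using S'(2) z(1) e(2) by (simp add: local_points_D(4)[OF P S'(1)])
   then have "- z \<in> P S \<inter> ball 0 1" using patch_determinedD[OF R translate_mem[OF S'(1)] S z(2) order_refl] by blast
   then show False using e(3)[of "- z"] z(1) by simp
  qed
  then show ?thesis using \<delta>(1) by blast
 qed
 then have "\<forall>S. \<exists>\<delta>. S \<in> \<Omega> --> 0 < \<delta> \<and> (\<forall>S'\<in>\<Omega>. 0 \<in> P S' --> config_dist dL S S' < \<delta> --> 0 \<in> P S \<and> patch S' 0 (N S) = patch S 0 (N S))"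
  by blast
 from choice[OF this] obtain \<delta> where \<delta>: "!!S. S \<in> \<Omega> ==> 0 < \<delta> S"
  "!!S S'. S \<in> \<Omega> ==> S' \<in> \<Omega> ==> 0 \<in> P S' ==> config_dist dL S S' < \<delta> S ==> 0 \<in> P S \<and> patch S' 0 (N S) = patch S 0 (N S)"
  by blast
 obtain \<S> where \<S>: "finite \<S>" "\<S> \<subseteq> \<Omega>" "!!S'. S' \<in> \<Omega> ==> \<exists>S\<in>\<S>. config_dist dL S S' < \<delta> S"
  using finite_cover[of \<delta>] \<delta>(1) by blast
 have "\<exists>S\<in>{S \<in> \<S>. 0 \<in> P S}. patch S' 0 (N S) = patch S 0 (N S)" if S': "S' \<in> \<Omega>" "0 \<in> P S'" for S'
 proof -
  obtain S where "S \<in> \<S>" "config_dist dL S S' < \<delta> S" using \<S>(3)[OF S'(1)] by blast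
  then show ?thesis using \<delta>(2)[of S S'] S' \<S>(2) by blast
 qed
 then show ?thesis using \<S>(1,2) by (intro exI[of _ "{S \<in> \<S>. 0 \<in> P S}"] conjI ballI impI) (simp_all add: subset_iff)
qed

text \<open>Compactness of the transversal turns the neighbourhoods on which f is constant into one radius.\<close>

lemma transversal_uniform:
 assumes P: "local_points P"
  and f: "!!S. S \<in> \<Omega> ==> 0 \<in> P S ==> \<exists>\<delta>>0. \<forall>S'\<in>\<Omega>. 0 \<in> P S' --> config_dist dL S S' < \<delta> --> f S' = f S"
 shows "\<exists>N. \<forall>S\<in>\<Omega>. \<forall>S'\<in>\<Omega>. 0 \<in> P S --> 0 \<in> P S' --> patch S 0 N = patch S' 0 N --> f S = f S'"
proof -
 have "\<exists>N. \<forall>S'\<in>\<Omega>. 0 \<in> P S' --> patch S' 0 N = patch S 0 N --> f S' = f S" if S: "S \<in> \<Omega>" "0 \<in> P S" for S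
 proof -
  obtain \<delta> where \<delta>: "\<delta> > 0" "!!S'. S' \<in> \<Omega> ==> 0 \<in> P S' ==> config_dist dL S S' < \<delta> ==> f S' = f S"
   using f[OF S] by blast
  have "f S' = f S" if S': "S' \<in> \<Omega>" "0 \<in> P S'" "patch S' 0 (1 / (\<delta> / 2) + \<delta> / 2) = patch S 0 (1 / (\<delta> / 2) + \<delta> / 2)" for S'
  proof (rule \<delta>(2)[OF S'(1,2)])
   have "config_dist dL S S' <= \<delta> / 2"
    by (rule config_dist_patch_eq[OF labels lf[OF S(1)], of S' 0]) (use S'(3) \<delta>(1) in auto)
   then show "config_dist dL S S' < \<delta>" using \<delta>(1) by linarith
  qed
  then show ?thesis by blast
 qed
 then have "\<forall>S. \<exists>N. S \<in> \<Omega> --> 0 \<in> P S --> (\<forall>S'\<in>\<Omega>. 0 \<in> P S' --> patch S' 0 N = patch S 0 N --> f S' = f S)" by blast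
 from choice[OF this] obtain N where N: "!!S S'. S \<in> \<Omega> ==> 0 \<in> P S ==> S' \<in> \<Omega> ==> 0 \<in> P S' ==> patch S' 0 (N S) = patch S 0 (N S) ==> f S' = f S"
  by blast
 obtain \<S> where \<S>: "finite \<S>" "\<S> \<subseteq> \<Omega>" "!!S. S \<in> \<S> ==> 0 \<in> P S"
  "!!S'. S' \<in> \<Omega> ==> 0 \<in> P S' ==> \<exists>S\<in>\<S>. patch S' 0 (N S) = patch S 0 (N S)"
  using transversal_cover[OF P, of N] by blast
 show ?thesis
 proof (intro exI[of _ "Max (insert 0 (N ` \<S>))"] ballI impI)
  fix S1 S2 assume S: "S1 \<in> \<Omega>" "S2 \<in> \<Omega>" "0 \<in> P S1" "0 \<in> P S2"
   and eq: "patch S1 0 (Max (insert 0 (N ` \<S>))) = patch S2 0 (Max (insert 0 (N ` \<S>)))"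
  obtain S where S0: "S \<in> \<S>" "patch S1 0 (N S) = patch S 0 (N S)" using \<S>(4)[OF S(1,3)] by blast
  have "patch S1 0 (N S) = patch S2 0 (N S)" by (rule patch_eq_le[OF eq]) (use \<S>(1) S0(1) in auto)
  moreover have "S \<in> \<Omega>" "0 \<in> P S" using S0(1) \<S>(2,3) by auto
  ultimately show "f S1 = f S2" using N[of S S1] N[of S S2] S S0(2) by simp
 qed
qed

lemma transversally_locally_constant_iff:
 "transversally_locally_constant L dL \<Omega> f \<longleftrightarrow> (\<forall>P. local_points P -->
   (\<forall>S\<in>\<Omega>. 0 \<in> P S --> (\<exists>\<delta>>0. \<forall>S'\<in>\<Omega>. 0 \<in> P S' --> config_dist dL S S' < \<delta> --> f S' = f S)))"
proof -
 have "(\<exists>U. openin (config_topology dL \<Omega>) U \<and> S \<in> U \<and> (\<forall>S'\<in>U \<inter> \<Xi>. f S' = f S)) \<longleftrightarrow>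
  (\<exists>\<delta>>0. \<forall>S'\<in>\<Omega>. S' \<in> \<Xi> --> config_dist dL S S' < \<delta> --> f S' = f S)" if S: "S \<in> \<Omega>" for S \<Xi>
 proof
  assume "\<exists>U. openin (config_topology dL \<Omega>) U \<and> S \<in> U \<and> (\<forall>S'\<in>U \<inter> \<Xi>. f S' = f S)"
  then obtain U where U: "openin M.mtopology U" "S \<in> U" "\<forall>S'\<in>U \<inter> \<Xi>. f S' = f S" unfolding config_topology_def by blast
  then obtain r where "r > 0" "M.mball S r \<subseteq> U" unfolding M.openin_mtopology by metis
  then show "\<exists>\<delta>>0. \<forall>S'\<in>\<Omega>. S' \<in> \<Xi> --> config_dist dL S S' < \<delta> --> f S' = f S" using U(3) S
   by (intro exI[of _ r]) auto
 next
  assume "\<exists>\<delta>>0. \<forall>S'\<in>\<Omega>. S' \<in> \<Xi> --> config_dist dL S S' < \<delta> --> f S' = f S"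
  then obtain \<delta> where "\<delta> > 0" "\<forall>S'\<in>\<Omega>. S' \<in> \<Xi> --> config_dist dL S S' < \<delta> --> f S' = f S" by blast
  then show "\<exists>U. openin (config_topology dL \<Omega>) U \<and> S \<in> U \<and> (\<forall>S'\<in>U \<inter> \<Xi>. f S' = f S)"
   unfolding config_topology_def using S by (intro exI[of _ "M.mball S \<delta>"]) auto
 qed
 then have *: "(\<forall>S\<in>\<Xi>. \<exists>U. openin (config_topology dL \<Omega>) U \<and> S \<in> U \<and> (\<forall>S'\<in>U \<inter> \<Xi>. f S' = f S)) \<longleftrightarrow>
  (\<forall>S\<in>\<Xi>. \<exists>\<delta>>0. \<forall>S'\<in>\<Omega>. S' \<in> \<Xi> --> config_dist dL S S' < \<delta> --> f S' = f S)" if "\<Xi> \<subseteq> \<Omega>" for \<Xi>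
  by (rule ball_cong[OF refl]) (use that in blast)
 have "transversally_locally_constant L dL \<Omega> f \<longleftrightarrow> (\<forall>P. local_points P -->
   (\<forall>S\<in>{T \<in> \<Omega>. 0 \<in> P T}. \<exists>U. openin (config_topology dL \<Omega>) U \<and> S \<in> U \<and> (\<forall>S'\<in>U \<inter> {T \<in> \<Omega>. 0 \<in> P T}. f S' = f S)))"
  unfolding transversally_locally_constant_def FLC_transversal_iff by blast
 also have "... \<longleftrightarrow> (\<forall>P. local_points P --> (\<forall>S\<in>{T \<in> \<Omega>. 0 \<in> P T}.
   \<exists>\<delta>>0. \<forall>S'\<in>\<Omega>. S' \<in> {T \<in> \<Omega>. 0 \<in> P T} --> config_dist dL S S' < \<delta> --> f S' = f S))"
  by (subst *) simp_all
 finally show ?thesis by (simp add: Ball_def imp_conjL)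
qed

lemma patch_determined_transversally_locally_constant:
 assumes "patch_determined \<Omega> N f" shows "transversally_locally_constant L dL \<Omega> f"
 unfolding transversally_locally_constant_iff
 using transversal_rigidity[of _ _ N] assms unfolding patch_determined_def by metis

text \<open>A vertex in a ball belongs to a tile meeting that ball.\<close>

lemma local_points_vertices: "local_points vertices"
 unfolding local_points_def
proof (intro conjI ballI allI)
 fix T assume T: "T \<in> \<Omega>"
 have t: "(convex (fst t) \<and> compact (fst t) \<and> fst t ~= {}) \<and> finite {v. v extreme_point_of fst t}" if "t \<in> T" for t
 proof -
  have "is_delone L T \<or> is_tiling L T" using space T unfolding tiling_space_def by blast
  then have "(\<exists>p. fst t = {p}) \<or> is_tile L t"
   using that unfolding is_delone_def labelled_points_def is_tiling_def by auto
  then show ?thesis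
  proof
   assume "is_tile L t"
   then show ?thesis using polytope_imp_compact polytope_imp_convex finite_polyhedron_extreme_points polytope_imp_polyhedron
    unfolding is_tile_def by fastforce
  qed auto
 qed
 obtain t0 where "t0 \<in> T" using tiling_space_nonempty[OF space T] by blast
 moreover from this obtain v where "v extreme_point_of fst t0" using extreme_point_exists_convex[of "fst t0"] t by blast
 ultimately show "vertices T ~= {}" unfolding vertices_def by blast
 show "finite (vertices T \<inter> ball 0 r)" for r
 proof (rule finite_subset)
  show "vertices T \<inter> ball 0 r \<subseteq> (\<Union>t\<in>patch T 0 r. {v. v extreme_point_of fst t})"
   unfolding vertices_def patch_def extreme_point_of_def by auto
  show "finite (\<Union>t\<in>patch T 0 r. {v. v extreme_point_of fst t})"
   using locally_finite_config_patch[OF lf[OF T]] t patch_subset by blast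
 qed
 show "vertices (translate T x) = (\<lambda>p. p - x) ` vertices T" for x
 proof -
  have *: "v extreme_point_of (\<lambda>y. y - x) ` K \<longleftrightarrow> v + x extreme_point_of K" for v K
   using extreme_point_of_translation_eq[of "- x" "v + x" K] by (simp add: add.commute)
  have "vertices (translate T x) = {v. v + x \<in> vertices T}"
   unfolding vertices_def translate_eq_image translate_tile_def by (auto simp: *)
  also have "... = (\<lambda>p. p - x) ` vertices T" by force
  finally show ?thesis .
 qed
next
 fix r
 have *: "vertices T \<inter> ball 0 r = vertices (patch T 0 r) \<inter> ball 0 r" for T :: "('a, 'l) config"
  unfolding vertices_def patch_def extreme_point_of_def by (simp only: set_eq_iff mem_Collect_eq Int_iff) blast
 have "vertices T \<inter> ball 0 r = vertices T' \<inter> ball 0 r" if "patch T 0 r = patch T' 0 r" for T T' :: "('a, 'l) config"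
  using *[of T] *[of T'] that by simp
 then show "\<exists>R. patch_determined \<Omega> R (\<lambda>T. vertices T \<inter> ball 0 r)" unfolding patch_determined_def by blast
qed

text \<open>Shifted point sets provide transversals through every element of the space.\<close>

lemma local_points_shift:
 assumes P: "local_points P" shows "local_points (\<lambda>T. (\<lambda>p. p - a) ` P T)"
 unfolding local_points_def
proof (intro conjI ballI allI)
 fix T assume T: "T \<in> \<Omega>"
 show "(\<lambda>p. p - a) ` P T ~= {}" using local_points_D(1)[OF P T] by simp
 show "finite ((\<lambda>p. p - a) ` P T \<inter> ball 0 r)" for r
  using local_points_D(2)[OF P translate_mem[OF T, of a], of r] unfolding local_points_D(3)[OF P T] .
 show "(\<lambda>p. p - a) ` P (translate T x) = (\<lambda>p. p - x) ` (\<lambda>p. p - a) ` P T" for x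
  unfolding local_points_D(3)[OF P T] image_image by (simp add: algebra_simps)
next
 fix r
 obtain R where R: "patch_determined \<Omega> R (\<lambda>T. P T \<inter> ball 0 r)" using local_points_local[OF P, of r] by blast
 have "(\<lambda>p. p - a) ` P T \<inter> ball 0 r = (\<lambda>p. p - a) ` P T' \<inter> ball 0 r"
  if T: "T \<in> \<Omega>" "T' \<in> \<Omega>" "patch T 0 (norm a + R) = patch T' 0 (norm a + R)" for T T'
  using patch_determinedD[OF R translate_mem[OF T(1)] translate_mem[OF T(2)] patch_eq_translate[OF T(3) order_refl] order_refl]
  unfolding local_points_D(3)[OF P T(1)] local_points_D(3)[OF P T(2)] .
 then show "\<exists>R. patch_determined \<Omega> R (\<lambda>T. (\<lambda>p. p - a) ` P T \<inter> ball 0 r)" unfolding patch_determined_def by blast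
qed

end

section \<open>Local representatives of strong classes\<close>

lemma finite_uniform_radius:
 fixes d :: "'b => real"
 assumes "finite A" "!!v. v \<in> A ==> \<exists>\<delta>>0. \<forall>x. d x < \<delta> --> Q v x"
 shows "\<exists>\<delta>>0. \<forall>v\<in>A. \<forall>x. d x < \<delta> --> Q v x"
 using assms
proof (induction A)
 case (insert a A)
 obtain \<delta>1 where 1: "\<delta>1 > 0" "\<forall>v\<in>A. \<forall>x. d x < \<delta>1 --> Q v x" using insert by blast
 obtain \<delta>2 where 2: "\<delta>2 > 0" "\<forall>x. d x < \<delta>2 --> Q a x" using insert.prems[of a] by blast
 show ?case using 1 2 by (intro exI[of _ "min \<delta>1 \<delta>2"]) simp
qed (auto intro: exI[of _ 1])

lemma continuous_map_scaleR:
 fixes g :: "'x => 'b::real_normed_vector"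
 assumes "continuous_map X euclidean f" "continuous_map X euclidean g"
 shows "continuous_map X euclidean (\<lambda>x. f x *\<^sub>R g x)"
 using assms by (simp add: continuous_map_atin tendsto_scaleR)

definition tent :: "real => 'a::real_normed_vector => real" where
 "tent \<rho> p = max 0 (\<rho> - norm p)"

definition vertex_weight :: "real => ('a::real_normed_vector, 'l) config => 'a => real" where
 "vertex_weight \<rho> S x = (\<Sum>p\<in>vertices S \<inter> ball x \<rho>. tent \<rho> (p - x))"

text \<open>
 The tents around the vertices, divided by their sum, form a partition of unity; the average is
 the corresponding combination of the values of the cochain at the vertices around x.
\<close>

definition vertex_average :: "real => ('a::real_normed_vector, 'l) cochain => ('a, 'l) config => 'a => 'a" where
 "vertex_average \<rho> \<alpha> S x = (\<Sum>p\<in>vertices S \<inter> ball x \<rho>. tent \<rho> (p - x) *\<^sub>R \<alpha> S p) /\<^sub>R vertex_weight \<rho> S x"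

context flc_space
begin

lemma transversally_locally_constant_combine:
 assumes "transversally_locally_constant L dL \<Omega> s" "transversally_locally_constant L dL \<Omega> t"
 shows "transversally_locally_constant L dL \<Omega> (\<lambda>T. g (s T) (t T))"
 unfolding transversally_locally_constant_iff
proof (intro allI ballI impI)
 fix P S assume P: "local_points P" "S \<in> \<Omega>" "0 \<in> P S"
 obtain \<delta>1 where 1: "\<delta>1 > 0" "\<forall>S'\<in>\<Omega>. 0 \<in> P S' --> config_dist dL S S' < \<delta>1 --> s S' = s S"
  using assms(1) P unfolding transversally_locally_constant_iff by blast
 obtain \<delta>2 where 2: "\<delta>2 > 0" "\<forall>S'\<in>\<Omega>. 0 \<in> P S' --> config_dist dL S S' < \<delta>2 --> t S' = t S"
  using assms(2) P unfolding transversally_locally_constant_iff by blast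
 show "\<exists>\<delta>>0. \<forall>S'\<in>\<Omega>. 0 \<in> P S' --> config_dist dL S S' < \<delta> --> g (s S') (t S') = g (s S) (t S)"
  using 1 2 by (intro exI[of _ "min \<delta>1 \<delta>2"]) simp
qed

text \<open>
 Nearby elements have the same points up to a small translation near the ball, and points that cross
 the boundary of the ball are harmless because the summand vanishes there.
\<close>

lemma local_sum_continuous:
 fixes k :: "('a, 'l) config => 'a => 'b::real_normed_vector"
 assumes P: "local_points P"
  and k: "continuous_map (prod_topology (config_topology dL \<Omega>) euclidean) euclidean (\<lambda>(S, p). k S p)"
  and k0: "!!S p. \<rho> <= norm p ==> k S p = 0"
 shows "continuous_map (config_topology dL \<Omega>) euclidean (\<lambda>S. \<Sum>p\<in>P S \<inter> ball 0 \<rho>. k S p)"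
 unfolding config_topology_def continuous_map_metric_euclidean_iff[OF M.Metric_space_axioms]
proof (intro ballI allI impI)
 fix S and e :: real assume S: "S \<in> \<Omega>" and e: "0 < e"
 define F where "F = P S \<inter> ball 0 (\<rho> + 1)"
 have F: "finite F" unfolding F_def by (rule local_points_D(2)[OF P S])
 define e1 where "e1 = e / (real (card F) + 1)"
 have e1: "e1 > 0" unfolding e1_def using e by simp
 have "\<forall>p. \<exists>\<delta>. \<delta> > 0 \<and> (\<forall>S'\<in>\<Omega>. \<forall>p'. config_dist dL S S' < \<delta> --> dist p p' < \<delta> --> dist (k S p) (k S' p') < e1)"
  using k S e1
  unfolding config_topology_def continuous_map_metric_times_euclidean_iff[OF M.Metric_space_axioms] by blast
 from choice[OF this] obtain d where d: "!!p. d p > 0"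
  "!!p S' p'. S' \<in> \<Omega> ==> config_dist dL S S' < d p ==> dist p p' < d p ==> dist (k S p) (k S' p') < e1" by blast
 define \<delta>0 where "\<delta>0 = Min (insert 1 (d ` F))"
 have \<delta>0: "0 < \<delta>0" "\<delta>0 <= 1" "!!p. p \<in> F ==> \<delta>0 <= d p" unfolding \<delta>0_def using F d(1) by auto
 obtain R where R: "patch_determined \<Omega> R (\<lambda>T. P T \<inter> ball 0 (\<rho> + 1))"
  using local_points_local[OF P, of "\<rho> + 1"] by blast
 obtain \<delta> where \<delta>: "\<delta> > 0" "!!S'. S' \<in> \<Omega> ==> config_dist dL S S' < \<delta> ==> \<exists>z. norm z < \<delta>0 \<and> patch (translate S' z) 0 R = patch S 0 R"
  using patch_rigidity[OF S \<delta>0(1)] by blast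
 show "\<exists>\<delta>>0. \<forall>S'\<in>\<Omega>. config_dist dL S S' < \<delta> -->
  dist (\<Sum>p\<in>P S \<inter> ball 0 \<rho>. k S p) (\<Sum>p\<in>P S' \<inter> ball 0 \<rho>. k S' p) < e"
 proof (intro exI[of _ "min \<delta> \<delta>0"] conjI ballI impI)
  fix S' assume S': "S' \<in> \<Omega>" "config_dist dL S S' < min \<delta> \<delta>0"
  obtain z where z: "norm z < \<delta>0" "patch (translate S' z) 0 R = patch S 0 R" using \<delta>(2)[OF S'(1)] S'(2) by auto
  have eq: "P (translate S' z) \<inter> ball 0 (\<rho> + 1) = F" unfolding F_def by (rule patch_determinedD[OF R translate_mem[OF S'(1)] S z(2)]) simp
  have "(\<Sum>p\<in>P S \<inter> ball 0 \<rho>. k S p) = (\<Sum>p\<in>F. k S p)"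
   by (rule sum.mono_neutral_left[OF F]) (auto simp: F_def not_less intro!: k0)
  moreover have "(\<Sum>p\<in>P S' \<inter> ball 0 \<rho>. k S' p) = (\<Sum>p\<in>(\<lambda>p. p + z) ` F. k S' p)"
  proof (rule sum.mono_neutral_left)
   show "P S' \<inter> ball 0 \<rho> \<subseteq> (\<lambda>p. p + z) ` F"
   proof
    fix p assume p: "p \<in> P S' \<inter> ball 0 \<rho>"
    then have "p - z \<in> P (translate S' z)" by (simp add: local_points_D(4)[OF P S'(1)])
    moreover have "norm (p - z) < \<rho> + 1" using p z(1) \<delta>0(2) norm_triangle_ineq4[of p z] by simp
    ultimately have "p - z \<in> F" unfolding eq[symmetric] by simp
    then show "p \<in> (\<lambda>p. p + z) ` F" by (intro image_eqI[of _ _ "p - z"]) simp_all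
   qed
   show "\<forall>p\<in>(\<lambda>p. p + z) ` F - (P S' \<inter> ball 0 \<rho>). k S' p = 0"
   proof
    fix p assume p: "p \<in> (\<lambda>p. p + z) ` F - (P S' \<inter> ball 0 \<rho>)"
    then have "p - z \<in> F" by auto
    then have "p \<in> P S'" using local_points_D(4)[OF P S'(1), of "p - z" z] unfolding eq[symmetric] by simp
    then show "k S' p = 0" using p by (intro k0) auto
   qed
  qed (use F in simp)
  moreover have "(\<Sum>p\<in>(\<lambda>p. p + z) ` F. k S' p) = (\<Sum>p\<in>F. k S' (p + z))"
   by (subst sum.reindex) (auto simp: inj_on_def)
  moreover have "dist (\<Sum>p\<in>F. k S p) (\<Sum>p\<in>F. k S' (p + z)) <= (\<Sum>p\<in>F. e1)"
  proof -
   have "norm (k S p - k S' (p + z)) <= e1" if "p \<in> F" for p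
    using d(2)[OF S'(1), of p "p + z"] S'(2) z(1) \<delta>0(3)[OF that] by (simp add: dist_norm)
   then show ?thesis unfolding dist_norm sum_subtractf[symmetric] by (intro sum_norm_le) 
  qed
  moreover have "(\<Sum>p\<in>F. e1) < e" unfolding e1_def using e by (simp add: field_simps)
  ultimately show "dist (\<Sum>p\<in>P S \<inter> ball 0 \<rho>. k S p) (\<Sum>p\<in>P S' \<inter> ball 0 \<rho>. k S' p) < e" by simp
 qed (use \<delta> \<delta>0 in simp)
qed

lemma strong_cocycle_near:
 assumes \<alpha>: "strong_cocycle L dL \<Omega> \<alpha>" and P: "local_points P" and S: "S \<in> \<Omega>" "0 \<in> P S" and V: "finite V"
 shows "\<exists>\<delta>>0. \<forall>S'\<in>\<Omega>. 0 \<in> P S' --> config_dist dL S S' < \<delta> --> (\<forall>v\<in>V. \<alpha> S' v = \<alpha> S v)"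
proof -
 have "\<exists>\<delta>>0. \<forall>S'. config_dist dL S S' < \<delta> --> S' \<in> \<Omega> --> 0 \<in> P S' --> \<alpha> S' v = \<alpha> S v" for v
  using \<alpha> P S unfolding strong_cocycle_def transversally_locally_constant_iff by blast
 from finite_uniform_radius[OF V, of "config_dist dL S" "\<lambda>v S'. S' \<in> \<Omega> --> 0 \<in> P S' --> \<alpha> S' v = \<alpha> S v", OF this]
 show ?thesis by blast
qed

text \<open>
 A cocycle is not local in arbitrary directions, but its values on vectors joining two points of the
 same set are: collected into one function on the transversal they are locally constant, hence
 determined by a patch of uniform radius.
\<close>

lemma strong_cocycle_returns:
 assumes \<alpha>: "strong_cocycle L dL \<Omega> \<alpha>" and P: "local_points P"
 shows "\<exists>N. \<forall>S\<in>\<Omega>. \<forall>S'\<in>\<Omega>. 0 \<in> P S --> 0 \<in> P S' --> patch S 0 N = patch S' 0 N -->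
  (\<forall>v\<in>P S \<inter> P S' \<inter> ball 0 M. \<alpha> S v = \<alpha> S' v)"
proof -
 define f where "f S v = (if v \<in> P S \<inter> ball 0 M then \<alpha> S v else 0)" for S v
 have "\<exists>\<delta>>0. \<forall>S'\<in>\<Omega>. 0 \<in> P S' --> config_dist dL S S' < \<delta> --> f S' = f S" if S: "S \<in> \<Omega>" "0 \<in> P S" for S
 proof -
  obtain R where R: "patch_determined \<Omega> R (\<lambda>T. P T \<inter> ball 0 M)"
   using local_points_local[OF P, of M] by blast
  obtain \<delta>1 where 1: "\<delta>1 > 0" "!!S'. S' \<in> \<Omega> ==> 0 \<in> P S' ==> config_dist dL S S' < \<delta>1 ==> patch S' 0 R = patch S 0 R"
   using transversal_rigidity[OF P S] by blast
  obtain \<delta>2 where 2: "\<delta>2 > 0" "\<forall>S'\<in>\<Omega>. 0 \<in> P S' --> config_dist dL S S' < \<delta>2 --> (\<forall>v\<in>P S \<inter> ball 0 M. \<alpha> S' v = \<alpha> S v)"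
   using strong_cocycle_near[OF \<alpha> P S local_points_D(2)[OF P S(1), of M]] by blast
  have "f S' = f S" if S': "S' \<in> \<Omega>" "0 \<in> P S'" "config_dist dL S S' < min \<delta>1 \<delta>2" for S'
  proof -
   have "patch S' 0 R = patch S 0 R" using 1(2)[OF S'(1,2)] S'(3) by simp
   then have eq: "P S' \<inter> ball 0 M = P S \<inter> ball 0 M" by (rule patch_determinedD[OF R S'(1) S(1)]) simp
   have "\<alpha> S' v = \<alpha> S v" if "v \<in> P S \<inter> ball 0 M" for v using 2(2) S' that by auto
   then show ?thesis unfolding f_def eq by (intro ext) simp
  qed
  then show ?thesis using 1(1) 2(1) by (intro exI[of _ "min \<delta>1 \<delta>2"]) simp
 qed
 from transversal_uniform[OF P this]
 obtain N where N: "\<forall>S\<in>\<Omega>. \<forall>S'\<in>\<Omega>. 0 \<in> P S --> 0 \<in> P S' --> patch S 0 N = patch S' 0 N --> f S = f S'" by blast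
 have "\<alpha> S v = \<alpha> S' v" if "f S = f S'" "v \<in> P S \<inter> P S' \<inter> ball 0 M" for S S' v
  using fun_cong[OF that(1), of v] that(2) unfolding f_def by simp
 then show ?thesis using N by (intro exI[of _ N]) blast
qed

definition local_cochain :: "('a, 'l) cochain => bool" where
 "local_cochain \<beta> \<longleftrightarrow> (\<forall>M. \<exists>N. \<forall>x. norm x <= M --> patch_determined \<Omega> N (\<lambda>S. \<beta> S x))"

lemma local_cocycle_strong:
 assumes "weak_cocycle dL \<Omega> \<beta>" "local_cochain \<beta>"
 shows "strong_cocycle L dL \<Omega> \<beta>"
 unfolding strong_cocycle_def
proof (intro conjI allI)
 fix v :: 'a
 show "transversally_locally_constant L dL \<Omega> (\<lambda>T. \<beta> T v)"
  using assms(2) patch_determined_transversally_locally_constant unfolding local_cochain_def by blast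
qed (rule assms)

text \<open>By the cocycle equation all averaged values change by the same vector \<open>\<alpha> S x\<close>.\<close>

lemma vertex_average_translate:
 assumes \<alpha>: "weak_cocycle dL \<Omega> \<alpha>" and S: "S \<in> \<Omega>" and w: "vertex_weight \<rho> S x ~= 0"
 shows "vertex_average \<rho> \<alpha> (translate S x) 0 = vertex_average \<rho> \<alpha> S x - \<alpha> S x"
proof -
 have V: "vertices (translate S x) \<inter> ball 0 \<rho> = (\<lambda>p. p - x) ` (vertices S \<inter> ball x \<rho>)"
  unfolding local_points_D(3)[OF local_points_vertices S] by (auto simp: dist_norm norm_minus_commute)
 have W: "vertex_weight \<rho> (translate S x) 0 = vertex_weight \<rho> S x"
  unfolding vertex_weight_def V by (subst sum.reindex) (auto simp: inj_on_def)
 have "(\<Sum>p\<in>vertices (translate S x) \<inter> ball 0 \<rho>. tent \<rho> (p - 0) *\<^sub>R \<alpha> (translate S x) p)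
   = (\<Sum>p\<in>vertices S \<inter> ball x \<rho>. tent \<rho> (p - x) *\<^sub>R (\<alpha> S p - \<alpha> S x))"
  unfolding V by (subst sum.reindex) (auto simp: inj_on_def weak_cocycle_translate[OF \<alpha> S])
 also have "... = (\<Sum>p\<in>vertices S \<inter> ball x \<rho>. tent \<rho> (p - x) *\<^sub>R \<alpha> S p) - vertex_weight \<rho> S x *\<^sub>R \<alpha> S x"
  unfolding vertex_weight_def by (simp add: scaleR_diff_right sum_subtractf scaleR_sum_left)
 finally show ?thesis unfolding vertex_average_def W using w by (simp add: scaleR_diff_right)
qed

text \<open>
 The average at the origin serves as s. After adding its coboundary, the value at x becomes the
 difference of the averages around x and around the origin. If two elements share a large patch,
 then their values at the vertices involved differ by one common constant, since the differences between
 vertices are returns, and the constant cancels.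
\<close>

theorem local_representative:
 assumes \<alpha>: "strong_cocycle L dL \<Omega> \<alpha>"
 shows "\<exists>s. continuous_map (config_topology dL \<Omega>) euclidean s \<and> transversally_locally_constant L dL \<Omega> s \<and>
  weak_cocycle dL \<Omega> (\<lambda>S x. \<alpha> S x + s (translate S x) - s S) \<and> local_cochain (\<lambda>S x. \<alpha> S x + s (translate S x) - s S)"
proof -
 note V = local_points_vertices
 have w\<alpha>: "weak_cocycle dL \<Omega> \<alpha>" using \<alpha> unfolding strong_cocycle_def by blast
 obtain \<rho>0 where \<rho>0: "\<rho>0 > 0" "!!T x. T \<in> \<Omega> ==> \<exists>p\<in>vertices T. dist x p <= \<rho>0" using local_points_dense[OF V] by blast
 define \<rho> where "\<rho> = \<rho>0 + 1"
 have fin: "finite (vertices S \<inter> ball x \<rho>)" if "S \<in> \<Omega>" for S x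
  by (rule uniform_discrete_finite_ball[OF local_points_delone(1)[OF V that]]) simp
 have w: "0 < vertex_weight \<rho> S x" if S: "S \<in> \<Omega>" for S x
 proof -
  obtain p where p: "p \<in> vertices S" "dist x p <= \<rho>0" using \<rho>0(2)[OF S] by blast
  then have "0 < tent \<rho> (p - x)" unfolding tent_def \<rho>_def by (simp add: dist_norm norm_minus_commute)
  then show ?thesis unfolding vertex_weight_def using p fin[OF S, of x]
   by (intro sum_pos2[of _ p]) (auto simp: tent_def \<rho>_def)
 qed
 define s where "s S = vertex_average \<rho> \<alpha> S 0" for S
 have sc: "continuous_map (config_topology dL \<Omega>) euclidean s"
 proof -
  have tent0: "tent \<rho> p = 0" if "\<rho> <= norm p" for p :: 'a using that unfolding tent_def by simp
  have "continuous_map euclidean euclidean (tent \<rho> :: 'a => real)"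
   unfolding tent_def by (auto intro!: continuous_intros)
  from continuous_map_compose[OF continuous_map_snd this]
  have t: "continuous_map (prod_topology (config_topology dL \<Omega>) euclidean) euclidean (\<lambda>z. tent \<rho> (snd z :: 'a))" by (simp add: o_def)
  have c1: "continuous_map (config_topology dL \<Omega>) euclidean (\<lambda>S. \<Sum>p\<in>vertices S \<inter> ball 0 \<rho>. tent \<rho> p)"
   by (rule local_sum_continuous[OF V]) (use t in \<open>simp_all add: case_prod_unfold tent0\<close>)
  have "continuous_map (prod_topology (config_topology dL \<Omega>) euclidean) euclidean (\<lambda>z. tent \<rho> (snd z) *\<^sub>R \<alpha> (fst z) (snd z))"
   using continuous_map_scaleR[OF t, of "\<lambda>(S, x). \<alpha> S x"] w\<alpha> unfolding weak_cocycle_def by (simp add: case_prod_unfold)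
  then have c2: "continuous_map (config_topology dL \<Omega>) euclidean (\<lambda>S. \<Sum>p\<in>vertices S \<inter> ball 0 \<rho>. tent \<rho> p *\<^sub>R \<alpha> S p)"
   by (intro local_sum_continuous[OF V]) (simp_all add: case_prod_unfold tent0)
  have wn: "(\<Sum>p\<in>vertices S \<inter> ball 0 \<rho>. tent \<rho> p) ~= 0" if "S \<in> \<Omega>" for S
   using w[OF that, of 0] unfolding vertex_weight_def by (simp add: less_imp_neq)
  show ?thesis unfolding s_def vertex_average_def vertex_weight_def
   using c1 c2 wn by (intro continuous_map_scaleR continuous_map_real_inverse) (auto simp: topspace_config_topology[OF space])
 qed
 moreover have "transversally_locally_constant L dL \<Omega> s"
  unfolding transversally_locally_constant_iff
 proof (intro allI ballI impI)
  fix P S assume P: "local_points P" and S: "S \<in> \<Omega>" "0 \<in> P S"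
  obtain R where R: "patch_determined \<Omega> R (\<lambda>T. vertices T \<inter> ball 0 \<rho>)"
   using local_points_local[OF V, of \<rho>] by blast
  obtain \<delta>1 where 1: "\<delta>1 > 0" "!!S'. S' \<in> \<Omega> ==> 0 \<in> P S' ==> config_dist dL S S' < \<delta>1 ==> patch S' 0 R = patch S 0 R"
   using transversal_rigidity[OF P S] by blast
  obtain \<delta>2 where 2: "\<delta>2 > 0" "\<forall>S'\<in>\<Omega>. 0 \<in> P S' --> config_dist dL S S' < \<delta>2 --> (\<forall>v\<in>vertices S \<inter> ball 0 \<rho>. \<alpha> S' v = \<alpha> S v)"
   using strong_cocycle_near[OF \<alpha> P S fin[OF S(1), of 0]] by blast
  have "s S' = s S" if S': "S' \<in> \<Omega>" "0 \<in> P S'" "config_dist dL S S' < min \<delta>1 \<delta>2" for S'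
  proof -
   have "patch S' 0 R = patch S 0 R" using 1(2)[OF S'(1,2)] S'(3) by simp
   then have eq: "vertices S' \<inter> ball 0 \<rho> = vertices S \<inter> ball 0 \<rho>" by (rule patch_determinedD[OF R S'(1) S(1)]) simp
   have "(\<Sum>p\<in>vertices S \<inter> ball 0 \<rho>. tent \<rho> (p - 0) *\<^sub>R \<alpha> S' p) = (\<Sum>p\<in>vertices S \<inter> ball 0 \<rho>. tent \<rho> (p - 0) *\<^sub>R \<alpha> S p)"
    by (rule sum.cong) (use 2(2) S' in auto)
   then show ?thesis unfolding s_def vertex_average_def vertex_weight_def eq by simp
  qed
  then show "\<exists>\<delta>>0. \<forall>S'\<in>\<Omega>. 0 \<in> P S' --> config_dist dL S S' < \<delta> --> s S' = s S"
   using 1(1) 2(1) by (intro exI[of _ "min \<delta>1 \<delta>2"]) simp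
 qed
 moreover have "weak_cocycle dL \<Omega> (\<lambda>S x. \<alpha> S x + s (translate S x) - s S)"
  using sc unfolding config_topology_def continuous_map_metric_euclidean_iff[OF M.Metric_space_axioms]
  by (intro weak_cocycle_add_coboundary[OF space w\<alpha>]) blast
 moreover have "local_cochain (\<lambda>S x. \<alpha> S x + s (translate S x) - s S)"
  unfolding local_cochain_def
 proof
  fix M
  \<comment> \<open>The averages around points of norm at most M involve vertices in the ball of radius M' only.\<close>
  define M' where "M' = \<bar>M\<bar> + 2 * \<rho>"
  obtain R where R: "patch_determined \<Omega> R (\<lambda>T. vertices T \<inter> ball 0 M')"
   using local_points_local[OF V, of M'] by blast
  obtain N where N: "!!S S' v. S \<in> \<Omega> ==> S' \<in> \<Omega> ==> 0 \<in> vertices S ==> 0 \<in> vertices S' ==> patch S 0 N = patch S' 0 N ==>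
    v \<in> vertices S \<inter> vertices S' \<inter> ball 0 (M' + \<rho>) ==> \<alpha> S v = \<alpha> S' v"
   using strong_cocycle_returns[OF \<alpha> V, of "M' + \<rho>"] by blast
  show "\<exists>N. \<forall>x. norm x <= M --> patch_determined \<Omega> N (\<lambda>S. \<alpha> S x + s (translate S x) - s S)"
   unfolding patch_determined_def
  proof (intro exI[of _ "max R (\<rho> + N)"] ballI allI impI)
   fix S S' and x :: 'a assume S: "S \<in> \<Omega>" "S' \<in> \<Omega>" and eq: "patch S 0 (max R (\<rho> + N)) = patch S' 0 (max R (\<rho> + N))" and x: "norm x <= M"
   have VV: "vertices S \<inter> ball 0 M' = vertices S' \<inter> ball 0 M'" by (rule patch_determinedD[OF R S eq]) simp
   obtain q where q: "q \<in> vertices S" "norm q <= \<rho>0" using \<rho>0(2)[OF S(1), of 0] by auto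
   have "q \<in> ball 0 M'" using q(2) unfolding M'_def \<rho>_def using \<rho>0(1) by simp
   then have q': "q \<in> vertices S'" using q(1) VV by blast
   \<comment> \<open>All vertices are compared with the reference vertex q, from which p is a return.\<close>
   have D: "\<alpha> S p = \<alpha> S' p + (\<alpha> S q - \<alpha> S' q)" if p: "p \<in> vertices S \<inter> ball 0 M'" for p
   proof -
    have pm: "p - q \<in> vertices (translate S q) \<inter> vertices (translate S' q) \<inter> ball 0 (M' + \<rho>)"
    proof -
     have "p \<in> vertices S' \<inter> ball 0 M'" using p unfolding VV .
     moreover have "p \<in> vertices S" using p by simp
     ultimately show ?thesis using q(2) norm_triangle_ineq4[of p q]
      by (simp add: \<rho>_def local_points_D(4)[OF V S(1)] local_points_D(4)[OF V S(2)])
    qed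
    have "\<alpha> (translate S q) (p - q) = \<alpha> (translate S' q) (p - q)"
    proof (rule N[OF translate_mem[OF S(1)] translate_mem[OF S(2)] _ _ _ pm])
     show "0 \<in> vertices (translate S q)" "0 \<in> vertices (translate S' q)"
      using q(1) q' by (simp_all add: local_points_D(4)[OF V S(1)] local_points_D(4)[OF V S(2)])
     show "patch (translate S q) 0 N = patch (translate S' q) 0 N"
      by (rule patch_eq_translate[OF eq]) (use q(2) in \<open>simp add: \<rho>_def\<close>)
    qed
    then show ?thesis unfolding weak_cocycle_translate[OF w\<alpha> S(1)] weak_cocycle_translate[OF w\<alpha> S(2)]
     by (simp add: algebra_simps)
   qed
   have A: "vertex_average \<rho> \<alpha> S y = vertex_average \<rho> \<alpha> S' y + (\<alpha> S q - \<alpha> S' q)" if y: "norm y <= \<bar>M\<bar>" for y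
   proof -
    have "ball y \<rho> \<subseteq> ball 0 M'" using y \<rho>0(1) unfolding M'_def \<rho>_def by (intro ball_subset_origin) simp
    then have VB: "vertices S' \<inter> ball y \<rho> = vertices S \<inter> ball y \<rho>" and sub: "vertices S \<inter> ball y \<rho> \<subseteq> vertices S \<inter> ball 0 M'"
     using VV by blast+
    have W: "vertex_weight \<rho> S' y = vertex_weight \<rho> S y" unfolding vertex_weight_def VB ..
    have "(\<Sum>p\<in>vertices S \<inter> ball y \<rho>. tent \<rho> (p - y) *\<^sub>R \<alpha> S p) =
     (\<Sum>p\<in>vertices S \<inter> ball y \<rho>. tent \<rho> (p - y) *\<^sub>R (\<alpha> S' p + (\<alpha> S q - \<alpha> S' q)))"
     by (rule sum.cong[OF refl], subst D) (use sub in auto)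
    also have "... = (\<Sum>p\<in>vertices S \<inter> ball y \<rho>. tent \<rho> (p - y) *\<^sub>R \<alpha> S' p) + vertex_weight \<rho> S y *\<^sub>R (\<alpha> S q - \<alpha> S' q)"
     unfolding vertex_weight_def by (simp add: scaleR_add_right sum.distrib scaleR_sum_left)
    finally show ?thesis unfolding vertex_average_def W VB using w[OF S(1), of y] by (simp add: scaleR_add_right)
   qed
   have "\<alpha> S x + s (translate S x) - s S = vertex_average \<rho> \<alpha> S x - vertex_average \<rho> \<alpha> S 0"
    if "S \<in> \<Omega>" for S
    unfolding s_def vertex_average_translate[OF w\<alpha> that w[OF that, THEN less_imp_neq, symmetric]] by simp
   then show "\<alpha> S x + s (translate S x) - s S = \<alpha> S' x + s (translate S' x) - s S'"
    using S A[of x] A[of 0] x by simp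
  qed
 qed
 ultimately show ?thesis by blast
qed

end

section \<open>Deformations labelled by patches\<close>

lemma local_cochain_smoothing:
 fixes \<Omega> :: "(real ^ 'n::finite, 'l) config set"
 assumes \<Omega>: "flc_space \<Omega> L dL" and \<beta>: "flc_space.local_cochain \<Omega> \<beta>" and r: "0 <= r"
 shows "\<exists>N. \<forall>\<phi>. patch_determined \<Omega> N (smoothing \<phi> r \<beta>)"
proof -
 interpret flc_space \<Omega> L dL by (rule \<Omega>)
 obtain N where N: "!!x. norm x <= r * real CARD('n) ==> patch_determined \<Omega> N (\<lambda>S. \<beta> S x)"
  using \<beta> unfolding local_cochain_def by blast
 show ?thesis unfolding patch_determined_def
 proof (intro exI[of _ N] ballI impI allI)
  fix S S' \<phi> assume S: "S \<in> \<Omega>" "S' \<in> \<Omega>" "patch S 0 N = patch S' 0 N"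
  have "\<beta> S (r *\<^sub>R u) = \<beta> S' (r *\<^sub>R u)" if "u \<in> cbox (- 1) 1" for u
  proof -
   have "norm (r *\<^sub>R u) <= r * real CARD('n)" using norm_cbox_1[OF that] r by (simp add: mult_left_mono)
   from patch_determinedD[OF N[OF this] S order_refl] show ?thesis .
  qed
  then show "smoothing \<phi> r \<beta> S = smoothing \<phi> r \<beta> S'"
   unfolding smoothing_def by (intro arg_cong[where f = vec_lambda] ext integral_cong) simp
 qed
qed

lemma local_cochain_smooth_cocycle:
 fixes \<Omega> :: "(real ^ 'n::finite, 'l) config set"
 assumes \<Omega>: "flc_space \<Omega> L dL" and \<beta>: "flc_space.local_cochain \<Omega> \<beta>" and r: "0 <= r"
 shows "flc_space.local_cochain \<Omega> (smooth_cocycle \<phi> r \<beta>)"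
proof -
 interpret flc_space \<Omega> L dL by (rule \<Omega>)
 show ?thesis unfolding local_cochain_def
 proof
  fix M
  obtain N1 where N1: "!!x. norm x <= M ==> patch_determined \<Omega> N1 (\<lambda>S. \<beta> S x)"
   using \<beta> unfolding local_cochain_def by blast
  obtain N2 where N2: "!!\<phi>. patch_determined \<Omega> N2 (smoothing \<phi> r \<beta>)"
   using local_cochain_smoothing[OF \<Omega> \<beta> r] by blast
  show "\<exists>N. \<forall>x. norm x <= M --> patch_determined \<Omega> N (\<lambda>S. smooth_cocycle \<phi> r \<beta> S x)"
   unfolding patch_determined_def
  proof (intro exI[of _ "max N1 (\<bar>M\<bar> + N2)"] ballI impI allI)
   fix S S' and x :: "real ^ 'n"
   assume S: "S \<in> \<Omega>" "S' \<in> \<Omega>" and eq: "patch S 0 (max N1 (\<bar>M\<bar> + N2)) = patch S' 0 (max N1 (\<bar>M\<bar> + N2))" and x: "norm x <= M"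
   have "\<beta> S x = \<beta> S' x" by (rule patch_determinedD[OF N1[OF x] S eq]) simp
   moreover have "smoothing \<phi> r \<beta> S = smoothing \<phi> r \<beta> S'" by (rule patch_determinedD[OF N2 S eq]) simp
   moreover have "patch (translate S x) 0 N2 = patch (translate S' x) 0 N2"
    by (rule patch_eq_translate[OF eq]) (use x in simp)
   then have "smoothing \<phi> r \<beta> (translate S x) = smoothing \<phi> r \<beta> (translate S' x)"
    by (rule patch_determinedD[OF N2 translate_mem[OF S(1)] translate_mem[OF S(2)]]) simp
   ultimately show "smooth_cocycle \<phi> r \<beta> S x = smooth_cocycle \<phi> r \<beta> S' x" unfolding smooth_cocycle_def by simp
  qed
 qed
qed

text \<open>
 Here \<open>\<rho>\<close> is a covering radius of the vertices. The labels are patches of a radius R0 so large that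
 the label at a vertex knows all vertices within \<open>2 * \<rho> + 2\<close> and their displacements from it. Steps of
 this length suffice to walk from vertex to vertex towards any other vertex.
\<close>

locale patch_deformation = flc_space \<Omega> L dL
 for \<Omega> :: "('a::euclidean_space, 'l) config set" and L dL +
 fixes \<gamma> :: "('a, 'l) cochain" and K R0 \<rho> :: real
 assumes \<gamma>_cocycle: "weak_cocycle dL \<Omega> \<gamma>" and K_pos: "0 < K"
  and \<gamma>_expand: "!!T x y. T \<in> \<Omega> ==> norm (x - y) <= K * norm (\<gamma> T x - \<gamma> T y)"
  and \<gamma>_surj: "!!T. T \<in> \<Omega> ==> surj (\<gamma> T)"
  and \<gamma>_local: "local_cochain \<gamma>"
  and \<rho>: "0 < \<rho>" "!!T x. T \<in> \<Omega> ==> \<exists>p\<in>vertices T. dist x p <= \<rho>" "\<rho> < R0"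
  and R0_vertices: "patch_determined \<Omega> R0 (\<lambda>S. vertices S \<inter> ball 0 (2 * \<rho> + 2))"
  and R0_\<gamma>: "!!x. norm x <= 2 * \<rho> + 2 ==> patch_determined \<Omega> R0 (\<lambda>S. \<gamma> S x)"
begin

definition patch_labels :: "('a, 'l) config set" where
 "patch_labels = {patch S 0 R0 | S. S \<in> \<Omega> \<and> 0 \<in> vertices S}"

lemma finite_patch_labels: "finite patch_labels"
proof -
 obtain \<S> where "finite \<S>" "\<forall>S'\<in>\<Omega>. 0 \<in> vertices S' --> (\<exists>S\<in>\<S>. patch S' 0 R0 = patch S 0 R0)"
  using transversal_cover[OF local_points_vertices, of "\<lambda>_. R0"] by blast
 then have "finite ((\<lambda>S. patch S 0 R0) ` \<S>)" "patch_labels \<subseteq> (\<lambda>S. patch S 0 R0) ` \<S>"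
  unfolding patch_labels_def by auto
 then show ?thesis by (metis finite_subset)
qed

lemma vertex_translate: "S \<in> \<Omega> ==> 0 \<in> vertices (translate S p) \<longleftrightarrow> p \<in> vertices S"
 using local_points_D(4)[OF local_points_vertices, of S 0 p] by simp

lemma patch_label_mem: "T \<in> \<Omega> ==> p \<in> vertices T ==> patch_label T R0 p \<in> patch_labels"
 unfolding patch_labels_def patch_label_def
 by (intro CollectI exI[of _ "translate T p"]) (simp add: vertex_translate)

lemma patch_label_translate: "patch_label (translate T x) R0 (p - x) = patch_label T R0 p" for T :: "('a, 'l) config"
 unfolding patch_label_def by (simp add: translate_add)

lemma patch_label_continuous:
 assumes T: "T \<in> \<Omega>" and p: "p \<in> vertices T" and e: "0 < e"
 shows "\<exists>\<delta>>0. \<forall>T'\<in>\<Omega>. \<forall>p'\<in>vertices T'. config_dist dL T T' < \<delta> --> dist p p' < \<delta> -->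
   discrete_metric.dd (patch_label T R0 p) (patch_label T' R0 p') < e"
proof -
 obtain \<delta>1 where 1: "\<delta>1 > 0" "!!S'. S' \<in> \<Omega> ==> 0 \<in> vertices S' ==> config_dist dL (translate T p) S' < \<delta>1 ==>
   patch S' 0 R0 = patch (translate T p) 0 R0"
  using transversal_rigidity[OF local_points_vertices translate_mem[OF T, of p] vertex_translate[OF T, THEN iffD2, OF p], of R0]
  by blast
 obtain d where d: "d > 0" "!!T' p'. T' \<in> \<Omega> ==> config_dist dL T T' < d ==> norm (p - p') < d ==>
   config_dist dL (translate T p) (translate T' p') < \<delta>1"
  using tiling_space_translate_continuous[OF space T 1(1), of p] by blast
 have "patch_label T R0 p = patch_label T' R0 p'"
  if "T' \<in> \<Omega>" "p' \<in> vertices T'" "config_dist dL T T' < d" "dist p p' < d" for T' p'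
  unfolding patch_label_def using 1(2)[OF translate_mem[OF that(1)]] d(2)[OF that(1,3)] that vertex_translate
  by (simp add: dist_norm)
 then show ?thesis
  using d(1) e by (intro exI[of _ d]) (simp add: discrete_metric.dd_def)
qed

lemma deformation: "deformation \<Omega> L dL vertices \<gamma> K patch_labels discrete_metric.dd (\<lambda>S. patch_label S R0)"
proof (rule deformation.intro)
 show M: "Metric_space patch_labels discrete_metric.dd" by (rule metric_M_dd)
 show "compact_space (Metric_space.mtopology patch_labels discrete_metric.dd)"
  by (rule compact_space_finite_metric[OF M finite_patch_labels])
 show "patch_label (translate T x) R0 (p - x) = patch_label T R0 p" for T :: "('a, 'l) config" and p x
  by (rule patch_label_translate)
qed (fact space local_points_associated[OF local_points_vertices] \<gamma>_cocycle K_pos \<gamma>_expand \<gamma>_surj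
 patch_label_mem patch_label_continuous)+

sublocale deformation \<Omega> L dL vertices \<gamma> K patch_labels discrete_metric.dd "\<lambda>S. patch_label S R0"
 by (rule deformation)

text \<open>By expansion the moved points in a ball of radius r come from the ball of radius \<open>K * r\<close>.\<close>

lemma deform_local:
 "\<exists>R. patch_determined \<Omega> R (\<lambda>T. patch (deform T) 0 r)"
proof -
 obtain N1 where N1: "patch_determined \<Omega> N1 (\<lambda>T. vertices T \<inter> ball 0 (K * r))"
  using local_points_local[OF local_points_vertices, of "K * r"] by blast
 obtain N2 where N2: "!!x. norm x <= K * r ==> patch_determined \<Omega> N2 (\<lambda>T. \<gamma> T x)"
  using \<gamma>_local unfolding local_cochain_def by blast
 have P: "patch (deform T) 0 r = (\<lambda>p. ({\<gamma> T p}, patch_label T R0 p)) ` {p \<in> vertices T \<inter> ball 0 (K * r). norm (\<gamma> T p) < r}"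
  if T: "T \<in> \<Omega>" for T
 proof -
  have "norm p < K * r" if "norm (\<gamma> T p) < r" for p
  proof -
   have "norm p <= K * norm (\<gamma> T p)" using \<gamma>_expand[OF T, of p 0] by (simp add: weak_cocycle_0[OF \<gamma>_cocycle T])
   also have "... < K * r" using that K_pos by simp
   finally show ?thesis .
  qed
  then show ?thesis unfolding patch_def deform_def by auto
 qed
 show ?thesis unfolding patch_determined_def
 proof (intro exI[of _ "max N1 (max N2 (K * r + R0))"] ballI impI)
  fix T T' assume T: "T \<in> \<Omega>" "T' \<in> \<Omega>"
   and eq: "patch T 0 (max N1 (max N2 (K * r + R0))) = patch T' 0 (max N1 (max N2 (K * r + R0)))"
  have V: "vertices T \<inter> ball 0 (K * r) = vertices T' \<inter> ball 0 (K * r)" by (rule patch_determinedD[OF N1 T eq]) simp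
  have g: "\<gamma> T x = \<gamma> T' x" if "norm x <= K * r" for x by (rule patch_determinedD[OF N2[OF that] T eq]) simp
  have l: "patch_label T R0 p = patch_label T' R0 p" if "norm p <= K * r" for p
   unfolding patch_label_def by (rule patch_eq_translate[OF eq]) (use that in simp)
  show "patch (deform T) 0 r = patch (deform T') 0 r"
   unfolding P[OF T(1)] P[OF T(2)] V by (rule image_cong) (auto simp: g l)
 qed
qed

lemma FLC_deform: "FLC (deform ` \<Omega>)"
proof -
 obtain B where B: "!!T x. T \<in> \<Omega> ==> norm x <= 1 ==> norm (\<gamma> T x) <= B"
  using weak_cocycle_bounded[OF space \<gamma>_cocycle, of 1] by blast
 show ?thesis
 proof (rule FLC_local_image[OF _ _ _ deform_local])
  show "translate (deform T) x \<in> deform ` \<Omega>" if "T \<in> \<Omega>" for T x by (rule translate_deform_mem[OF that])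
  show "finite (patch (deform T) 0 r)" if "T \<in> \<Omega>" for T r
   by (rule locally_finite_config_patch[OF is_delone_imp_locally_finite[OF is_delone_deform[OF that]]])
  show "\<exists>w. norm w <= B \<and> deform (translate T z) = translate (deform T) w" if "T \<in> \<Omega>" "norm z < 1" for T z
   using deform_translate[OF that(1)] B[OF that(1)] that(2) by (intro exI[of _ "\<gamma> T z"]) simp
 qed
qed

lemma deform_eq_vertex:
 assumes S: "S \<in> \<Omega>" "S' \<in> \<Omega>" "deform S = deform S'" and p: "p \<in> vertices S"
 shows "\<exists>q\<in>vertices S'. \<gamma> S p = \<gamma> S' q \<and> patch_label S R0 p = patch_label S' R0 q"
proof -
 have "({\<gamma> S p}, patch_label S R0 p) \<in> deform S" unfolding deform_def using p by blast
 then have "({\<gamma> S p}, patch_label S R0 p) \<in> deform S'" unfolding S(3) .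
 then show ?thesis unfolding deform_def by auto
qed

text \<open>
 Agreement of two elements propagates along chains of vertices: the label at one vertex knows
 the next vertex and its displacement, and the common deformation then shows that the labels
 there agree as well.
\<close>

lemma deform_propagate:
 assumes S: "S \<in> \<Omega>" "S' \<in> \<Omega>" "deform S = deform S'" and 0: "0 \<in> vertices S" "patch S 0 R0 = patch S' 0 R0"
  and p: "p \<in> vertices S" "norm p <= real k"
 shows "p \<in> vertices S' \<and> \<gamma> S p = \<gamma> S' p \<and> patch_label S R0 p = patch_label S' R0 p"
 using p
proof (induction k arbitrary: p)
 note V = local_points_D(4)[OF local_points_vertices]
 have z: "0 \<in> vertices S'" "\<gamma> S 0 = \<gamma> S' 0" "patch_label S R0 0 = patch_label S' R0 0"
 proof -
  have "0 \<in> vertices S' \<inter> ball 0 (2 * \<rho> + 2)" unfolding patch_determinedD[OF R0_vertices S(1,2) 0(2) order_refl, symmetric] using 0(1) \<rho>(1) by simp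
  then show "0 \<in> vertices S'" by simp
  show "\<gamma> S 0 = \<gamma> S' 0" using weak_cocycle_0[OF \<gamma>_cocycle] S by simp
  show "patch_label S R0 0 = patch_label S' R0 0" unfolding patch_label_def using 0(2) by simp
 qed
 {
  case 0
  then have "p = 0" by simp
  then show ?case using z by simp
 next
  case (Suc k)
  obtain q where q: "q \<in> vertices S'" "q \<in> vertices S" "\<gamma> S q = \<gamma> S' q" "patch_label S R0 q = patch_label S' R0 q" "norm (p - q) <= 2 * \<rho> + 1"
  proof (cases "norm p <= \<rho> + 1")
   case True
   then show thesis using that[of 0] z 0(1) \<rho>(1) by simp
  next
   case False
   \<comment> \<open>On the way from p to the origin, x lies at distance \<open>\<rho> + 1\<close> from p; a vertex
    within \<open>\<rho>\<close> of x is closer to the origin than p by at least 1, and at most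
    \<open>2 * \<rho> + 1\<close> away from p.\<close>
   define x where "x = ((norm p - \<rho> - 1) / norm p) *\<^sub>R p"
   have p0: "norm p > 0" using False \<rho>(1) by linarith
   have "norm x = norm p - \<rho> - 1" unfolding x_def using False p0 by simp
   moreover have "p - x = ((\<rho> + 1) / norm p) *\<^sub>R p" unfolding x_def using p0 by (simp add: algebra_simps diff_divide_distrib add_divide_distrib)
   then have px: "norm (p - x) = \<rho> + 1" using p0 \<rho>(1) by simp
   obtain q where q: "q \<in> vertices S" "dist x q <= \<rho>" using \<rho>(2)[OF S(1)] by blast
   ultimately have "norm q <= real k"
    using Suc.prems(2) norm_triangle_sub[of q x] by (simp add: dist_norm norm_minus_commute)
   moreover have "norm (p - q) <= 2 * \<rho> + 1" using px q(2) norm_triangle_ineq[of "p - x" "x - q"] by (simp add: dist_norm)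
   ultimately show thesis using that[of q] Suc.IH[OF q(1)] q(1) by blast
  qed
  have eq: "patch (translate S q) 0 R0 = patch (translate S' q) 0 R0" using q(4) unfolding patch_label_def .
  have "p - q \<in> vertices (translate S q) \<inter> ball 0 (2 * \<rho> + 2)" using Suc.prems(1) q(5) by (simp add: V[OF S(1)])
  then have "p - q \<in> vertices (translate S' q)"
   using patch_determinedD[OF R0_vertices translate_mem[OF S(1)] translate_mem[OF S(2)] eq order_refl] by blast
  then have p': "p \<in> vertices S'" by (simp add: V[OF S(2)])
  have "\<gamma> (translate S q) (p - q) = \<gamma> (translate S' q) (p - q)"
   by (rule patch_determinedD[OF R0_\<gamma> translate_mem[OF S(1)] translate_mem[OF S(2)] eq]) (use q(5) in simp_all)
  then have g: "\<gamma> S p = \<gamma> S' p"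
   using q(3) unfolding weak_cocycle_translate[OF \<gamma>_cocycle S(1)] weak_cocycle_translate[OF \<gamma>_cocycle S(2)] by simp
  obtain p1 where p1: "p1 \<in> vertices S'" "\<gamma> S p = \<gamma> S' p1" "patch_label S R0 p = patch_label S' R0 p1"
   using deform_eq_vertex[OF S Suc.prems(1)] by blast
  then have "p1 = p" using g inj_\<gamma>[OF S(2)] by (simp add: inj_eq)
  then show ?case using p' g p1(3) by simp
 }
qed

text \<open>
 Some pair of vertices \<open>p\<close>, \<open>q\<close> has the same label and is moved to the same place. Moving p and q to the
 origin makes the two elements agree around it, hence everywhere by propagation. So \<open>S' = S - (p - q)\<close>,
 and then \<open>\<gamma> S (p - q) = 0\<close> forces \<open>p = q\<close>.
\<close>

lemma inj_deform: "inj_on deform \<Omega>"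
proof (rule inj_onI)
 fix S S' assume S: "S \<in> \<Omega>" "S' \<in> \<Omega>" "deform S = deform S'"
 have sub: "A \<subseteq> B" if A: "A \<in> \<Omega>" "B \<in> \<Omega>" "deform A = deform B" "0 \<in> vertices A" "patch A 0 R0 = patch B 0 R0" for A B
 proof
  fix t assume t: "t \<in> A"
  then obtain y where y: "y \<in> fst t" using tiles[OF A(1)] unfolding ctile_def by blast
  obtain p where p: "p \<in> vertices A" "dist y p <= \<rho>" using \<rho>(2)[OF A(1)] by blast
  obtain k where "norm p <= real k" using real_arch_simple by blast
  then have "patch (translate A p) 0 R0 = patch (translate B p) 0 R0"
   using deform_propagate[OF A p(1)] unfolding patch_label_def by blast
  then have "translate (patch A p R0) p = translate (patch B p R0) p" unfolding patch_translate by simp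
  then have "translate (translate (patch A p R0) p) (- p) = translate (translate (patch B p R0) p) (- p)" by simp
  then have "patch A p R0 = patch B p R0" by simp
  moreover have "t \<in> patch A p R0" using t y p(2) \<rho>(3) unfolding patch_def by (auto simp: dist_commute)
  ultimately show "t \<in> B" using patch_subset by blast
 qed
 obtain p where p: "p \<in> vertices S" using \<rho>(2)[OF S(1)] by blast
 obtain q where q: "q \<in> vertices S'" "\<gamma> S p = \<gamma> S' q" "patch_label S R0 p = patch_label S' R0 q"
  using deform_eq_vertex[OF S p] by blast
 define A where "A = translate S p"
 define B where "B = translate S' q"
 have AB: "A \<in> \<Omega>" "B \<in> \<Omega>" "deform A = deform B" "0 \<in> vertices A" "0 \<in> vertices B" "patch A 0 R0 = patch B 0 R0"
  unfolding A_def B_def using S p q vertex_translate deform_translate unfolding patch_label_def by auto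
 have "A = B" using sub[OF AB(1,2,3,4,6)] sub[OF AB(2,1) AB(3)[symmetric] AB(5) AB(6)[symmetric]] by blast
 then have "translate (translate S p) (- q) = S'" unfolding A_def B_def by simp
 then have S': "S' = translate S (p - q)" by (simp add: translate_add)
 have "\<gamma> S p = \<gamma> S p - \<gamma> S (p - q)"
  using q(2) weak_cocycle_translate[OF \<gamma>_cocycle S(1), of "p - q" q] unfolding S' by simp
 then have "\<gamma> S (p - q) = \<gamma> S 0" using weak_cocycle_0[OF \<gamma>_cocycle S(1)] by simp
 then have "p - q = 0" using inj_\<gamma>[OF S(1)] by (simp add: inj_eq)
 then show "S = S'" unfolding S' by simp
qed

text \<open>By minimality and rigidity every patch around a vertex of some element occurs around a vertex of T.\<close>

lemma patch_labels_minimal: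
 assumes min: "minimal_space dL \<Omega>" and T: "T \<in> \<Omega>"
 shows "patch_labels = patch_label T R0 ` vertices T"
proof (intro equalityI subsetI)
 fix l assume "l \<in> patch_labels"
 then obtain S where S: "S \<in> \<Omega>" "0 \<in> vertices S" "l = patch S 0 R0" unfolding patch_labels_def by blast
 obtain \<delta> where \<delta>: "\<delta> > 0" "!!S'. S' \<in> \<Omega> ==> config_dist dL S S' < \<delta> ==> \<exists>z. norm z < 1 \<and> patch (translate S' z) 0 R0 = patch S 0 R0"
  using patch_rigidity[OF S(1), of 1 R0] by auto
 have "S \<in> M.mtopology closure_of translation_orbit T" using min T S(1) unfolding minimal_space_def config_topology_def by blast
 then have "\<exists>y. y \<in> translation_orbit T \<and> y \<in> M.mball S \<delta>" using \<delta>(1) unfolding M.metric_closure_of by blast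
 then obtain x where x: "config_dist dL S (translate T x) < \<delta>" unfolding translation_orbit_def by auto
 obtain z where z: "patch (translate (translate T x) z) 0 R0 = patch S 0 R0" using \<delta>(2)[OF translate_mem[OF T] x] by blast
 have "0 \<in> vertices (translate (translate T x) z) \<inter> ball 0 (2 * \<rho> + 2)"
  unfolding patch_determinedD[OF R0_vertices translate_mem[OF translate_mem[OF T]] S(1) z order_refl] using S(2) \<rho>(1) by simp
 then have "x + z \<in> vertices T" using vertex_translate[OF T] by (simp add: translate_add)
 moreover have "l = patch_label T R0 (x + z)" unfolding S(3) z[symmetric] patch_label_def by (simp add: translate_add)
 ultimately show "l \<in> patch_label T R0 ` vertices T" by blast
next
 fix l assume "l \<in> patch_label T R0 ` vertices T"
 then show "l \<in> patch_labels" unfolding patch_labels_def patch_label_def using vertex_translate[OF T] translate_mem[OF T] by blast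
qed

end

section \<open>Cech cocycles of flow boxes\<close>

lemma cech_cocycle_pullback:
 assumes h: "continuous_map X Y h" and c: "cech_cocycle Y c"
 shows "cech_cocycle X (cech_pullback X h c)"
proof -
 obtain I V k where I: "c = (I, V, k)" by (metis prod_cases3)
 have V: "!!i. i \<in> I ==> openin Y (V i)" "(\<Union>i\<in>I. V i) = topspace Y"
  and lc: "!!i j. i \<in> I ==> j \<in> I ==> locally_constant_on Y (V i \<inter> V j) (k i j)"
  and co: "!!i j l y. i \<in> I ==> j \<in> I ==> l \<in> I ==> y \<in> V i \<inter> V j \<inter> V l ==> k i j y + k j l y = k i l y"
  using c unfolding I cech_cocycle_def open_cover_def by auto
 have hY: "h x \<in> topspace Y" if "x \<in> topspace X" for x using h that by (auto simp: continuous_map_def)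
 have op: "openin X {x \<in> topspace X. h x \<in> W}" if "openin Y W" for W
  using h that by (auto simp: continuous_map_def)
 have "open_cover X I (\<lambda>i. {x \<in> topspace X. h x \<in> V i})"
  unfolding open_cover_def
 proof (intro conjI ballI equalityI subsetI)
  fix x assume x: "x \<in> topspace X"
  then obtain i where "i \<in> I" "h x \<in> V i" using hY[OF x] V(2) by blast
  then show "x \<in> (\<Union>i\<in>I. {x \<in> topspace X. h x \<in> V i})" using x by blast
 qed (use op V(1) in auto)
 moreover have "locally_constant_on X ({x \<in> topspace X. h x \<in> V i} \<inter> {x \<in> topspace X. h x \<in> V j}) (\<lambda>x. k i j (h x))"
  if ij: "i \<in> I" "j \<in> I" for i j
  unfolding locally_constant_on_def
 proof
  fix x assume "x \<in> {x \<in> topspace X. h x \<in> V i} \<inter> {x \<in> topspace X. h x \<in> V j}"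
  then have x: "x \<in> topspace X" "h x \<in> V i \<inter> V j" by auto
  obtain W where W: "openin Y W" "h x \<in> W" "\<forall>y\<in>W \<inter> (V i \<inter> V j). k i j y = k i j (h x)"
   using lc[OF ij] x(2) unfolding locally_constant_on_def by blast
  have "x \<in> {x \<in> topspace X. h x \<in> W}" using x(1) W(2) by simp
  moreover have "\<forall>y\<in>{x \<in> topspace X. h x \<in> W} \<inter> ({x \<in> topspace X. h x \<in> V i} \<inter> {x \<in> topspace X. h x \<in> V j}). k i j (h y) = k i j (h x)"
   using W(3) by blast
  ultimately show "\<exists>W. openin X W \<and> x \<in> W \<and>
   (\<forall>y\<in>W \<inter> ({x \<in> topspace X. h x \<in> V i} \<inter> {x \<in> topspace X. h x \<in> V j}). k i j (h y) = k i j (h x))"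
   using op[OF W(1)] by blast
 qed
 moreover have "k i j (h x) + k j l (h x) = k i l (h x)"
  if "i \<in> I" "j \<in> I" "l \<in> I" "h x \<in> V i \<inter> V j \<inter> V l" for i j l x using co[OF that] .
 ultimately show ?thesis unfolding I cech_cocycle_def cech_pullback_def by auto
qed

context flc_space
begin

lemma rigid_neighbourhood:
 assumes Q: "Q \<in> \<Omega>" and \<eta>: "0 < \<eta>"
 shows "\<exists>V. openin (config_topology dL \<Omega>) V \<and> Q \<in> V \<and>
  (\<forall>Q'\<in>V. Q' \<in> \<Omega> \<and> (\<exists>z. norm z < \<eta> \<and> patch (translate Q' z) 0 N = patch Q 0 N))"
proof -
 obtain \<delta> where \<delta>: "\<delta> > 0" "\<forall>S'\<in>\<Omega>. config_dist dL Q S' < \<delta> --> (\<exists>z. norm z < \<eta> \<and> patch (translate S' z) 0 N = patch Q 0 N)"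
  using patch_rigidity[OF Q \<eta>] by blast
 show ?thesis unfolding config_topology_def
  by (intro exI[of _ "M.mball Q \<delta>"]) (use \<delta> Q in auto)
qed

lemma flow_boxes_D:
 assumes "(\<Xi>, e) \<in> flow_boxes L dL \<Omega>"
 shows "\<exists>P. local_points P \<and> \<Xi> = {T \<in> \<Omega>. 0 \<in> P T}" "0 < e" "inj_on flow (\<Xi> \<times> ball 0 e)"
  "openin (config_topology dL \<Omega>) (flow ` (\<Xi> \<times> ball 0 e))"
 using assms unfolding flow_boxes_def FLC_transversal_iff by auto

lemma flow_box_potential_eq:
 assumes "(\<Xi>, e) \<in> flow_boxes L dL \<Omega>" "S \<in> \<Xi>" "norm x < e"
 shows "flow_box_potential \<alpha> (\<Xi>, e) (translate S x) = \<alpha> S x"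
proof -
 have "the_inv_into (\<Xi> \<times> ball 0 e) flow (flow (S, x)) = (S, x)"
  by (rule the_inv_into_f_f[OF flow_boxes_D(3)[OF assms(1)]]) (use assms in auto)
 then show ?thesis unfolding flow_box_potential_def by (simp add: flow_def)
qed

text \<open>
 Half the separation of the points makes the product coordinates unique. The box consists of the
 elements with a point at distance less than e from the origin, which is an open condition by rigidity.
\<close>

lemma local_points_flow_box:
 assumes P: "local_points P"
 shows "\<exists>e. ({T \<in> \<Omega>. 0 \<in> P T}, e) \<in> flow_boxes L dL \<Omega>"
proof -
 define \<Xi> where "\<Xi> = {T \<in> \<Omega>. 0 \<in> P T}"
 obtain d where d: "d > 0" "!!T p q. T \<in> \<Omega> ==> p \<in> P T ==> q \<in> P T ==> p ~= q ==> d <= dist p q"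
  using local_points_separated[OF P] by blast
 define e where "e = d / 2"
 have e: "0 < e" unfolding e_def using d(1) by simp
 have inj: "inj_on flow (\<Xi> \<times> ball 0 e)"
 proof (rule inj_onI)
  fix a b assume "a \<in> \<Xi> \<times> ball 0 e" "b \<in> \<Xi> \<times> ball 0 e" and eq: "flow a = flow b"
  then obtain S x S' x' where ab: "a = (S, x)" "b = (S', x')" "S \<in> \<Xi>" "S' \<in> \<Xi>" "norm x < e" "norm x' < e" by auto
  have "translate (translate S x) (- x') = S'" using eq unfolding ab flow_def by simp
  then have S': "translate S (x - x') = S'" by (simp add: translate_add)
  have "x - x' \<in> P S" using ab(3,4) local_points_D(4)[OF P, of S 0 "x - x'"] unfolding S' \<Xi>_def by simp
  then have "x - x' = 0" using d(2)[of S "x - x'" 0] ab(3,5,6) norm_triangle_ineq4[of x x'] unfolding \<Xi>_def e_def by fastforce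
  then show "a = b" using S' unfolding ab by simp
 qed
 have img: "flow ` (\<Xi> \<times> ball 0 e) = {Q \<in> \<Omega>. \<exists>p\<in>P Q. norm p < e}"
 proof (intro equalityI subsetI)
  fix Q assume "Q \<in> flow ` (\<Xi> \<times> ball 0 e)"
  then obtain S x where S: "S \<in> \<Omega>" "0 \<in> P S" "norm x < e" "Q = translate S x" unfolding \<Xi>_def flow_def by auto
  have "- x \<in> P Q" using S(2) unfolding S(4) by (simp add: local_points_D(4)[OF P S(1)])
  then show "Q \<in> {Q \<in> \<Omega>. \<exists>p\<in>P Q. norm p < e}" using S by (auto intro!: bexI[of _ "- x"])
 next
  fix Q assume "Q \<in> {Q \<in> \<Omega>. \<exists>p\<in>P Q. norm p < e}"
  then obtain p where Q: "Q \<in> \<Omega>" "p \<in> P Q" "norm p < e" by blast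
  have "(translate Q p, - p) \<in> \<Xi> \<times> ball 0 e" using Q unfolding \<Xi>_def by (simp add: local_points_D(4)[OF P Q(1)])
  then show "Q \<in> flow ` (\<Xi> \<times> ball 0 e)" by (intro image_eqI[of _ _ "(translate Q p, - p)"]) (simp_all add: flow_def)
 qed
 have "openin (config_topology dL \<Omega>) {Q \<in> \<Omega>. \<exists>p\<in>P Q. norm p < e}"
 proof (subst openin_subopen, intro ballI)
  fix Q assume "Q \<in> {Q \<in> \<Omega>. \<exists>p\<in>P Q. norm p < e}"
  then obtain p where Q: "Q \<in> \<Omega>" "p \<in> P Q" "norm p < e" by blast
  obtain R where R: "patch_determined \<Omega> R (\<lambda>T. P T \<inter> ball 0 e)"
   using local_points_local[OF P, of e] by blast
  obtain V where V: "openin (config_topology dL \<Omega>) V" "Q \<in> V"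
   "\<forall>Q'\<in>V. Q' \<in> \<Omega> \<and> (\<exists>z. norm z < e - norm p \<and> patch (translate Q' z) 0 R = patch Q 0 R)"
   using rigid_neighbourhood[OF Q(1), of "e - norm p" R] Q(3) by auto
  have "V \<subseteq> {Q \<in> \<Omega>. \<exists>p\<in>P Q. norm p < e}"
  proof
   fix Q' assume "Q' \<in> V"
   then obtain z where z: "Q' \<in> \<Omega>" "norm z < e - norm p" "patch (translate Q' z) 0 R = patch Q 0 R" using V(3) by blast
   have "p \<in> P Q \<inter> ball 0 e" using Q by simp
   then have "p \<in> P (translate Q' z)" using patch_determinedD[OF R translate_mem[OF z(1)] Q(1) z(3) order_refl] by blast
   then have "p + z \<in> P Q'" by (simp add: local_points_D(4)[OF P z(1)])
   moreover have "norm (p + z) < e" using z(2) norm_triangle_ineq[of p z] by linarith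
   ultimately show "Q' \<in> {Q \<in> \<Omega>. \<exists>p\<in>P Q. norm p < e}" using z(1) by blast
  qed
  then show "\<exists>V. openin (config_topology dL \<Omega>) V \<and> Q \<in> V \<and> V \<subseteq> {Q \<in> \<Omega>. \<exists>p\<in>P Q. norm p < e}" using V by blast
 qed
 then have "openin (config_topology dL \<Omega>) (flow ` (\<Xi> \<times> ball 0 e))" unfolding img .
 moreover have "FLC_transversal L dL \<Omega> \<Xi>" unfolding FLC_transversal_iff \<Xi>_def using P by blast
 ultimately have "(\<Xi>, e) \<in> flow_boxes L dL \<Omega>" unfolding flow_boxes_def using e inj by simp
 then show ?thesis unfolding \<Xi>_def by blast
qed

text \<open>The vertices shifted by one vertex of Q define a transversal containing Q.\<close>

lemma flow_boxes_cover:
 "open_cover (config_topology dL \<Omega>) (flow_boxes L dL \<Omega>) (\<lambda>(\<Xi>, e). flow ` (\<Xi> \<times> ball 0 e))"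
 unfolding open_cover_def
proof (intro conjI ballI equalityI subsetI)
 fix i assume i: "i \<in> flow_boxes L dL \<Omega>"
 obtain \<Xi> e where "i = (\<Xi>, e)" by (cases i) auto
 then show "openin (config_topology dL \<Omega>) (case i of (\<Xi>, e) => flow ` (\<Xi> \<times> ball 0 e))" using flow_boxes_D(4) i by simp
next
 fix Q assume "Q \<in> (\<Union>i\<in>flow_boxes L dL \<Omega>. case i of (\<Xi>, e) => flow ` (\<Xi> \<times> ball 0 e))"
 then obtain \<Xi> e where "(\<Xi>, e) \<in> flow_boxes L dL \<Omega>" "Q \<in> flow ` (\<Xi> \<times> ball 0 e)" by auto
 then show "Q \<in> topspace (config_topology dL \<Omega>)" using flow_boxes_D(4) openin_subset by blast
next
 fix Q assume "Q \<in> topspace (config_topology dL \<Omega>)"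
 then have Q: "Q \<in> \<Omega>" unfolding topspace_config_topology[OF space] .
 obtain a where a: "a \<in> vertices Q" using local_points_D(1)[OF local_points_vertices Q] by blast
 define P where "P T = (\<lambda>p. p - a) ` vertices T" for T :: "('a, 'l) config"
 have P: "local_points P" unfolding P_def using local_points_shift[OF local_points_vertices, of a] by simp
 obtain e where e: "({T \<in> \<Omega>. 0 \<in> P T}, e) \<in> flow_boxes L dL \<Omega>" using local_points_flow_box[OF P] by blast
 have "0 \<in> P Q" unfolding P_def using a by (intro image_eqI[of _ _ a]) simp_all
 then have "(Q, 0) \<in> {T \<in> \<Omega>. 0 \<in> P T} \<times> ball 0 e" using Q flow_boxes_D(2)[OF e] by simp
 then have "Q \<in> flow ` ({T \<in> \<Omega>. 0 \<in> P T} \<times> ball 0 e)" by (intro image_eqI[of _ _ "(Q, 0)"]) (simp_all add: flow_def)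
 then show "Q \<in> (\<Union>i\<in>flow_boxes L dL \<Omega>. case i of (\<Xi>, e) => flow ` (\<Xi> \<times> ball 0 e))" using e by (intro UN_I) auto
qed

text \<open>
 Nearby elements have the same patch up to a small translation z, and the potential of every
 flow box changes by the same amount \<open>\<alpha>(Q', z)\<close>.
\<close>

lemma flow_box_potential_shift:
 assumes \<alpha>: "strong_cocycle L dL \<Omega> \<alpha>" and i: "i \<in> flow_boxes L dL \<Omega>"
  and Q: "Q \<in> (case i of (\<Xi>, e) => flow ` (\<Xi> \<times> ball 0 e))"
 shows "\<exists>N. \<exists>\<eta>>0. \<forall>Q'\<in>\<Omega>. \<forall>z. norm z < \<eta> --> patch (translate Q' z) 0 N = patch Q 0 N -->
  flow_box_potential \<alpha> i Q' = flow_box_potential \<alpha> i Q - \<alpha> Q' z"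
proof -
 obtain \<Xi> e where ie: "i = (\<Xi>, e)" by (cases i) auto
 note box = i[unfolded ie]
 obtain P where P: "local_points P" "\<Xi> = {T \<in> \<Omega>. 0 \<in> P T}" using flow_boxes_D(1)[OF box] by blast
 obtain S x where S: "S \<in> \<Xi>" "norm x < e" "Q = translate S x" using Q unfolding ie flow_def by auto
 have S': "S \<in> \<Omega>" "0 \<in> P S" using S(1) P(2) by auto
 have w\<alpha>: "weak_cocycle dL \<Omega> \<alpha>" using \<alpha> unfolding strong_cocycle_def by blast
 obtain N1 where N1: "patch_determined \<Omega> N1 (\<lambda>T. P T \<inter> ball 0 e)"
  using local_points_local[OF P(1), of e] by blast
 obtain \<delta> where \<delta>: "\<delta> > 0" "!!S'. S' \<in> \<Omega> ==> 0 \<in> P S' ==> config_dist dL S S' < \<delta> ==> \<alpha> S' x = \<alpha> S x"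
  using \<alpha> P(1) S' unfolding strong_cocycle_def transversally_locally_constant_iff by blast
 define M where "M = 1 / (\<delta> / 2) + \<delta> / 2"
 show ?thesis
 proof (rule exI[of _ "max N1 (norm x + M)"], rule exI[of _ "e - norm x"], intro conjI ballI allI impI)
  show "0 < e - norm x" using S(2) by simp
  fix Q' z assume Q': "Q' \<in> \<Omega>" and z: "norm z < e - norm x"
   and eq: "patch (translate Q' z) 0 (max N1 (norm x + M)) = patch Q 0 (max N1 (norm x + M))"
  define S1 where "S1 = translate Q' (z - x)"
  have S1: "S1 \<in> \<Omega>" unfolding S1_def using Q' by simp
  have "P (translate Q' z) \<inter> ball 0 e = P Q \<inter> ball 0 e"
   by (rule patch_determinedD[OF N1 translate_mem[OF Q'] _ eq]) (use S'(1) S(3) in auto)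
  moreover have "- x \<in> P Q \<inter> ball 0 e" unfolding S(3) using S'(2) S(2) by (simp add: local_points_D(4)[OF P(1) S'(1)])
  ultimately have "- x \<in> P (translate Q' z)" by blast
  then have P1: "0 \<in> P S1" unfolding S1_def by (simp add: local_points_D(4)[OF P(1) Q'])
  have "patch (translate (translate Q' z) (- x)) 0 M = patch (translate Q (- x)) 0 M"
   by (rule patch_eq_translate[OF eq]) simp
  then have "patch (translate S1 0) 0 M = patch S 0 M" unfolding S1_def S(3) by (simp add: translate_add)
  then have "config_dist dL S S1 <= \<delta> / 2"
   by (rule config_dist_patch_eq[OF labels lf[OF S'(1)]]) (use \<delta>(1) in \<open>auto simp: M_def\<close>)
  then have "\<alpha> S1 x = \<alpha> S x" using \<delta>(1) by (intro \<delta>(2)[OF S1 P1]) simp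
  moreover have Q'1: "Q' = translate S1 (x - z)" unfolding S1_def by (simp add: translate_add)
  moreover have "norm (x - z) < e" using z norm_triangle_ineq4[of x z] by linarith
  then have "flow_box_potential \<alpha> (\<Xi>, e) Q' = \<alpha> S1 (x - z)"
   unfolding Q'1 using S1 P1 P(2) by (intro flow_box_potential_eq[OF box]) auto
  moreover have "flow_box_potential \<alpha> (\<Xi>, e) Q = \<alpha> S x" unfolding S(3) by (rule flow_box_potential_eq[OF box S(1,2)])
  moreover have "\<alpha> Q' z = \<alpha> S1 x - \<alpha> S1 (x - z)" unfolding Q'1 weak_cocycle_translate[OF w\<alpha> S1] by simp
  ultimately show "flow_box_potential \<alpha> i Q' = flow_box_potential \<alpha> i Q - \<alpha> Q' z" unfolding ie by simp
 qed
qed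

text \<open>The common change of all potentials cancels in their differences.\<close>

lemma cech_cocycle_of_cocycle:
 assumes \<alpha>: "strong_cocycle L dL \<Omega> \<alpha>"
 shows "cech_cocycle (config_topology dL \<Omega>) (cech_of_cocycle L dL \<Omega> \<alpha>)"
proof -
 let ?U = "\<lambda>(\<Xi>, e). flow ` (\<Xi> \<times> ball 0 e) :: ('a, 'l) config set"
 have "locally_constant_on (config_topology dL \<Omega>) (?U i \<inter> ?U j) (\<lambda>P. flow_box_potential \<alpha> i P - flow_box_potential \<alpha> j P)"
  if ij: "i \<in> flow_boxes L dL \<Omega>" "j \<in> flow_boxes L dL \<Omega>" for i j
  unfolding locally_constant_on_def
 proof
  fix Q assume "Q \<in> ?U i \<inter> ?U j"
  then have Qi: "Q \<in> ?U i" and Qj: "Q \<in> ?U j" by auto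
  have "openin (config_topology dL \<Omega>) (?U i)" using flow_boxes_cover ij(1) unfolding open_cover_def by blast
  from subsetD[OF openin_subset[OF this] Qi] have Q: "Q \<in> \<Omega>" unfolding topspace_config_topology[OF space] .
  obtain N1 \<eta>1 where 1: "\<eta>1 > 0" "!!Q' z. Q' \<in> \<Omega> ==> norm z < \<eta>1 ==> patch (translate Q' z) 0 N1 = patch Q 0 N1 ==>
   flow_box_potential \<alpha> i Q' = flow_box_potential \<alpha> i Q - \<alpha> Q' z" using flow_box_potential_shift[OF \<alpha> ij(1) Qi] by blast
  obtain N2 \<eta>2 where 2: "\<eta>2 > 0" "!!Q' z. Q' \<in> \<Omega> ==> norm z < \<eta>2 ==> patch (translate Q' z) 0 N2 = patch Q 0 N2 ==>
   flow_box_potential \<alpha> j Q' = flow_box_potential \<alpha> j Q - \<alpha> Q' z" using flow_box_potential_shift[OF \<alpha> ij(2) Qj] by blast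
  obtain V where V: "openin (config_topology dL \<Omega>) V" "Q \<in> V"
   "\<forall>Q'\<in>V. Q' \<in> \<Omega> \<and> (\<exists>z. norm z < min \<eta>1 \<eta>2 \<and> patch (translate Q' z) 0 (max N1 N2) = patch Q 0 (max N1 N2))"
   using rigid_neighbourhood[OF Q, of "min \<eta>1 \<eta>2" "max N1 N2"] 1(1) 2(1) by auto
  have "flow_box_potential \<alpha> i Q' - flow_box_potential \<alpha> j Q' = flow_box_potential \<alpha> i Q - flow_box_potential \<alpha> j Q" if "Q' \<in> V" for Q'
  proof -
   obtain z where z: "Q' \<in> \<Omega>" "norm z < min \<eta>1 \<eta>2" "patch (translate Q' z) 0 (max N1 N2) = patch Q 0 (max N1 N2)"
    using V(3) \<open>Q' \<in> V\<close> by blast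
   have "patch (translate Q' z) 0 N1 = patch Q 0 N1" "patch (translate Q' z) 0 N2 = patch Q 0 N2"
    by (rule patch_eq_le[OF z(3)], simp)+
   then show ?thesis using 1(2)[OF z(1), of z] 2(2)[OF z(1), of z] z(2) by simp
  qed
  then show "\<exists>V. openin (config_topology dL \<Omega>) V \<and> Q \<in> V \<and> (\<forall>Q'\<in>V \<inter> (?U i \<inter> ?U j).
    flow_box_potential \<alpha> i Q' - flow_box_potential \<alpha> j Q' = flow_box_potential \<alpha> i Q - flow_box_potential \<alpha> j Q)"
   using V(1,2) by blast
 qed
 then show ?thesis unfolding cech_cocycle_def cech_of_cocycle_def using flow_boxes_cover by simp
qed

lemma fundamental_shape_strong: "strong_cocycle L dL \<Omega> fundamental_shape"
 unfolding strong_cocycle_def weak_cocycle_def fundamental_shape_def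
proof (intro conjI allI ballI)
 show "continuous_map (prod_topology (config_topology dL \<Omega>) euclidean) euclidean (\<lambda>(T, x). x)"
  using continuous_map_snd by (simp add: case_prod_unfold)
 show "transversally_locally_constant L dL \<Omega> (\<lambda>T. v)" for v :: 'a
  by (rule patch_determined_transversally_locally_constant) (simp add: patch_determined_def)
qed simp

end

context patch_deformation
begin

lemma flc_space_deform: "flc_space (deform ` \<Omega>) patch_labels discrete_metric.dd"
 by (rule flc_space.intro[OF tiling_space_deform(2) FLC_deform])

text \<open>
 The two covers are compared on the intersections of flow boxes of the space with preimages of flow
 boxes of its image. If a small translation z matches Q' with Q, then \<open>\<gamma> Q' z\<close> matches the
 deformations, so that the potential of \<open>\<gamma>\<close> upstairs and that of the fundamental shape downstairs
 both drop by \<open>\<gamma> Q' z\<close>. Their difference is locally constant and is the coboundary sought.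
\<close>

theorem has_strong_class_deform:
 assumes c: "\<gamma> \<in> c"
 shows "has_strong_class L dL \<Omega> patch_labels discrete_metric.dd (deform ` \<Omega>) deform c"
proof -
 interpret D: flc_space "deform ` \<Omega>" patch_labels discrete_metric.dd by (rule flc_space_deform)
 let ?X = "config_topology dL \<Omega>" and ?Y = "config_topology discrete_metric.dd (deform ` \<Omega>)"
 let ?I = "flow_boxes L dL \<Omega>" and ?J = "flow_boxes patch_labels discrete_metric.dd (deform ` \<Omega>)"
 let ?p = "flow_box_potential \<gamma>" and ?q = "flow_box_potential fundamental_shape :: _ => ('a, ('a, 'l) config) config => 'a"
 define U where "U = (\<lambda>(\<Xi>, e). flow ` (\<Xi> \<times> ball 0 e) :: ('a, 'l) config set)"
 define V where "V = (\<lambda>(\<Xi>, e). flow ` (\<Xi> \<times> ball 0 e) :: ('a, ('a, 'l) config) config set)"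
 have \<gamma>: "strong_cocycle L dL \<Omega> \<gamma>" by (rule local_cocycle_strong[OF \<gamma>_cocycle \<gamma>_local])
 have cU: "open_cover ?X ?I U" unfolding U_def by (rule flow_boxes_cover)
 have cV: "open_cover ?Y ?J V" unfolding V_def by (rule D.flow_boxes_cover)
 have top: "topspace ?X = \<Omega>" "topspace ?Y = deform ` \<Omega>"
  using topspace_config_topology[OF space] topspace_config_topology[OF tiling_space_deform(2)] by auto
 define pre where "pre j = {Q \<in> \<Omega>. deform Q \<in> V j}" for j
 have pre: "openin ?X (pre j)" if "j \<in> ?J" for j
  unfolding pre_def using tiling_space_deform(1) cV that unfolding continuous_map_def open_cover_def top by auto
 define \<W> where "\<W> = {U i \<inter> pre j | i j. i \<in> ?I \<and> j \<in> ?J}"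
 have "\<forall>W. \<exists>ij. W \<in> \<W> --> fst ij \<in> ?I \<and> snd ij \<in> ?J \<and> W = U (fst ij) \<inter> pre (snd ij)"
  unfolding \<W>_def by auto
 from choice[OF this] obtain f where f: "!!W. W \<in> \<W> ==> fst (f W) \<in> ?I \<and> snd (f W) \<in> ?J \<and> W = U (fst (f W)) \<inter> pre (snd (f W))" by blast
 define b where "b W Q = ?q (snd (f W)) (deform Q) - ?p (fst (f W)) Q" for W Q
 have coverW: "open_cover ?X \<W> id" unfolding open_cover_def
 proof (intro conjI ballI equalityI subsetI)
  fix W assume "W \<in> \<W>"
  then show "openin ?X (id W)" using cU pre unfolding \<W>_def open_cover_def by auto
 next
  fix Q assume "Q \<in> (\<Union>W\<in>\<W>. id W)"
  then show "Q \<in> topspace ?X" unfolding top \<W>_def pre_def by auto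
 next
  fix Q assume "Q \<in> topspace ?X"
  then have Q: "Q \<in> \<Omega>" unfolding top .
  obtain i where i: "i \<in> ?I" "Q \<in> U i" using cU Q unfolding open_cover_def top by blast
  have "deform Q \<in> (\<Union>j\<in>?J. V j)" using cV Q unfolding open_cover_def top by simp
  then obtain j where j: "j \<in> ?J" "deform Q \<in> V j" by blast
  then have "Q \<in> U i \<inter> pre j" "U i \<inter> pre j \<in> \<W>" using i Q unfolding pre_def \<W>_def by blast+
  then show "Q \<in> (\<Union>W\<in>\<W>. id W)" unfolding id_apply by (intro UN_I)
 qed
 have lc: "locally_constant_on ?X W (b W)" if W: "W \<in> \<W>" for W
  unfolding locally_constant_on_def
 proof
  fix Q assume "Q \<in> W"
  then have QW: "Q \<in> U (fst (f W))" "deform Q \<in> V (snd (f W))" and Q: "Q \<in> \<Omega>" using f[OF W] unfolding pre_def by auto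
  obtain N1 \<eta>1 where 1: "\<eta>1 > 0" "!!Q' z. Q' \<in> \<Omega> ==> norm z < \<eta>1 ==> patch (translate Q' z) 0 N1 = patch Q 0 N1 ==>
   ?p (fst (f W)) Q' = ?p (fst (f W)) Q - \<gamma> Q' z"
   using flow_box_potential_shift[OF \<gamma> _ QW(1)[unfolded U_def]] f[OF W] by blast
  obtain N2 \<eta>2 where 2: "\<eta>2 > 0" "!!Q' z. Q' \<in> deform ` \<Omega> ==> norm z < \<eta>2 ==> patch (translate Q' z) 0 N2 = patch (deform Q) 0 N2 ==>
   ?q (snd (f W)) Q' = ?q (snd (f W)) (deform Q) - z"
   using D.flow_box_potential_shift[OF D.fundamental_shape_strong _ QW(2)[unfolded V_def]] f[OF W]
   unfolding fundamental_shape_def by blast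
  obtain N3 where N3: "patch_determined \<Omega> N3 (\<lambda>T. patch (deform T) 0 N2)" using deform_local[of N2] by blast
  obtain \<delta>3 where 3: "\<delta>3 > 0" "!!Q' z. Q' \<in> \<Omega> ==> config_dist dL Q Q' < \<delta>3 ==> dist 0 z < \<delta>3 ==> dist (\<gamma> Q 0) (\<gamma> Q' z) < \<eta>2"
   using weak_cocycle_continuous[OF space \<gamma>_cocycle Q 2(1), of 0] by blast
  define \<eta> where "\<eta> = min \<eta>1 \<delta>3"
  define N where "N = max N1 N3"
  obtain Z where Z: "openin ?X Z" "Q \<in> Z"
   "\<forall>Q'\<in>Z. Q' \<in> \<Omega> \<and> (\<exists>z. norm z < \<eta> \<and> patch (translate Q' z) 0 N = patch Q 0 N)"
   using rigid_neighbourhood[OF Q, of \<eta> N] 1(1) 3(1) unfolding \<eta>_def by auto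
  have "b W Q' = b W Q" if Q': "Q' \<in> Z \<inter> M.mball Q \<delta>3" for Q'
  proof -
   obtain z where z: "Q' \<in> \<Omega>" "norm z < \<eta>" "patch (translate Q' z) 0 N = patch Q 0 N" using Z(3) Q' by blast
   have "patch (deform (translate Q' z)) 0 N2 = patch (deform Q) 0 N2"
    by (rule patch_determinedD[OF N3 translate_mem[OF z(1)] Q z(3)]) (simp add: N_def)
   then have d: "patch (translate (deform Q') (\<gamma> Q' z)) 0 N2 = patch (deform Q) 0 N2" unfolding deform_translate[OF z(1)] .
   have "dist (\<gamma> Q 0) (\<gamma> Q' z) < \<eta>2" using 3(2)[OF z(1)] Q' z(2) unfolding \<eta>_def by simp
   then have "norm (\<gamma> Q' z) < \<eta>2" using weak_cocycle_0[OF \<gamma>_cocycle Q] by (simp add: dist_norm)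
   then have "?q (snd (f W)) (deform Q') = ?q (snd (f W)) (deform Q) - \<gamma> Q' z" using z(1) by (intro 2(2) d) auto
   moreover have "?p (fst (f W)) Q' = ?p (fst (f W)) Q - \<gamma> Q' z"
    using z(2) by (intro 1(2)[OF z(1) _ patch_eq_le[OF z(3)]]) (simp_all add: \<eta>_def N_def)
   ultimately show ?thesis unfolding b_def by simp
  qed
  moreover have "openin ?X (Z \<inter> M.mball Q \<delta>3)" "Q \<in> Z \<inter> M.mball Q \<delta>3"
   using Z(1,2) Q 3(1) unfolding config_topology_def by auto
  ultimately show "\<exists>Z. openin ?X Z \<and> Q \<in> Z \<and> (\<forall>Q'\<in>Z \<inter> W. b W Q' = b W Q)" by blast
 qed
 have c1: "cech_cocycle ?X (cech_pullback ?X deform (cech_of_cocycle patch_labels discrete_metric.dd (deform ` \<Omega>) fundamental_shape))"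
  by (rule cech_cocycle_pullback[OF tiling_space_deform(1) D.cech_cocycle_of_cocycle[OF D.fundamental_shape_strong]])
 have c2: "cech_cocycle ?X (cech_of_cocycle L dL \<Omega> \<gamma>)" by (rule cech_cocycle_of_cocycle[OF \<gamma>])
 have "cech_cohomologous ?X (cech_pullback ?X deform (cech_of_cocycle patch_labels discrete_metric.dd (deform ` \<Omega>) fundamental_shape))
  (cech_of_cocycle L dL \<Omega> \<gamma>)"
  unfolding cech_cohomologous_def
 proof (intro conjI c1 c2)
  have sub: "snd (f W) \<in> ?J \<and> W \<subseteq> {x \<in> topspace ?X. deform x \<in> V (snd (f W))} \<and> fst (f W) \<in> ?I \<and> W \<subseteq> U (fst (f W)) \<and>
    locally_constant_on ?X W (b W)" if "W \<in> \<W>" for W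
   using f[OF that] lc[OF that] unfolding pre_def top by blast
  have diff: "(?q (snd (f W)) (deform x) - ?q (snd (f W')) (deform x)) - (?p (fst (f W)) x - ?p (fst (f W')) x) = b W x - b W' x" for W W' x
   unfolding b_def by simp
  show "case cech_pullback ?X deform (cech_of_cocycle patch_labels discrete_metric.dd (deform ` \<Omega>) fundamental_shape) of
   (I, U, g) => case cech_of_cocycle L dL \<Omega> \<gamma> of (J, V, k) => \<exists>\<W> r s b. open_cover ?X \<W> id \<and>
     (\<forall>W\<in>\<W>. r W \<in> I \<and> W \<subseteq> U (r W) \<and> s W \<in> J \<and> W \<subseteq> V (s W) \<and> locally_constant_on ?X W (b W)) \<and>
     (\<forall>W\<in>\<W>. \<forall>W'\<in>\<W>. \<forall>x\<in>W \<inter> W'. g (r W) (r W') x - k (s W) (s W') x = b W x - b W' x)"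
   unfolding cech_pullback_def cech_of_cocycle_def prod.case U_def[symmetric] V_def[symmetric]
   by (intro exI[of _ \<W>] exI[of _ "\<lambda>W. snd (f W)"] exI[of _ "\<lambda>W. fst (f W)"] exI[of _ b] conjI coverW ballI)
    (use sub diff in blast)+
 qed
 then show ?thesis unfolding has_strong_class_def using c by blast
qed

end

section \<open>Strong classes\<close>

text \<open>
 The weak argument is applied to a local representative \<open>\<beta>\<close>, whose smoothing \<open>\<gamma>\<close> is local
 again. This makes the form strongly pattern-equivariant, keeps \<open>\<gamma>\<close> in the strong class, and
 allows patches as labels.
\<close>

theorem strong_deformation_exists:
 assumes \<Omega>: "tiling_space L dL \<Omega>" and min: "minimal_space dL \<Omega>" and flc: "FLC \<Omega>"
  and ue: "uniquely_ergodic dL \<Omega>" and \<mu>: "invariant_probability dL \<Omega> \<mu>"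
  and c: "c \<in> H1_strong L dL \<Omega>" and inv: "invertible (ruelle_sullivan_class \<mu> c)" and T: "T \<in> \<Omega>"
 shows "\<exists>\<omega> R R0 L' \<Omega>' h. L' = patch_label T R0 ` vertices T \<and>
  tiling_space L' discrete_metric.dd \<Omega>' \<and> FLC \<Omega>' \<and> strongly_PE_form T R \<omega> \<and> represents T \<omega> c \<and>
  strong_shape_deformation dL \<Omega> T (vertices T) \<omega> R R0 \<Omega>' h \<and>
  homeomorphic_map (config_topology dL \<Omega>) (config_topology discrete_metric.dd \<Omega>') h \<and>
  has_strong_class L dL \<Omega> L' discrete_metric.dd \<Omega>' h c"
proof -
 have F: "flc_space \<Omega> L dL" by (rule flc_space.intro[OF \<Omega> flc])
 interpret F: flc_space \<Omega> L dL by (rule F)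
 let ?X = "config_topology dL \<Omega>"
 \<comment> \<open>The matrix of the class is computed from this representative.\<close>
 define \<alpha> where "\<alpha> = (SOME \<alpha>. \<alpha> \<in> c)"
 obtain \<alpha>0 where \<alpha>0: "strong_cocycle L dL \<Omega> \<alpha>0" "c = strong_rel L dL \<Omega> `` {\<alpha>0}"
  using c unfolding H1_strong_def by (auto elim!: quotientE)
 have tlc0: "transversally_locally_constant L dL \<Omega> (\<lambda>T. 0)"
  by (rule F.patch_determined_transversally_locally_constant) (simp add: patch_determined_def)
 have "\<alpha>0 \<in> c" unfolding \<alpha>0(2) strong_rel_def strong_coboundary_def using \<alpha>0(1) tlc0
  by (auto intro!: exI[of _ "\<lambda>_. 0"])
 then have "\<alpha> \<in> c" unfolding \<alpha>_def by (metis someI)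
 then have "(\<alpha>0, \<alpha>) \<in> strong_rel L dL \<Omega>" unfolding \<alpha>0(2) by simp
 then obtain s1 where \<alpha>: "strong_cocycle L dL \<Omega> \<alpha>" and s1: "continuous_map ?X euclidean s1"
  "transversally_locally_constant L dL \<Omega> s1" "!!T v. T \<in> \<Omega> ==> \<alpha>0 T v - \<alpha> T v = s1 (translate T v) - s1 T"
  unfolding strong_rel_def strong_coboundary_def by blast
 have w\<alpha>: "weak_cocycle dL \<Omega> \<alpha>" using \<alpha> unfolding strong_cocycle_def by blast
 obtain s where s: "continuous_map ?X euclidean s" "transversally_locally_constant L dL \<Omega> s"
  "weak_cocycle dL \<Omega> (\<lambda>S x. \<alpha> S x + s (translate S x) - s S)" "F.local_cochain (\<lambda>S x. \<alpha> S x + s (translate S x) - s S)"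
  using F.local_representative[OF \<alpha>] by blast
 define \<beta> where "\<beta> = (\<lambda>S x. \<alpha> S x + s (translate S x) - s S)"
 have \<beta>: "weak_cocycle dL \<Omega> \<beta>" and \<beta>l: "F.local_cochain \<beta>" unfolding \<beta>_def by (fact s(3), fact s(4))
 have C: "invertible (ruelle_sullivan \<mu> \<alpha>)" using inv unfolding ruelle_sullivan_class_def \<alpha>_def .
 have "compactin ?X \<Omega>"
  using tiling_space_compact[OF \<Omega>] topspace_config_topology[OF \<Omega>] unfolding compact_space_def config_topology_def by simp
 from image_compactin[OF this s(1)] have "compact (s ` \<Omega>)" by simp
 then obtain B0 where B0: "!!T. T \<in> \<Omega> ==> norm (s T) <= B0" using compact_imp_bounded bounded_iff by (metis imageI)
 \<comment> \<open>The coboundary of s is bounded, so \<open>\<beta>\<close> has the same slope as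
  \<open>\<alpha>\<close>.\<close>
 have growth: "\<exists>B. \<forall>T\<in>\<Omega>. \<forall>v. norm (\<beta> T v - ruelle_sullivan \<mu> \<alpha> *v v) <= e * norm v + B" if e: "0 < e" for e
 proof -
  obtain B where B: "!!T v. T \<in> \<Omega> ==> norm (\<alpha> T v - ruelle_sullivan \<mu> \<alpha> *v v) <= e * norm v + B"
   using cocycle_growth[OF \<Omega> ue \<mu> w\<alpha> e] unfolding ruelle_sullivan_components[OF \<Omega> \<mu> w\<alpha>] by blast
  have "norm (\<beta> T v - ruelle_sullivan \<mu> \<alpha> *v v) <= e * norm v + (B + 2 * B0)" if T: "T \<in> \<Omega>" for T v
  proof -
   have "\<beta> T v - ruelle_sullivan \<mu> \<alpha> *v v = (\<alpha> T v - ruelle_sullivan \<mu> \<alpha> *v v) + (s (translate T v) - s T)"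
    unfolding \<beta>_def by simp
   also have "norm ... <= (e * norm v + B) + (B0 + B0)"
    by (intro norm_triangle_mono B[OF T] order_trans[OF norm_triangle_ineq4] add_mono B0 T F.translate_mem)
   finally show ?thesis by simp
  qed
  then show ?thesis by blast
 qed
 obtain \<phi> r K where \<phi>: "bumps \<phi>" "integral (cbox (- 1) 1) (bump_prod \<phi>) = 1" and r: "0 < r" and K: "0 < K"
  and g: "\<forall>T\<in>\<Omega>. (\<forall>x y. norm (x - y) <= K * norm (smooth_cocycle \<phi> r \<beta> T x - smooth_cocycle \<phi> r \<beta> T y)) \<and>
    surj (smooth_cocycle \<phi> r \<beta> T) \<and> homeomorphic_map euclidean euclidean (smooth_cocycle \<phi> r \<beta> T)"
  using near_linear_smoothing[OF \<Omega> \<beta> C] growth by metis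
 define \<gamma> where "\<gamma> = smooth_cocycle \<phi> r \<beta>"
 define \<omega> where "\<omega> = (\<lambda>x. smooth_deriv \<phi> r \<beta> (translate T x))"
 have \<gamma>: "weak_cocycle dL \<Omega> \<gamma>" unfolding \<gamma>_def by (rule smooth_weak_cocycle[OF \<Omega> \<beta> \<phi>(1)])
 have \<gamma>l: "F.local_cochain \<gamma>" unfolding \<gamma>_def using local_cochain_smooth_cocycle[OF F \<beta>l] r by simp
 have \<gamma>s: "strong_cocycle L dL \<Omega> \<gamma>" by (rule F.local_cocycle_strong[OF \<gamma> \<gamma>l])
 \<comment> \<open>One radius for all bumps serves the smoothing and the coefficients of the form alike.\<close>
 obtain N3 where N3: "!!\<phi>. patch_determined \<Omega> N3 (smoothing \<phi> r \<beta>)"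
  using local_cochain_smoothing[OF F \<beta>l less_imp_le[OF r]] by blast
 have \<gamma>c: "\<gamma> \<in> c"
 proof -
  define t where "t S = s1 S - (s S + smoothing \<phi> r \<beta> S)" for S
  have "transversally_locally_constant L dL \<Omega> (smoothing \<phi> r \<beta>)"
   by (rule F.patch_determined_transversally_locally_constant[of N3]) (rule N3)
  note F.transversally_locally_constant_combine[OF s1(2) F.transversally_locally_constant_combine[OF s(2) this, of "(+)"], of "(-)"]
  then have "transversally_locally_constant L dL \<Omega> t" unfolding t_def .
  moreover have "continuous_map ?X euclidean t"
   unfolding t_def by (intro continuous_map_diff_config s1(1) s(1) smoothing_continuous_map[OF \<Omega> \<beta> \<phi>(1)])
  moreover have "\<alpha>0 S v - \<gamma> S v = t (translate S v) - t S" if "S \<in> \<Omega>" for S v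
   using s1(3)[OF that, of v] unfolding \<gamma>_def smooth_cocycle_def t_def \<beta>_def by (simp add: algebra_simps)
  ultimately show ?thesis unfolding \<alpha>0(2) strong_rel_def strong_coboundary_def using \<alpha>0(1) \<gamma>s by blast
 qed
 define R where "R = max N3 1"
 have PE: "strongly_PE_form T R \<omega>"
  unfolding strongly_PE_form_def strongly_PE_def
 proof (intro conjI allI impI)
  show "0 < R" unfolding R_def by simp
  show "smooth_form \<omega>" unfolding \<omega>_def by (rule smooth_form_smooth_deriv[OF \<Omega> \<beta> \<phi>(1) T r])
  fix i j x y assume eq: "patch (translate T x) 0 R = patch (translate T y) 0 R"
  have "smoothing \<phi> r \<beta> (translate T x) = smoothing \<phi> r \<beta> (translate T y)" for \<phi>
   by (rule patch_determinedD[OF N3 F.translate_mem[OF T] F.translate_mem[OF T] eq]) (simp add: R_def)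
  then show "\<omega> x $ i $ j = \<omega> y $ i $ j" unfolding \<omega>_def smooth_deriv_def by simp
 qed
 obtain \<rho> where \<rho>: "\<rho> > 0" "!!T x. T \<in> \<Omega> ==> \<exists>p\<in>vertices T. dist x p <= \<rho>"
  using F.local_points_dense[OF F.local_points_vertices] by blast
 obtain N1 where N1: "patch_determined \<Omega> N1 (\<lambda>S. vertices S \<inter> ball 0 (2 * \<rho> + 2))"
  using F.local_points_local[OF F.local_points_vertices, of "2 * \<rho> + 2"] by blast
 obtain N2 where N2: "!!x. norm x <= 2 * \<rho> + 2 ==> patch_determined \<Omega> N2 (\<lambda>S. \<gamma> S x)"
  using \<gamma>l unfolding F.local_cochain_def by blast
 \<comment> \<open>Neighbouring vertices are at most \<open>2 * \<rho>\<close> apart.\<close>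
 define R0 where "R0 = max (max N1 N2) (R + 2 * \<rho> + 1)"
 have R0: "N1 <= R0" "N2 <= R0" "R + 2 * \<rho> < R0" unfolding R0_def by auto
 interpret patch_deformation \<Omega> L dL \<gamma> K R0 \<rho>
 proof (unfold_locales)
  show "norm (x - y) <= K * norm (\<gamma> S x - \<gamma> S y)" if "S \<in> \<Omega>" for S x y using g that unfolding \<gamma>_def by blast
  show "surj (\<gamma> S)" if "S \<in> \<Omega>" for S using g that unfolding \<gamma>_def by blast
  show "\<rho> < R0" using R0(3) \<rho>(1) unfolding R_def by linarith
  show "patch_determined \<Omega> R0 (\<lambda>S. vertices S \<inter> ball 0 (2 * \<rho> + 2))" by (rule patch_determined_mono[OF N1 R0(1)])
  show "patch_determined \<Omega> R0 (\<lambda>S. \<gamma> S x)" if "norm x <= 2 * \<rho> + 2" for x by (rule patch_determined_mono[OF N2[OF that] R0(2)])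
 qed (use \<gamma> K \<gamma>l \<rho> in auto)
 have lab: "patch_labels = patch_label T R0 ` vertices T" by (rule patch_labels_minimal[OF min T])
 have near: "R + dist p q < R0" if pq: "neighbours (vertices T) p q" for p q
 proof -
  obtain x where x: "dist x p = infdist x (vertices T)" "dist x q = infdist x (vertices T)" using pq unfolding neighbours_def by blast
  obtain a where "a \<in> vertices T" "dist x a <= \<rho>" using \<rho>(2)[OF T] by blast
  then have "infdist x (vertices T) <= \<rho>" by (meson infdist_le order_trans)
  then have "dist p q <= 2 * \<rho>" using x dist_triangle2[of p q x] by (simp add: dist_commute)
  then show ?thesis using R0(3) by linarith
 qed
 have form: "form_integral \<omega> x y = \<gamma> T y - \<gamma> T x" for x y
  unfolding \<omega>_def \<gamma>_def by (rule form_integral_smooth_deriv[OF \<Omega> \<beta> \<phi> r T])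
 have A: "form_integral \<omega> 0 = \<gamma> T" unfolding form using weak_cocycle_0[OF \<gamma> T] by auto
 have rep: "represents T \<omega> c"
  unfolding represents_def using \<gamma>c by (intro bexI[of _ \<gamma>]) (auto simp: form weak_cocycle_translate[OF \<gamma> T])
 have T': "(\<lambda>p. ({\<gamma> T p}, patch_label T R0 p)) ` vertices T = deform T" unfolding deform_def ..
 have "strong_shape_deformation dL \<Omega> T (vertices T) \<omega> R R0 (deform ` \<Omega>) deform"
  unfolding strong_shape_deformation_def shape_deformation_def Let_def A T' lab[symmetric]
  using PE near closed_form_smooth_deriv[OF \<Omega> \<beta> \<phi>(1) T r] g T orbit_closure_deform[OF min T] tiling_space_deform(1)
   deform_translate[OF T] unfolding \<omega>_def \<gamma>_def by auto
 then show ?thesis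
  using tiling_space_deform(2) FLC_deform PE rep homeomorphic_map_deform[OF inj_deform] has_strong_class_deform[OF \<gamma>c]
  unfolding lab by blast
qed

theorem theorem8p1:
  fixes L :: "'l set" and dL :: "'l \<Rightarrow> 'l \<Rightarrow> real"
    and \<Omega> :: "(real ^ 'n, 'l) config set" and \<mu> :: "(real ^ 'n, 'l) config measure"
  assumes "tiling_space L dL \<Omega>"
    and "minimal_space dL \<Omega>"
    and "aperiodic \<Omega>"
    and "uniquely_ergodic dL \<Omega>"
    and "invariant_probability dL \<Omega> \<mu>"
  shows
    "(FLC \<Omega> \<longrightarrow>
       (\<forall>c \<in> H1_strong L dL \<Omega>. invertible (ruelle_sullivan_class \<mu> c) \<longrightarrow>
         (\<forall>T \<in> \<Omega>. 0 \<in> vertices T \<longrightarrow>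
           (\<exists>\<omega> R R0 L' \<Omega>' h.
              L' = patch_label T R0 ` vertices T \<and>
              tiling_space L' discrete_metric.dd \<Omega>' \<and> FLC \<Omega>' \<and>
              strongly_PE_form T R \<omega> \<and> represents T \<omega> c \<and>
              strong_shape_deformation dL \<Omega> T (vertices T) \<omega> R R0 \<Omega>' h \<and>
              homeomorphic_map (config_topology dL \<Omega>) (config_topology discrete_metric.dd \<Omega>') h \<and>
              has_strong_class L dL \<Omega> L' discrete_metric.dd \<Omega>' h c)))) \<and>
     (\<exists>\<Lambda>. associated_delone_sets dL \<Omega> \<Lambda>) \<and>
     (\<forall>c \<in> H1_weak dL \<Omega>. invertible (ruelle_sullivan_class \<mu> c) \<longrightarrow>
       (\<forall>\<Lambda>. associated_delone_sets dL \<Omega> \<Lambda> \<longrightarrow> (\<forall>T \<in> \<Omega>. 0 \<in> \<Lambda> T \<longrightarrow>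
         (\<exists>\<omega> \<Omega>' h.
            tiling_space \<Omega> (config_dist dL) \<Omega>' \<and> aperiodic \<Omega>' \<and>
            weakly_PE_form dL \<Omega> T \<omega> \<and>
            weak_shape_deformation dL \<Omega> T (\<Lambda> T) \<omega> \<Omega>' h \<and>
            orbit_equivalence dL \<Omega> (config_dist dL) \<Omega>' h \<and>
            weak_class dL \<Omega> h = c))))"
proof (intro conjI impI ballI allI, goal_cases)
  case (1 c T)
  then show ?case using strong_deformation_exists[OF assms(1,2) _ assms(4,5)] by blast
next
  case 2
  show ?case by (rule associated_delone_sets_exist[OF assms(1)])
next
  case (3 c \<Lambda> T)
  then show ?case using weak_deformation_exists[OF assms(1-5)] by blast
qed

end
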